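(* Let $a$ and $b$ satisfy the Lipschitz condition and the linear-growth bound stated in the context. Let a DO approximation $X$ on $[0,T_e)$ be given, where $T_e<\infty$ is the explosion time. If $\mathbb E[|X_0|^{2k}]<\infty$ for some integer $k>1$, then $X$ admits a unique continuous extension to $[0,T_e]$, almost surely. This extension is Hölder continuous on $[0,T_e]$ (almost surely), and satisfies $\mathbb E[|X_t|^{2k}]<\infty$ for all $t\in[0,T_e]$.
   Context: Let $(\Omega,\mathscr F,\mathbb P;(\mathscr F_t)_{t\ge0})$ be a filtered complete probability space with the usual conditions and $W$ a standard $m$-dimensional $(\mathscr F_t)$-Brownian motion. $|\cdot|$ is the Euclidean norm, $\|\cdot\|_{\mathrm F}$ the Frobenius norm, and $R\le d$ are positive integers. $a:[0,\infty)\times\mathbb R^d\to\mathbb R^d$ and $b:[0,\infty)\times\mathbb R^d\to\mathbb R^{d\times m}$ are jointly measurable. Lipschitz condition: for some $C_{\mathrm{Lip}}>0$, $|a(s,x)-a(s,y)|\le C_{\mathrm{Lip}}|x-y|$ and $\|b(s,x)-b(s,y)\|_{\mathrm F}\le C_{\mathrm{Lip}}|x-y|$ for all $s\geq 0$, $x,y\in\mathbb R^d$. Linear-growth bound: for some $C_{\mathrm{lgb}}>0$, $|a(s,x)|^2+\|b(s,x)\|_{\mathrm F}^2\le C_{\mathrm{lgb}}(1+|x|^2)$ for all $s\geq 0$, $x\in\mathbb R^d$. Strong DO solution. Write $C_{\boldsymbol Y_t}=\mathbb E[\boldsymbol Y_t\boldsymbol Y_t^\top]\in\mathbb R^{R\times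 R}$ and let $P^{\mathrm{row}}_{\boldsymbol U_t}\in\mathbb R^{d\times d}$ be the orthogonal projection onto the span of the rows of $\boldsymbol U_t$. $(\boldsymbol U,\boldsymbol Y):[0,T]\to\mathbb R^{R\times d}\times L^2(\Omega;\mathbb R^R)$ is a strong DO solution on $[0,T]$ if (1) $\boldsymbol U_0$ has orthonormal rows and $\boldsymbol Y_0\in L^2(\Omega;\mathbb R^R)$ has linearly independent components; (2) $t\mapsto\boldsymbol U_t$ is absolutely continuous on $[0,T]$ and $\boldsymbol U_t\dot{\boldsymbol U}_t^\top=0$ for a.e. $t$; (3) $\boldsymbol Y$ has almost surely continuous paths, is $(\mathscr F_t)$-adapted, and for every $t\in[0,T]$ the components $Y^1_t,\dots,Y^R_t$ are linearly independent in $L^2(\Omega)$; (4) for a.e. $t\in[0,T]$, $C_{\boldsymbol Y_t}\dot{\boldsymbol U}_t=\mathbb E[\boldsymbol Y_t a(t,\boldsymbol U_t^\top\boldsymbol Y_t)^\top](I_{d\times d}-P^{\mathrm{row}}_{\boldsymbol U_t})$, and $\boldsymbol Y$ is a strong solution on $[0,T]$ of $d\boldsymbol Y_t=\boldsymbol U_t a(t,\boldsymbol U_t^\top\boldsymbol Y_t)\,dt+\boldsymbol U_t b(t,\boldsymbol U_t^\top\boldsymbol Y_t)\,dW_t$. A DO approximation is a process $X_t=\boldsymbol U_t^\top\boldsymbol Y_t$ for a strong DO solution $(\boldsymbol U,\boldsymbol Y)$; on $[0,T_e)$ this means that $(\boldsymbol U,\boldsymbol Y)$ is a strong DO solution on $[0,T]$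 for every $T<T_e$. Explosion time. A unique strong DO solution with given initial datum exists locally in time and is extended as far as possible. With $t$ ranging over the interval of existence and $\inf\varnothing=\infty$, let $\tau^1_n:=\inf\{t>0:\|C_{\boldsymbol Y_t}^{-1}\|_{\mathrm F}=\|C_{\boldsymbol Y_0}^{-1}\|_{\mathrm F}+n\}$, $\tau^2_n:=\inf\{t>0:\|\boldsymbol Y_t\|_{[L^2(\Omega)]^R}=\|\boldsymbol Y_0\|_{[L^2(\Omega)]^R}+n\}$ (with $\|\boldsymbol Y\|_{[L^2(\Omega)]^R}^2=\mathbb E[|\boldsymbol Y|^2]$), $\tau_n:=\min\{\tau_n^1,\tau_n^2\}$; the explosion time is $T_e:=\lim_{n\to\infty}\tau_n$, and the solution exists on $[0,T_e)$. *)

theory Defs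
  imports "HOL-Probability.Probability"
begin

section \<open>Stochastic basis and Brownian motion\<close>

text \<open>Time is the half-line of nonnegative reals; all processes and filtrations are total
  functions on the reals of which only the values at nonnegative times are constrained.\<close>

locale usual_filtered_space = prob_space M
  for M :: "'w measure" and F :: "real \<Rightarrow> 'w measure" +
  assumes complete: "\<And>A N. N \<in> null_sets M \<Longrightarrow> A \<subseteq> N \<Longrightarrow> A \<in> sets M"
    and subalg: "\<And>t. 0 \<le> t \<Longrightarrow> subalgebra M (F t)"
    and mono: "\<And>s t. 0 \<le> s \<Longrightarrow> s \<le> t \<Longrightarrow> sets (F s) \<subseteq> sets (F t)"
    and right_cont: "\<And>t. 0 \<le> t \<Longrightarrow> sets (F t) = (\<Inter>s\<in>{t<..}. sets (F s))"
    and null_sets_F0: "null_sets M \<subseteq> sets (F 0)"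

locale brownian_motion = usual_filtered_space M F
  for M :: "'w measure" and F :: "real \<Rightarrow> 'w measure" +
  fixes W :: "real \<Rightarrow> 'w \<Rightarrow> real ^ 'm"
  assumes start: "AE \<omega> in M. W 0 \<omega> = 0"
    and adapted: "\<And>t. 0 \<le> t \<Longrightarrow> W t \<in> borel_measurable (F t)"
    and cont_paths: "AE \<omega> in M. continuous_on {0..} (\<lambda>t. W t \<omega>)"
    and indep_incr: "\<And>s t. 0 \<le> s \<Longrightarrow> s < t \<Longrightarrow>
      indep_set (sets (F s)) {(\<lambda>\<omega>. W t \<omega> - W s \<omega>) -` A \<inter> space M | A. A \<in> sets borel}"
    and gauss_incr: "\<And>s t. 0 \<le> s \<Longrightarrow> s < t \<Longrightarrow>
      distributed M lborel (\<lambda>\<omega>. W t \<omega> - W s \<omega>)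
        (\<lambda>x. \<Prod>i\<in>UNIV. ennreal (normal_density 0 (sqrt (t - s)) (x $ i)))"

section \<open>The Ito integral\<close>

definition conv_in_prob ::
  "'w measure \<Rightarrow> (nat \<Rightarrow> 'w \<Rightarrow> 'b::{metric_space, second_countable_topology}) \<Rightarrow> ('w \<Rightarrow> 'b) \<Rightarrow> bool"
  where "conv_in_prob M X Z \<longleftrightarrow>
    (\<forall>n. X n \<in> borel_measurable M) \<and> Z \<in> borel_measurable M \<and>
    (\<forall>\<epsilon>>0. (\<lambda>n. measure M {\<omega> \<in> space M. dist (X n \<omega>) (Z \<omega>) > \<epsilon>}) \<longlonglongrightarrow> 0)"

text \<open>The triple \<open>(n, p, \<xi>)\<close> encodes the simple process equal to \<open>\<xi> i\<close> on the interval
  \<open>(p i, p (i + 1)]\<close> for \<open>i < n\<close> and to zero elsewhere.\<close>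

type_synonym ('w, 'b) simple_proc = "nat \<times> (nat \<Rightarrow> real) \<times> (nat \<Rightarrow> 'w \<Rightarrow> 'b)"

definition is_simple_proc ::
  "'w measure \<Rightarrow> (real \<Rightarrow> 'w measure) \<Rightarrow> ('w, 'b::real_normed_vector) simple_proc \<Rightarrow> bool"
  where "is_simple_proc M F = (\<lambda>(n, p, \<xi>).
    0 \<le> p 0 \<and> (\<forall>i<n. p i \<le> p (Suc i)) \<and>
    (\<forall>i<n. \<xi> i \<in> borel_measurable (F (p i))) \<and>
    (\<exists>B. \<forall>i<n. \<forall>\<omega>\<in>space M. norm (\<xi> i \<omega>) \<le> B))"

definition simple_val :: "('w, 'b::real_vector) simple_proc \<Rightarrow> real \<Rightarrow> 'w \<Rightarrow> 'b"
  where "simple_val = (\<lambda>(n, p, \<xi>) t \<omega>. \<Sum>i<n. indicator {p i<..p (Suc i)} t *\<^sub>R \<xi> i \<omega>)"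

definition simple_ito ::
  "(real \<Rightarrow> 'w \<Rightarrow> real ^ 'm) \<Rightarrow> ('w, real ^ 'm ^ 'r) simple_proc \<Rightarrow> real \<Rightarrow> 'w \<Rightarrow> real ^ 'r"
  where "simple_ito W = (\<lambda>(n, p, \<xi>) t \<omega>.
    \<Sum>i<n. \<xi> i \<omega> *v (W (min t (p (Suc i))) \<omega> - W (min t (p i)) \<omega>))"

text \<open>\<open>is_ito_integral M F W T H I\<close>: the process \<open>I\<close> is (a continuous version of) the Ito integral
  of \<open>H\<close> with respect to \<open>W\<close> on \<open>[0, T]\<close>. As usual for integrands with almost surely
  square-integrable paths, it is the limit in probability of integrals of simple processes that
  approximate \<open>H\<close>. The norm of a matrix in \<^typ>\<open>real ^ 'm ^ 'r\<close> is its Frobenius norm.\<close>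

definition is_ito_integral ::
  "'w measure \<Rightarrow> (real \<Rightarrow> 'w measure) \<Rightarrow> (real \<Rightarrow> 'w \<Rightarrow> real ^ 'm) \<Rightarrow> real \<Rightarrow>
   (real \<Rightarrow> 'w \<Rightarrow> real ^ 'm ^ 'r) \<Rightarrow> (real \<Rightarrow> 'w \<Rightarrow> real ^ 'r) \<Rightarrow> bool"
  where "is_ito_integral M F W T H I \<longleftrightarrow>
    (AE \<omega> in M. set_borel_measurable lborel {0..T} (\<lambda>t. H t \<omega>) \<and>
                set_integrable lborel {0..T} (\<lambda>t. (norm (H t \<omega>))\<^sup>2)) \<and>
    (\<forall>t\<in>{0..T}. I t \<in> borel_measurable (F t)) \<and>
    (AE \<omega> in M. continuous_on {0..T} (\<lambda>t. I t \<omega>)) \<and>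
    (\<exists>Hs. (\<forall>n. is_simple_proc M F (Hs n)) \<and>
      conv_in_prob M
        (\<lambda>n \<omega>. LINT t:{0..T}|lborel. (norm (simple_val (Hs n) t \<omega> - H t \<omega>))\<^sup>2) (\<lambda>_. 0) \<and>
      (\<forall>t\<in>{0..T}. conv_in_prob M (\<lambda>n. simple_ito W (Hs n) t) (I t)))"

text \<open>\<open>Z\<close> solves \<open>dZ = \<mu> dt + \<sigma> dW\<close> on \<open>[0, T]\<close>, for given coefficient processes \<open>\<mu>\<close> and \<open>\<sigma>\<close>.\<close>

definition solves_sde ::
  "'w measure \<Rightarrow> (real \<Rightarrow> 'w measure) \<Rightarrow> (real \<Rightarrow> 'w \<Rightarrow> real ^ 'm) \<Rightarrow> real \<Rightarrow>
   (real \<Rightarrow> 'w \<Rightarrow> real ^ 'r) \<Rightarrow> (real \<Rightarrow> 'w \<Rightarrow> real ^ 'm ^ 'r) \<Rightarrow> (real \<Rightarrow> 'w \<Rightarrow> real ^ 'r) \<Rightarrow> bool"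
  where "solves_sde M F W T \<mu> \<sigma> Z \<longleftrightarrow>
    (AE \<omega> in M. set_integrable lborel {0..T} (\<lambda>t. \<mu> t \<omega>)) \<and>
    (\<exists>I. is_ito_integral M F W T \<sigma> I \<and>
      (AE \<omega> in M. \<forall>t\<in>{0..T}. Z t \<omega> = Z 0 \<omega> + (LINT s:{0..t}|lborel. \<mu> s \<omega>) + I t \<omega>))"

section \<open>Conditions on the coefficients\<close>

definition jointly_measurable :: "(real \<Rightarrow> 'x::topological_space \<Rightarrow> 'y::topological_space) \<Rightarrow> bool"
  where "jointly_measurable f \<longleftrightarrow>
    (\<lambda>(s, x). f s x) \<in> borel_measurable (restrict_space borel {0..} \<Otimes>\<^sub>M borel)"

definition lipschitz_cond ::
  "(real \<Rightarrow> real ^ 'd \<Rightarrow> real ^ 'd) \<Rightarrow> (real \<Rightarrow> real ^ 'd \<Rightarrow> real ^ 'm ^ 'd) \<Rightarrow> bool"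
  where "lipschitz_cond a b \<longleftrightarrow> (\<exists>C>0. \<forall>s\<ge>0. \<forall>x y.
    norm (a s x - a s y) \<le> C * norm (x - y) \<and> norm (b s x - b s y) \<le> C * norm (x - y))"

definition linear_growth ::
  "(real \<Rightarrow> real ^ 'd \<Rightarrow> real ^ 'd) \<Rightarrow> (real \<Rightarrow> real ^ 'd \<Rightarrow> real ^ 'm ^ 'd) \<Rightarrow> bool"
  where "linear_growth a b \<longleftrightarrow> (\<exists>C>0. \<forall>s\<ge>0. \<forall>x.
    (norm (a s x))\<^sup>2 + (norm (b s x))\<^sup>2 \<le> C * (1 + (norm x)\<^sup>2))"

section \<open>Dynamically orthogonal (DO) solutions\<close>

definition abs_continuous_on :: "real \<Rightarrow> real \<Rightarrow> (real \<Rightarrow> 'b::real_normed_vector) \<Rightarrow> bool"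
  where "abs_continuous_on u v f \<longleftrightarrow>
    (\<forall>\<epsilon>>0. \<exists>\<delta>>0. \<forall>(n::nat) l r.
      (\<forall>i<n. u \<le> l i \<and> l i \<le> r i \<and> r i \<le> v) \<and>
      (\<forall>i<n. \<forall>j<n. i \<noteq> j \<longrightarrow> {l i<..<r i} \<inter> {l j<..<r j} = {}) \<and>
      (\<Sum>i<n. r i - l i) < \<delta> \<longrightarrow> (\<Sum>i<n. norm (f (r i) - f (l i))) < \<epsilon>)"

definition square_integrable :: "'w measure \<Rightarrow> ('w \<Rightarrow> real ^ 'r) \<Rightarrow> bool"
  where "square_integrable M Z \<longleftrightarrow>
    Z \<in> borel_measurable M \<and> integrable M (\<lambda>\<omega>. (norm (Z \<omega>))\<^sup>2)"

definition L2_norm :: "'w measure \<Rightarrow> ('w \<Rightarrow> real ^ 'r) \<Rightarrow> real"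
  where "L2_norm M Z = sqrt (LINT \<omega>|M. (norm (Z \<omega>))\<^sup>2)"

definition lin_indep_components :: "'w measure \<Rightarrow> ('w \<Rightarrow> real ^ 'r) \<Rightarrow> bool"
  where "lin_indep_components M Z \<longleftrightarrow>
    (\<forall>c. (AE \<omega> in M. (\<Sum>i\<in>UNIV. c i * Z \<omega> $ i) = 0) \<longrightarrow> (\<forall>i. c i = 0))"

text \<open>The matrix of \<open>E[Z V\<^sup>T]\<close>.\<close>

definition cross_moment ::
  "'w measure \<Rightarrow> ('w \<Rightarrow> real ^ 'r) \<Rightarrow> ('w \<Rightarrow> real ^ 'd) \<Rightarrow> real ^ 'd ^ 'r"
  where "cross_moment M Z V = (\<chi> i j. LINT \<omega>|M. Z \<omega> $ i * V \<omega> $ j)"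

definition orth_proj :: "(real ^ 'd) set \<Rightarrow> real ^ 'd ^ 'd"
  where "orth_proj S = (THE P. \<forall>x. P *v x \<in> S \<and> (\<forall>y\<in>S. orthogonal (x - P *v x) y))"

lemma orth_proj_ex1:
  fixes S :: "(real ^ 'd) set"
  assumes S: "subspace S"
  shows "\<exists>!P :: real ^ 'd ^ 'd. \<forall>x. P *v x \<in> S \<and> (\<forall>y\<in>S. orthogonal (x - P *v x) y)"
proof -
  obtain B where B: "B \<subseteq> S" "pairwise orthogonal B" "finite B" "span B = S"
    using orthonormal_basis_subspace[OF S] by (metis independent_imp_finite)
  define f where "f x = (\<Sum>b\<in>B. (b \<bullet> x / (b \<bullet> b)) *\<^sub>R b)" for x
  have "linear f"
    unfolding f_def
    by (intro linearI) (simp_all add: inner_add_right add_divide_distrib scaleR_add_left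
        sum.distrib scaleR_sum_right)
  hence f: "matrix f *v x = f x" for x
    by (simp add: matrix_works)
  have ex: "matrix f *v x \<in> S \<and> (\<forall>y\<in>S. orthogonal (x - matrix f *v x) y)" for x
  proof -
    have "f x \<in> S"
      unfolding f_def using B(1) S by (intro subspace_sum subspace_scale) auto
    moreover have "orthogonal (x - f x) y" if "y \<in> S" for y
      using Gram_Schmidt_step[OF B(2), of y x] that B(4)
      by (simp add: f_def orthogonal_commute)
    ultimately show ?thesis by (simp add: f)
  qed
  have "P = Q"
    if P: "\<forall>x. P *v x \<in> S \<and> (\<forall>y\<in>S. orthogonal (x - P *v x) y)"
      and Q: "\<forall>x. Q *v x \<in> S \<and> (\<forall>y\<in>S. orthogonal (x - Q *v x) y)"
    for P Q :: "real ^ 'd ^ 'd"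
  proof -
    have "P *v x = Q *v x" for x
    proof -
      let ?y = "P *v x - Q *v x"
      have "?y \<in> S" using P Q S by (simp add: subspace_diff)
      hence "(x - P *v x) \<bullet> ?y = 0" "(x - Q *v x) \<bullet> ?y = 0"
        using P Q by (auto simp: orthogonal_def)
      hence "?y \<bullet> ?y = 0" by (simp add: inner_diff_left)
      thus ?thesis by simp
    qed
    thus ?thesis by (simp add: matrix_eq)
  qed
  with ex show ?thesis by blast
qed

lemma orth_proj:
  assumes "subspace S"
  shows "orth_proj S *v x \<in> S" "y \<in> S \<Longrightarrow> orthogonal (x - orth_proj S *v x) y"
  using theI'[OF orth_proj_ex1[OF assms]] unfolding orth_proj_def by blast+

text \<open>The process \<open>X\<^sub>t = U\<^sub>t\<^sup>T Y\<^sub>t\<close>. Here \<open>U\<^sub>t\<close> has its rows indexed by \<open>'r\<close>, its columns by \<open>'d\<close>.\<close>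

definition DO_approx ::
  "(real \<Rightarrow> real ^ 'd ^ 'r) \<Rightarrow> (real \<Rightarrow> 'w \<Rightarrow> real ^ 'r) \<Rightarrow> real \<Rightarrow> 'w \<Rightarrow> real ^ 'd"
  where "DO_approx U Y t \<omega> = transpose (U t) *v Y t \<omega>"

definition strong_DO_solution ::
  "'w measure \<Rightarrow> (real \<Rightarrow> 'w measure) \<Rightarrow> (real \<Rightarrow> 'w \<Rightarrow> real ^ 'm) \<Rightarrow>
   (real \<Rightarrow> real ^ 'd \<Rightarrow> real ^ 'd) \<Rightarrow> (real \<Rightarrow> real ^ 'd \<Rightarrow> real ^ 'm ^ 'd) \<Rightarrow> real \<Rightarrow>
   (real \<Rightarrow> real ^ 'd ^ 'r) \<Rightarrow> (real \<Rightarrow> 'w \<Rightarrow> real ^ 'r) \<Rightarrow> bool"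
  where "strong_DO_solution M F W a b T U Y \<longleftrightarrow>
    (\<forall>t\<in>{0..T}. square_integrable M (Y t)) \<and>
    (\<forall>i j. row i (U 0) \<bullet> row j (U 0) = (if i = j then 1 else 0)) \<and>
    lin_indep_components M (Y 0) \<and>
    abs_continuous_on 0 T U \<and>
    (AE t in lborel. t \<in> {0<..<T} \<longrightarrow>
      (\<exists>D. (U has_vector_derivative D) (at t) \<and> U t ** transpose D = 0)) \<and>
    (AE \<omega> in M. continuous_on {0..T} (\<lambda>t. Y t \<omega>)) \<and>
    (\<forall>t\<in>{0..T}. Y t \<in> borel_measurable (F t)) \<and>
    (\<forall>t\<in>{0..T}. lin_indep_components M (Y t)) \<and>
    (AE t in lborel. t \<in> {0<..<T} \<longrightarrow>
      (\<exists>D. (U has_vector_derivative D) (at t) \<and>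
        cross_moment M (Y t) (Y t) ** D =
          cross_moment M (Y t) (\<lambda>\<omega>. a t (DO_approx U Y t \<omega>)) **
            (mat 1 - orth_proj (span (rows (U t)))))) \<and>
    solves_sde M F W T
      (\<lambda>t \<omega>. U t *v a t (DO_approx U Y t \<omega>))
      (\<lambda>t \<omega>. U t ** b t (DO_approx U Y t \<omega>)) Y"

text \<open>\<open>[0, S)\<close> is the interval of existence of the solution extended as far as possible.\<close>

definition maximal_DO_solution ::
  "'w measure \<Rightarrow> (real \<Rightarrow> 'w measure) \<Rightarrow> (real \<Rightarrow> 'w \<Rightarrow> real ^ 'm) \<Rightarrow>
   (real \<Rightarrow> real ^ 'd \<Rightarrow> real ^ 'd) \<Rightarrow> (real \<Rightarrow> real ^ 'd \<Rightarrow> real ^ 'm ^ 'd) \<Rightarrow> ereal \<Rightarrow>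
   (real \<Rightarrow> real ^ 'd ^ 'r) \<Rightarrow> (real \<Rightarrow> 'w \<Rightarrow> real ^ 'r) \<Rightarrow> bool"
  where "maximal_DO_solution M F W a b S U Y \<longleftrightarrow>
    0 < S \<and>
    (\<forall>T>0. ereal T < S \<longrightarrow> strong_DO_solution M F W a b T U Y) \<and>
    \<not> (\<exists>T U' Y'. S \<le> ereal T \<and> strong_DO_solution M F W a b T U' Y' \<and>
         (\<forall>t\<ge>0. ereal t < S \<longrightarrow> U' t = U t \<and> (AE \<omega> in M. Y' t \<omega> = Y t \<omega>)))"

text \<open>In the complete lattice \<^typ>\<open>ereal\<close> the infimum of the empty set is \<open>\<infinity>\<close>.\<close>

definition DO_tau1 ::
  "'w measure \<Rightarrow> ereal \<Rightarrow> (real \<Rightarrow> 'w \<Rightarrow> real ^ 'r) \<Rightarrow> nat \<Rightarrow> ereal"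
  where "DO_tau1 M S Y n = Inf (ereal ` {t. 0 < t \<and> ereal t < S \<and>
    norm (matrix_inv (cross_moment M (Y t) (Y t))) =
      norm (matrix_inv (cross_moment M (Y 0) (Y 0))) + real n})"

definition DO_tau2 ::
  "'w measure \<Rightarrow> ereal \<Rightarrow> (real \<Rightarrow> 'w \<Rightarrow> real ^ 'r) \<Rightarrow> nat \<Rightarrow> ereal"
  where "DO_tau2 M S Y n = Inf (ereal ` {t. 0 < t \<and> ereal t < S \<and>
    L2_norm M (Y t) = L2_norm M (Y 0) + real n})"

definition is_explosion_time ::
  "'w measure \<Rightarrow> ereal \<Rightarrow> (real \<Rightarrow> 'w \<Rightarrow> real ^ 'r) \<Rightarrow> ereal \<Rightarrow> bool"
  where "is_explosion_time M S Y Te \<longleftrightarrow>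
    (\<lambda>n. min (DO_tau1 M S Y n) (DO_tau2 M S Y n)) \<longlonglongrightarrow> Te"

section \<open>Continuous extension of paths\<close>

definition continuous_extension ::
  "real \<Rightarrow> (real \<Rightarrow> 'b::topological_space) \<Rightarrow> (real \<Rightarrow> 'b) \<Rightarrow> bool"
  where "continuous_extension T x z \<longleftrightarrow>
    continuous_on {0..T} z \<and> (\<forall>t\<in>{0..<T}. z t = x t)"

definition holder_continuous_on ::
  "real \<Rightarrow> real set \<Rightarrow> (real \<Rightarrow> 'b::metric_space) \<Rightarrow> bool"
  where "holder_continuous_on \<alpha> A f \<longleftrightarrow>
    (\<exists>C. \<forall>s\<in>A. \<forall>t\<in>A. dist (f s) (f t) \<le> C * \<bar>s - t\<bar> powr \<alpha>)"

end

theory Submission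
  imports Defs
begin

text \<open>The rows of \<open>U\<^sub>t\<close> stay orthonormal, so \<open>\<bar>X\<^sub>t\<bar> = \<bar>Y\<^sub>t\<bar>\<close>, and linear growth gives moment bounds for
  \<open>Y\<close> with constants that do not deteriorate at \<open>T\<^sub>e\<close>, whatever happens to the inverse of
  \<open>C\<^sub>Y = E[Y Y\<^sup>T]\<close>. Write \<open>dX = (dU)\<^sup>T Y + U\<^sup>T dY\<close>. Taking the trace of
  \<open>C\<^sub>Y U' = E[Y a\<^sup>T] (I - P)\<close> against \<open>U'\<close> yields \<open>E \<bar>U'\<^sup>T Y\<bar>\<^sup>2 \<le> E \<bar>a\<bar>\<^sup>2\<close> without inverting \<open>C\<^sub>Y\<close>, so the
  first part is almost surely the primitive of a square integrable function. The increments of the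
  second part have fourth moments of order \<open>\<bar>t - s\<bar>\<^sup>2\<close>, and Kolmogorov's criterion applies. Hence the
  paths of \<open>X\<close> are Hoelder continuous on \<open>[0, T\<^sub>e)\<close> and extend to \<open>T\<^sub>e\<close>, where Fatou's lemma bounds
  the moment.\<close>

section \<open>Absolutely continuous functions\<close>

text \<open>The Ito integral is given only as a limit in probability of simple integrals, so moment
  estimates are proved for simple integrands and carried over by Fatou's lemma. Two obstacles shape
  this. The approximating simple processes have no common bound: the solution is localized by exit
  times from balls and the simple integrands are clipped at the matching level, with constants that
  do not see this level. And the stochastic part of \<open>X\<close> carries the moving factor
  \<open>U\<close>: the estimates are made for sums of
  \<open>A j *v (Y (u (Suc j)) - Y (u j))\<close> with arbitrary contractions \<open>A j\<close>,
  uniformly in the partition; with the transpose of \<open>U (u j)\<close> as \<open>A j\<close>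
  these are Riemann sums of the integral of \<open>U\<close> against \<open>dY\<close>. A time step
  enters each one-step bound only relative to the length \<open>L\<close> of the whole interval, so
  the factors multiply to a constant however fine the grid is. The exponent 1/8 is one choice below
  1/4, the threshold for fourth moments of order \<open>\<bar>t - s\<bar>\<^sup>2\<close>. That the
  explosion time is positive comes from mean-square continuity of \<open>Y\<close> at 0; that it
  lies within the interval of existence comes from its finiteness.\<close>

lemma abs_continuous_on_sum_less:
  fixes f :: "real \<Rightarrow> 'b::real_normed_vector"
  assumes AC: "abs_continuous_on u v f" and "\<epsilon> > 0"
  obtains \<delta> where "\<delta> > 0"
    "\<And>(I::'i set) l r. finite I \<Longrightarrow> (\<forall>i\<in>I. u \<le> l i \<and> l i \<le> r i \<and> r i \<le> v) \<Longrightarrow>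
      (\<forall>i\<in>I. \<forall>j\<in>I. i \<noteq> j \<longrightarrow> {l i<..<r i} \<inter> {l j<..<r j} = {}) \<Longrightarrow>
      (\<Sum>i\<in>I. r i - l i) < \<delta> \<Longrightarrow> (\<Sum>i\<in>I. norm (f (r i) - f (l i))) < \<epsilon>"
proof -
  obtain \<delta> where \<delta>: "\<delta> > 0" and ac: "\<And>(n::nat) l r.
      (\<forall>i<n. u \<le> l i \<and> l i \<le> r i \<and> r i \<le> v) \<Longrightarrow>
      (\<forall>i<n. \<forall>j<n. i \<noteq> j \<longrightarrow> {l i<..<r i} \<inter> {l j<..<r j} = {}) \<Longrightarrow>
      (\<Sum>i<n. r i - l i) < \<delta> \<Longrightarrow> (\<Sum>i<n. norm (f (r i) - f (l i))) < \<epsilon>"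
    using AC[unfolded abs_continuous_on_def, rule_format, OF \<open>\<epsilon> > 0\<close>] by auto
  have "(\<Sum>i\<in>I. norm (f (r i) - f (l i))) < \<epsilon>"
    if "finite I" "\<forall>i\<in>I. u \<le> l i \<and> l i \<le> r i \<and> r i \<le> v"
      "\<forall>i\<in>I. \<forall>j\<in>I. i \<noteq> j \<longrightarrow> {l i<..<r i} \<inter> {l j<..<r j} = {}"
      "(\<Sum>i\<in>I. r i - l i) < \<delta>" for I :: "'i set" and l r
  proof -
    \<comment> \<open>Tagged divisions are indexed by pairs and divisions by sets, while the
      definition of absolute continuity numbers its intervals; an enumeration of \<open>I\<close>
      bridges the two.\<close>
    obtain h where h: "bij_betw h {0..<card I} I"
      using ex_bij_betw_nat_finite[OF \<open>finite I\<close>] by blast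
    hence h': "bij_betw h {..<card I} I" by (simp add: atLeast0LessThan)
    have mem: "h i \<in> I" if "i < card I" for i
      using h' that by (auto simp: bij_betw_def)
    have inj: "h i \<noteq> h j" if "i < card I" "j < card I" "i \<noteq> j" for i j
      using h' that by (auto simp: bij_betw_def inj_on_def)
    have s: "(\<Sum>i<card I. g (h i)) = (\<Sum>i\<in>I. g i)" for g :: "'i \<Rightarrow> real"
      by (rule sum.reindex_bij_betw[OF h'])
    have "(\<Sum>i<card I. norm (f ((r \<circ> h) i) - f ((l \<circ> h) i))) < \<epsilon>"
    proof (rule ac)
      show "(\<Sum>i<card I. (r \<circ> h) i - (l \<circ> h) i) < \<delta>"
        using that(4) s[of "\<lambda>i. r i - l i"] by simp
    qed (use that mem inj in auto)
    thus ?thesis using s[of "\<lambda>i. norm (f (r i) - f (l i))"] by simp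
  qed
  thus ?thesis using \<delta> by (intro that) auto
qed

text \<open>Points of the exceptional null set are tagged inside an open set of small measure, where
  absolute continuity controls the increments.\<close>

lemma abs_continuous_on_has_integral:
  fixes f :: "real \<Rightarrow> 'b::banach"
  assumes AC: "abs_continuous_on u v f" and uv: "u \<le> x" "x \<le> y" "y \<le> v"
    and deriv: "AE t in lborel. t \<in> {u<..<v} \<longrightarrow> (f has_vector_derivative D t) (at t)"
  shows "(D has_integral f y - f x) {x..y}"
proof -
  obtain N0 where N0: "{t \<in> space lborel. \<not> (t \<in> {u<..<v} \<longrightarrow> (f has_vector_derivative D t) (at t))} \<subseteq> N0"
      "N0 \<in> null_sets lborel"
    using deriv by (auto simp: eventually_ae_filter)
  \<comment> \<open>The endpoints join the null set because no derivative is assumed there.\<close>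
  define N where "N = N0 \<union> {u, v}"
  have N: "N \<in> null_sets lborel"
    unfolding N_def using N0(2) by (intro null_sets.Un) (auto intro!: finite_imp_null_set_lborel)
  have D: "(f has_vector_derivative D t) (at t)" if "t \<in> {x..y}" "t \<notin> N" for t
  proof -
    have "t \<in> {u<..<v}" using that uv by (auto simp: N_def)
    thus ?thesis using N0(1) that by (auto simp: N_def)
  qed
  \<comment> \<open>With the value 0 on \<open>N\<close>, a tag in \<open>N\<close> enters the
    Riemann error only through the increment of \<open>f\<close>; the change on a null set is undone
    at the end.\<close>
  define E where "E t = (if t \<in> N then 0 else D t)" for t
  have "(E has_integral f y - f x) {x..y}"
    unfolding has_integral_real
  proof (intro allI impI)
    fix e :: real assume "e > 0"
    \<comment> \<open>Half of \<open>e\<close> pays for the tags of differentiability and half for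
      the tags in \<open>N\<close>. The added 1 keeps the quotient meaningful when
      \<open>x = y\<close>.\<close>
    define e1 where "e1 = e / (2 * (1 + (y - x)))"
    have e1: "e1 > 0" unfolding e1_def using \<open>e > 0\<close> uv by (intro divide_pos_pos) auto
    have e1': "e1 * (y - x) \<le> e / 2"
      unfolding e1_def using \<open>e > 0\<close> uv by (simp add: field_simps)
    obtain \<delta> where "\<delta> > 0" and ac: "\<And>(I::(real \<times> real set) set) l r. finite I \<Longrightarrow>
       (\<forall>i\<in>I. u \<le> l i \<and> l i \<le> r i \<and> r i \<le> v) \<Longrightarrow>
       (\<forall>i\<in>I. \<forall>j\<in>I. i \<noteq> j \<longrightarrow> {l i<..<r i} \<inter> {l j<..<r j} = {}) \<Longrightarrow>
       (\<Sum>i\<in>I. r i - l i) < \<delta> \<Longrightarrow> (\<Sum>i\<in>I. norm (f (r i) - f (l i))) < e / 2"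
      by (rule abs_continuous_on_sum_less[OF AC half_gt_zero[OF \<open>e > 0\<close>], where 'i="real \<times> real set"]) blast
    have "N \<in> sets borel" using N by auto
    then obtain G where G: "open G" "N \<subseteq> G" "emeasure lborel (G - N) < ennreal \<delta>"
      using outer_regular_lborel[of N "\<delta>"] \<open>\<delta> > 0\<close> by auto
    have "emeasure lborel G = emeasure lborel (G - N)"
      by (rule emeasure_Diff_null_set[symmetric]) (use N G in auto)
    hence G\<delta>: "emeasure lborel G < ennreal \<delta>" using G by simp
    have "\<forall>t\<in>{x..y} - N. \<exists>d. d > 0 \<and> (\<forall>s. \<bar>s - t\<bar> < d \<longrightarrow> norm (f s - f t - (s - t) *\<^sub>R D t) \<le> e1 * \<bar>s - t\<bar>)"
      using D e1 unfolding has_vector_derivative_def has_derivative_at_alt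
      by (auto simp: real_norm_def)
    from bchoice[OF this] obtain d where
      d0: "\<forall>t\<in>{x..y} - N. d t > 0 \<and> (\<forall>s. \<bar>s - t\<bar> < d t \<longrightarrow> norm (f s - f t - (s - t) *\<^sub>R D t) \<le> e1 * \<bar>s - t\<bar>)"
      by blast
    hence d: "\<And>t. t \<in> {x..y} \<Longrightarrow> t \<notin> N \<Longrightarrow> d t > 0"
      and dd: "\<And>t s. t \<in> {x..y} \<Longrightarrow> t \<notin> N \<Longrightarrow> \<bar>s - t\<bar> < d t \<Longrightarrow> norm (f s - f t - (s - t) *\<^sub>R D t) \<le> e1 * \<bar>s - t\<bar>"
      by auto
    define \<gamma> where "\<gamma> t = (if t \<in> N then G else if t \<in> {x..y} then ball t (d t) else UNIV)" for t
    have gauge: "gauge \<gamma>"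
      unfolding gauge_def \<gamma>_def using d G by auto
    show "\<exists>\<gamma>. gauge \<gamma> \<and> (\<forall>\<D>. \<D> tagged_division_of {x..y} \<and> \<gamma> fine \<D> \<longrightarrow>
            norm ((\<Sum>(t, K)\<in>\<D>. measure lborel K *\<^sub>R E t) - (f y - f x)) < e)"
    proof (intro exI[of _ \<gamma>] conjI gauge allI impI)
      fix p assume "p tagged_division_of {x..y} \<and> \<gamma> fine p"
      hence p: "p tagged_division_of {x..y}" "\<gamma> fine p" by auto
      have fin: "finite p" using p(1) by auto
      have K: "\<exists>l r. K = {l..r} \<and> l \<le> t \<and> t \<le> r \<and> x \<le> l \<and> r \<le> y \<and> K \<subseteq> \<gamma> t"
        if tK: "(t, K) \<in> p" for t K
      proof -
        obtain l r where lr: "K = cbox l r" using tagged_division_ofD(4)[OF p(1) tK] by blast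
        have "t \<in> K" "K \<subseteq> {x..y}"
          using tagged_division_ofD(2,3)[OF p(1) tK] by auto
        moreover have "K \<subseteq> \<gamma> t" using p(2) tK by (auto simp: fine_def)
        ultimately show ?thesis using lr by (intro exI[of _ l] exI[of _ r]) auto
      qed
      have sum_f: "f y - f x = (\<Sum>(t,K)\<in>p. f (Sup K) - f (Inf K))"
        using additive_tagged_division_1[of x y p f] p uv by auto
      have sum_l: "y - x = (\<Sum>(t,K)\<in>p. Sup K - Inf K)"
        using additive_tagged_division_1[of x y p "\<lambda>x. x"] p uv by auto
      define q where "q = {z \<in> p. fst z \<in> N}"
      have q: "q \<subseteq> p" "finite q" using fin by (auto simp: q_def)
      have bnd: "norm (case z of (t,K) \<Rightarrow> measure lborel K *\<^sub>R E t - (f (Sup K) - f (Inf K)))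
           \<le> (if z \<in> q then norm (f (Sup (snd z)) - f (Inf (snd z))) else 0)
             + e1 * (Sup (snd z) - Inf (snd z))" if "z \<in> p" for z
      proof -
        obtain t K0 where z: "z = (t, K0)" by (cases z)
        obtain l r where lr: "K0 = {l..r}" "l \<le> t" "t \<le> r" "x \<le> l" "r \<le> y" "K0 \<subseteq> \<gamma> t"
          using K \<open>z \<in> p\<close> z by blast
        show ?thesis
        proof (cases "t \<in> N")
          case True
          thus ?thesis using z lr that e1 by (simp add: q_def E_def norm_minus_commute[of "f l" "f r"])
        next
          case False
          have t: "t \<in> {x..y}" using lr by auto
          have "l \<in> K0" "r \<in> K0" "K0 \<subseteq> ball t (d t)"
            using lr False t by (auto simp: \<gamma>_def)
          hence "l \<in> ball t (d t)" "r \<in> ball t (d t)" by auto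
          \<comment> \<open>Straddling: the linearization errors at the two ends of an interval
            around its tag add up to \<open>e1\<close> times the length of the interval.\<close>
          hence "norm (f r - f t - (r - t) *\<^sub>R D t) \<le> e1 * (r - t)"
                "norm (f l - f t - (l - t) *\<^sub>R D t) \<le> e1 * (t - l)"
            using dd[OF t False, of r] dd[OF t False, of l] lr by (auto simp: dist_real_def)
          hence "norm ((f l - f t - (l - t) *\<^sub>R D t) - (f r - f t - (r - t) *\<^sub>R D t)) \<le> e1 * (r - l)"
            by (smt (verit, best) norm_triangle_ineq4 distrib_left right_diff_distrib)
          moreover have "(f l - f t - (l - t) *\<^sub>R D t) - (f r - f t - (r - t) *\<^sub>R D t)
             = (r - l) *\<^sub>R D t - (f r - f l)"
            by (simp add: algebra_simps)
          ultimately show ?thesis using z lr False by (auto simp: E_def q_def)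
        qed
      qed
      have lenq: "(\<Sum>z\<in>q. Sup (snd z) - Inf (snd z)) < \<delta>"
        and disj: "\<forall>i\<in>q. \<forall>j\<in>q. i \<noteq> j \<longrightarrow>
           {Inf (snd i)<..<Sup (snd i)} \<inter> {Inf (snd j)<..<Sup (snd j)} = {}"
        and rng: "\<forall>i\<in>q. u \<le> Inf (snd i) \<and> Inf (snd i) \<le> Sup (snd i) \<and> Sup (snd i) \<le> v"
      proof -
        show disj: "\<forall>i\<in>q. \<forall>j\<in>q. i \<noteq> j \<longrightarrow>
           {Inf (snd i)<..<Sup (snd i)} \<inter> {Inf (snd j)<..<Sup (snd j)} = {}"
        proof (intro ballI impI)
          fix i j assume ij: "i \<in> q" "j \<in> q" "i \<noteq> j"
          obtain t K1 s K2 where z: "i = (t,K1)" "j = (s,K2)" by (cases i; cases j)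
          have "(t,K1) \<in> p" "(s,K2) \<in> p" "(t,K1) \<noteq> (s,K2)" using ij z q by auto
          hence "interior K1 \<inter> interior K2 = {}" using tagged_division_ofD(5)[OF p(1)] by blast
          moreover obtain l r where "K1 = {l..r}" "l \<le> r" using K[of t K1] ij z q by fastforce
          moreover obtain l' r' where "K2 = {l'..r'}" "l' \<le> r'" using K[of s K2] ij z q by fastforce
          ultimately show "{Inf (snd i)<..<Sup (snd i)} \<inter> {Inf (snd j)<..<Sup (snd j)} = {}"
            using z by simp
        qed
        show rng: "\<forall>i\<in>q. u \<le> Inf (snd i) \<and> Inf (snd i) \<le> Sup (snd i) \<and> Sup (snd i) \<le> v"
        proof
          fix i assume i: "i \<in> q"
          obtain t K1 where z: "i = (t,K1)" by (cases i)
          obtain l r where "K1 = {l..r}" "l \<le> t" "t \<le> r" "x \<le> l" "r \<le> y" using K[of t K1] i z q by blast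
          thus "u \<le> Inf (snd i) \<and> Inf (snd i) \<le> Sup (snd i) \<and> Sup (snd i) \<le> v"
            using z uv by auto
        qed
        \<comment> \<open>The intervals tagged in \<open>N\<close> have disjoint interiors and lie
          in \<open>G\<close> by the choice of the gauge, so their total length is below
          \<open>\<delta>\<close>.\<close>
        have "ennreal (\<Sum>z\<in>q. Sup (snd z) - Inf (snd z)) = (\<Sum>z\<in>q. emeasure lborel {Inf (snd z)<..<Sup (snd z)})"
          using rng by (subst sum_ennreal[symmetric]) (auto intro!: sum.cong)
        also have "\<dots> = emeasure lborel (\<Union>z\<in>q. {Inf (snd z)<..<Sup (snd z)})"
          using disj q by (intro sum_emeasure) (auto simp: disjoint_family_on_def)
        also have "\<dots> \<le> emeasure lborel G"
        proof (rule emeasure_mono)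
          show "(\<Union>z\<in>q. {Inf (snd z)<..<Sup (snd z)}) \<subseteq> G"
          proof (rule UN_least)
            fix i assume i: "i \<in> q"
            obtain t K1 where z: "i = (t,K1)" by (cases i)
            obtain l r where "K1 = {l..r}" "l \<le> t" "t \<le> r" "K1 \<subseteq> \<gamma> t" using K[of t K1] i z q by blast
            thus "{Inf (snd i)<..<Sup (snd i)} \<subseteq> G"
              using z i by (auto simp: q_def \<gamma>_def subset_iff)
          qed
        qed (use G in auto)
        finally have "ennreal (\<Sum>z\<in>q. Sup (snd z) - Inf (snd z)) < ennreal \<delta>" using G\<delta> by order
        thus "(\<Sum>z\<in>q. Sup (snd z) - Inf (snd z)) < \<delta>"
          using ennreal_less_iff sum_nonneg[of q] rng by (simp add: ennreal_less_iff sum_nonneg)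
      qed
      have "norm ((\<Sum>(t, K)\<in>p. measure lborel K *\<^sub>R E t) - (f y - f x))
          = norm (\<Sum>z\<in>p. (case z of (t,K) \<Rightarrow> measure lborel K *\<^sub>R E t - (f (Sup K) - f (Inf K))))"
        unfolding sum_f sum_subtractf[symmetric] by (simp add: case_prod_beta)
      also have "\<dots> \<le> (\<Sum>z\<in>p. (if z \<in> q then norm (f (Sup (snd z)) - f (Inf (snd z))) else 0)
             + e1 * (Sup (snd z) - Inf (snd z)))"
        by (rule sum_norm_le) (use bnd in auto)
      also have "\<dots> = (\<Sum>z\<in>q. norm (f (Sup (snd z)) - f (Inf (snd z)))) + e1 * (y - x)"
        using q fin by (simp add: sum.distrib sum_distrib_left[symmetric] sum_l case_prod_beta
            sum.inter_restrict[symmetric] Int_absorb1)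
      also have "\<dots> < e / 2 + e / 2"
        using ac[OF q(2) rng disj lenq] e1' by linarith
      finally show "norm ((\<Sum>(t, K)\<in>p. measure lborel K *\<^sub>R E t) - (f y - f x)) < e" by simp
    qed
  qed
  moreover have "negligible N"
    using N by (simp add: negligible_iff_null_sets null_sets_completionI)
  ultimately show ?thesis
    by (elim has_integral_spike[rotated 2]) (auto simp: E_def)
qed

text \<open>On an interval shorter than the \<open>\<delta>\<close> that belongs to \<epsilon> = 1,
  the sums of \<open>norm (integral K D)\<close> over a division are sums of increments of
  \<open>f\<close>, hence at most 1. So the indefinite integral has bounded variation there, which
  is absolute integrability. Finitely many such intervals cover \<open>{u..v}\<close>.\<close>

lemma abs_continuous_on_absolutely_integrable:
  fixes f :: "real \<Rightarrow> 'b::euclidean_space"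
  assumes AC: "abs_continuous_on u v f" and uv: "u \<le> v"
    and deriv: "AE t in lborel. t \<in> {u<..<v} \<longrightarrow> (f has_vector_derivative D t) (at t)"
  shows "D absolutely_integrable_on {u..v}"
proof -
  note int = abs_continuous_on_has_integral[OF AC _ _ _ deriv]
  obtain \<delta> where "\<delta> > 0" and ac: "\<And>(I::real set set) l r. finite I \<Longrightarrow>
       (\<forall>i\<in>I. u \<le> l i \<and> l i \<le> r i \<and> r i \<le> v) \<Longrightarrow>
       (\<forall>i\<in>I. \<forall>j\<in>I. i \<noteq> j \<longrightarrow> {l i<..<r i} \<inter> {l j<..<r j} = {}) \<Longrightarrow>
       (\<Sum>i\<in>I. r i - l i) < \<delta> \<Longrightarrow> (\<Sum>i\<in>I. norm (f (r i) - f (l i))) < 1"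
    by (rule abs_continuous_on_sum_less[OF AC zero_less_one, where 'i="real set"]) blast
  have short: "D absolutely_integrable_on {x..y}" if xy: "u \<le> x" "x \<le> y" "y \<le> v" "y - x < \<delta>" for x y
  proof -
    have "D absolutely_integrable_on cbox x y"
    proof (rule bounded_variation_absolutely_integrable_interval)
      show "D integrable_on cbox x y" using int[of x y] xy by auto
      fix d assume d: "d division_of cbox x y"
      have K: "\<exists>l r. K = {l..r} \<and> x \<le> l \<and> l \<le> r \<and> r \<le> y" if "K \<in> d" for K
      proof -
        have "\<exists>l r. K = cbox l r" "K \<noteq> {}" "K \<subseteq> cbox x y" using d that by blast+
        then obtain l r where "K = {l..r}" "l \<le> r" "K \<subseteq> {x..y}" by auto
        thus ?thesis by (intro exI[of _ l] exI[of _ r]) auto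
      qed
      have "(\<Sum>K\<in>d. norm (integral K D)) = (\<Sum>K\<in>d. norm (f (Sup K) - f (Inf K)))"
      proof (rule sum.cong[OF refl])
        fix K assume "K \<in> d"
        then obtain l r where "K = {l..r}" "x \<le> l" "l \<le> r" "r \<le> y" using K by blast
        thus "norm (integral K D) = norm (f (Sup K) - f (Inf K))"
          using int[of l r] xy by (auto simp: integral_unique)
      qed
      also have "\<dots> < 1"
      proof (rule ac)
        show "finite d" using d by auto
        show "\<forall>i\<in>d. u \<le> Inf i \<and> Inf i \<le> Sup i \<and> Sup i \<le> v"
          using K xy by fastforce
        show "\<forall>i\<in>d. \<forall>j\<in>d. i \<noteq> j \<longrightarrow> {Inf i<..<Sup i} \<inter> {Inf j<..<Sup j} = {}"
        proof (intro ballI impI)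
          fix i j assume ij: "i \<in> d" "j \<in> d" "i \<noteq> j"
          hence "interior i \<inter> interior j = {}" using d by blast
          moreover obtain l r where "i = {l..r}" "l \<le> r" using K ij by blast
          moreover obtain l' r' where "j = {l'..r'}" "l' \<le> r'" using K ij by blast
          ultimately show "{Inf i<..<Sup i} \<inter> {Inf j<..<Sup j} = {}" by simp
        qed
        have "(\<Sum>i\<in>d. Sup i - Inf i) = (\<Sum>i\<in>d. measure lborel i)"
          by (rule sum.cong[OF refl]) (use K in fastforce)
        also have "\<dots> = y - x" using additive_content_division[OF d] xy by simp
        finally show "(\<Sum>i\<in>d. Sup i - Inf i) < \<delta>" using xy by simp
      qed
      finally show "(\<Sum>K\<in>d. norm (integral K D)) \<le> 1" by simp
    qed
    thus ?thesis by simp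
  qed
  \<comment> \<open>Steps of \<open>\<delta> / 2\<close> keep the added piece strictly shorter than
    \<open>\<delta>\<close>, as \<open>short\<close> demands.\<close>
  have "D absolutely_integrable_on {u..min v (u + real n * (\<delta> / 2))}" for n
  proof (induction n)
    case 0
    show ?case using short[of u u] uv \<open>\<delta> > 0\<close> by simp
  next
    case (Suc n)
    define c where "c = real n * (\<delta> / 2)"
    have c: "0 \<le> c" and c': "real (Suc n) * (\<delta> / 2) = c + \<delta> / 2"
      using \<open>\<delta> > 0\<close> by (auto simp: c_def field_simps)
    let ?p = "min v (u + c)" and ?q = "min v (u + (c + \<delta> / 2))"
    have le: "u \<le> ?p" "?p \<le> ?q" "?q \<le> v" "?q - ?p < \<delta>"
      using uv \<open>\<delta> > 0\<close> c by (auto simp: min_def)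
    have "D absolutely_integrable_on {u..?p} \<union> {?p..?q}"
      by (rule set_integrable_Un[OF Suc[folded c_def] short]) (use le in auto)
    moreover have "{u..?p} \<union> {?p..?q} = {u..?q}" using le by auto
    ultimately show ?case unfolding c' by simp
  qed
  moreover obtain n where "(v - u) / (\<delta>/2) < real n" using reals_Archimedean2 by blast
  hence "min v (u + real n * (\<delta> / 2)) = v" using \<open>\<delta> > 0\<close> by (auto simp: field_simps)
  ultimately show ?thesis by metis
qed

text \<open>Meant for the inner products of rows of \<open>U\<close>, which are Lipschitz functions
  of \<open>U\<close> on bounded sets.\<close>

lemma abs_continuous_on_dominated:
  fixes f :: "real \<Rightarrow> 'b::real_normed_vector" and g :: "real \<Rightarrow> 'c::real_normed_vector"
  assumes AC: "abs_continuous_on u v f" and "C > 0"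
    and le: "\<And>x y. u \<le> x \<Longrightarrow> x \<le> y \<Longrightarrow> y \<le> v \<Longrightarrow> norm (g y - g x) \<le> C * norm (f y - f x)"
  shows "abs_continuous_on u v g"
  unfolding abs_continuous_on_def
proof (intro allI impI)
  fix \<epsilon> :: real assume "\<epsilon> > 0"
  hence "\<epsilon> / C > 0" using \<open>C > 0\<close> by simp
  from AC[unfolded abs_continuous_on_def, rule_format, OF this]
  obtain \<delta> where \<delta>: "\<delta> > 0" and ac: "\<And>(n::nat) l r.
      (\<forall>i<n. u \<le> l i \<and> l i \<le> r i \<and> r i \<le> v) \<Longrightarrow>
      (\<forall>i<n. \<forall>j<n. i \<noteq> j \<longrightarrow> {l i<..<r i} \<inter> {l j<..<r j} = {}) \<Longrightarrow>
      (\<Sum>i<n. r i - l i) < \<delta> \<Longrightarrow> (\<Sum>i<n. norm (f (r i) - f (l i))) < \<epsilon> / C"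
    by auto
  show "\<exists>\<delta>>0. \<forall>(n::nat) l r.
      (\<forall>i<n. u \<le> l i \<and> l i \<le> r i \<and> r i \<le> v) \<and>
      (\<forall>i<n. \<forall>j<n. i \<noteq> j \<longrightarrow> {l i<..<r i} \<inter> {l j<..<r j} = {}) \<and>
      (\<Sum>i<n. r i - l i) < \<delta> \<longrightarrow> (\<Sum>i<n. norm (g (r i) - g (l i))) < \<epsilon>"
  proof (intro exI[of _ \<delta>] conjI \<delta> allI impI, elim conjE)
    fix n :: nat and l r
    assume *: "\<forall>i<n. u \<le> l i \<and> l i \<le> r i \<and> r i \<le> v"
      "\<forall>i<n. \<forall>j<n. i \<noteq> j \<longrightarrow> {l i<..<r i} \<inter> {l j<..<r j} = {}" "(\<Sum>i<n. r i - l i) < \<delta>"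
    have "(\<Sum>i<n. norm (g (r i) - g (l i))) \<le> (\<Sum>i<n. C * norm (f (r i) - f (l i)))"
      by (rule sum_mono) (use * le in auto)
    also have "\<dots> = C * (\<Sum>i<n. norm (f (r i) - f (l i)))" by (simp add: sum_distrib_left)
    also have "\<dots> < C * (\<epsilon> / C)" using ac[of n l r] * \<open>C > 0\<close> by (intro mult_strict_left_mono) auto
    finally show "(\<Sum>i<n. norm (g (r i) - g (l i))) < \<epsilon>" using \<open>C > 0\<close> by simp
  qed
qed

lemma abs_continuous_on_imp_continuous_on:
  fixes f :: "real \<Rightarrow> 'b::real_normed_vector"
  assumes AC: "abs_continuous_on u v f"
  shows "continuous_on {u..v} f"
  unfolding continuous_on_iff
proof (intro ballI allI impI)
  fix x e :: real assume x: "x \<in> {u..v}" and "e > 0"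
  obtain \<delta> where \<delta>: "\<delta> > 0" and ac: "\<And>(I::nat set) l r. finite I \<Longrightarrow>
       (\<forall>i\<in>I. u \<le> l i \<and> l i \<le> r i \<and> r i \<le> v) \<Longrightarrow>
       (\<forall>i\<in>I. \<forall>j\<in>I. i \<noteq> j \<longrightarrow> {l i<..<r i} \<inter> {l j<..<r j} = {}) \<Longrightarrow>
       (\<Sum>i\<in>I. r i - l i) < \<delta> \<Longrightarrow> (\<Sum>i\<in>I. norm (f (r i) - f (l i))) < e"
    by (rule abs_continuous_on_sum_less[OF AC \<open>e > 0\<close>, where 'i=nat]) blast
  have "dist (f y) (f x) < e" if "y \<in> {u..v}" "dist y x < \<delta>" for y
    using ac[of "{0}" "\<lambda>_. min x y" "\<lambda>_. max x y"] x that
    by (cases "x \<le> y") (auto simp: dist_norm dist_real_def norm_minus_commute)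
  thus "\<exists>d>0. \<forall>x'\<in>{u..v}. dist x' x < d \<longrightarrow> dist (f x') (f x) < e" using \<delta> by blast
qed

section \<open>Elementary inequalities\<close>

lemma power_diff_abs_le:
  fixes x y :: real
  assumes "\<bar>x\<bar> \<le> m" "\<bar>y\<bar> \<le> m"
  shows "\<bar>x ^ n - y ^ n\<bar> \<le> real n * m ^ (n - 1) * \<bar>x - y\<bar>"
proof (induction n)
  case (Suc n)
  have m: "m \<ge> 0" using assms by linarith
  have "\<bar>y ^ n\<bar> \<le> m ^ n" using assms by (simp add: power_abs power_mono)
  have "x ^ Suc n - y ^ Suc n = x * (x ^ n - y ^ n) + y ^ n * (x - y)"
    by (simp add: algebra_simps)
  hence "\<bar>x ^ Suc n - y ^ Suc n\<bar> \<le> \<bar>x\<bar> * \<bar>x ^ n - y ^ n\<bar> + \<bar>y ^ n\<bar> * \<bar>x - y\<bar>"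
    by (metis abs_mult abs_triangle_ineq)
  also have "\<dots> \<le> m * (real n * m ^ (n - 1) * \<bar>x - y\<bar>) + m ^ n * \<bar>x - y\<bar>"
    using assms m Suc \<open>\<bar>y ^ n\<bar> \<le> m ^ n\<close> by (intro add_mono mult_mono) auto
  also have "m * (real n * m ^ (n - 1) * \<bar>x - y\<bar>) = real n * m ^ n * \<bar>x - y\<bar>"
    by (cases n) auto
  finally show ?case by (simp add: algebra_simps)
qed auto

lemma add_power_le:
  fixes a b :: real
  assumes "0 \<le> a" "0 \<le> b"
  shows "(a + b) ^ k \<le> 2 ^ k * (a ^ k + b ^ k)"
proof -
  have "(a + b) ^ k \<le> (2 * max a b) ^ k" using assms by (intro power_mono) auto
  also have "\<dots> = 2 ^ k * max a b ^ k" by (simp add: power_mult_distrib)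
  also have "max a b ^ k \<le> a ^ k + b ^ k" using assms by (auto simp: max_def)
  finally show ?thesis by simp
qed

text \<open>In the application \<open>z\<close> is the sum of the squared norms of two vectors x and
  y, \<open>c\<close> is twice their inner product and \<open>q\<close> is the squared norm of y, so
  \<open>z + c\<close> and \<open>z - c\<close> are the squared norms of x + y and x - y. The terms
  linear in \<open>c\<close> cancel between the two signs; what remains is quadratic in
  \<open>c\<close> and hence, by Cauchy-Schwarz, of order \<open>z * q\<close>.\<close>

lemma sym_power_le:
  "\<exists>B\<ge>0. \<forall>z c q :: real. \<bar>c\<bar> \<le> z \<longrightarrow> 0 \<le> q \<longrightarrow> c\<^sup>2 \<le> 4 * z * q \<longrightarrow>
     (z + c) ^ Suc n + (z - c) ^ Suc n \<le> 2 * z ^ Suc n + B * z ^ n * q"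
proof (induction n)
  case 0
  show ?case by (intro exI[of _ 0]) auto
next
  case (Suc n)
  then obtain B where B: "B \<ge> 0" and IH: "\<And>z c q :: real. \<bar>c\<bar> \<le> z \<Longrightarrow> 0 \<le> q \<Longrightarrow> c\<^sup>2 \<le> 4 * z * q \<Longrightarrow>
     (z + c) ^ Suc n + (z - c) ^ Suc n \<le> 2 * z ^ Suc n + B * z ^ n * q" by blast
  define B' where "B' = B + 8 * real (Suc n) * 2 ^ n"
  have "(z + c) ^ Suc (Suc n) + (z - c) ^ Suc (Suc n) \<le> 2 * z ^ Suc (Suc n) + B' * z ^ Suc n * q"
    if h: "\<bar>c\<bar> \<le> z" "0 \<le> q" "c\<^sup>2 \<le> 4 * z * q" for z c q :: real
  proof -
    have z: "z \<ge> 0" using h by linarith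
    \<comment> \<open>The difference of the powers is itself of order \<open>c\<close>, so this
      product is quadratic in \<open>c\<close>.\<close>
    have "c * ((z + c) ^ Suc n - (z - c) ^ Suc n) \<le> \<bar>c\<bar> * \<bar>(z + c) ^ Suc n - (z - c) ^ Suc n\<bar>"
      by (metis abs_ge_self abs_mult)
    also have "\<dots> \<le> \<bar>c\<bar> * (real (Suc n) * (2 * z) ^ n * \<bar>2 * c\<bar>)"
      using power_diff_abs_le[of "z + c" "2 * z" "z - c" "Suc n"] h by (intro mult_left_mono) auto
    also have "\<dots> = real (Suc n) * (2 * z) ^ n * 2 * c\<^sup>2"
    proof -
      have "\<bar>c\<bar> * \<bar>2 * c\<bar> = 2 * c\<^sup>2" by (cases "c \<ge> 0") (auto simp: power2_eq_square)
      thus ?thesis by (simp add: mult.assoc mult.left_commute[of "\<bar>c\<bar>"])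
    qed
    also have "\<dots> \<le> real (Suc n) * (2 * z) ^ n * 2 * (4 * z * q)"
      using h z by (intro mult_left_mono) auto
    finally have 1: "c * ((z + c) ^ Suc n - (z - c) ^ Suc n) \<le> 8 * real (Suc n) * 2 ^ n * z ^ Suc n * q"
      by (simp add: power_mult_distrib algebra_simps)
    have 2: "z * ((z + c) ^ Suc n + (z - c) ^ Suc n) \<le> z * (2 * z ^ Suc n + B * z ^ n * q)"
      using IH[OF h] z by (intro mult_left_mono) auto
    have "(z + c) ^ Suc (Suc n) + (z - c) ^ Suc (Suc n)
        = z * ((z + c) ^ Suc n + (z - c) ^ Suc n) + c * ((z + c) ^ Suc n - (z - c) ^ Suc n)"
      by (simp add: algebra_simps)
    also have "\<dots> \<le> z * (2 * z ^ Suc n + B * z ^ n * q) + 8 * real (Suc n) * 2 ^ n * z ^ Suc n * q"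
      using 1 2 by linarith
    also have "\<dots> = 2 * z ^ Suc (Suc n) + B' * z ^ Suc n * q"
      by (simp add: B'_def algebra_simps)
    finally show ?thesis .
  qed
  moreover have "B' \<ge> 0" using B by (simp add: B'_def)
  ultimately show ?case by blast
qed

text \<open>Averaging over the sign of \<open>y\<close> removes the term linear in \<open>y\<close>; this is what replaces
  Ito's formula for \<open>\<bar>x\<bar>\<^sup>2\<^sup>k\<close>.\<close>

lemma norm_sym_power_le:
  assumes "k \<ge> 1"
  shows "\<exists>B\<ge>0. \<forall>(x::'a::real_inner) y h L b g. 0 \<le> h \<longrightarrow> h \<le> L \<longrightarrow> 0 < L \<longrightarrow> 0 \<le> g \<longrightarrow> 0 \<le> b \<longrightarrow>
     (norm y)\<^sup>2 \<le> h * b\<^sup>2 * g \<longrightarrow>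
     norm (x + y) ^ (2 * k) + norm (x - y) ^ (2 * k)
       \<le> 2 * norm x ^ (2 * k) + B * (h / L) * (1 + g) ^ k * (norm x ^ (2 * k) + L ^ k * b ^ (2 * k))"
proof -
  obtain n where k: "k = Suc n" using assms by (cases k) auto
  obtain B where B: "B \<ge> 0" and sp: "\<And>z c q :: real. \<bar>c\<bar> \<le> z \<Longrightarrow> 0 \<le> q \<Longrightarrow> c\<^sup>2 \<le> 4 * z * q \<Longrightarrow>
     (z + c) ^ Suc n + (z - c) ^ Suc n \<le> 2 * z ^ Suc n + B * z ^ n * q"
    using sym_power_le[of n] by blast
  define B' where "B' = (B + 2 * real k) * 2 ^ k"
  have "norm (x + y) ^ (2 * k) + norm (x - y) ^ (2 * k)
       \<le> 2 * norm x ^ (2 * k) + B' * (h / L) * (1 + g) ^ k * (norm x ^ (2 * k) + L ^ k * b ^ (2 * k))"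
    if h: "0 \<le> h" "h \<le> L" "0 < L" "0 \<le> g" "0 \<le> b" "(norm y)\<^sup>2 \<le> h * b\<^sup>2 * g" for x y :: 'a and h L b g
  proof -
    define p where "p = (norm x)\<^sup>2"
    define q where "q = (norm y)\<^sup>2"
    define c where "c = 2 * (x \<bullet> y)"
    define z where "z = p + q"
    have nn: "p \<ge> 0" "q \<ge> 0" "z \<ge> 0" by (auto simp: p_def q_def z_def)
    have xy: "\<bar>x \<bullet> y\<bar> \<le> norm x * norm y" by (rule Cauchy_Schwarz_ineq2)
    have "2 * (norm x * norm y) \<le> z"
      using sum_squares_bound[of "norm x" "norm y"] by (simp add: z_def p_def q_def)
    hence c1: "\<bar>c\<bar> \<le> z" using xy by (simp add: c_def)
    have "c\<^sup>2 \<le> 4 * (norm x * norm y)\<^sup>2"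
      using power_mono[OF xy, of 2] by (simp add: c_def power_mult_distrib)
    also have "\<dots> \<le> 4 * z * q"
      by (simp add: z_def p_def q_def power_mult_distrib algebra_simps)
    finally have c2: "c\<^sup>2 \<le> 4 * z * q" .
    have a: "(norm (x + y))\<^sup>2 = z + c" "(norm (x - y))\<^sup>2 = z - c"
      by (simp_all add: power2_norm_eq_inner z_def p_def q_def c_def inner_add inner_diff inner_commute)
    have "norm (x + y) ^ (2 * k) + norm (x - y) ^ (2 * k) = (z + c) ^ k + (z - c) ^ k"
      by (simp add: power_mult a)
    also have "\<dots> \<le> 2 * z ^ k + B * z ^ n * q" using sp[OF c1 nn(2) c2] by (simp add: k)
    also have "z ^ k \<le> p ^ k + real k * z ^ n * q"
      using power_diff_abs_le[of z z p k] nn by (simp add: k z_def)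
    finally have 1: "norm (x + y) ^ (2 * k) + norm (x - y) ^ (2 * k) \<le> 2 * p ^ k + (B + 2 * real k) * (z ^ n * q)"
      by (simp add: algebra_simps)
    \<comment> \<open>\<open>b\<close> is measured on the scale of the length \<open>L\<close>
      instead of the step \<open>h\<close>. The step then survives only in the factor
      \<open>h / L\<close>, and such factors add up to at most 1 along a grid of total length
      \<open>L\<close>.\<close>
    define w where "w = L * b\<^sup>2"
    have w: "w \<ge> 0" using h by (simp add: w_def)
    have q: "q \<le> (h / L) * (w * g)" using h by (simp add: q_def w_def)
    also have "\<dots> \<le> 1 * (w * g)" using h w by (intro mult_right_mono) auto
    also have "\<dots> = w * g" by simp
    finally have qw: "q \<le> w * g" .
    have "z ^ n * q \<le> (p + w * g) ^ n * ((h / L) * (w * g))"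
      using q qw nn w h by (intro mult_mono power_mono) (auto simp: z_def)
    also have "\<dots> = (h / L) * ((p + w * g) ^ n * (w * g))" by (simp add: algebra_simps)
    also have "\<dots> \<le> (h / L) * ((p + w * g) ^ n * (p + w * g))"
      using h nn w by (intro mult_left_mono) auto
    also have "(p + w * g) ^ n * (p + w * g) = (p + w * g) ^ k" by (simp add: k)
    also have "\<dots> \<le> ((1 + g) * (p + w)) ^ k"
      using h nn w by (intro power_mono) (auto simp: algebra_simps)
    also have "\<dots> = (1 + g) ^ k * (p + w) ^ k" by (simp add: power_mult_distrib)
    also have "\<dots> \<le> (1 + g) ^ k * (2 ^ k * (p ^ k + w ^ k))"
      using h nn w by (intro mult_left_mono add_power_le) auto
    finally have 2: "z ^ n * q \<le> (h / L) * ((1 + g) ^ k * (2 ^ k * (p ^ k + w ^ k)))"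
      using h by (simp add: mult_left_mono divide_right_mono)
    have "(B + 2 * real k) * (z ^ n * q) \<le> (B + 2 * real k) * ((h / L) * ((1 + g) ^ k * (2 ^ k * (p ^ k + w ^ k))))"
      using B 2 by (intro mult_left_mono) auto
    also have "\<dots> = B' * (h / L) * (1 + g) ^ k * (p ^ k + w ^ k)"
      by (simp add: B'_def)
    also have "w ^ k = L ^ k * b ^ (2 * k)" by (simp add: w_def power_mult_distrib power_mult)
    also have "p ^ k = norm x ^ (2 * k)" by (simp add: p_def power_mult)
    finally show ?thesis using 1 by (simp add: p_def power_mult)
  qed
  moreover have "B' \<ge> 0" using B by (simp add: B'_def)
  ultimately show ?thesis by blast
qed

text \<open>Jensen's inequality by tangent lines: convexity of the power gives
  \<open>real n * m ^ (n - 1) * x \<le> x ^ n + real (n - 1) * m ^ n\<close>, which is integrated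
  over \<open>A\<close>.\<close>

lemma nn_integral_power_mean:
  fixes f :: "'a \<Rightarrow> real"
  assumes [measurable]: "f \<in> borel_measurable M" "A \<in> sets M"
    and f: "\<And>x. 0 \<le> f x" and A: "emeasure M A = ennreal L" "L > 0" and n: "n \<ge> 1"
  shows "(\<integral>\<^sup>+x\<in>A. ennreal (f x) \<partial>M) ^ n \<le> ennreal (L ^ (n - 1)) * (\<integral>\<^sup>+x\<in>A. ennreal (f x ^ n) \<partial>M)"
proof -
  let ?I = "\<integral>\<^sup>+x\<in>A. ennreal (f x) \<partial>M" and ?J = "\<integral>\<^sup>+x\<in>A. ennreal (f x ^ n) \<partial>M"
  have tangent: "real n * m ^ (n - 1) * x \<le> x ^ n + real (n - 1) * m ^ n" if "0 \<le> x" "0 \<le> m" for x m :: real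
    using n that
  proof (induction n rule: nat_induct_at_least)
    case (Suc n)
    have e: "m * m ^ (n - 1) = m ^ n" using Suc.hyps by (cases n) auto
    have "x * (real n * m ^ (n - 1) * x) \<le> x * (x ^ n + real (n - 1) * m ^ n)"
      using Suc by (intro mult_left_mono) auto
    moreover have "0 \<le> real n * (m ^ (n - 1) * (x - m)\<^sup>2)" using Suc.prems by simp
    hence "0 \<le> real n * (m ^ (n - 1) * x\<^sup>2 - 2 * (m * m ^ (n - 1)) * x + m * (m * m ^ (n - 1)))"
      by (simp add: power2_eq_square algebra_simps)
    hence "0 \<le> real n * (m ^ (n - 1) * x\<^sup>2 - 2 * m ^ n * x + m * m ^ n)" unfolding e .
    moreover have "real (n - 1) = real n - 1" using Suc.hyps by simp
    ultimately show ?case by (simp add: power2_eq_square algebra_simps)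
  qed simp
  have key: "ennreal (real n * m ^ (n - 1)) * ?I \<le> ?J + ennreal (real (n - 1) * m ^ n * L)" if m: "m \<ge> 0" for m
  proof -
    have "ennreal (real n * m ^ (n - 1)) * ?I = (\<integral>\<^sup>+x\<in>A. ennreal (real n * m ^ (n - 1) * f x) \<partial>M)"
      using m f by (subst nn_integral_cmult[symmetric]) (auto simp: ennreal_mult mult.assoc)
    also have "\<dots> \<le> (\<integral>\<^sup>+x\<in>A. ennreal (f x ^ n) + ennreal (real (n - 1) * m ^ n) \<partial>M)"
      using tangent[OF f m] m f
      by (intro nn_integral_mono mult_right_mono)
        (auto simp: ennreal_plus[symmetric] simp del: ennreal_plus intro!: ennreal_leI)
    also have "\<dots> = ?J + (\<integral>\<^sup>+x\<in>A. ennreal (real (n - 1) * m ^ n) \<partial>M)"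
      by (subst nn_integral_add[symmetric]) (auto simp: distrib_right)
    also have "(\<integral>\<^sup>+x\<in>A. ennreal (real (n - 1) * m ^ n) \<partial>M) = ennreal (real (n - 1) * m ^ n * L)"
      using A m by (simp add: nn_integral_cmult_indicator ennreal_mult)
    finally show ?thesis .
  qed
  show ?thesis
  proof (cases "?J = \<infinity>")
    case True
    thus ?thesis using A by (simp add: ennreal_mult_top)
  next
    case False
    have "?I \<noteq> \<infinity>"
    proof
      assume "?I = \<infinity>"
      moreover have "ennreal (real n * 1 ^ (n - 1)) \<noteq> 0" using n by simp
      ultimately have "ennreal (real n * 1 ^ (n - 1)) * ?I = \<infinity>" by (simp add: ennreal_mult_top)
      thus False using key[of 1] False by (simp add: top_unique)
    qed
    then obtain i where i: "?I = ennreal i" "i \<ge> 0" by (cases ?I) auto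
    obtain j where j: "?J = ennreal j" "j \<ge> 0" using False by (cases ?J) auto
    have e: "i * i ^ (n - 1) = i ^ n" "L * L ^ (n - 1) = L ^ n" using n by (cases n; simp)+
    \<comment> \<open>The tangent point is the mean \<open>i / L\<close> of \<open>f\<close> over
      \<open>A\<close>, where the bound is sharpest.\<close>
    have "ennreal (real n * (i / L) ^ (n - 1) * i) \<le> ennreal (j + real (n - 1) * (i / L) ^ n * L)"
      using key[of "i / L"] i j A by (simp add: ennreal_mult)
    hence le: "real n * (i / L) ^ (n - 1) * i \<le> j + real (n - 1) * (i / L) ^ n * L"
      using i j A by (subst (asm) ennreal_le_iff) auto
    have "(i / L) ^ (n - 1) * i = i ^ n / L ^ (n - 1)"
      using e by (simp add: power_divide field_simps)
    moreover have "(i / L) ^ n * L = i ^ n / L ^ (n - 1)"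
      using e(2)[symmetric] A by (simp add: power_divide)
    ultimately have "real n * (i ^ n / L ^ (n - 1)) \<le> j + real (n - 1) * (i ^ n / L ^ (n - 1))"
      using le by (simp only: mult.assoc)
    also have "real (n - 1) = real n - 1" using n by simp
    finally have "i ^ n / L ^ (n - 1) \<le> j" by (simp only: left_diff_distrib)
    hence "i ^ n \<le> L ^ (n - 1) * j" using A by (simp add: field_simps)
    thus ?thesis using i j A by (simp add: ennreal_power ennreal_mult[symmetric] ennreal_leI)
  qed
qed

text \<open>In the supremum norm weighted with \<open>exp (- 2 * b * t)\<close> the integral term
  contracts by the factor 1/2, so the weighted supremum satisfies F \<le> a + F / 2. The a priori
  bound \<open>R\<close> makes F finite, which permits the subtraction; it leaves no trace in the
  conclusion, and later it is the truncation level that must disappear.\<close>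

lemma gronwall_ennreal:
  fixes f :: "real \<Rightarrow> ennreal"
  assumes [measurable]: "f \<in> borel_measurable borel"
    and bdd: "\<And>t. t \<in> {0..T} \<Longrightarrow> f t \<le> ennreal R" and "a \<ge> 0" "b > 0"
    and le: "\<And>t. t \<in> {0..T} \<Longrightarrow> f t \<le> ennreal a + ennreal b * (\<integral>\<^sup>+s\<in>{0..t}. f s \<partial>lborel)"
    and t: "t \<in> {0..T}"
  shows "f t \<le> ennreal (2 * a * exp (2 * b * T))"
proof -
  define F where "F = (SUP t\<in>{0..T}. f t * ennreal (exp (- 2 * b * t)))"
  have "F \<le> ennreal (max R 0)"
    unfolding F_def
  proof (rule SUP_least)
    fix s assume s: "s \<in> {0..T}"
    have "f s * ennreal (exp (- 2 * b * s)) \<le> ennreal (max R 0) * ennreal 1"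
      using bdd[OF s] s \<open>b > 0\<close>
      by (intro mult_mono) (auto intro!: ennreal_leI order_trans[OF bdd[OF s]] simp del: ennreal_1)
    thus "f s * ennreal (exp (- 2 * b * s)) \<le> ennreal (max R 0)" by simp
  qed
  then obtain F' where F': "F = ennreal F'" "F' \<ge> 0" by (cases F) (auto simp: top_unique)
  have fF: "f s \<le> ennreal (F' * exp (2 * b * s))" if s: "s \<in> {0..T}" for s
  proof -
    have "f s * ennreal (exp (- 2 * b * s)) \<le> ennreal F'"
      unfolding F'(1)[symmetric] F_def by (rule SUP_upper[OF s])
    hence "f s * ennreal (exp (- 2 * b * s)) * ennreal (exp (2 * b * s)) \<le> ennreal F' * ennreal (exp (2 * b * s))"
      by (rule mult_right_mono) auto
    thus ?thesis using F'
      by (simp add: mult.assoc ennreal_mult[symmetric] exp_add[symmetric])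
  qed
  have "F \<le> ennreal (a + F' / 2)"
    unfolding F_def
  proof (rule SUP_least)
    fix s assume s: "s \<in> {0..T}"
    have "(\<integral>\<^sup>+r\<in>{0..s}. f r \<partial>lborel) \<le> (\<integral>\<^sup>+r\<in>{0..s}. ennreal (F' * exp (2 * b * r)) \<partial>lborel)"
      using fF s by (intro nn_integral_mono) (auto split: split_indicator)
    also have "\<dots> = ennreal (F' * exp (2 * b * s) / (2 * b) - F' * exp (2 * b * 0) / (2 * b))"
      by (rule nn_integral_FTC_Icc[where F="\<lambda>r. F' * exp (2 * b * r) / (2 * b)"])
         (use s F' \<open>b > 0\<close> in \<open>auto intro!: derivative_eq_intros\<close>)
    also have "\<dots> \<le> ennreal (F' * exp (2 * b * s) / (2 * b))"
      using F' \<open>b > 0\<close> by (intro ennreal_leI) auto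
    finally have "ennreal b * (\<integral>\<^sup>+r\<in>{0..s}. f r \<partial>lborel) \<le> ennreal b * ennreal (F' * exp (2 * b * s) / (2 * b))"
      by (rule mult_left_mono) auto
    also have "\<dots> = ennreal (F' * exp (2 * b * s) / 2)"
      using F' \<open>b > 0\<close> by (simp add: ennreal_mult[symmetric])
    finally have "f s \<le> ennreal a + ennreal (F' * exp (2 * b * s) / 2)"
      using le[OF s] by (meson add_left_mono order_trans)
    hence "f s * ennreal (exp (- 2 * b * s)) \<le> (ennreal a + ennreal (F' * exp (2 * b * s) / 2)) * ennreal (exp (- 2 * b * s))"
      by (rule mult_right_mono) auto
    also have "\<dots> = ennreal ((a + F' * exp (2 * b * s) / 2) * exp (- 2 * b * s))"
      using F' \<open>a \<ge> 0\<close> by (simp add: ennreal_mult)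
    also have "(a + F' * exp (2 * b * s) / 2) * exp (- 2 * b * s) = a * exp (- 2 * b * s) + F' / 2"
      by (simp add: distrib_right exp_minus)
    also have "ennreal \<dots> \<le> ennreal (a + F' / 2)"
      using s \<open>b > 0\<close> \<open>a \<ge> 0\<close> by (intro ennreal_leI) (auto intro!: mult_left_le)
    finally show "f s * ennreal (exp (- 2 * b * s)) \<le> ennreal (a + F' / 2)" .
  qed
  hence "F' \<le> a + F' / 2" unfolding F'(1) using F'(2) \<open>a \<ge> 0\<close> by (subst (asm) ennreal_le_iff) auto
  hence "F' \<le> 2 * a" by simp
  have "f t \<le> ennreal (F' * exp (2 * b * t))" by (rule fF[OF t])
  also have "\<dots> \<le> ennreal (2 * a * exp (2 * b * T))"
    using \<open>F' \<le> 2 * a\<close> t \<open>b > 0\<close> F' \<open>a \<ge> 0\<close> by (intro ennreal_leI mult_mono) auto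
  finally show ?thesis .
qed

section \<open>Norms of matrices\<close>

lemma norm_matrix_power2:
  fixes A :: "real ^ 'n ^ 'm"
  shows "(norm A)\<^sup>2 = (\<Sum>i\<in>UNIV. \<Sum>j\<in>UNIV. (A $ i $ j)\<^sup>2)"
  unfolding power2_norm_eq_inner inner_vec_def by (simp add: power2_eq_square)

lemma norm_matrix_power2_columns:
  fixes A :: "real ^ 'n ^ 'm"
  shows "(norm A)\<^sup>2 = (\<Sum>j\<in>UNIV. (norm (column j A))\<^sup>2)"
  unfolding norm_matrix_power2
  by (subst sum.swap) (simp add: power2_norm_eq_inner inner_vec_def column_def, simp add: power2_eq_square)

lemma norm_transpose: "norm (transpose (A :: real ^ 'n ^ 'm)) = norm A"
proof -
  have "(norm (transpose A))\<^sup>2 = (norm A)\<^sup>2"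
    unfolding norm_matrix_power2 transpose_def by (subst sum.swap) simp
  thus ?thesis by (simp add: power2_eq_iff_nonneg)
qed

lemma norm_matrix_vector_le:
  fixes A :: "real ^ 'n ^ 'm"
  shows "norm (A *v x) \<le> norm A * norm x"
proof -
  have "(norm (A *v x))\<^sup>2 = (\<Sum>i\<in>UNIV. (A $ i \<bullet> x)\<^sup>2)"
    unfolding power2_norm_eq_inner inner_vec_def[of "A *v x"]
    by (simp add: matrix_vector_mult_def inner_vec_def power2_eq_square)
  also have "\<dots> \<le> (\<Sum>i\<in>UNIV. (A $ i \<bullet> A $ i) * (x \<bullet> x))"
    by (intro sum_mono Cauchy_Schwarz_ineq)
  also have "\<dots> = (norm A * norm x)\<^sup>2"
    unfolding power_mult_distrib power2_norm_eq_inner inner_vec_def[of A] sum_distrib_right ..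
  finally show ?thesis by (rule power2_le_imp_le) simp
qed

lemma norm_contraction_matrix_mult:
  fixes A :: "real ^ 'n ^ 'm" and B :: "real ^ 'k ^ 'n"
  assumes "\<And>v. norm (A *v v) \<le> norm v"
  shows "norm (A ** B) \<le> norm B"
proof -
  have "column j (A ** B) = A *v column j B" for j
    by (simp add: column_def matrix_matrix_mult_def matrix_vector_mult_def vec_eq_iff)
  hence "(norm (A ** B))\<^sup>2 \<le> (norm B)\<^sup>2"
    unfolding norm_matrix_power2_columns by (auto intro!: sum_mono power_mono assms)
  thus ?thesis by (rule power2_le_imp_le) simp
qed

section \<open>Hoelder continuity\<close>

lemma holder_continuous_on_imp_continuous_on:
  assumes h: "holder_continuous_on \<alpha> A f" and "\<alpha> > 0"
  shows "continuous_on A f"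
proof -
  obtain C where C: "\<And>s t. s \<in> A \<Longrightarrow> t \<in> A \<Longrightarrow> dist (f s) (f t) \<le> C * \<bar>s - t\<bar> powr \<alpha>"
    using h unfolding holder_continuous_on_def by blast
  show ?thesis
    unfolding continuous_on_def
  proof
    fix x assume x: "x \<in> A"
    have "((\<lambda>t. C * \<bar>t - x\<bar> powr \<alpha>) \<longlongrightarrow> C * (0 powr \<alpha>)) (at x within A)"
    proof -
      have "((\<lambda>t. \<bar>t - x\<bar> powr \<alpha>) \<longlongrightarrow> 0) (at x within A)"
        by (rule tendsto_zero_powrI[of _ _ _ \<alpha>])
           (use \<open>\<alpha> > 0\<close> in \<open>auto intro!: tendsto_eq_intros\<close>)
      from tendsto_mult[OF tendsto_const this, of C] show ?thesis by simp
    qed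
    hence lim: "((\<lambda>t. C * \<bar>t - x\<bar> powr \<alpha>) \<longlongrightarrow> 0) (at x within A)" by simp
    show "(f \<longlongrightarrow> f x) (at x within A)"
    proof (subst tendsto_dist_iff, rule tendsto_sandwich[OF _ _ tendsto_const lim])
      show "\<forall>\<^sub>F t in at x within A. dist (f t) (f x) \<le> C * \<bar>t - x\<bar> powr \<alpha>"
        using C x by (auto simp: eventually_at_filter)
    qed auto
  qed
qed

text \<open>The missing value is the limit along one explicit sequence, independent of
  \<open>f\<close>; for random paths this makes the end value a measurable function. The Hoelder
  bound makes the sequence of values Cauchy and passes to the limit with the same constant.\<close>

lemma holder_continuous_on_extend:
  fixes f :: "real \<Rightarrow> 'b::complete_space"
  assumes h: "holder_continuous_on \<alpha> {0..<T} f" and "\<alpha> > 0" "T > 0"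
  shows "convergent (\<lambda>n. f (T * (1 - 1 / real (Suc n))))"
    and "holder_continuous_on \<alpha> {0..T} (\<lambda>t. if t < T then f t else lim (\<lambda>n. f (T * (1 - 1 / real (Suc n)))))"
proof -
  obtain C where C: "\<And>s t. s \<in> {0..<T} \<Longrightarrow> t \<in> {0..<T} \<Longrightarrow> dist (f s) (f t) \<le> C * \<bar>s - t\<bar> powr \<alpha>"
    using h unfolding holder_continuous_on_def by blast
  let ?x = "\<lambda>n. T * (1 - 1 / real (Suc n))"
  have x: "?x n \<in> {0..<T}" for n using \<open>T > 0\<close> by (auto simp: field_simps)
  have xT: "?x \<longlonglongrightarrow> T"
  proof -
    have "(\<lambda>n. T * (1 - 1 / real (Suc n))) \<longlonglongrightarrow> T * (1 - 0)"
      by (intro tendsto_intros LIMSEQ_Suc lim_1_over_n)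
    thus ?thesis by simp
  qed
  have "Cauchy (\<lambda>n. f (?x n))"
    unfolding Cauchy_def
  proof (intro allI impI)
    fix e :: real assume "e > 0"
    define C' where "C' = max C 1"
    have C': "C' > 0" "C \<le> C'" by (auto simp: C'_def)
    define d where "d = (e / C') powr (1 / \<alpha>)"
    have "d > 0" using \<open>e > 0\<close> C' by (simp add: d_def)
    then obtain N where N: "\<forall>m\<ge>N. \<forall>n\<ge>N. dist (?x m) (?x n) < d"
      using LIMSEQ_imp_Cauchy[OF xT] unfolding Cauchy_def by blast
    have "dist (f (?x m)) (f (?x n)) < e" if "m \<ge> N" "n \<ge> N" for m n
    proof -
      have "\<bar>?x m - ?x n\<bar> powr \<alpha> < d powr \<alpha>"
        using N that \<open>\<alpha> > 0\<close> by (intro powr_less_mono2) (auto simp: dist_real_def)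
      also have "d powr \<alpha> = e / C'" using \<open>\<alpha> > 0\<close> \<open>e > 0\<close> C' by (simp add: d_def powr_powr)
      finally have "C' * \<bar>?x m - ?x n\<bar> powr \<alpha> < e" using C' by (simp add: field_simps)
      moreover have "C * \<bar>?x m - ?x n\<bar> powr \<alpha> \<le> C' * \<bar>?x m - ?x n\<bar> powr \<alpha>"
        using C' by (intro mult_right_mono) auto
      ultimately show ?thesis using C[OF x x, of m n] by linarith
    qed
    thus "\<exists>N. \<forall>m\<ge>N. \<forall>n\<ge>N. dist (f (?x m)) (f (?x n)) < e" by blast
  qed
  thus conv: "convergent (\<lambda>n. f (?x n))" by (simp add: Cauchy_convergent_iff)
  let ?l = "lim (\<lambda>n. f (?x n))"
  have l: "(\<lambda>n. f (?x n)) \<longlonglongrightarrow> ?l" using conv by (simp add: convergent_LIMSEQ_iff)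
  have lT: "dist (f s) ?l \<le> C * \<bar>s - T\<bar> powr \<alpha>" if s: "s \<in> {0..<T}" for s
  proof (rule LIMSEQ_le)
    show "(\<lambda>n. dist (f s) (f (?x n))) \<longlonglongrightarrow> dist (f s) ?l" by (intro tendsto_intros l)
    have "s - T \<noteq> 0" using s by auto
    thus "(\<lambda>n. C * \<bar>s - ?x n\<bar> powr \<alpha>) \<longlonglongrightarrow> C * \<bar>s - T\<bar> powr \<alpha>"
      by (intro tendsto_intros xT) auto
    show "\<exists>N. \<forall>n\<ge>N. dist (f s) (f (?x n)) \<le> C * \<bar>s - ?x n\<bar> powr \<alpha>" using C[OF s x] by blast
  qed
  show "holder_continuous_on \<alpha> {0..T} (\<lambda>t. if t < T then f t else ?l)"
    unfolding holder_continuous_on_def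
  proof (intro exI[of _ C] ballI)
    fix s t assume st: "s \<in> {0..T}" "t \<in> {0..T}"
    show "dist (if s < T then f s else ?l) (if t < T then f t else ?l) \<le> C * \<bar>s - t\<bar> powr \<alpha>"
      using st C[of s t] lT[of s] lT[of t]
      by (cases "s < T"; cases "t < T") (auto simp: dist_commute abs_minus_commute)
  qed
qed

text \<open>Each time is reached through its dyadic approximations from the left. Successive levels
  differ by at most one dyadic increment, so the distance to level \<open>n\<close> is a geometric
  tail. Two times at distance about \<open>T / 2 ^ n\<close> have equal or adjacent approximations
  of level \<open>n\<close>.\<close>

lemma dyadic_chaining:
  fixes f :: "real \<Rightarrow> 'b::real_normed_vector"
  assumes cont: "continuous_on {0..<T} f" and "T > 0" "\<gamma> > 0" "K \<ge> 0"
    and inc: "\<And>n j. Suc j < 2 ^ n \<Longrightarrow>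
      norm (f (T * real (Suc j) / 2 ^ n) - f (T * real j / 2 ^ n)) \<le> K * (2 powr - \<gamma>) ^ n"
  shows "holder_continuous_on \<gamma> {0..<T} f"
proof -
  define \<rho> where "\<rho> = 2 powr - \<gamma>"
  have \<rho>: "0 < \<rho>" "\<rho> < 1" using \<open>\<gamma> > 0\<close> by (auto simp: \<rho>_def powr_less_one)
  \<comment> \<open>Rounding down keeps all dyadic approximations inside \<open>[0, T)\<close>,
    which is why \<open>inc\<close> is asked only for \<open>Suc j < 2 ^ n\<close>.\<close>
  define j where "j n t = nat \<lfloor>t * 2 ^ n / T\<rfloor>" for n t
  define d where "d n t = T * real (j n t) / 2 ^ n" for n t
  have rj: "real (j n t) = of_int \<lfloor>t * 2 ^ n / T\<rfloor>" if "t \<in> {0..<T}" for n t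
    using that \<open>T > 0\<close> by (simp add: j_def)
  have jlt: "j n t < 2 ^ n" if t: "t \<in> {0..<T}" for n t
  proof -
    have "real (j n t) \<le> t * 2 ^ n / T" unfolding rj[OF t] by simp
    also have "\<dots> < 2 ^ n" using t \<open>T > 0\<close> by (simp add: field_simps)
    finally show ?thesis using of_nat_less_iff[where 'a=real, of "j n t" "2^n"] by simp
  qed
  have dle: "d n t \<le> t \<and> t \<le> d n t + T / 2 ^ n" if t: "t \<in> {0..<T}" for n t
  proof -
    have "real (j n t) \<le> t * 2 ^ n / T" "t * 2 ^ n / T \<le> real (j n t) + 1"
      unfolding rj[OF t] by linarith+
    hence "T * real (j n t) / 2 ^ n \<le> T * (t * 2 ^ n / T) / 2 ^ n"
      "T * (t * 2 ^ n / T) / 2 ^ n \<le> T * (real (j n t) + 1) / 2 ^ n"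
      using \<open>T > 0\<close> by (intro divide_right_mono mult_left_mono; simp)+
    thus ?thesis using \<open>T > 0\<close> by (simp add: d_def distrib_left add_divide_distrib)
  qed
  have dn: "d n t \<in> {0..<T}" if t: "t \<in> {0..<T}" for n t
    using dle[OF t, of n] t \<open>T > 0\<close> by (auto simp: d_def)
  have step: "norm (f (d (Suc n) t) - f (d n t)) \<le> K * \<rho> ^ Suc n" if t: "t \<in> {0..<T}" for n t
  proof -
    define x where "x = t * 2 ^ n / T"
    have x2: "t * 2 ^ Suc n / T = 2 * x" by (simp add: x_def)
    \<comment> \<open>Passing to the next level keeps the left dyadic neighbour or moves it by one
      step of the finer grid.\<close>
    have "\<lfloor>2 * x\<rfloor> = 2 * \<lfloor>x\<rfloor> \<or> \<lfloor>2 * x\<rfloor> = 2 * \<lfloor>x\<rfloor> + 1" by linarith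
    moreover have "\<lfloor>x\<rfloor> \<ge> 0" using t \<open>T > 0\<close> by (simp add: x_def)
    ultimately have "j (Suc n) t = 2 * j n t \<or> j (Suc n) t = Suc (2 * j n t)"
      unfolding j_def x2 x_def[symmetric] by linarith
    moreover have d2: "d n t = T * real (2 * j n t) / 2 ^ Suc n" by (simp add: d_def)
    ultimately show ?thesis
    proof (elim disjE)
      assume "j (Suc n) t = 2 * j n t"
      hence "d (Suc n) t = d n t" by (simp add: d_def)
      thus ?thesis using \<open>K \<ge> 0\<close> \<rho> by simp
    next
      assume e: "j (Suc n) t = Suc (2 * j n t)"
      thus ?thesis using inc[of "2 * j n t" "Suc n"] jlt[OF t, of "Suc n"]
        unfolding \<rho>_def[symmetric] d2 by (simp only: d_def e)
    qed
  qed
  have chain: "norm (f (d (n + m) t) - f (d n t)) \<le> K * \<rho> ^ n * (\<Sum>i<m. \<rho> ^ Suc i)" if t: "t \<in> {0..<T}" for n m t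
  proof (induction m)
    case (Suc m)
    have "norm (f (d (n + Suc m) t) - f (d n t))
       \<le> norm (f (d (Suc (n + m)) t) - f (d (n + m) t)) + norm (f (d (n + m) t) - f (d n t))"
      using norm_triangle_ineq[of "f (d (Suc (n + m)) t) - f (d (n + m) t)" "f (d (n + m) t) - f (d n t)"] by simp
    also have "\<dots> \<le> K * \<rho> ^ Suc (n + m) + K * \<rho> ^ n * (\<Sum>i<m. \<rho> ^ Suc i)"
      using step[OF t] Suc by (intro add_mono) auto
    also have "\<dots> = K * \<rho> ^ n * (\<Sum>i<Suc m. \<rho> ^ Suc i)" by (simp add: algebra_simps power_add)
    finally show ?case .
  qed simp
  have geo: "(\<Sum>i<m. \<rho> ^ Suc i) \<le> 1 / (1 - \<rho>)" for m
  proof -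
    have "(\<Sum>i<m. \<rho> ^ Suc i) \<le> (\<Sum>i<m. \<rho> ^ i)"
      using \<rho> by (intro sum_mono) (simp add: mult_left_le_one_le)
    also have "\<dots> = (1 - \<rho> ^ m) / (1 - \<rho>)" using \<rho> by (simp add: sum_gp_strict)
    also have "\<dots> \<le> 1 / (1 - \<rho>)" using \<rho> by (intro divide_right_mono) auto
    finally show ?thesis .
  qed
  define c where "c = K / (1 - \<rho>)"
  have c: "c \<ge> 0" using \<rho> \<open>K \<ge> 0\<close> by (simp add: c_def)
  have tail: "norm (f t - f (d n t)) \<le> c * \<rho> ^ n" if t: "t \<in> {0..<T}" for n t
  proof (rule LIMSEQ_le_const2)
    have "(\<lambda>m. d (n + m) t) \<longlonglongrightarrow> t"
    proof (rule tendsto_sandwich)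
      show "(\<lambda>m. t - T / 2 ^ (n + m)) \<longlonglongrightarrow> t"
      proof -
        have "(\<lambda>m. t - T / 2 ^ n * (1 / 2) ^ m) \<longlonglongrightarrow> t - T / 2 ^ n * 0"
          by (intro tendsto_intros LIMSEQ_realpow_zero) auto
        thus ?thesis by (simp add: power_add power_divide)
      qed
      show "\<forall>\<^sub>F m in sequentially. t - T / 2 ^ (n + m) \<le> d (n + m) t"
        using dle[OF t] by (intro always_eventually allI) (simp add: algebra_simps)
      show "\<forall>\<^sub>F m in sequentially. d (n + m) t \<le> t" using dle[OF t] by simp
    qed auto
    hence "(\<lambda>m. f (d (n + m) t)) \<longlonglongrightarrow> f t"
      using continuous_on_tendsto_compose[OF cont _ t, of "\<lambda>m. d (n + m) t" sequentially] dn[OF t] by auto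
    thus "(\<lambda>m. norm (f (d (n + m) t) - f (d n t))) \<longlonglongrightarrow> norm (f t - f (d n t))"
      by (intro tendsto_intros)
    show "\<exists>N. \<forall>m\<ge>N. norm (f (d (n + m) t) - f (d n t)) \<le> c * \<rho> ^ n"
    proof (intro exI[of _ 0] allI impI)
      fix m
      have "norm (f (d (n + m) t) - f (d n t)) \<le> K * \<rho> ^ n * (\<Sum>i<m. \<rho> ^ Suc i)" by (rule chain[OF t])
      also have "\<dots> \<le> K * \<rho> ^ n * (1 / (1 - \<rho>))" using geo \<open>K \<ge> 0\<close> \<rho> by (intro mult_left_mono) auto
      finally show "norm (f (d (n + m) t) - f (d n t)) \<le> c * \<rho> ^ n" by (simp add: c_def)
    qed
  qed
  have near: "norm (f (d n t) - f (d n s)) \<le> K * \<rho> ^ n"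
    if st: "s \<in> {0..<T}" "t \<in> {0..<T}" "s \<le> t" "t - s \<le> T / 2 ^ n" for n s t
  proof -
    have "t * 2 ^ n / T - s * 2 ^ n / T = (t - s) * (2 ^ n / T)" by (simp add: algebra_simps diff_divide_distrib)
    also have "\<dots> \<le> T / 2 ^ n * (2 ^ n / T)" using st \<open>T > 0\<close> by (intro mult_right_mono) auto
    also have "\<dots> = 1" using \<open>T > 0\<close> by simp
    finally have "t * 2 ^ n / T \<le> s * 2 ^ n / T + 1" by simp
    moreover have "s * 2 ^ n / T \<le> t * 2 ^ n / T" "0 \<le> s * 2 ^ n / T"
      using st \<open>T > 0\<close> by (auto intro!: divide_right_mono)
    ultimately have "j n t = j n s \<or> j n t = Suc (j n s)" unfolding j_def by linarith
    thus ?thesis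
    proof
      assume "j n t = j n s"
      thus ?thesis using \<open>K \<ge> 0\<close> \<rho> by (simp add: d_def)
    next
      assume "j n t = Suc (j n s)"
      thus ?thesis using inc[of "j n s" n] jlt[OF st(2), of n] by (simp only: d_def \<rho>_def)
    qed
  qed
  \<comment> \<open>Two tails of size \<open>c * \<rho> ^ n\<close> and one dyadic increment; the
    last factor converts \<open>\<rho> ^ n\<close> into a power of the distance.\<close>
  define C where "C = (2 * c + K) * (2 / T) powr \<gamma>"
  have main: "dist (f s) (f t) \<le> C * \<bar>s - t\<bar> powr \<gamma>"
    if st: "s \<in> {0..<T}" "t \<in> {0..<T}" "s < t" for s t
  proof -
    define x where "x = (t - s) / T"
    have x: "0 < x" "x < 1" using st \<open>T > 0\<close> by (auto simp: x_def field_simps)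
    have ex: "\<exists>N. (1 / 2) ^ N < x" using x real_arch_pow_inv[of x "1/2"] by auto
    \<comment> \<open>Selects the scale: with \<open>N = Suc n\<close>, minimality gives (1/2)^(n+1)
      < x \<le> (1/2)^n. The upper bound makes the dyadic neighbours adjacent, the lower one turns
      \<open>\<rho> ^ n\<close> back into a power of \<open>x\<close>.\<close>
    define N where "N = (LEAST N. (1 / 2) ^ N < x)"
    have N: "(1 / 2) ^ N < x" unfolding N_def using ex by (rule LeastI_ex)
    have "N \<noteq> 0" using N x by (intro notI) auto
    then obtain n where n: "N = Suc n" by (cases N) auto
    have "\<not> (1 / 2) ^ n < x" using not_less_Least[of n "\<lambda>N. (1 / 2) ^ N < x"] n N_def by auto
    hence x1: "x \<le> (1 / 2) ^ n" by simp
    have x2: "(1 / 2) ^ n < 2 * x" using N n by simp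
    have "t - s \<le> T / 2 ^ n" using x1 \<open>T > 0\<close> by (simp add: x_def power_divide field_simps)
    hence nr: "norm (f (d n t) - f (d n s)) \<le> K * \<rho> ^ n" using near st by auto
    have "f s - f t = (f s - f (d n s)) - (f (d n t) - f (d n s)) - (f t - f (d n t))" by simp
    hence "norm (f s - f t) \<le> norm (f s - f (d n s)) + norm (f (d n t) - f (d n s)) + norm (f t - f (d n t))"
      by (metis norm_triangle_ineq4 add_right_mono order_trans)
    also have "\<dots> \<le> c * \<rho> ^ n + K * \<rho> ^ n + c * \<rho> ^ n" using tail st nr by (intro add_mono) auto
    also have "\<dots> = (2 * c + K) * \<rho> ^ n" by (simp add: algebra_simps)
    also have "\<rho> ^ n = ((1 / 2) ^ n) powr \<gamma>"
      by (simp add: \<rho>_def powr_minus powr_power powr_divide power_one_over inverse_eq_divide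
          powr_realpow[symmetric] powr_powr mult.commute)
    also have "\<dots> \<le> (2 * x) powr \<gamma>" using x2 \<open>\<gamma> > 0\<close> by (intro powr_mono2) auto
    also have "(2 * x) powr \<gamma> = (2 / T) powr \<gamma> * \<bar>s - t\<bar> powr \<gamma>"
      using st \<open>T > 0\<close> by (simp add: x_def powr_mult[symmetric])
    finally show ?thesis using c \<open>K \<ge> 0\<close> by (simp add: C_def dist_norm mult_left_mono mult.assoc)
  qed
  show ?thesis
    unfolding holder_continuous_on_def
  proof (intro exI[of _ C] ballI)
    fix s t assume "s \<in> {0..<T}" "t \<in> {0..<T}"
    thus "dist (f s) (f t) \<le> C * \<bar>s - t\<bar> powr \<gamma>"
      using main[of s t] main[of t s] by (cases s t rule: linorder_cases) (auto simp: dist_commute abs_minus_commute)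
  qed
qed

section \<open>Moments of simple Ito integrals\<close>

lemma nn_integral_lborel_uminus:
  fixes f :: "'a::euclidean_space \<Rightarrow> ennreal"
  assumes [measurable]: "f \<in> borel_measurable borel"
  shows "(\<integral>\<^sup>+x. f (- x) \<partial>lborel) = (\<integral>\<^sup>+x. f x \<partial>lborel)"
proof -
  have "lborel = density (distr lborel borel (\<lambda>x::'a. - x)) (\<lambda>_. 1)"
    using lborel_affine[of "-1" "0::'a"] by simp
  hence "(\<integral>\<^sup>+x. f x \<partial>lborel) = (\<integral>\<^sup>+x. f x \<partial>(distr lborel borel (\<lambda>x::'a. - x)))"
    by (metis density_1)
  also have "\<dots> = (\<integral>\<^sup>+x. f (- x) \<partial>lborel)"
    by (subst nn_integral_distr) auto
  finally show ?thesis ..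
qed

lemma nn_integral_lborel_vec_prod:
  fixes g :: "real \<Rightarrow> ennreal"
  assumes [measurable]: "g \<in> borel_measurable borel"
  shows "(\<integral>\<^sup>+x. (\<Prod>i\<in>UNIV. g (x $ i)) \<partial>(lborel :: (real^'m) measure)) = (\<integral>\<^sup>+x. g x \<partial>lborel) ^ CARD('m)"
proof -
  have B: "(Basis :: (real^'m) set) = (\<lambda>i. axis i 1) ` UNIV"
    by (auto simp: Basis_vec_def)
  have inj: "inj (\<lambda>i. axis i 1 :: real^'m)" by (auto simp: inj_on_def axis_eq_axis)
  have "(\<Prod>i\<in>UNIV. g (x $ i)) = (\<Prod>b\<in>Basis. g (x \<bullet> b))" for x :: "real^'m"
    unfolding B by (subst prod.reindex[OF inj]) (simp add: inner_axis)
  hence "(\<integral>\<^sup>+x. (\<Prod>i\<in>UNIV. g (x $ i)) \<partial>(lborel :: (real^'m) measure)) = (\<Prod>b\<in>(Basis::(real^'m) set). (\<integral>\<^sup>+x. g x \<partial>lborel))"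
    using nn_integral_lborel_prod[of "\<lambda>_::real^'m. g"] by simp
  thus ?thesis by (simp add: DIM_cart)
qed

lemma borel_measurable_matrix_vector_mult[measurable (raw)]:
  fixes A :: "'a \<Rightarrow> real ^ 'n ^ 'm"
  assumes "A \<in> borel_measurable M" "x \<in> borel_measurable M"
  shows "(\<lambda>z. A z *v x z) \<in> borel_measurable M"
  by (rule borel_measurable_continuous_Pair[OF assms])
     (unfold matrix_vector_mult_def, intro continuous_intros)

lemma borel_measurable_matrix_mult[measurable (raw)]:
  fixes A :: "'a \<Rightarrow> real ^ 'n ^ 'm" and B :: "'a \<Rightarrow> real ^ 'k ^ 'n"
  assumes "A \<in> borel_measurable M" "B \<in> borel_measurable M"
  shows "(\<lambda>z. A z ** B z) \<in> borel_measurable M"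
  by (rule borel_measurable_continuous_Pair[OF assms])
     (unfold matrix_matrix_mult_def, intro continuous_intros)

lemma borel_measurable_transpose[measurable (raw)]:
  fixes A :: "'a \<Rightarrow> real ^ 'n ^ 'm"
  assumes "A \<in> borel_measurable M"
  shows "(\<lambda>z. transpose (A z)) \<in> borel_measurable M"
  by (rule borel_measurable_continuous_on[OF _ assms, of transpose])
     (unfold transpose_def, intro continuous_intros)

text \<open>Bounds a function of the Euclidean norm by a product over coordinates, so that the
  Gaussian integral factorizes.\<close>

lemma one_plus_sum_le_prod:
  fixes f :: "'a \<Rightarrow> real"
  assumes "finite A" "\<And>i. i \<in> A \<Longrightarrow> 0 \<le> f i"
  shows "1 + (\<Sum>i\<in>A. f i) \<le> (\<Prod>i\<in>A. 1 + f i)"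
  using assms
proof (induction A rule: finite_induct)
  case (insert x A)
  have "1 + (\<Sum>i\<in>insert x A. f i) \<le> (1 + f x) * (1 + (\<Sum>i\<in>A. f i))"
    using insert by (simp add: algebra_simps sum_nonneg)
  also have "\<dots> \<le> (1 + f x) * (\<Prod>i\<in>A. 1 + f i)"
    using insert by (intro mult_left_mono) auto
  finally show ?case using insert by simp
qed simp

lemma std_normal_poly_moment_finite:
  "(\<integral>\<^sup>+x. ennreal (std_normal_density x) * ennreal ((1 + x\<^sup>2) ^ k) \<partial>lborel) < \<infinity>"
proof -
  have int: "integrable lborel (\<lambda>x. 2 ^ k * (std_normal_density x * x ^ 0 + std_normal_density x * x ^ (2 * k)))"
    by (intro integrable_mult_right Bochner_Integration.integrable_add integrable_std_normal_moment)
  have "(\<integral>\<^sup>+x. ennreal (std_normal_density x) * ennreal ((1 + x\<^sup>2) ^ k) \<partial>lborel)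
     \<le> (\<integral>\<^sup>+x. ennreal (2 ^ k * (std_normal_density x * x ^ 0 + std_normal_density x * x ^ (2 * k))) \<partial>lborel)"
  proof (rule nn_integral_mono)
    fix x :: real
    have eq: "2 ^ k * (std_normal_density x * x ^ 0 + std_normal_density x * x ^ (2 * k))
        = std_normal_density x * (2 ^ k * (1 ^ k + (x\<^sup>2) ^ k))"
      unfolding power_mult by (simp add: algebra_simps del: power_mult_distrib power_even_eq)
    have "std_normal_density x * (1 + x\<^sup>2) ^ k \<le> std_normal_density x * (2 ^ k * (1 ^ k + (x\<^sup>2) ^ k))"
      by (intro mult_left_mono add_power_le) auto
    thus "ennreal (std_normal_density x) * ennreal ((1 + x\<^sup>2) ^ k)
       \<le> ennreal (2 ^ k * (std_normal_density x * x ^ 0 + std_normal_density x * x ^ (2 * k)))"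
      unfolding eq by (subst ennreal_mult[symmetric]) (auto intro!: ennreal_leI)
  qed
  also have "\<dots> < \<infinity>" using int by (subst (asm) integrable_iff_bounded) auto
  finally show ?thesis .
qed

context usual_filtered_space
begin

lemma space_F: "0 \<le> t \<Longrightarrow> space (F t) = space M"
  using subalg by (auto simp: subalgebra_def)

lemma sets_F: "0 \<le> t \<Longrightarrow> A \<in> sets (F t) \<Longrightarrow> A \<in> sets M"
  using subalg by (auto simp: subalgebra_def)

lemma measurable_F: "f \<in> measurable (F t) N \<Longrightarrow> 0 \<le> t \<Longrightarrow> f \<in> measurable M N"
  using measurable_from_subalg[OF subalg] by blast

lemma measurable_F_mono: "f \<in> measurable (F s) N \<Longrightarrow> 0 \<le> s \<Longrightarrow> s \<le> t \<Longrightarrow> f \<in> measurable (F t) N"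
  by (rule measurable_from_subalg[of "F t" "F s"]) (auto simp: subalgebra_def space_F mono)

end

section \<open>Brownian increments: freezing, symmetry, scaling\<close>

context brownian_motion
begin

text \<open>Freezing: independence makes the joint law of \<open>Z\<close> and the increment a
  product measure, and Tonelli's theorem separates the two variables. This takes the place of
  conditioning on \<open>F s\<close>.\<close>

lemma increment_nn_integral_indep:
  assumes st: "0 \<le> s" "s < t" and Z: "Z \<in> measurable (F s) N"
    and f: "f \<in> borel_measurable (N \<Otimes>\<^sub>M borel)"
  shows "(\<integral>\<^sup>+\<omega>. f (Z \<omega>, W t \<omega> - W s \<omega>) \<partial>M) = (\<integral>\<^sup>+\<omega>. \<integral>\<^sup>+\<omega>'. f (Z \<omega>, W t \<omega>' - W s \<omega>') \<partial>M \<partial>M)"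
proof -
  let ?D = "\<lambda>\<omega>. W t \<omega> - W s \<omega>"
  have ZM: "Z \<in> measurable M N" using measurable_F[OF Z] st by simp
  have D: "?D \<in> borel_measurable M"
    using measurable_F[OF adapted[of t]] measurable_F[OF adapted[of s]] st by simp
  interpret D: prob_space "distr M borel ?D" by (rule prob_space_distr[OF D])
  interpret Z: prob_space "distr M N Z" by (rule prob_space_distr[OF ZM])
  have ZD: "(\<lambda>\<omega>. (Z \<omega>, ?D \<omega>)) \<in> measurable M (N \<Otimes>\<^sub>M borel)" using ZM D by measurable
  have eq: "distr M N Z \<Otimes>\<^sub>M distr M borel ?D = distr M (N \<Otimes>\<^sub>M borel) (\<lambda>\<omega>. (Z \<omega>, ?D \<omega>))"
  proof (rule pair_measure_eqI)
    fix A B assume "A \<in> sets (distr M N Z)" "B \<in> sets (distr M borel ?D)"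
    hence A: "A \<in> sets N" and B: "B \<in> sets borel" by auto
    have Z': "Z -` A \<inter> space M \<in> sets (F s)"
      using measurable_sets[OF Z A] space_F[OF st(1)] by simp
    have "(\<lambda>\<omega>. (Z \<omega>, ?D \<omega>)) -` (A \<times> B) \<inter> space M = (Z -` A \<inter> space M) \<inter> (?D -` B \<inter> space M)"
      by auto
    moreover have "prob ((Z -` A \<inter> space M) \<inter> (?D -` B \<inter> space M)) = prob (Z -` A \<inter> space M) * prob (?D -` B \<inter> space M)"
      using indep_incr[OF st] Z' B unfolding indep_sets2_eq by blast
    ultimately show "emeasure (distr M N Z) A * emeasure (distr M borel ?D) B =
        emeasure (distr M (N \<Otimes>\<^sub>M borel) (\<lambda>\<omega>. (Z \<omega>, ?D \<omega>))) (A \<times> B)"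
      using A B ZM D ZD by (simp add: emeasure_distr emeasure_eq_measure ennreal_mult[symmetric])
  qed (auto intro: D.sigma_finite_measure_axioms Z.sigma_finite_measure_axioms)
  have "(\<integral>\<^sup>+\<omega>. f (Z \<omega>, ?D \<omega>) \<partial>M) = integral\<^sup>N (distr M (N \<Otimes>\<^sub>M borel) (\<lambda>\<omega>. (Z \<omega>, ?D \<omega>))) f"
    by (subst nn_integral_distr) (use f ZM D in auto)
  also have "\<dots> = (\<integral>\<^sup>+z. \<integral>\<^sup>+w. f (z, w) \<partial>distr M borel ?D \<partial>distr M N Z)"
    unfolding eq[symmetric] by (subst D.nn_integral_fst[symmetric]) (use f in auto)
  also have "\<dots> = (\<integral>\<^sup>+\<omega>. \<integral>\<^sup>+w. f (Z \<omega>, w) \<partial>distr M borel ?D \<partial>M)"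
    by (subst nn_integral_distr[OF ZM]) (use f D.borel_measurable_nn_integral_fst[of f N] in auto)
  also have "\<dots> = (\<integral>\<^sup>+\<omega>. \<integral>\<^sup>+\<omega>'. f (Z \<omega>, ?D \<omega>') \<partial>M \<partial>M)"
    by (intro nn_integral_cong, subst nn_integral_distr[OF D])
       (use f measurable_space[OF ZM] in auto)
  finally show ?thesis .
qed

text \<open>The Gaussian density is even. This is what allows the average over the two signs in
  \<open>norm_sym_power_le\<close>.\<close>

lemma increment_nn_integral_uminus:
  assumes st: "0 \<le> s" "s < t" and [measurable]: "g \<in> borel_measurable borel"
  shows "(\<integral>\<^sup>+\<omega>. g (- (W t \<omega> - W s \<omega>)) \<partial>M) = (\<integral>\<^sup>+\<omega>. g (W t \<omega> - W s \<omega>) \<partial>M)"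
proof -
  let ?f = "\<lambda>x::real^'m. \<Prod>i\<in>UNIV. ennreal (normal_density 0 (sqrt (t - s)) (x $ i))"
  have even: "?f (- x) = ?f x" for x by (simp add: normal_density_def)
  have "(\<integral>\<^sup>+\<omega>. g (- (W t \<omega> - W s \<omega>)) \<partial>M) = (\<integral>\<^sup>+x. ?f x * g (- x) \<partial>lborel)"
    by (rule distributed_nn_integral[symmetric, OF gauss_incr[OF st]]) simp
  also have "\<dots> = (\<integral>\<^sup>+x. ?f (- x) * g (- x) \<partial>lborel)" by (simp only: even)
  also have "\<dots> = (\<integral>\<^sup>+x. ?f x * g x \<partial>lborel)"
    by (rule nn_integral_lborel_uminus) measurable
  also have "\<dots> = (\<integral>\<^sup>+\<omega>. g (W t \<omega> - W s \<omega>) \<partial>M)"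
    by (rule distributed_nn_integral[OF gauss_incr[OF st]]) simp
  finally show ?thesis .
qed

text \<open>Uniform in the times because the increment divided by \<open>sqrt (t - s)\<close> is
  standard normal. The product bound reduces the moment to the power \<open>CARD('m)\<close> of a
  one-dimensional Gaussian integral.\<close>

lemma increment_moment_bound:
  "\<exists>m\<ge>0. \<forall>s t. 0 \<le> s \<longrightarrow> s < t \<longrightarrow>
     (\<integral>\<^sup>+\<omega>. ennreal ((1 + (norm (W t \<omega> - W s \<omega>))\<^sup>2 / (t - s)) ^ k) \<partial>M) \<le> ennreal m"
proof -
  define G where "G = (\<integral>\<^sup>+x. ennreal (std_normal_density x) * ennreal ((1 + x\<^sup>2) ^ k) \<partial>lborel)"
  have "G < \<infinity>" unfolding G_def by (rule std_normal_poly_moment_finite)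
  then obtain g0 where "G = ennreal g0" "g0 \<ge> 0" by (cases G) auto
  hence "G ^ CARD('m) < \<infinity>" by (simp add: ennreal_power)
  then obtain m where m: "G ^ CARD('m) = ennreal m" "m \<ge> 0" by (cases "G ^ CARD('m)") auto
  have "(\<integral>\<^sup>+\<omega>. ennreal ((1 + (norm (W t \<omega> - W s \<omega>))\<^sup>2 / (t - s)) ^ k) \<partial>M) \<le> G ^ CARD('m)"
    if st: "0 \<le> s" "s < t" for s t
  proof -
    define h where "h = t - s"
    have h: "h > 0" using st by (simp add: h_def)
    define \<sigma> where "\<sigma> = sqrt h"
    have \<sigma>: "\<sigma> > 0" "\<sigma>\<^sup>2 = h" using h by (auto simp: \<sigma>_def)
    define g where "g x = ennreal (normal_density 0 \<sigma> x) * ennreal ((1 + x\<^sup>2 / h) ^ k)" for x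
    have [measurable]: "g \<in> borel_measurable borel" unfolding g_def by measurable
    have le: "ennreal ((1 + (norm x)\<^sup>2 / h) ^ k) \<le> (\<Prod>i\<in>UNIV. ennreal ((1 + (x $ i)\<^sup>2 / h) ^ k))" for x :: "real^'m"
    proof -
      have "(norm x)\<^sup>2 = (\<Sum>i\<in>UNIV. (x $ i)\<^sup>2)"
        unfolding power2_norm_eq_inner inner_vec_def by (simp add: power2_eq_square)
      hence "1 + (norm x)\<^sup>2 / h = 1 + (\<Sum>i\<in>UNIV. (x $ i)\<^sup>2 / h)" by (simp add: sum_divide_distrib)
      also have "\<dots> \<le> (\<Prod>i\<in>UNIV. 1 + (x $ i)\<^sup>2 / h)"
        using h by (intro one_plus_sum_le_prod) auto
      finally have "(1 + (norm x)\<^sup>2 / h) ^ k \<le> (\<Prod>i\<in>UNIV. 1 + (x $ i)\<^sup>2 / h) ^ k"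
        using h by (intro power_mono) auto
      also have "\<dots> = (\<Prod>i\<in>UNIV. (1 + (x $ i)\<^sup>2 / h) ^ k)" by (rule prod_power_distrib)
      finally show ?thesis using h by (subst prod_ennreal) (auto intro!: ennreal_leI)
    qed
    have "(\<integral>\<^sup>+\<omega>. ennreal ((1 + (norm (W t \<omega> - W s \<omega>))\<^sup>2 / (t - s)) ^ k) \<partial>M)
       = (\<integral>\<^sup>+x. (\<Prod>i\<in>UNIV. ennreal (normal_density 0 \<sigma> (x $ i))) * ennreal ((1 + (norm x)\<^sup>2 / h) ^ k) \<partial>(lborel :: (real^'m) measure))"
      unfolding h_def \<sigma>_def by (rule distributed_nn_integral[symmetric, OF gauss_incr[OF st],
          where g="\<lambda>x. ennreal ((1 + (norm x)\<^sup>2 / (t - s)) ^ k)"]) simp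
    also have "\<dots> \<le> (\<integral>\<^sup>+x. (\<Prod>i\<in>UNIV. g (x $ i)) \<partial>(lborel :: (real^'m) measure))"
      unfolding g_def prod.distrib by (intro nn_integral_mono mult_left_mono le) auto
    also have "\<dots> = (\<integral>\<^sup>+x. g x \<partial>lborel) ^ CARD('m)" by (rule nn_integral_lborel_vec_prod) simp
    \<comment> \<open>Brownian scaling: the substitution by \<open>\<sigma>\<close> removes the time
      step from the integral.\<close>
    also have "(\<integral>\<^sup>+x. g x \<partial>lborel) = ennreal \<bar>\<sigma>\<bar> * (\<integral>\<^sup>+x. g (0 + \<sigma> * x) \<partial>lborel)"
      by (rule nn_integral_real_affine) (use \<sigma> in auto)
    also have "\<dots> = (\<integral>\<^sup>+x. ennreal \<bar>\<sigma>\<bar> * g (0 + \<sigma> * x) \<partial>lborel)"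
      by (rule nn_integral_cmult[symmetric]) simp
    also have "\<dots> = G"
      unfolding G_def
    proof (rule nn_integral_cong)
      fix x :: real
      have 1: "\<sigma> * normal_density 0 \<sigma> (\<sigma> * x) = std_normal_density x"
        using \<sigma> h by (simp add: normal_density_def power_mult_distrib real_sqrt_mult \<sigma>_def[symmetric])
      have 2: "(\<sigma> * x)\<^sup>2 / h = x\<^sup>2" using \<sigma> h by (simp add: power_mult_distrib)
      show "ennreal \<bar>\<sigma>\<bar> * g (0 + \<sigma> * x) = ennreal (std_normal_density x) * ennreal ((1 + x\<^sup>2) ^ k)"
        unfolding g_def add_0 2 1[symmetric] using \<sigma> by (simp add: ennreal_mult mult.assoc)
    qed
    finally show ?thesis .
  qed
  thus ?thesis using m by auto
qed

text \<open>Given \<open>F s\<close>, both \<open>S\<close> and \<open>B\<close> are constants and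
  the increment may change its sign, so twice the left side is the expectation of the symmetrized
  power, which \<open>norm_sym_power_le\<close> bounds. The growth factor is 1 plus a multiple of
  \<open>(t - s) / L\<close>, without a term of order \<open>sqrt (t - s)\<close>; this is what
  makes iteration along a fine grid possible.\<close>

lemma moment_one_step:
  assumes k: "k \<ge> 1"
  shows "\<exists>c\<ge>0. \<forall>(S :: 'w \<Rightarrow> real ^ 'q) (B :: 'w \<Rightarrow> real ^ 'm ^ 'q) s t L.
    S \<in> borel_measurable (F s) \<longrightarrow> B \<in> borel_measurable (F s) \<longrightarrow> 0 \<le> s \<longrightarrow> s \<le> t \<longrightarrow> t - s \<le> L \<longrightarrow> 0 < L \<longrightarrow>
    (\<integral>\<^sup>+\<omega>. ennreal (norm (S \<omega> + B \<omega> *v (W t \<omega> - W s \<omega>)) ^ (2 * k)) \<partial>M)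
      \<le> ennreal (1 + c * ((t - s) / L)) * (\<integral>\<^sup>+\<omega>. ennreal (norm (S \<omega>) ^ (2 * k)) \<partial>M)
        + ennreal (c * ((t - s) / L) * L ^ k) * (\<integral>\<^sup>+\<omega>. ennreal (norm (B \<omega>) ^ (2 * k)) \<partial>M)"
proof -
  obtain C where C: "C \<ge> 0" and sym: "\<And>(x::real^'q) y h L b g. 0 \<le> h \<Longrightarrow> h \<le> L \<Longrightarrow> 0 < L \<Longrightarrow> 0 \<le> g \<Longrightarrow> 0 \<le> b \<Longrightarrow>
     (norm y)\<^sup>2 \<le> h * b\<^sup>2 * g \<Longrightarrow>
     norm (x + y) ^ (2 * k) + norm (x - y) ^ (2 * k)
       \<le> 2 * norm x ^ (2 * k) + C * (h / L) * (1 + g) ^ k * (norm x ^ (2 * k) + L ^ k * b ^ (2 * k))"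
    using norm_sym_power_le[OF k, where 'a="real^'q"] by blast
  obtain m where m: "m \<ge> 0" and mom: "\<And>s t. 0 \<le> s \<Longrightarrow> s < t \<Longrightarrow>
     (\<integral>\<^sup>+\<omega>. ennreal ((1 + (norm (W t \<omega> - W s \<omega>))\<^sup>2 / (t - s)) ^ k) \<partial>M) \<le> ennreal m"
    using increment_moment_bound[of k] by blast
  \<comment> \<open>Halved because the symmetrized estimate bounds twice the moment.\<close>
  define c where "c = C * m / 2"
  have c: "c \<ge> 0" using C m by (simp add: c_def)
  have "(\<integral>\<^sup>+\<omega>. ennreal (norm (S \<omega> + B \<omega> *v (W t \<omega> - W s \<omega>)) ^ (2 * k)) \<partial>M)
      \<le> ennreal (1 + c * ((t - s) / L)) * (\<integral>\<^sup>+\<omega>. ennreal (norm (S \<omega>) ^ (2 * k)) \<partial>M)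
        + ennreal (c * ((t - s) / L) * L ^ k) * (\<integral>\<^sup>+\<omega>. ennreal (norm (B \<omega>) ^ (2 * k)) \<partial>M)"
    if SB: "S \<in> borel_measurable (F s)" "B \<in> borel_measurable (F s)"
      and st: "0 \<le> s" "s \<le> t" "t - s \<le> L" "0 < L"
    for S :: "'w \<Rightarrow> real ^ 'q" and B :: "'w \<Rightarrow> real ^ 'm ^ 'q" and s t L
  proof (cases "s = t")
    case True
    thus ?thesis by simp
  next
    case False
    hence lt: "s < t" using st by simp
    define h where "h = t - s"
    have h: "h > 0" "h \<le> L" using lt st by (auto simp: h_def)
    let ?D = "\<lambda>\<omega>. W t \<omega> - W s \<omega>"
    have [measurable]: "S \<in> borel_measurable M" "B \<in> borel_measurable M"
      using SB measurable_F st by auto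
    have [measurable]: "?D \<in> borel_measurable M"
      using measurable_F[OF adapted[of t]] measurable_F[OF adapted[of s]] st by simp
    define \<Phi> where "\<Phi> z = ennreal (norm (fst (fst z) + snd (fst z) *v snd z) ^ (2 * k))"
      for z :: "((real^'q) \<times> (real^'m^'q)) \<times> (real^'m)"
    define \<Psi> where "\<Psi> z = ennreal (norm (fst (fst z) - snd (fst z) *v snd z) ^ (2 * k))"
      for z :: "((real^'q) \<times> (real^'m^'q)) \<times> (real^'m)"
    have \<Phi>[measurable]: "\<Phi> \<in> borel_measurable ((borel \<Otimes>\<^sub>M borel) \<Otimes>\<^sub>M borel)"
      unfolding \<Phi>_def[abs_def] by measurable
    have \<Psi>[measurable]: "\<Psi> \<in> borel_measurable ((borel \<Otimes>\<^sub>M borel) \<Otimes>\<^sub>M borel)"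
      unfolding \<Psi>_def[abs_def] by measurable
    let ?Z = "\<lambda>\<omega>. (S \<omega>, B \<omega>)"
    have Z: "?Z \<in> measurable (F s) (borel \<Otimes>\<^sub>M borel)" using SB by measurable
    define X where "X = (\<integral>\<^sup>+\<omega>. ennreal (norm (S \<omega>) ^ (2 * k)) \<partial>M)"
    define Y where "Y = (\<integral>\<^sup>+\<omega>. ennreal (norm (B \<omega>) ^ (2 * k)) \<partial>M)"
    define E where "E = (\<integral>\<^sup>+\<omega>. \<Phi> (?Z \<omega>, ?D \<omega>) \<partial>M)"
    have E1: "E = (\<integral>\<^sup>+\<omega>. \<integral>\<^sup>+\<omega>'. \<Phi> (?Z \<omega>, ?D \<omega>') \<partial>M \<partial>M)"
      unfolding E_def by (rule increment_nn_integral_indep[OF st(1) lt Z \<Phi>])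
    have "(\<integral>\<^sup>+\<omega>'. \<Phi> (?Z \<omega>, ?D \<omega>') \<partial>M) = (\<integral>\<^sup>+\<omega>'. \<Psi> (?Z \<omega>, ?D \<omega>') \<partial>M)" for \<omega>
    proof -
      have "(\<integral>\<^sup>+\<omega>'. \<Phi> (?Z \<omega>, ?D \<omega>') \<partial>M) = (\<integral>\<^sup>+\<omega>'. \<Phi> (?Z \<omega>, - ?D \<omega>') \<partial>M)"
        by (rule increment_nn_integral_uminus[symmetric, OF st(1) lt, of "\<lambda>w. \<Phi> (?Z \<omega>, w)"]) measurable
      also have "\<dots> = (\<integral>\<^sup>+\<omega>'. \<Psi> (?Z \<omega>, ?D \<omega>') \<partial>M)"
        by (simp add: \<Phi>_def \<Psi>_def matrix_vector_mult_diff_distrib algebra_simps)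
      finally show ?thesis .
    qed
    hence E2: "E = (\<integral>\<^sup>+\<omega>. \<integral>\<^sup>+\<omega>'. \<Psi> (?Z \<omega>, ?D \<omega>') \<partial>M \<partial>M)" using E1 by simp
    define r where "r = C * (h / L)"
    have r: "r \<ge> 0" using C h by (simp add: r_def)
    have mult2: "2 * E = E + E" by (simp add: mult_2)
    \<comment> \<open>One copy of \<open>E\<close> is written with the increment, the other with its
      negative.\<close>
    have "2 * E = (\<integral>\<^sup>+\<omega>. (\<integral>\<^sup>+\<omega>'. \<Phi> (?Z \<omega>, ?D \<omega>') \<partial>M) + (\<integral>\<^sup>+\<omega>'. \<Psi> (?Z \<omega>, ?D \<omega>') \<partial>M) \<partial>M)"
      unfolding mult2 by (subst (1) E1, subst E2, subst nn_integral_add) auto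
    also have "\<dots> = (\<integral>\<^sup>+\<omega>. \<integral>\<^sup>+\<omega>'. \<Phi> (?Z \<omega>, ?D \<omega>') + \<Psi> (?Z \<omega>, ?D \<omega>') \<partial>M \<partial>M)"
      by (intro nn_integral_cong nn_integral_add[symmetric]) measurable
    also have "\<dots> \<le> (\<integral>\<^sup>+\<omega>. ennreal (2 * norm (S \<omega>) ^ (2 * k)) + ennreal (r * m) * ennreal (norm (S \<omega>) ^ (2 * k) + L ^ k * norm (B \<omega>) ^ (2 * k)) \<partial>M)"
    proof (rule nn_integral_mono)
      fix \<omega>
      let ?a = "norm (S \<omega>) ^ (2 * k) + L ^ k * norm (B \<omega>) ^ (2 * k)"
      let ?g = "\<lambda>\<omega>'. (norm (?D \<omega>'))\<^sup>2 / h"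
      have a: "?a \<ge> 0" using st by simp
      have "(\<integral>\<^sup>+\<omega>'. \<Phi> (?Z \<omega>, ?D \<omega>') + \<Psi> (?Z \<omega>, ?D \<omega>') \<partial>M)
        \<le> (\<integral>\<^sup>+\<omega>'. ennreal (2 * norm (S \<omega>) ^ (2 * k)) + ennreal (r * ?a) * ennreal ((1 + ?g \<omega>') ^ k) \<partial>M)"
      proof (rule nn_integral_mono)
        fix \<omega>'
        have "norm (B \<omega> *v ?D \<omega>') \<le> norm (B \<omega>) * norm (?D \<omega>')" by (rule norm_matrix_vector_le)
        hence "(norm (B \<omega> *v ?D \<omega>'))\<^sup>2 \<le> (norm (B \<omega>) * norm (?D \<omega>'))\<^sup>2" by (rule power_mono) simp
        also have "\<dots> = h * (norm (B \<omega>))\<^sup>2 * ?g \<omega>'" using h by (simp add: power_mult_distrib)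
        finally have "norm (S \<omega> + B \<omega> *v ?D \<omega>') ^ (2 * k) + norm (S \<omega> - B \<omega> *v ?D \<omega>') ^ (2 * k)
           \<le> 2 * norm (S \<omega>) ^ (2 * k) + C * (h / L) * (1 + ?g \<omega>') ^ k * ?a"
          using h by (intro sym) auto
        also have "C * (h / L) * (1 + ?g \<omega>') ^ k * ?a = (r * ?a) * (1 + ?g \<omega>') ^ k" by (simp add: r_def)
        finally show "\<Phi> (?Z \<omega>, ?D \<omega>') + \<Psi> (?Z \<omega>, ?D \<omega>') \<le>
            ennreal (2 * norm (S \<omega>) ^ (2 * k)) + ennreal (r * ?a) * ennreal ((1 + ?g \<omega>') ^ k)"
          using r a h by (simp add: \<Phi>_def \<Psi>_def ennreal_mult[symmetric] ennreal_plus[symmetric] del: ennreal_plus)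
      qed
      also have "\<dots> = ennreal (2 * norm (S \<omega>) ^ (2 * k)) + ennreal (r * ?a) * (\<integral>\<^sup>+\<omega>'. ennreal ((1 + ?g \<omega>') ^ k) \<partial>M)"
        by (subst nn_integral_add) (auto simp: nn_integral_cmult emeasure_space_1)
      also have "\<dots> \<le> ennreal (2 * norm (S \<omega>) ^ (2 * k)) + ennreal (r * ?a) * ennreal m"
        using mom[OF st(1) lt] by (intro add_left_mono mult_left_mono) (auto simp: h_def)
      also have "ennreal (r * ?a) * ennreal m = ennreal (r * m) * ennreal ?a"
        using r a m by (simp add: ennreal_mult[symmetric] mult.commute mult.left_commute)
      finally show "(\<integral>\<^sup>+\<omega>'. \<Phi> (?Z \<omega>, ?D \<omega>') + \<Psi> (?Z \<omega>, ?D \<omega>') \<partial>M)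
        \<le> ennreal (2 * norm (S \<omega>) ^ (2 * k)) + ennreal (r * m) * ennreal ?a" .
    qed
    also have "\<dots> = 2 * X + ennreal (r * m) * (X + ennreal (L ^ k) * Y)"
      unfolding X_def Y_def
      using st by (subst nn_integral_add) (auto simp: nn_integral_cmult nn_integral_add ennreal_mult ennreal_plus)
    also have "r * m = 2 * (c * (h / L))" by (simp add: r_def c_def)
    also have "ennreal (2 * (c * (h / L))) = 2 * ennreal (c * (h / L))"
      using c h by (subst ennreal_mult) auto
    also have "2 * X + 2 * ennreal (c * (h / L)) * (X + ennreal (L ^ k) * Y)
       = 2 * (ennreal (1 + c * (h / L)) * X + ennreal (c * (h / L) * L ^ k) * Y)"
    proof -
      have e1: "ennreal (1 + c * (h / L)) = 1 + ennreal (c * (h / L))"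
        using c h by (subst ennreal_plus) auto
      have e2: "ennreal (c * (h / L) * L ^ k) = ennreal (c * (h / L)) * ennreal (L ^ k)"
        using c h by (intro ennreal_mult) auto
      show ?thesis unfolding e1 e2 by (simp only: distrib_left distrib_right mult_1 add_ac mult_ac)
    qed
    finally have "E \<le> ennreal (1 + c * (h / L)) * X + ennreal (c * (h / L) * L ^ k) * Y"
      by (subst (asm) ennreal_mult_le_mult_iff) auto
    thus ?thesis unfolding E_def \<Phi>_def X_def Y_def h_def by simp
  qed
  thus ?thesis using c by blast
qed

end

section \<open>Simple processes seen through a time window\<close>

lemma is_simple_proc_times:
  assumes "is_simple_proc M F (n, p, \<xi>)"
  shows "i \<le> j \<Longrightarrow> j \<le> n \<Longrightarrow> p i \<le> p j" "i \<le> n \<Longrightarrow> 0 \<le> p i"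
proof -
  have p0: "0 \<le> p 0" and st: "\<And>i. i < n \<Longrightarrow> p i \<le> p (Suc i)"
    using assms by (auto simp: is_simple_proc_def)
  show mono: "p i \<le> p j" if "i \<le> j" "j \<le> n" for i j
    using that
  proof (induction j rule: dec_induct)
    case (step m)
    thus ?case using st[of m] by auto
  qed simp
  show "i \<le> n \<Longrightarrow> 0 \<le> p i" using mono[of 0 i] p0 by simp
qed

text \<open>The grid intervals are disjoint, so at most one summand is active;
  \<open>m \<ge> 1\<close> settles the times off the grid, where both sides must vanish.\<close>

lemma norm_simple_val_power:
  fixes \<xi> :: "nat \<Rightarrow> 'w \<Rightarrow> 'b::real_normed_vector"
  assumes sp: "is_simple_proc M F (n, p, \<xi>)" and m: "m \<ge> 1"
  shows "norm (simple_val (n, p, \<xi>) r \<omega>) ^ m = (\<Sum>i<n. indicator {p i<..p (Suc i)} r * norm (\<xi> i \<omega>) ^ m)"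
proof (cases "\<exists>i<n. r \<in> {p i<..p (Suc i)}")
  case True
  then obtain i where i: "i < n" "r \<in> {p i<..p (Suc i)}" by blast
  have other: "indicator {p j<..p (Suc j)} r = (0::real)" if "j < n" "j \<noteq> i" for j
  proof -
    have "p (Suc j) \<le> p i \<or> p (Suc i) \<le> p j"
      using is_simple_proc_times(1)[OF sp, of "Suc j" i] is_simple_proc_times(1)[OF sp, of "Suc i" j] that i
      by (cases "j < i") auto
    thus ?thesis using i by (auto simp: indicator_def)
  qed
  have "(\<Sum>j<n. indicator {p j<..p (Suc j)} r *\<^sub>R \<xi> j \<omega>) = indicator {p i<..p (Suc i)} r *\<^sub>R \<xi> i \<omega>"
    using i other by (subst sum.remove[of _ i]) (auto intro!: sum.neutral)
  moreover have "(\<Sum>j<n. indicator {p j<..p (Suc j)} r * norm (\<xi> j \<omega>) ^ m) = indicator {p i<..p (Suc i)} r * norm (\<xi> i \<omega>) ^ m"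
    using i other by (subst sum.remove[of _ i]) (auto intro!: sum.neutral)
  ultimately show ?thesis using i by (simp add: simple_val_def)
next
  case False
  hence "indicator {p j<..p (Suc j)} r = (0::real)" if "j < n" for j using that by (auto simp: indicator_def)
  hence "(\<Sum>j<n. indicator {p j<..p (Suc j)} r *\<^sub>R \<xi> j \<omega>) = 0"
    "(\<Sum>j<n. indicator {p j<..p (Suc j)} r * norm (\<xi> j \<omega>) ^ m) = 0"
    by (intro sum.neutral; simp)+
  thus ?thesis using m by (simp add: simple_val_def)
qed

text \<open>For \<open>s \<le> t\<close> this is the nearest-point projection onto
  \<open>[s, t]\<close>. A simple process is integrated over \<open>(s, t]\<close> by moving its
  grid points with this map: intervals outside the window collapse to length zero, so the number of
  summands never changes.\<close>

definition clamp_time :: "real \<Rightarrow> real \<Rightarrow> real \<Rightarrow> real"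
  where "clamp_time s t x = max s (min t x)"

lemma nn_integral_simple_val_power:
  fixes \<xi> :: "nat \<Rightarrow> 'w \<Rightarrow> 'b::real_normed_vector"
  assumes sp: "is_simple_proc M F (n, p, \<xi>)" and m: "m \<ge> 1" and st: "s \<le> t"
  shows "(\<integral>\<^sup>+r\<in>{s<..t}. ennreal (norm (simple_val (n, p, \<xi>) r \<omega>) ^ m) \<partial>lborel)
    = (\<Sum>i<n. ennreal ((clamp_time s t (p (Suc i)) - clamp_time s t (p i)) * norm (\<xi> i \<omega>) ^ m))"
proof -
  have "(\<integral>\<^sup>+r\<in>{s<..t}. ennreal (norm (simple_val (n, p, \<xi>) r \<omega>) ^ m) \<partial>lborel)
     = (\<integral>\<^sup>+r. (\<Sum>i<n. ennreal (norm (\<xi> i \<omega>) ^ m) * indicator ({p i<..p (Suc i)} \<inter> {s<..t}) r) \<partial>lborel)"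
  proof (rule nn_integral_cong)
    fix r
    have "ennreal (\<Sum>i<n. indicator {p i<..p (Suc i)} r * norm (\<xi> i \<omega>) ^ m) * indicator {s<..t} r
       = (\<Sum>i<n. ennreal (indicator {p i<..p (Suc i)} r * norm (\<xi> i \<omega>) ^ m)) * indicator {s<..t} r"
      by (subst sum_ennreal) auto
    also have "\<dots> = (\<Sum>i<n. ennreal (norm (\<xi> i \<omega>) ^ m) * indicator ({p i<..p (Suc i)} \<inter> {s<..t}) r)"
      unfolding sum_distrib_right by (intro sum.cong refl) (auto split: split_indicator)
    finally show "ennreal (norm (simple_val (n, p, \<xi>) r \<omega>) ^ m) * indicator {s<..t} r
      = (\<Sum>i<n. ennreal (norm (\<xi> i \<omega>) ^ m) * indicator ({p i<..p (Suc i)} \<inter> {s<..t}) r)"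
      unfolding norm_simple_val_power[OF sp m] .
  qed
  also have "\<dots> = (\<Sum>i<n. ennreal (norm (\<xi> i \<omega>) ^ m) * emeasure lborel ({p i<..p (Suc i)} \<inter> {s<..t}))"
    by (subst nn_integral_sum) (auto simp: nn_integral_cmult)
  also have "\<dots> = (\<Sum>i<n. ennreal ((clamp_time s t (p (Suc i)) - clamp_time s t (p i)) * norm (\<xi> i \<omega>) ^ m))"
  proof (intro sum.cong refl)
    fix i assume "i \<in> {..<n}"
    hence le: "p i \<le> p (Suc i)" using sp by (auto simp: is_simple_proc_def)
    have "{p i<..p (Suc i)} \<inter> {s<..t} = {clamp_time s t (p i)<..clamp_time s t (p (Suc i))}"
      using st le by (auto simp: clamp_time_def)
    moreover have "clamp_time s t (p i) \<le> clamp_time s t (p (Suc i))"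
      using le by (auto simp: clamp_time_def)
    ultimately show "ennreal (norm (\<xi> i \<omega>) ^ m) * emeasure lborel ({p i<..p (Suc i)} \<inter> {s<..t})
       = ennreal ((clamp_time s t (p (Suc i)) - clamp_time s t (p i)) * norm (\<xi> i \<omega>) ^ m)"
      by (simp add: ennreal_mult mult.commute)
  qed
  finally show ?thesis .
qed

text \<open>Fatou's lemma along an almost surely convergent subsequence.\<close>

lemma (in finite_measure) nn_integral_norm_power_le_of_prob_limit:
  fixes Z :: "'a \<Rightarrow> 'b::euclidean_space"
  assumes Zn[measurable]: "\<And>n. Zn n \<in> borel_measurable M" and Z[measurable]: "Z \<in> borel_measurable M"
    and G[measurable]: "G \<in> sets M"
    and conv: "\<And>\<epsilon>. \<epsilon> > 0 \<Longrightarrow> (\<lambda>n. measure M {\<omega> \<in> space M. \<omega> \<in> G \<and> norm (Zn n \<omega> - Z \<omega>) > \<epsilon>}) \<longlonglongrightarrow> 0"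
    and le: "\<And>n. (\<integral>\<^sup>+\<omega>. ennreal (norm (Zn n \<omega>) ^ m) \<partial>M) \<le> b + e n" and e: "e \<longlonglongrightarrow> (0::ennreal)"
  shows "(\<integral>\<^sup>+\<omega>. indicator G \<omega> * ennreal (norm (Z \<omega>) ^ m) \<partial>M) \<le> b"
proof -
  \<comment> \<open>The truncated distance on \<open>G\<close> is bounded, so convergence in
    probability becomes convergence in mean, from which an almost surely convergent subsequence can
    be drawn.\<close>
  define v where "v n \<omega> = indicator G \<omega> * min 1 (norm (Zn n \<omega> - Z \<omega>))" for n \<omega>
  have [measurable]: "v n \<in> borel_measurable M" for n unfolding v_def by measurable
  have v01: "0 \<le> v n \<omega>" "v n \<omega> \<le> 1" for n \<omega> by (auto simp: v_def indicator_def)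
  have int: "integrable M (v n)" for n
    by (rule integrable_const_bound[where B=1]) (use v01 in auto)
  have "(\<lambda>n. \<integral>\<omega>. norm (v n \<omega>) \<partial>M) \<longlonglongrightarrow> 0"
  proof (rule LIMSEQ_I)
    fix r :: real assume "r > 0"
    define \<mu> where "\<mu> = measure M (space M) + 1"
    have \<mu>: "\<mu> > 0" by (simp add: \<mu>_def add_nonneg_pos)
    define \<epsilon> where "\<epsilon> = r / (2 * \<mu>)"
    have \<epsilon>: "\<epsilon> > 0" using \<open>r > 0\<close> \<mu> by (simp add: \<epsilon>_def)
    have \<epsilon>2: "\<epsilon> * measure M (space M) \<le> r / 2"
    proof -
      have "\<epsilon> * measure M (space M) \<le> \<epsilon> * \<mu>" using \<epsilon> by (intro mult_left_mono) (auto simp: \<mu>_def)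
      also have "\<dots> = r / 2" using \<mu> by (simp add: \<epsilon>_def)
      finally show ?thesis .
    qed
    let ?B = "\<lambda>n. {\<omega> \<in> space M. \<omega> \<in> G \<and> norm (Zn n \<omega> - Z \<omega>) > \<epsilon>}"
    obtain N where N: "\<And>n. n \<ge> N \<Longrightarrow> measure M (?B n) < r / 2"
      using LIMSEQ_D[OF conv[OF \<epsilon>], of "r / 2"] \<open>r > 0\<close> by auto
    show "\<exists>no. \<forall>n\<ge>no. norm ((\<integral>\<omega>. norm (v n \<omega>) \<partial>M) - 0) < r"
    proof (intro exI[of _ N] allI impI)
      fix n assume n: "n \<ge> N"
      have "(\<integral>\<omega>. norm (v n \<omega>) \<partial>M) \<le> (\<integral>\<omega>. \<epsilon> + indicator (?B n) \<omega> \<partial>M)"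
      proof (rule integral_mono)
        show "integrable M (\<lambda>\<omega>. norm (v n \<omega>))" using int by simp
        show "integrable M (\<lambda>\<omega>. \<epsilon> + indicator (?B n) \<omega>)" by (auto simp: emeasure_eq_measure)
        show "norm (v n \<omega>) \<le> \<epsilon> + indicator (?B n) \<omega>" if "\<omega> \<in> space M" for \<omega>
          using that \<epsilon> by (auto simp: v_def indicator_def min_def)
      qed
      also have "\<dots> = \<epsilon> * measure M (space M) + measure M (?B n)"
        by (subst Bochner_Integration.integral_add) (auto simp: emeasure_eq_measure)
      also have "\<dots> < r" using \<epsilon>2 N[OF n] by simp
      finally show "norm ((\<integral>\<omega>. norm (v n \<omega>) \<partial>M) - 0) < r" by simp
    qed
  qed
  from tendsto_L1_AE_subseq[OF int this] obtain r where
    r: "strict_mono r" "AE \<omega> in M. (\<lambda>n. v (r n) \<omega>) \<longlonglongrightarrow> 0" by blast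
  have "(\<integral>\<^sup>+\<omega>. indicator G \<omega> * ennreal (norm (Z \<omega>) ^ m) \<partial>M)
     \<le> (\<integral>\<^sup>+\<omega>. liminf (\<lambda>n. ennreal (norm (Zn (r n) \<omega>) ^ m)) \<partial>M)"
  proof (rule nn_integral_mono_AE, use r(2) in eventually_elim)
    fix \<omega> assume lim: "(\<lambda>n. v (r n) \<omega>) \<longlonglongrightarrow> 0"
    show "indicator G \<omega> * ennreal (norm (Z \<omega>) ^ m) \<le> liminf (\<lambda>n. ennreal (norm (Zn (r n) \<omega>) ^ m))"
    proof (cases "\<omega> \<in> G")
      case True
      have "(\<lambda>n. norm (Zn (r n) \<omega> - Z \<omega>)) \<longlonglongrightarrow> 0"
      proof (rule Lim_transform_eventually[OF lim])
        have "\<forall>\<^sub>F n in sequentially. v (r n) \<omega> < 1" using lim by (rule order_tendstoD) simp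
        thus "\<forall>\<^sub>F n in sequentially. v (r n) \<omega> = norm (Zn (r n) \<omega> - Z \<omega>)"
          by eventually_elim (use True in \<open>auto simp: v_def min_def split: if_splits\<close>)
      qed
      hence "(\<lambda>n. Zn (r n) \<omega>) \<longlonglongrightarrow> Z \<omega>"
        by (simp add: tendsto_norm_zero_iff LIM_zero_iff)
      hence "(\<lambda>n. ennreal (norm (Zn (r n) \<omega>) ^ m)) \<longlonglongrightarrow> ennreal (norm (Z \<omega>) ^ m)"
        by (intro tendsto_intros)
      hence "liminf (\<lambda>n. ennreal (norm (Zn (r n) \<omega>) ^ m)) = ennreal (norm (Z \<omega>) ^ m)"
        by (intro lim_imp_Liminf) auto
      thus ?thesis using True by simp
    qed simp
  qed
  also have "\<dots> \<le> liminf (\<lambda>n. (\<integral>\<^sup>+\<omega>. ennreal (norm (Zn (r n) \<omega>) ^ m) \<partial>M))"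
    by (rule nn_integral_liminf) measurable
  also have "\<dots> \<le> liminf (\<lambda>n. b + e (r n))"
    by (intro Liminf_mono always_eventually allI le)
  also have "\<dots> = b"
  proof (rule lim_imp_Liminf)
    have "(\<lambda>n. e (r n)) \<longlonglongrightarrow> 0" using LIMSEQ_subseq_LIMSEQ[OF e r(1)] by (simp add: o_def)
    hence "(\<lambda>n. b + e (r n)) \<longlonglongrightarrow> b + 0" by (intro tendsto_intros)
    thus "(\<lambda>n. b + e (r n)) \<longlonglongrightarrow> b" by simp
  qed simp
  finally show ?thesis .
qed

section \<open>Simple integrals over one block of time\<close>

context brownian_motion
begin

lemma simple_ito_diff:
  assumes sp: "is_simple_proc M F (n, p, \<xi>)" and st: "0 \<le> s" "s \<le> t"
  shows "simple_ito W (n, p, \<xi>) t \<omega> - simple_ito W (n, p, \<xi>) s \<omega>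
    = (\<Sum>i<n. \<xi> i \<omega> *v (W (clamp_time s t (p (Suc i))) \<omega> - W (clamp_time s t (p i)) \<omega>))"
proof -
  have e: "W (min t x) \<omega> - W (min s x) \<omega> = W (clamp_time s t x) \<omega> - W s \<omega>" for x
    using st by (cases "x \<le> s") (auto simp: clamp_time_def min_def max_def)
  have d: "(W (min t y) \<omega> - W (min t x) \<omega>) - (W (min s y) \<omega> - W (min s x) \<omega>)
      = W (clamp_time s t y) \<omega> - W (clamp_time s t x) \<omega>" for x y
  proof -
    have "(W (min t y) \<omega> - W (min t x) \<omega>) - (W (min s y) \<omega> - W (min s x) \<omega>)
        = (W (min t y) \<omega> - W (min s y) \<omega>) - (W (min t x) \<omega> - W (min s x) \<omega>)" by simp
    thus ?thesis unfolding e by simp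
  qed
  show ?thesis
    unfolding simple_ito_def prod.case sum_subtractf[symmetric] matrix_vector_mult_diff_distrib[symmetric] d ..
qed

lemma simple_ito_0: 
  assumes sp: "is_simple_proc M F Hs"
  shows "simple_ito W Hs 0 \<omega> = 0"
proof -
  obtain n p \<xi> where Hs: "Hs = (n, p, \<xi>)" by (cases Hs)
  have "min 0 (p i) = 0" if "i \<le> n" for i using is_simple_proc_times(2)[OF sp[unfolded Hs] that] by simp
  thus ?thesis unfolding Hs simple_ito_def by (auto intro!: sum.neutral)
qed

lemma simple_ito_measurable:
  assumes sp: "is_simple_proc M F Hs" and t: "0 \<le> t"
  shows "simple_ito W Hs t \<in> borel_measurable (F t)"
proof -
  obtain n p \<xi> where Hs: "Hs = (n, p, \<xi>)" by (cases Hs)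
  note sp = sp[unfolded Hs]
  have "(\<lambda>\<omega>. \<xi> i \<omega> *v (W (min t (p (Suc i))) \<omega> - W (min t (p i)) \<omega>)) \<in> borel_measurable (F t)" if i: "i < n" for i
  proof (cases "p i < t")
    case True
    have \<xi>: "\<xi> i \<in> borel_measurable (F (p i))" using sp i by (auto simp: is_simple_proc_def)
    have [measurable]: "\<xi> i \<in> borel_measurable (F t)"
      by (rule measurable_F_mono[OF \<xi>]) (use is_simple_proc_times(2)[OF sp, of i] i True in auto)
    have Wm: "W (min t (p j)) \<in> borel_measurable (F t)" if "j \<le> n" for j
      using measurable_F_mono[OF adapted, of "min t (p j)" t] is_simple_proc_times(2)[OF sp that] t by auto
    have [measurable]: "W (min t (p i)) \<in> borel_measurable (F t)" "W (min t (p (Suc i))) \<in> borel_measurable (F t)"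
      using Wm i by auto
    show ?thesis by measurable
  next
    \<comment> \<open>Here \<open>\<xi> i\<close> is known only at a time not before
      \<open>t\<close>, but it is multiplied by a vanishing increment.\<close>
    case False
    hence "min t (p i) = t" "min t (p (Suc i)) = t"
      using is_simple_proc_times(1)[OF sp, of i "Suc i"] i by auto
    thus ?thesis by simp
  qed
  thus ?thesis unfolding Hs simple_ito_def by (auto intro!: borel_measurable_sum)
qed

text \<open>\<open>moment_one_step\<close> is iterated along the clamped grid; the factors
  \<open>1 + c * (h / L)\<close> are bounded by exponentials whose exponents telescope. The general
  starting value \<open>S\<close> lets blocks be chained, the contraction \<open>A\<close> and the
  event \<open>G\<close>, fixed at the start of the block, prepare matrix-weighted sums and
  stopping.\<close>

lemma simple_ito_block_moment:
  assumes k: "k \<ge> 1"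
  shows "\<exists>c\<ge>0. \<forall>(S :: 'w \<Rightarrow> real ^ 'q) (A :: real ^ 'r ^ 'q) (Hs :: ('w, real ^ 'm ^ 'r) simple_proc) G s t L.
    is_simple_proc M F Hs \<longrightarrow> S \<in> borel_measurable (F s) \<longrightarrow> G \<in> sets (F s) \<longrightarrow> (\<forall>v. norm (A *v v) \<le> norm v) \<longrightarrow>
    0 \<le> s \<longrightarrow> s \<le> t \<longrightarrow> t - s \<le> L \<longrightarrow> 0 < L \<longrightarrow>
    (\<integral>\<^sup>+\<omega>. ennreal (norm (S \<omega> + indicator G \<omega> *\<^sub>R (A *v (simple_ito W Hs t \<omega> - simple_ito W Hs s \<omega>))) ^ (2 * k)) \<partial>M)
      \<le> ennreal (exp (c * ((t - s) / L))) * ((\<integral>\<^sup>+\<omega>. ennreal (norm (S \<omega>) ^ (2 * k)) \<partial>M)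
        + ennreal (c * L ^ (k - 1)) *
          (\<integral>\<^sup>+\<omega>. indicator G \<omega> * (\<integral>\<^sup>+r\<in>{s<..t}. ennreal (norm (simple_val Hs r \<omega>) ^ (2 * k)) \<partial>lborel) \<partial>M))"
proof -
  obtain c where c: "c \<ge> 0" and one: "\<And>(S :: 'w \<Rightarrow> real ^ 'q) (B :: 'w \<Rightarrow> real ^ 'm ^ 'q) s t L.
    S \<in> borel_measurable (F s) \<Longrightarrow> B \<in> borel_measurable (F s) \<Longrightarrow> 0 \<le> s \<Longrightarrow> s \<le> t \<Longrightarrow> t - s \<le> L \<Longrightarrow> 0 < L \<Longrightarrow>
    (\<integral>\<^sup>+\<omega>. ennreal (norm (S \<omega> + B \<omega> *v (W t \<omega> - W s \<omega>)) ^ (2 * k)) \<partial>M)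
      \<le> ennreal (1 + c * ((t - s) / L)) * (\<integral>\<^sup>+\<omega>. ennreal (norm (S \<omega>) ^ (2 * k)) \<partial>M)
        + ennreal (c * ((t - s) / L) * L ^ k) * (\<integral>\<^sup>+\<omega>. ennreal (norm (B \<omega>) ^ (2 * k)) \<partial>M)"
    using moment_one_step[OF k, where 'q='q] by blast
  have "(\<integral>\<^sup>+\<omega>. ennreal (norm (S \<omega> + indicator G \<omega> *\<^sub>R (A *v (simple_ito W Hs t \<omega> - simple_ito W Hs s \<omega>))) ^ (2 * k)) \<partial>M)
      \<le> ennreal (exp (c * ((t - s) / L))) * ((\<integral>\<^sup>+\<omega>. ennreal (norm (S \<omega>) ^ (2 * k)) \<partial>M)
        + ennreal (c * L ^ (k - 1)) *
          (\<integral>\<^sup>+\<omega>. indicator G \<omega> * (\<integral>\<^sup>+r\<in>{s<..t}. ennreal (norm (simple_val Hs r \<omega>) ^ (2 * k)) \<partial>lborel) \<partial>M))"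
    if sp0: "is_simple_proc M F Hs" and S: "S \<in> borel_measurable (F s)" and G: "G \<in> sets (F s)"
      and A: "\<forall>v. norm (A *v v) \<le> norm v" and st: "0 \<le> s" "s \<le> t" "t - s \<le> L" "0 < L"
    for S :: "'w \<Rightarrow> real ^ 'q" and A :: "real ^ 'r ^ 'q" and Hs :: "('w, real ^ 'm ^ 'r) simple_proc" and G s t L
  proof -
    obtain n p \<xi> where Hs: "Hs = (n, p, \<xi>)" by (cases Hs)
    note sp = sp0[unfolded Hs]
    have \<xi>: "\<xi> i \<in> borel_measurable (F (p i))" if "i < n" for i using sp that by (auto simp: is_simple_proc_def)
    have \<xi>M[measurable]: "\<xi> i \<in> borel_measurable M" if "i < n" for i
      using measurable_F[OF \<xi>[OF that]] is_simple_proc_times(2)[OF sp, of i] that by auto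
    have GM[measurable]: "G \<in> sets M" using sets_F[OF st(1) G] .
    define cl where "cl i = clamp_time s t (p i)" for i
    have cls: "s \<le> cl i" "cl i \<le> t" for i using st by (auto simp: cl_def clamp_time_def)
    have clm: "cl i \<le> cl j" if "i \<le> j" "j \<le> n" for i j
      using is_simple_proc_times(1)[OF sp that] by (auto simp: cl_def clamp_time_def)
    \<comment> \<open>An interval that survives clamping starts no later than its clamped left end,
      so \<open>\<xi> i\<close> is already known there.\<close>
    have clp: "p i \<le> cl i" if "i < n" "cl i < cl (Suc i)" for i
    proof (rule ccontr)
      assume "\<not> p i \<le> cl i"
      hence "t \<le> p i" by (auto simp: cl_def clamp_time_def)
      hence "cl i = t" "cl (Suc i) = t"
        using is_simple_proc_times(1)[OF sp, of i "Suc i"] that st by (auto simp: cl_def clamp_time_def)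
      thus False using that by simp
    qed
    \<comment> \<open>Event and contraction are absorbed into the integrand;
      \<open>G \<in> sets (F s)\<close> keeps it measurable at the left end of each clamped
      interval.\<close>
    define B where "B i \<omega> = (indicator G \<omega> :: real) *\<^sub>R (A ** \<xi> i \<omega>)" for i \<omega>
    have Bm: "B i \<in> borel_measurable (F (cl i))" if i: "i < n" "cl i < cl (Suc i)" for i
    proof -
      have [measurable]: "\<xi> i \<in> borel_measurable (F (cl i))"
        using measurable_F_mono[OF \<xi>[OF i(1)]] is_simple_proc_times(2)[OF sp, of i] clp[OF i] i by auto
      have [measurable]: "G \<in> sets (F (cl i))" using mono[OF st(1) cls(1)[of i]] G by auto
      show ?thesis unfolding B_def by measurable
    qed
    define T where "T i \<omega> = B i \<omega> *v (W (cl (Suc i)) \<omega> - W (cl i) \<omega>)" for i \<omega>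
    have T0: "T i \<omega> = 0" if "i < n" "\<not> cl i < cl (Suc i)" for i \<omega>
    proof -
      have "cl (Suc i) = cl i" using that clm[of i "Suc i"] by simp
      thus ?thesis by (simp add: T_def)
    qed
    have Tm: "T i \<in> borel_measurable (F (cl (Suc i)))" if i: "i < n" for i
    proof (cases "cl i < cl (Suc i)")
      case True
      have 0: "0 \<le> cl i" using cls[of i] st by simp
      have [measurable]: "B i \<in> borel_measurable (F (cl (Suc i)))" "W (cl i) \<in> borel_measurable (F (cl (Suc i)))"
          "W (cl (Suc i)) \<in> borel_measurable (F (cl (Suc i)))"
        using measurable_F_mono[OF Bm[OF i True] 0, of "cl (Suc i)"] measurable_F_mono[OF adapted[OF 0] 0, of "cl (Suc i)"]
          adapted[of "cl (Suc i)"] True 0 by auto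
      show ?thesis unfolding T_def by measurable
    next
      case False
      hence "T i = (\<lambda>_. 0)" using T0[OF i] by auto
      thus ?thesis by simp
    qed
    \<comment> \<open>The state after \<open>j\<close> grid steps is measurable at
      \<open>cl j\<close>, as the next one-step bound requires of its starting value.\<close>
    define P where "P j \<omega> = S \<omega> + (\<Sum>i<j. T i \<omega>)" for j \<omega>
    have Pm: "P j \<in> borel_measurable (F (cl j))" if j: "j \<le> n" for j
    proof -
      have "S \<in> borel_measurable (F (cl j))" using measurable_F_mono[OF S st(1) cls(1)] .
      moreover have "T i \<in> borel_measurable (F (cl j))" if "i < j" for i
        using measurable_F_mono[OF Tm, of i "cl j"] that j cls[of "Suc i"] st clm[of "Suc i" j] by auto
      ultimately show ?thesis unfolding P_def by (intro borel_measurable_add borel_measurable_sum) auto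
    qed
    define X where "X i = (\<integral>\<^sup>+\<omega>. indicator G \<omega> * ennreal (norm (\<xi> i \<omega>) ^ (2 * k)) \<partial>M)" for i
    have BX: "(\<integral>\<^sup>+\<omega>. ennreal (norm (B i \<omega>) ^ (2 * k)) \<partial>M) \<le> X i" for i
      unfolding X_def
    proof (rule nn_integral_mono)
      fix \<omega>
      have "norm (A ** \<xi> i \<omega>) \<le> norm (\<xi> i \<omega>)" by (rule norm_contraction_matrix_mult) (use A in blast)
      thus "ennreal (norm (B i \<omega>) ^ (2 * k)) \<le> indicator G \<omega> * ennreal (norm (\<xi> i \<omega>) ^ (2 * k))"
        using k by (auto simp: B_def indicator_def intro!: ennreal_leI power_mono)
    qed
    \<comment> \<open>One power of \<open>L\<close> is spent on turning \<open>h / L\<close> into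
      the interval length \<open>h\<close>, so that the sum over intervals becomes a time
      integral.\<close>
    define \<alpha> where "\<alpha> = c * L ^ (k - 1)"
    have \<alpha>: "\<alpha> \<ge> 0" using c st by (simp add: \<alpha>_def)
    have Lk: "c * (h / L) * L ^ k = \<alpha> * h" for h
      using k st by (cases k) (auto simp: \<alpha>_def)
    have main: "(\<integral>\<^sup>+\<omega>. ennreal (norm (P j \<omega>) ^ (2 * k)) \<partial>M)
       \<le> ennreal (exp (c * ((cl j - cl 0) / L))) * ((\<integral>\<^sup>+\<omega>. ennreal (norm (S \<omega>) ^ (2 * k)) \<partial>M)
           + ennreal \<alpha> * (\<Sum>i<j. ennreal (cl (Suc i) - cl i) * X i))" (is "?E j \<le> ennreal (?e j) * (?S + ennreal \<alpha> * ?Q j)")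
      if "j \<le> n" for j
      using that
    proof (induction j)
      case 0
      show ?case by (simp add: P_def)
    next
      case (Suc j)
      hence j: "j < n" and IH: "?E j \<le> ennreal (?e j) * (?S + ennreal \<alpha> * ?Q j)" by auto
      show ?case
      proof (cases "cl j < cl (Suc j)")
        case True
        define h where "h = cl (Suc j) - cl j"
        have h: "h \<ge> 0" "h \<le> L" using True cls[of j] cls[of "Suc j"] st by (auto simp: h_def)
        have 0: "0 \<le> cl j" using cls[of j] st by simp
        have ee: "1 + c * (h / L) \<le> exp (c * (h / L))" by (rule exp_ge_add_one_self)
        have e1: "exp (c * (h / L)) * ?e j = ?e (Suc j)"
          by (simp add: exp_add[symmetric] h_def add_divide_distrib[symmetric] distrib_left[symmetric])
        have e2: "1 \<le> ?e (Suc j)" using c st clm[of 0 "Suc j"] Suc.prems by simp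
        have "?E (Suc j) \<le> ennreal (1 + c * (h / L)) * ?E j + ennreal (c * (h / L) * L ^ k) * (\<integral>\<^sup>+\<omega>. ennreal (norm (B j \<omega>) ^ (2 * k)) \<partial>M)"
          using one[OF Pm Bm[OF j True] 0, of "cl (Suc j)" L] j h True st
          unfolding h_def by (simp add: P_def T_def add.assoc)
        also have "\<dots> \<le> ennreal (exp (c * (h / L))) * (ennreal (?e j) * (?S + ennreal \<alpha> * ?Q j)) + ennreal (\<alpha> * h) * X j"
          unfolding Lk using IH BX ee \<alpha> h by (intro add_mono mult_mono ennreal_leI) auto
        also have "\<dots> = ennreal (?e (Suc j)) * (?S + ennreal \<alpha> * ?Q j) + ennreal (\<alpha> * h) * X j"
          unfolding mult.assoc[symmetric] by (subst ennreal_mult[symmetric]) (auto simp only: e1 exp_ge_zero)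
        \<comment> \<open>The new term is multiplied by a factor at least 1 so that it joins the
          common bracket.\<close>
        also have "\<dots> \<le> ennreal (?e (Suc j)) * (?S + ennreal \<alpha> * ?Q j) + ennreal (?e (Suc j)) * (ennreal (\<alpha> * h) * X j)"
          using mult_right_mono[of 1 "ennreal (?e (Suc j))" "ennreal (\<alpha> * h) * X j"] e2
          by (intro add_left_mono) simp
        also have "\<dots> = ennreal (?e (Suc j)) * (?S + ennreal \<alpha> * ?Q (Suc j))"
          using \<alpha> h by (simp add: h_def[symmetric] ennreal_mult distrib_left add.assoc mult.assoc)
        finally show ?thesis .
      next
        case False
        hence e: "cl (Suc j) = cl j" using clm[of j "Suc j"] j by simp
        have "P (Suc j) = P j" using T0[OF j False] by (auto simp: P_def)
        thus ?thesis using IH e by simp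
      qed
    qed
    have "S \<omega> + indicator G \<omega> *\<^sub>R (A *v (simple_ito W Hs t \<omega> - simple_ito W Hs s \<omega>)) = P n \<omega>" for \<omega>
    proof -
      have lin: "A *v (\<Sum>i<n. f i) = (\<Sum>i<n. A *v f i)" for f :: "nat \<Rightarrow> real^'r"
        by (rule linear_sum) (rule matrix_vector_mul_linear)
      have sc: "(a *\<^sub>R M1) *v v = a *\<^sub>R (M1 *v v)" for a and M1 :: "real^'m^'q" and v
        by (simp add: scaleR_matrix_vector_assoc)
      show ?thesis
        unfolding Hs simple_ito_diff[OF sp st(1,2)] P_def T_def B_def lin scaleR_sum_right cl_def[symmetric]
          matrix_vector_mul_assoc sc ..
    qed
    hence "(\<integral>\<^sup>+\<omega>. ennreal (norm (S \<omega> + indicator G \<omega> *\<^sub>R (A *v (simple_ito W Hs t \<omega> - simple_ito W Hs s \<omega>))) ^ (2 * k)) \<partial>M)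
       = ?E n" by simp
    also have "\<dots> \<le> ennreal (?e n) * (?S + ennreal \<alpha> * ?Q n)" by (rule main) simp
    also have "\<dots> \<le> ennreal (exp (c * ((t - s) / L))) * (?S + ennreal \<alpha> * ?Q n)"
      using cls[of n] cls[of 0] c st
      by (intro mult_right_mono ennreal_leI) (auto intro!: mult_left_mono divide_right_mono)
    also have "?Q n = (\<Sum>i<n. \<integral>\<^sup>+\<omega>. indicator G \<omega> * ennreal ((cl (Suc i) - cl i) * norm (\<xi> i \<omega>) ^ (2 * k)) \<partial>M)"
    proof (intro sum.cong refl)
      fix i assume "i \<in> {..<n}"
      hence i: "i < n" by simp
      have h: "0 \<le> cl (Suc i) - cl i" using clm[of i "Suc i"] i by simp
      have "ennreal (cl (Suc i) - cl i) * X i = (\<integral>\<^sup>+\<omega>. ennreal (cl (Suc i) - cl i) * (indicator G \<omega> * ennreal (norm (\<xi> i \<omega>) ^ (2 * k))) \<partial>M)"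
        unfolding X_def by (rule nn_integral_cmult[symmetric]) (use i in measurable)
      thus "ennreal (cl (Suc i) - cl i) * X i = (\<integral>\<^sup>+\<omega>. indicator G \<omega> * ennreal ((cl (Suc i) - cl i) * norm (\<xi> i \<omega>) ^ (2 * k)) \<partial>M)"
        using h by (simp add: ennreal_mult mult.left_commute)
    qed
    also have "\<dots> = (\<integral>\<^sup>+\<omega>. (\<Sum>i<n. indicator G \<omega> * ennreal ((cl (Suc i) - cl i) * norm (\<xi> i \<omega>) ^ (2 * k))) \<partial>M)"
      by (rule nn_integral_sum[symmetric]) (auto intro!: borel_measurable_times borel_measurable_indicator borel_measurable_power \<xi>M measurable_compose[OF _ measurable_ennreal] borel_measurable_norm)
    also have "\<dots> = (\<integral>\<^sup>+\<omega>. indicator G \<omega> * (\<integral>\<^sup>+r\<in>{s<..t}. ennreal (norm (simple_val Hs r \<omega>) ^ (2 * k)) \<partial>lborel) \<partial>M)"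
      unfolding Hs using k by (subst nn_integral_simple_val_power[OF sp _ st(2)]) (auto simp: cl_def sum_distrib_left)
    finally show ?thesis unfolding \<alpha>_def .
  qed
  thus ?thesis using c by blast
qed

end

section \<open>Simple integrals over a partition; a bound in probability\<close>

context brownian_motion
begin

lemma simple_ito_random_variable:
  "is_simple_proc M F Hs \<Longrightarrow> 0 \<le> t \<Longrightarrow> simple_ito W Hs t \<in> borel_measurable M"
  by (rule measurable_F[OF simple_ito_measurable])

text \<open>All blocks share the \<open>L\<close> of the whole partition: a block costs the
  exponential of \<open>c\<close> times its share of the length, so the total is
  \<open>exp c\<close> whatever \<open>N\<close> is. The matrix \<open>A j\<close> changes from
  block to block, and \<open>G j\<close> has to be decided at the left end of its block.\<close>

lemma simple_ito_partition_moment: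
  assumes k: "k \<ge> 1"
  shows "\<exists>c\<ge>0. \<forall>(Hs :: ('w, real ^ 'm ^ 'r) simple_proc) N u (A :: nat \<Rightarrow> real ^ 'r ^ 'q) G.
    is_simple_proc M F Hs \<longrightarrow> (\<forall>j<N. u j \<le> u (Suc j)) \<longrightarrow> 0 \<le> u 0 \<longrightarrow> u 0 < u N \<longrightarrow>
    (\<forall>j<N. \<forall>v. norm (A j *v v) \<le> norm v) \<longrightarrow> (\<forall>j<N. G j \<in> sets (F (u j))) \<longrightarrow>
    (\<integral>\<^sup>+\<omega>. ennreal (norm (\<Sum>j<N. indicator (G j) \<omega> *\<^sub>R
        (A j *v (simple_ito W Hs (u (Suc j)) \<omega> - simple_ito W Hs (u j) \<omega>))) ^ (2 * k)) \<partial>M)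
      \<le> ennreal (c * (u N - u 0) ^ (k - 1)) * (\<Sum>j<N.
          \<integral>\<^sup>+\<omega>. indicator (G j) \<omega> * (\<integral>\<^sup>+r\<in>{u j<..u (Suc j)}. ennreal (norm (simple_val Hs r \<omega>) ^ (2 * k)) \<partial>lborel) \<partial>M)"
proof -
  obtain c where c: "c \<ge> 0" and block: "\<And>(S :: 'w \<Rightarrow> real ^ 'q) (A :: real ^ 'r ^ 'q) (Hs :: ('w, real ^ 'm ^ 'r) simple_proc) G s t L.
    is_simple_proc M F Hs \<Longrightarrow> S \<in> borel_measurable (F s) \<Longrightarrow> G \<in> sets (F s) \<Longrightarrow> (\<forall>v. norm (A *v v) \<le> norm v) \<Longrightarrow>
    0 \<le> s \<Longrightarrow> s \<le> t \<Longrightarrow> t - s \<le> L \<Longrightarrow> 0 < L \<Longrightarrow>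
    (\<integral>\<^sup>+\<omega>. ennreal (norm (S \<omega> + indicator G \<omega> *\<^sub>R (A *v (simple_ito W Hs t \<omega> - simple_ito W Hs s \<omega>))) ^ (2 * k)) \<partial>M)
      \<le> ennreal (exp (c * ((t - s) / L))) * ((\<integral>\<^sup>+\<omega>. ennreal (norm (S \<omega>) ^ (2 * k)) \<partial>M)
        + ennreal (c * L ^ (k - 1)) *
          (\<integral>\<^sup>+\<omega>. indicator G \<omega> * (\<integral>\<^sup>+r\<in>{s<..t}. ennreal (norm (simple_val Hs r \<omega>) ^ (2 * k)) \<partial>lborel) \<partial>M))"
    using simple_ito_block_moment[OF k, where 'q='q and 'r='r] by blast
  have "(\<integral>\<^sup>+\<omega>. ennreal (norm (\<Sum>j<N. indicator (G j) \<omega> *\<^sub>R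
        (A j *v (simple_ito W Hs (u (Suc j)) \<omega> - simple_ito W Hs (u j) \<omega>))) ^ (2 * k)) \<partial>M)
      \<le> ennreal (exp c * c * (u N - u 0) ^ (k - 1)) * (\<Sum>j<N.
          \<integral>\<^sup>+\<omega>. indicator (G j) \<omega> * (\<integral>\<^sup>+r\<in>{u j<..u (Suc j)}. ennreal (norm (simple_val Hs r \<omega>) ^ (2 * k)) \<partial>lborel) \<partial>M)"
    if sp: "is_simple_proc M F Hs" and u: "\<forall>j<N. u j \<le> u (Suc j)" "0 \<le> u 0" "u 0 < u N"
      and A: "\<forall>j<N. \<forall>v. norm (A j *v v) \<le> norm v" and G: "\<forall>j<N. G j \<in> sets (F (u j))"
    for Hs :: "('w, real ^ 'm ^ 'r) simple_proc" and N u and A :: "nat \<Rightarrow> real ^ 'r ^ 'q" and G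
  proof -
    define L where "L = u N - u 0"
    have L: "L > 0" using u by (simp add: L_def)
    have um: "u i \<le> u j" if "i \<le> j" "j \<le> N" for i j
      using that
    proof (induction j rule: dec_induct)
      case (step m)
      thus ?case using u(1)[rule_format, of m] by auto
    qed simp
    define T where "T j \<omega> = indicator (G j) \<omega> *\<^sub>R (A j *v (simple_ito W Hs (u (Suc j)) \<omega> - simple_ito W Hs (u j) \<omega>))" for j \<omega>
    define S where "S j \<omega> = (\<Sum>i<j. T i \<omega>)" for j \<omega>
    have Tm: "T j \<in> borel_measurable (F (u (Suc j)))" if j: "j < N" for j
    proof -
      have 0: "0 \<le> u j" using um[of 0 j] u j by simp
      have le: "u j \<le> u (Suc j)" using u j by simp
      have [measurable]: "simple_ito W Hs (u j) \<in> borel_measurable (F (u (Suc j)))"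
        by (rule measurable_F_mono[OF simple_ito_measurable[OF sp 0] 0 le])
      have [measurable]: "simple_ito W Hs (u (Suc j)) \<in> borel_measurable (F (u (Suc j)))"
        using simple_ito_measurable[OF sp] 0 le by simp
      have [measurable]: "G j \<in> sets (F (u (Suc j)))" using mono[OF 0 le] G j by auto
      show ?thesis unfolding T_def by measurable
    qed
    have Sm: "S j \<in> borel_measurable (F (u j))" if j: "j \<le> N" for j
    proof -
      have "T i \<in> borel_measurable (F (u j))" if "i < j" for i
        by (rule measurable_F_mono[OF Tm]) (use that j um[of 0 "Suc i"] um[of "Suc i" j] u in auto)
      thus ?thesis unfolding S_def by (intro borel_measurable_sum) auto
    qed
    let ?X = "\<lambda>j. \<integral>\<^sup>+\<omega>. indicator (G j) \<omega> * (\<integral>\<^sup>+r\<in>{u j<..u (Suc j)}. ennreal (norm (simple_val Hs r \<omega>) ^ (2 * k)) \<partial>lborel) \<partial>M"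
    let ?E = "\<lambda>j. \<integral>\<^sup>+\<omega>. ennreal (norm (S j \<omega>) ^ (2 * k)) \<partial>M"
    let ?e = "\<lambda>j. exp (c * ((u j - u 0) / L))"
    have main: "?E j \<le> ennreal (?e j) * (ennreal (c * L ^ (k - 1)) * (\<Sum>i<j. ?X i))" if "j \<le> N" for j
      using that
    proof (induction j)
      case 0
      show ?case using k by (simp add: S_def)
    next
      case (Suc j)
      hence j: "j < N" and IH: "?E j \<le> ennreal (?e j) * (ennreal (c * L ^ (k - 1)) * (\<Sum>i<j. ?X i))" by auto
      define h where "h = u (Suc j) - u j"
      have 0: "0 \<le> u j" "u j \<le> u (Suc j)" "u (Suc j) - u j \<le> L"
        using um[of 0 j] um[of "Suc j" N] u j by (auto simp: L_def)
      have e1: "exp (c * ((u (Suc j) - u j) / L)) * ?e j = ?e (Suc j)"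
        by (simp add: exp_add[symmetric] add_divide_distrib[symmetric] distrib_left[symmetric])
      have e2: "1 \<le> ?e j" using c L um[of 0 j] j by simp
      let ?Y = "ennreal (c * L ^ (k - 1))"
      have "?E (Suc j) \<le> ennreal (exp (c * ((u (Suc j) - u j) / L))) * (?E j + ?Y * ?X j)"
        using block[OF sp Sm, of j "G j" "A j" "u (Suc j)" L] j 0 L A G
        by (simp add: S_def T_def)
      also have "\<dots> \<le> ennreal (exp (c * ((u (Suc j) - u j) / L))) * (ennreal (?e j) * (?Y * (\<Sum>i<j. ?X i)) + ennreal (?e j) * (?Y * ?X j))"
        using mult_right_mono[of 1 "ennreal (?e j)" "?Y * ?X j"] e2 IH
        by (intro mult_left_mono add_mono) auto
      also have "\<dots> = (ennreal (exp (c * ((u (Suc j) - u j) / L))) * ennreal (?e j)) * (?Y * (\<Sum>i<Suc j. ?X i))"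
        by (simp add: distrib_left mult.assoc)
      also have "ennreal (exp (c * ((u (Suc j) - u j) / L))) * ennreal (?e j) = ennreal (?e (Suc j))"
        by (subst ennreal_mult[symmetric]) (auto simp only: e1 exp_ge_zero)
      finally show ?case .
    qed
    have "?E N \<le> ennreal (?e N) * (ennreal (c * L ^ (k - 1)) * (\<Sum>i<N. ?X i))" by (rule main) simp
    also have "?e N = exp c" using L by (simp add: L_def)
    also have "ennreal (exp c) * (ennreal (c * L ^ (k - 1)) * (\<Sum>i<N. ?X i)) = ennreal (exp c * c * L ^ (k - 1)) * (\<Sum>i<N. ?X i)"
      using c L by (simp add: ennreal_mult mult.assoc)
    finally show ?thesis unfolding S_def T_def L_def .
  qed
  moreover have "exp c * c \<ge> 0" using c by simp
  ultimately show ?thesis by blast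
qed

lemma is_simple_proc_map:
  assumes sp: "is_simple_proc M F (n, p, \<xi>)" and [measurable]: "g \<in> borel_measurable borel"
    and g: "\<And>x. norm (g x) \<le> norm x"
  shows "is_simple_proc M F (n, p, \<lambda>i \<omega>. g (\<xi> i \<omega>))"
proof -
  obtain B where B: "\<forall>i<n. \<forall>\<omega>\<in>space M. norm (\<xi> i \<omega>) \<le> B"
    using sp by (auto simp: is_simple_proc_def)
  have "\<forall>i<n. (\<lambda>\<omega>. g (\<xi> i \<omega>)) \<in> borel_measurable (F (p i))"
    using sp by (auto simp: is_simple_proc_def intro: measurable_compose[OF _ assms(2)])
  moreover have "\<forall>i<n. \<forall>\<omega>\<in>space M. norm (g (\<xi> i \<omega>)) \<le> B"
    using B g order_trans by blast
  ultimately show ?thesis using sp by (auto simp: is_simple_proc_def)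
qed

lemma simple_val_measurable_pair:
  fixes \<xi> :: "nat \<Rightarrow> 'w \<Rightarrow> real ^ 'm ^ 'r"
  assumes sp: "is_simple_proc M F (n, p, \<xi>)"
    and [measurable]: "f \<in> borel_measurable N" "g \<in> measurable N M"
  shows "(\<lambda>z. simple_val (n, p, \<xi>) (f z) (g z)) \<in> borel_measurable N"
proof -
  have "(\<lambda>z. indicator {p i<..p (Suc i)} (f z) *\<^sub>R \<xi> i (g z)) \<in> borel_measurable N" if i: "i < n" for i
  proof -
    have "\<xi> i \<in> borel_measurable (F (p i))" using sp i by (auto simp: is_simple_proc_def)
    hence [measurable]: "\<xi> i \<in> borel_measurable M"
      by (rule measurable_F) (use is_simple_proc_times(2)[OF sp, of i] i in auto)
    show ?thesis by measurable
  qed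
  thus ?thesis unfolding simple_val_def prod.case by (intro borel_measurable_sum) auto
qed

text \<open>Stopping the integrand at the first grid time at which its accumulated square exceeds
  \<open>\<delta>\<close> gives a Lenglart-type inequality.\<close>

lemma simple_ito_prob_bound:
  "\<exists>c\<ge>0. \<forall>(Hs :: ('w, real ^ 'm ^ 'r) simple_proc) t G \<delta> \<epsilon>.
    is_simple_proc M F Hs \<longrightarrow> 0 < t \<longrightarrow> G \<in> sets M \<longrightarrow> 0 < \<delta> \<longrightarrow> 0 < \<epsilon> \<longrightarrow>
    measure M {\<omega> \<in> space M. \<omega> \<in> G \<and> norm (simple_ito W Hs t \<omega>) > \<epsilon>}
      \<le> measure M {\<omega> \<in> space M. \<omega> \<in> G \<and> ennreal \<delta> < (\<integral>\<^sup>+r\<in>{0<..t}. ennreal ((norm (simple_val Hs r \<omega>))\<^sup>2) \<partial>lborel)}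
        + c * \<delta> / \<epsilon>\<^sup>2"
proof -
  obtain c where c: "c \<ge> 0" and part: "\<And>(Hs :: ('w, real ^ 'm ^ 'r) simple_proc) N u (A :: nat \<Rightarrow> real ^ 'r ^ 'r) G.
    is_simple_proc M F Hs \<Longrightarrow> (\<forall>j<N. u j \<le> u (Suc j)) \<Longrightarrow> 0 \<le> u 0 \<Longrightarrow> u 0 < u N \<Longrightarrow>
    (\<forall>j<N. \<forall>v. norm (A j *v v) \<le> norm v) \<Longrightarrow> (\<forall>j<N. G j \<in> sets (F (u j))) \<Longrightarrow>
    (\<integral>\<^sup>+\<omega>. ennreal (norm (\<Sum>j<N. indicator (G j) \<omega> *\<^sub>R
        (A j *v (simple_ito W Hs (u (Suc j)) \<omega> - simple_ito W Hs (u j) \<omega>))) ^ (2 * 1)) \<partial>M)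
      \<le> ennreal (c * (u N - u 0) ^ (1 - 1)) * (\<Sum>j<N.
          \<integral>\<^sup>+\<omega>. indicator (G j) \<omega> * (\<integral>\<^sup>+r\<in>{u j<..u (Suc j)}. ennreal (norm (simple_val Hs r \<omega>) ^ (2 * 1)) \<partial>lborel) \<partial>M)"
    using simple_ito_partition_moment[of 1, where 'q='r and 'r='r] by blast
  have "measure M {\<omega> \<in> space M. \<omega> \<in> G \<and> norm (simple_ito W Hs t \<omega>) > \<epsilon>}
      \<le> measure M {\<omega> \<in> space M. \<omega> \<in> G \<and> ennreal \<delta> < (\<integral>\<^sup>+r\<in>{0<..t}. ennreal ((norm (simple_val Hs r \<omega>))\<^sup>2) \<partial>lborel)}
        + c * \<delta> / \<epsilon>\<^sup>2"
    if sp0: "is_simple_proc M F Hs" and t: "0 < t" and [measurable]: "G \<in> sets M" and pos: "0 < \<delta>" "0 < \<epsilon>"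
    for Hs :: "('w, real ^ 'm ^ 'r) simple_proc" and t G \<delta> \<epsilon>
  proof -
    obtain n p \<xi> where Hs: "Hs = (n, p, \<xi>)" by (cases Hs)
    note sp = sp0[unfolded Hs]
    define h where "h i = clamp_time 0 t (p (Suc i)) - clamp_time 0 t (p i)" for i
    have h: "0 \<le> h i" if "i < n" for i
      using is_simple_proc_times(1)[OF sp, of i "Suc i"] that by (auto simp: h_def clamp_time_def)
    \<comment> \<open>The sum runs up to and including index \<open>i\<close>: the lengths
      \<open>h\<close> are deterministic and \<open>\<xi> i\<close> is known at \<open>p i\<close>,
      so the contribution of the interval ahead is known at its left end. Stopping before it is
      incurred keeps the accumulated square below \<open>\<delta>\<close> without overshoot.\<close>
    define q where "q i \<omega> = (\<Sum>j<Suc i. h j * (norm (\<xi> j \<omega>))\<^sup>2)" for i \<omega>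
    define \<xi>' where "\<xi>' i \<omega> = (if q i \<omega> \<le> \<delta> then \<xi> i \<omega> else 0)" for i \<omega>
    have \<xi>m: "\<xi> j \<in> borel_measurable (F (p i))" if "j \<le> i" "i < n" for i j
    proof (rule measurable_F_mono)
      show "\<xi> j \<in> borel_measurable (F (p j))" using sp that by (auto simp: is_simple_proc_def)
    qed (use is_simple_proc_times[OF sp, of j] that in auto)
    have sp': "is_simple_proc M F (n, p, \<xi>')"
    proof -
      have "\<xi>' i \<in> borel_measurable (F (p i))" if i: "i < n" for i
      proof -
        have [measurable]: "q i \<in> borel_measurable (F (p i))"
          unfolding q_def by (intro borel_measurable_sum borel_measurable_times borel_measurable_power borel_measurable_norm)
            (use \<xi>m i in auto)
        have [measurable]: "\<xi> i \<in> borel_measurable (F (p i))" using \<xi>m i by auto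
        show ?thesis unfolding \<xi>'_def by measurable
      qed
      moreover obtain B where "\<forall>i<n. \<forall>\<omega>\<in>space M. norm (\<xi> i \<omega>) \<le> B"
        using sp by (auto simp: is_simple_proc_def)
      hence "\<forall>i<n. \<forall>\<omega>\<in>space M. norm (\<xi>' i \<omega>) \<le> max B 0" by (auto simp: \<xi>'_def le_max_iff_disj)
      ultimately show ?thesis using sp by (auto simp: is_simple_proc_def)
    qed
    have int: "(\<integral>\<^sup>+r\<in>{0<..t}. ennreal (norm (simple_val (n, p, \<zeta>) r \<omega>) ^ 2) \<partial>lborel)
       = ennreal (\<Sum>i<n. h i * (norm (\<zeta> i \<omega>))\<^sup>2)" if "is_simple_proc M F (n, p, \<zeta>)" for \<zeta> :: "nat \<Rightarrow> 'w \<Rightarrow> real^'m^'r" and \<omega>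
    proof -
      have "(\<Sum>i<n. ennreal (h i * (norm (\<zeta> i \<omega>))\<^sup>2)) = ennreal (\<Sum>i<n. h i * (norm (\<zeta> i \<omega>))\<^sup>2)"
        by (rule sum_ennreal) (use h in auto)
      thus ?thesis using nn_integral_simple_val_power[OF that, of 2 0 t \<omega>] t by (simp add: h_def)
    qed
    have bnd: "(\<Sum>i<j. h i * (norm (\<xi>' i \<omega>))\<^sup>2) \<le> \<delta>" if "j \<le> n" for j \<omega>
      using that
    proof (induction j)
      case (Suc j)
      show ?case
      proof (cases "q j \<omega> \<le> \<delta>")
        case True
        have "(\<Sum>i<Suc j. h i * (norm (\<xi>' i \<omega>))\<^sup>2) \<le> q j \<omega>"
          unfolding q_def by (rule sum_mono) (use Suc.prems h in \<open>auto simp: \<xi>'_def\<close>)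
        thus ?thesis using True by simp
      next
        case False
        thus ?thesis using Suc by (simp add: \<xi>'_def)
      qed
    qed (use pos in simp)
    let ?J = "simple_ito W (n, p, \<xi>') t"
    have [measurable]: "?J \<in> borel_measurable M" "simple_ito W Hs t \<in> borel_measurable M"
      by (rule simple_ito_random_variable[OF sp'] simple_ito_random_variable[OF sp0], use t in simp)+
    \<comment> \<open>The partition estimate with the single block \<open>[0, t]\<close>, identity
      matrix and certain event.\<close>
    have "(\<integral>\<^sup>+\<omega>. ennreal ((norm (?J \<omega>))\<^sup>2) \<partial>M) \<le> ennreal c * (\<integral>\<^sup>+\<omega>. indicator (space M) \<omega> * (\<integral>\<^sup>+r\<in>{0<..t}. ennreal (norm (simple_val (n, p, \<xi>') r \<omega>) ^ 2) \<partial>lborel) \<partial>M)"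
      using part[OF sp', of 1 "\<lambda>j. if j = 0 then 0 else t" "\<lambda>_. mat 1" "\<lambda>_. space M"] t
        sets.top[of "F 0"] space_F[of 0]
      by (simp add: simple_ito_0[OF sp'] cong: nn_integral_cong_simp)
    also have "\<dots> \<le> ennreal c * (\<integral>\<^sup>+\<omega>. ennreal \<delta> \<partial>M)"
      unfolding int[OF sp'] using bnd[of n]
      by (intro mult_left_mono nn_integral_mono) (auto split: split_indicator intro!: ennreal_leI)
    also have "\<dots> = ennreal (c * \<delta>)" using c pos by (simp add: emeasure_space_1 ennreal_mult)
    finally have mom: "(\<integral>\<^sup>+\<omega>. ennreal ((norm (?J \<omega>))\<^sup>2) \<partial>M) \<le> ennreal (c * \<delta>)" .
    let ?B = "{\<omega> \<in> space M. norm (?J \<omega>) > \<epsilon>}"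
    have "emeasure M ?B \<le> emeasure M {\<omega> \<in> space M. 1 \<le> ennreal (1 / \<epsilon>\<^sup>2) * ennreal ((norm (?J \<omega>))\<^sup>2)}"
    proof (rule emeasure_mono)
      show "?B \<subseteq> {\<omega> \<in> space M. 1 \<le> ennreal (1 / \<epsilon>\<^sup>2) * ennreal ((norm (?J \<omega>))\<^sup>2)}"
      proof safe
        fix \<omega> assume "norm (?J \<omega>) > \<epsilon>"
        hence "\<epsilon>\<^sup>2 \<le> (norm (?J \<omega>))\<^sup>2" using pos by (intro power_mono) auto
        hence "1 \<le> 1 / \<epsilon>\<^sup>2 * (norm (?J \<omega>))\<^sup>2" using pos by (simp add: field_simps)
        thus "1 \<le> ennreal (1 / \<epsilon>\<^sup>2) * ennreal ((norm (?J \<omega>))\<^sup>2)"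
          using pos by (simp add: ennreal_mult[symmetric])
      qed
    qed measurable
    also have "\<dots> \<le> ennreal (1 / \<epsilon>\<^sup>2) * (\<integral>\<^sup>+\<omega>. ennreal ((norm (?J \<omega>))\<^sup>2) * indicator (space M) \<omega> \<partial>M)"
      by (rule nn_integral_Markov_inequality) auto
    also have "\<dots> \<le> ennreal (1 / \<epsilon>\<^sup>2) * ennreal (c * \<delta>)"
      using mom by (intro mult_left_mono) (auto cong: nn_integral_cong_simp simp: indicator_def)
    also have "\<dots> = ennreal (c * \<delta> / \<epsilon>\<^sup>2)" using c pos by (simp add: ennreal_mult[symmetric])
    finally have B: "measure M ?B \<le> c * \<delta> / \<epsilon>\<^sup>2"
      using c pos by (simp add: emeasure_eq_measure)
    let ?D = "{\<omega> \<in> space M. \<omega> \<in> G \<and> ennreal \<delta> < (\<integral>\<^sup>+r\<in>{0<..t}. ennreal ((norm (simple_val Hs r \<omega>))\<^sup>2) \<partial>lborel)}"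
    have Dm[measurable]: "?D \<in> sets M"
    proof -
      have "{\<omega> \<in> space M. \<omega> \<in> G \<and> ennreal \<delta> < ennreal (\<Sum>i<n. h i * (norm (\<xi> i \<omega>))\<^sup>2)} \<in> sets M"
      proof -
        have "\<xi> i \<in> borel_measurable M" if "i < n" for i
          by (rule measurable_F[OF \<xi>m[of i i]]) (use is_simple_proc_times(2)[OF sp, of i] that in auto)
        hence [measurable]: "(\<lambda>\<omega>. \<Sum>i<n. h i * (norm (\<xi> i \<omega>))\<^sup>2) \<in> borel_measurable M"
          by (intro borel_measurable_sum borel_measurable_times borel_measurable_power borel_measurable_norm) auto
        show ?thesis by measurable
      qed
      thus ?thesis unfolding Hs int[OF sp] .
    qed
    \<comment> \<open>Off \<open>?D\<close> the stopping is never triggered, so on \<open>G\<close>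
      the stopped and the original integral agree there.\<close>
    have "{\<omega> \<in> space M. \<omega> \<in> G \<and> norm (simple_ito W Hs t \<omega>) > \<epsilon>} \<subseteq> ?D \<union> ?B"
    proof safe
      fix \<omega> assume \<omega>: "\<omega> \<in> space M" "\<omega> \<in> G" "norm (simple_ito W Hs t \<omega>) > \<epsilon>" "\<not> \<epsilon> < norm (?J \<omega>)"
      show "ennreal \<delta> < (\<integral>\<^sup>+r\<in>{0<..t}. ennreal ((norm (simple_val Hs r \<omega>))\<^sup>2) \<partial>lborel)"
      proof (rule ccontr)
        assume "\<not> ?thesis"
        hence "(\<Sum>i<n. h i * (norm (\<xi> i \<omega>))\<^sup>2) \<le> \<delta>"
          unfolding Hs int[OF sp] using pos by (simp add: not_less ennreal_le_iff)
        moreover have "q i \<omega> \<le> (\<Sum>i<n. h i * (norm (\<xi> i \<omega>))\<^sup>2)" if "i < n" for i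
          unfolding q_def by (rule sum_mono2) (use that h in auto)
        ultimately have "\<xi>' i \<omega> = \<xi> i \<omega>" if "i < n" for i using that by (fastforce simp: \<xi>'_def)
        hence "?J \<omega> = simple_ito W Hs t \<omega>" unfolding Hs simple_ito_def by auto
        thus False using \<omega> by simp
      qed
    qed
    hence "measure M {\<omega> \<in> space M. \<omega> \<in> G \<and> norm (simple_ito W Hs t \<omega>) > \<epsilon>} \<le> measure M (?D \<union> ?B)"
      by (intro finite_measure_mono) auto
    also have "\<dots> \<le> measure M ?D + measure M ?B" by (intro measure_subadditive) (auto simp: emeasure_eq_measure)
    finally show ?thesis using B by simp
  qed
  thus ?thesis using c by blast
qed

end

section \<open>Moments of stopped Ito integrals\<close>

text \<open>Radial retraction onto the ball of radius \<open>K\<close>. It fixes 0, hence applying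
  it to the coefficients of a simple process applies it to the value at every time.\<close>

definition clip :: "real \<Rightarrow> 'a::real_normed_vector \<Rightarrow> 'a"
  where "clip K x = (if norm x \<le> K then x else (K / norm x) *\<^sub>R x)"

lemma norm_clip: "0 \<le> K \<Longrightarrow> norm (clip K x) = min K (norm x)"
  by (auto simp: clip_def)

lemma clip_0 [simp]: "0 \<le> K \<Longrightarrow> clip K 0 = 0"
  by (simp add: clip_def)

lemma norm_diff_clip: "0 \<le> K \<Longrightarrow> norm (x - clip K x) = max 0 (norm x - K)"
proof (cases "norm x \<le> K")
  case False
  assume "0 \<le> K"
  have "x - clip K x = (1 - K / norm x) *\<^sub>R x" using False by (simp add: clip_def algebra_simps)
  hence "norm (x - clip K x) = \<bar>1 - K / norm x\<bar> * norm x" by simp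
  also have "\<bar>1 - K / norm x\<bar> = 1 - K / norm x"
  proof -
    have "norm x > 0" "K \<le> norm x" using False \<open>0 \<le> K\<close> by linarith+
    hence "K / norm x \<le> 1" by (simp add: divide_le_eq)
    thus ?thesis by simp
  qed
  also have "\<dots> * norm x = norm x - K" using False \<open>0 \<le> K\<close> by (auto simp: left_diff_distrib)
  finally show ?thesis using False by simp
qed (simp add: clip_def)

lemma clip_measurable[measurable]: "clip K \<in> borel_measurable (borel :: 'a::euclidean_space measure)"
  unfolding clip_def by measurable

definition map_simple :: "('b \<Rightarrow> 'c) \<Rightarrow> ('w, 'b) simple_proc \<Rightarrow> ('w, 'c) simple_proc"
  where "map_simple g = (\<lambda>(n, p, \<xi>). (n, p, \<lambda>i \<omega>. g (\<xi> i \<omega>)))"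

lemma simple_val_map_simple:
  fixes Hs :: "('w, 'b::real_normed_vector) simple_proc" and g :: "'b \<Rightarrow> 'b"
  assumes sp0: "is_simple_proc M F Hs" and g: "g 0 = 0"
  shows "simple_val (map_simple g Hs) r \<omega> = g (simple_val Hs r \<omega>)"
proof -
  obtain n p \<xi> where Hs: "Hs = (n, p, \<xi>)" by (cases Hs)
  note sp = sp0[unfolded Hs]
  show ?thesis
  proof (cases "\<exists>i<n. r \<in> {p i<..p (Suc i)}")
    case True
    then obtain i where i: "i < n" "r \<in> {p i<..p (Suc i)}" by blast
    have other: "indicator {p j<..p (Suc j)} r = (0::real)" if "j < n" "j \<noteq> i" for j
    proof -
      have "p (Suc j) \<le> p i \<or> p (Suc i) \<le> p j"
        using is_simple_proc_times(1)[OF sp, of "Suc j" i] is_simple_proc_times(1)[OF sp, of "Suc i" j] that i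
        by (cases "j < i") auto
      thus ?thesis using i by (auto simp: indicator_def)
    qed
    have "(\<Sum>j<n. indicator {p j<..p (Suc j)} r *\<^sub>R f j) = f i" for f :: "nat \<Rightarrow> 'b"
      using i other by (subst sum.remove[of _ i]) (auto intro!: sum.neutral)
    thus ?thesis by (simp add: Hs map_simple_def simple_val_def del: indicator_simps)
  next
    case False
    hence "indicator {p j<..p (Suc j)} r = (0::real)" if "j < n" for j using that by (auto simp: indicator_def)
    hence "(\<Sum>j<n. indicator {p j<..p (Suc j)} r *\<^sub>R f j) = 0" for f :: "nat \<Rightarrow> 'b"
      by (intro sum.neutral) simp
    thus ?thesis using g by (simp add: Hs map_simple_def simple_val_def)
  qed
qed

lemma simple_ito_map_simple_diff:
  "simple_ito W (map_simple (\<lambda>x. x - g x) Hs) t \<omega> = simple_ito W Hs t \<omega> - simple_ito W (map_simple g Hs) t \<omega>"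
  by (cases Hs) (simp add: map_simple_def simple_ito_def matrix_vector_mult_diff_rdistrib sum_subtractf)

lemma ennreal_tendsto_0I:
  assumes "\<And>e::real. e > 0 \<Longrightarrow> \<forall>\<^sub>F n in F. f n \<le> ennreal e"
  shows "(f \<longlongrightarrow> 0) F"
proof (rule order_tendstoI)
  fix a :: ennreal assume "0 < a"
  then obtain b where b: "0 < b" "b < a" using dense by blast
  then obtain e where e: "b = ennreal e" "e > 0" by (cases b) auto
  show "\<forall>\<^sub>F n in F. f n < a" using assms[OF e(2)] by eventually_elim (use b e in auto)
qed simp

lemma (in finite_measure) measure_tendsto_0_UN:
  assumes "finite J" and lim: "\<And>j. j \<in> J \<Longrightarrow> (\<lambda>n. measure M (B j n)) \<longlonglongrightarrow> 0"
    and B: "\<And>j n. j \<in> J \<Longrightarrow> B j n \<in> sets M" and sub: "\<And>n. C n \<subseteq> (\<Union>j\<in>J. B j n)"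
  shows "(\<lambda>n. measure M (C n)) \<longlonglongrightarrow> 0"
proof (rule tendsto_sandwich[OF _ _ tendsto_const])
  show "(\<lambda>n. \<Sum>j\<in>J. measure M (B j n)) \<longlonglongrightarrow> 0"
    by (rule tendsto_null_sum) (use lim in auto)
  show "\<forall>\<^sub>F n in sequentially. measure M (C n) \<le> (\<Sum>j\<in>J. measure M (B j n))"
  proof (intro always_eventually allI)
    fix n
    have "measure M (C n) \<le> measure M (\<Union>j\<in>J. B j n)"
      by (rule finite_measure_mono[OF sub]) (use assms in auto)
    also have "\<dots> \<le> (\<Sum>j\<in>J. measure M (B j n))"
      by (rule finite_measure_subadditive_finite) (use assms in auto)
    finally show "measure M (C n) \<le> (\<Sum>j\<in>J. measure M (B j n))" .
  qed
qed auto

section \<open>From simple integrands to Ito integrals\<close>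

context brownian_motion
begin

lemma is_simple_proc_map_simple:
  fixes Hs :: "('w, real ^ 'm ^ 'r) simple_proc"
  assumes "is_simple_proc M F Hs" "g \<in> borel_measurable borel" "\<And>x. norm (g x) \<le> norm x"
  shows "is_simple_proc M F (map_simple g Hs)"
  using is_simple_proc_map[of "fst Hs" "fst (snd Hs)" "snd (snd Hs)" g] assms
  by (cases Hs) (auto simp: map_simple_def)

lemma simple_val_measurable_pair':
  fixes Hs :: "('w, real ^ 'm ^ 'r) simple_proc"
  assumes "is_simple_proc M F Hs" "f \<in> borel_measurable N" "g \<in> measurable N M"
  shows "(\<lambda>z. simple_val Hs (f z) (g z)) \<in> borel_measurable N"
  using simple_val_measurable_pair[of "fst Hs" "fst (snd Hs)" "snd (snd Hs)" f N g] assms by simp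

text \<open>The approximation error in \<open>is_ito_integral\<close> is a Bochner integral, whose
  value would be 0 for a non-integrable function. Square integrability of the path rules this out,
  so the error may be used as a genuine L2 distance.\<close>

lemma simple_approx_error_eq:
  fixes Hs :: "('w, real ^ 'm ^ 'r) simple_proc"
  assumes sp0: "is_simple_proc M F Hs" and T: "0 \<le> T" and \<omega>: "\<omega> \<in> space M"
    and H: "(\<lambda>t. H t \<omega>) \<in> borel_measurable borel"
    and int: "set_integrable lborel {0..T} (\<lambda>t. (norm (H t \<omega>))\<^sup>2)"
  shows "(\<integral>\<^sup>+t\<in>{0..T}. ennreal ((norm (simple_val Hs t \<omega> - H t \<omega>))\<^sup>2) \<partial>lborel)
    = ennreal (LINT t:{0..T}|lborel. (norm (simple_val Hs t \<omega> - H t \<omega>))\<^sup>2)"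
proof -
  obtain n p \<xi> where Hs: "Hs = (n, p, \<xi>)" by (cases Hs)
  note sp = sp0[unfolded Hs]
  have [measurable]: "(\<lambda>t. simple_val Hs t \<omega>) \<in> borel_measurable lborel"
    by (rule simple_val_measurable_pair'[OF sp0]) (use \<omega> in auto)
  have [measurable]: "(\<lambda>t. H t \<omega>) \<in> borel_measurable lborel" using H by simp
  have 1: "integrable lborel (\<lambda>t. (norm (simple_val Hs t \<omega>))\<^sup>2)"
  proof -
    have eq: "(\<lambda>t. (norm (simple_val Hs t \<omega>))\<^sup>2) = (\<lambda>t. \<Sum>i<n. indicator {p i<..p (Suc i)} t * (norm (\<xi> i \<omega>))\<^sup>2)"
      unfolding Hs by (rule ext, rule norm_simple_val_power[OF sp]) simp
    show ?thesis unfolding eq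
    by (intro Bochner_Integration.integrable_sum integrable_mult_left integrable_real_indicator)
      (use sp in \<open>auto simp: is_simple_proc_def\<close>)
  qed
  have "integrable lborel (\<lambda>t. indicator {0..T} t * (norm (simple_val Hs t \<omega> - H t \<omega>))\<^sup>2)"
  proof (rule Bochner_Integration.integrable_bound)
    show "integrable lborel (\<lambda>t. 2 * (norm (simple_val Hs t \<omega>))\<^sup>2 + 2 * (indicator {0..T} t *\<^sub>R (norm (H t \<omega>))\<^sup>2))"
      using 1 int unfolding set_integrable_def by auto
    show "AE t in lborel. norm (indicator {0..T} t * (norm (simple_val Hs t \<omega> - H t \<omega>))\<^sup>2)
       \<le> norm (2 * (norm (simple_val Hs t \<omega>))\<^sup>2 + 2 * (indicator {0..T} t *\<^sub>R (norm (H t \<omega>))\<^sup>2))"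
    proof (intro AE_I2)
      fix t
      have "(norm (simple_val Hs t \<omega> - H t \<omega>))\<^sup>2 \<le> (norm (simple_val Hs t \<omega>) + norm (H t \<omega>))\<^sup>2"
        by (intro power_mono norm_triangle_ineq4) auto
      also have "\<dots> \<le> 2 * (norm (simple_val Hs t \<omega>))\<^sup>2 + 2 * (norm (H t \<omega>))\<^sup>2"
        using sum_squares_bound[of "norm (simple_val Hs t \<omega>)" "norm (H t \<omega>)"] by (simp add: power2_sum)
      finally show "norm (indicator {0..T} t * (norm (simple_val Hs t \<omega> - H t \<omega>))\<^sup>2)
       \<le> norm (2 * (norm (simple_val Hs t \<omega>))\<^sup>2 + 2 * (indicator {0..T} t *\<^sub>R (norm (H t \<omega>))\<^sup>2))"
        by (auto simp: indicator_def)
    qed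
  qed measurable
  from nn_integral_eq_integral[OF this] show ?thesis
    by (simp add: set_lebesgue_integral_def ennreal_mult' ennreal_indicator[symmetric] mult.commute)
qed

text \<open>The approximating simple processes are clipped at \<open>K\<close>. Up to
  \<open>\<tau>\<close> the integrand is below \<open>K\<close>, so the part cut off is dominated by
  the approximation error, and by the Lenglart-type bound its integral vanishes in probability on
  the event \<open>u N \<le> \<tau>\<close>. There the clipped integrals still converge to
  \<open>I\<close>. They obey \<open>simple_ito_partition_moment\<close>; Fatou's lemma finishes. On
  the right the stopping event is read at the left end of each block, the only place where it is
  measurable enough.\<close>

lemma ito_moment_stopped:
  assumes k: "k \<ge> 1"
  shows "\<exists>c\<ge>0. \<forall>T (H :: real \<Rightarrow> 'w \<Rightarrow> real ^ 'm ^ 'r) I \<tau> K N u (A :: nat \<Rightarrow> real ^ 'r ^ 'q).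
    is_ito_integral M F W T H I \<longrightarrow> (\<lambda>z. H (fst z) (snd z)) \<in> borel_measurable (borel \<Otimes>\<^sub>M M) \<longrightarrow>
    \<tau> \<in> borel_measurable M \<longrightarrow> (\<forall>s\<in>{0..T}. {\<omega> \<in> space M. s \<le> \<tau> \<omega>} \<in> sets (F s)) \<longrightarrow>
    (AE \<omega> in M. \<forall>r\<in>{0<..T}. r \<le> \<tau> \<omega> \<longrightarrow> norm (H r \<omega>) \<le> K) \<longrightarrow> 0 \<le> K \<longrightarrow>
    (\<forall>j<N. u j \<le> u (Suc j)) \<longrightarrow> 0 \<le> u 0 \<longrightarrow> u 0 < u N \<longrightarrow> u N \<le> T \<longrightarrow>
    (\<forall>j<N. \<forall>v. norm (A j *v v) \<le> norm v) \<longrightarrow>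
    (\<integral>\<^sup>+\<omega>. indicator {\<omega> \<in> space M. u N \<le> \<tau> \<omega>} \<omega> *
        ennreal (norm (\<Sum>j<N. A j *v (I (u (Suc j)) \<omega> - I (u j) \<omega>)) ^ (2 * k)) \<partial>M)
      \<le> ennreal (c * (u N - u 0) ^ (k - 1)) * (\<Sum>j<N.
          \<integral>\<^sup>+\<omega>. indicator {\<omega> \<in> space M. u j \<le> \<tau> \<omega>} \<omega> *
            (\<integral>\<^sup>+r\<in>{u j<..u (Suc j)}. ennreal (min K (norm (H r \<omega>)) ^ (2 * k)) \<partial>lborel) \<partial>M)"
proof -
  obtain c where c: "c \<ge> 0" and part: "\<And>(Hs :: ('w, real ^ 'm ^ 'r) simple_proc) N u (A :: nat \<Rightarrow> real ^ 'r ^ 'q) G.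
    is_simple_proc M F Hs \<Longrightarrow> (\<forall>j<N. u j \<le> u (Suc j)) \<Longrightarrow> 0 \<le> u 0 \<Longrightarrow> u 0 < u N \<Longrightarrow>
    (\<forall>j<N. \<forall>v. norm (A j *v v) \<le> norm v) \<Longrightarrow> (\<forall>j<N. G j \<in> sets (F (u j))) \<Longrightarrow>
    (\<integral>\<^sup>+\<omega>. ennreal (norm (\<Sum>j<N. indicator (G j) \<omega> *\<^sub>R
        (A j *v (simple_ito W Hs (u (Suc j)) \<omega> - simple_ito W Hs (u j) \<omega>))) ^ (2 * k)) \<partial>M)
      \<le> ennreal (c * (u N - u 0) ^ (k - 1)) * (\<Sum>j<N.
          \<integral>\<^sup>+\<omega>. indicator (G j) \<omega> * (\<integral>\<^sup>+r\<in>{u j<..u (Suc j)}. ennreal (norm (simple_val Hs r \<omega>) ^ (2 * k)) \<partial>lborel) \<partial>M)"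
    using simple_ito_partition_moment[OF k, where 'q='q and 'r='r] by blast
  obtain c1 where c1: "c1 \<ge> 0" and leng: "\<And>(Hs :: ('w, real ^ 'm ^ 'r) simple_proc) t G \<delta> \<epsilon>.
    is_simple_proc M F Hs \<Longrightarrow> 0 < t \<Longrightarrow> G \<in> sets M \<Longrightarrow> 0 < \<delta> \<Longrightarrow> 0 < \<epsilon> \<Longrightarrow>
    measure M {\<omega> \<in> space M. \<omega> \<in> G \<and> norm (simple_ito W Hs t \<omega>) > \<epsilon>}
      \<le> measure M {\<omega> \<in> space M. \<omega> \<in> G \<and> ennreal \<delta> < (\<integral>\<^sup>+r\<in>{0<..t}. ennreal ((norm (simple_val Hs r \<omega>))\<^sup>2) \<partial>lborel)}
        + c1 * \<delta> / \<epsilon>\<^sup>2"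
    using simple_ito_prob_bound[where 'r='r] by blast
  have "(\<integral>\<^sup>+\<omega>. indicator {\<omega> \<in> space M. u N \<le> \<tau> \<omega>} \<omega> *
        ennreal (norm (\<Sum>j<N. A j *v (I (u (Suc j)) \<omega> - I (u j) \<omega>)) ^ (2 * k)) \<partial>M)
      \<le> ennreal (c * (u N - u 0) ^ (k - 1)) * (\<Sum>j<N.
          \<integral>\<^sup>+\<omega>. indicator {\<omega> \<in> space M. u j \<le> \<tau> \<omega>} \<omega> *
            (\<integral>\<^sup>+r\<in>{u j<..u (Suc j)}. ennreal (min K (norm (H r \<omega>)) ^ (2 * k)) \<partial>lborel) \<partial>M)"
    if ito: "is_ito_integral M F W T H I" and Hjm: "(\<lambda>z. H (fst z) (snd z)) \<in> borel_measurable (borel \<Otimes>\<^sub>M M)"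
      and \<tau>[measurable]: "\<tau> \<in> borel_measurable M" and st: "\<forall>s\<in>{0..T}. {\<omega> \<in> space M. s \<le> \<tau> \<omega>} \<in> sets (F s)"
      and HK: "AE \<omega> in M. \<forall>r\<in>{0<..T}. r \<le> \<tau> \<omega> \<longrightarrow> norm (H r \<omega>) \<le> K" and K: "0 \<le> K"
      and u: "\<forall>j<N. u j \<le> u (Suc j)" "0 \<le> u 0" "u 0 < u N" "u N \<le> T"
      and A: "\<forall>j<N. \<forall>v. norm (A j *v v) \<le> norm v"
    for T and H :: "real \<Rightarrow> 'w \<Rightarrow> real ^ 'm ^ 'r" and I \<tau> K N u and A :: "nat \<Rightarrow> real ^ 'r ^ 'q"
  proof -
    have um: "u i \<le> u j" if "i \<le> j" "j \<le> N" for i j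
      using that
    proof (induction j rule: dec_induct)
      case (step m)
      thus ?case using u(1)[rule_format, of m] by auto
    qed simp
    have uT: "u j \<in> {0..T}" if "j \<le> N" for j using um[of 0 j] um[of j N] that u by auto
    have T: "T > 0" using u by simp
    have Hm: "(\<lambda>z. H (f z) (g z)) \<in> borel_measurable N" if "f \<in> borel_measurable N" "g \<in> measurable N M"
      for f g and N :: "'z measure"
      using measurable_compose[OF measurable_Pair[OF that] Hjm] by simp
    obtain Hs where sp: "\<And>n. is_simple_proc M F (Hs n)"
      and cq: "conv_in_prob M (\<lambda>n \<omega>. LINT t:{0..T}|lborel. (norm (simple_val (Hs n) t \<omega> - H t \<omega>))\<^sup>2) (\<lambda>_. 0)"
      and cI: "\<And>t. t \<in> {0..T} \<Longrightarrow> conv_in_prob M (\<lambda>n. simple_ito W (Hs n) t) (I t)"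
      using ito unfolding is_ito_integral_def by blast
    have Im: "I t \<in> borel_measurable M" if "t \<in> {0..T}" for t
      using cI[OF that] by (auto simp: conv_in_prob_def)
    define Q where "Q n \<omega> = (LINT t:{0..T}|lborel. (norm (simple_val (Hs n) t \<omega> - H t \<omega>))\<^sup>2)" for n \<omega>
    have Qm[measurable]: "Q n \<in> borel_measurable M" for n using cq by (auto simp: conv_in_prob_def Q_def[abs_def])
    have Q0: "Q n \<omega> \<ge> 0" for n \<omega> unfolding Q_def set_lebesgue_integral_def by (rule Bochner_Integration.integral_nonneg) auto
    have Qlim: "(\<lambda>n. measure M {\<omega> \<in> space M. \<delta> < Q n \<omega>}) \<longlonglongrightarrow> 0" if "\<delta> > 0" for \<delta>
      using cq that Q0 unfolding conv_in_prob_def Q_def by (simp add: dist_real_def abs_of_nonneg)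
    have Qeq: "AE \<omega> in M. \<forall>n. (\<integral>\<^sup>+t\<in>{0..T}. ennreal ((norm (simple_val (Hs n) t \<omega> - H t \<omega>))\<^sup>2) \<partial>lborel) = ennreal (Q n \<omega>)"
    proof -
      have "AE \<omega> in M. set_integrable lborel {0..T} (\<lambda>t. (norm (H t \<omega>))\<^sup>2)"
        using ito unfolding is_ito_integral_def by auto
      thus ?thesis using AE_space
      proof eventually_elim
        case (elim \<omega>)
        have "(\<lambda>t. H t \<omega>) \<in> borel_measurable borel" by (rule Hm) (use elim in auto)
        from simple_approx_error_eq[where H=H, OF sp less_imp_le[OF T] elim(2) this elim(1)]
        show ?case unfolding Q_def by simp
      qed
    qed
    define G where "G j = {\<omega> \<in> space M. u j \<le> \<tau> \<omega>}" for j
    have GF: "G j \<in> sets (F (u j))" if "j \<le> N" for j using st uT[OF that] by (simp add: G_def)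
    have Gm[measurable]: "G j \<in> sets M" for j unfolding G_def by measurable
    define C where "C n = map_simple (clip K) (Hs n)" for n
    define D where "D n = map_simple (\<lambda>x. x - clip K x) (Hs n)" for n
    have spC: "is_simple_proc M F (C n)" for n
      unfolding C_def by (rule is_simple_proc_map_simple[OF sp]) (use K in \<open>auto simp: norm_clip\<close>)
    have spD: "is_simple_proc M F (D n)" for n
      unfolding D_def by (rule is_simple_proc_map_simple[OF sp]) (use K in \<open>auto simp: norm_diff_clip\<close>)
    have vC: "norm (simple_val (C n) r \<omega>) = min K (norm (simple_val (Hs n) r \<omega>))" for n r \<omega>
      unfolding C_def by (subst simple_val_map_simple[OF sp]) (use K in \<open>auto simp: norm_clip\<close>)
    have vD: "norm (simple_val (D n) r \<omega>) = max 0 (norm (simple_val (Hs n) r \<omega>) - K)" for n r \<omega>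
      unfolding D_def by (subst simple_val_map_simple[OF sp]) (use K in \<open>auto simp: norm_diff_clip\<close>)
    have jD: "simple_ito W (D n) t \<omega> = simple_ito W (Hs n) t \<omega> - simple_ito W (C n) t \<omega>" for n t \<omega>
      unfolding C_def D_def by (rule simple_ito_map_simple_diff)
    have jm: "simple_ito W (C n) t \<in> borel_measurable M" "simple_ito W (D n) t \<in> borel_measurable M"
      "simple_ito W (Hs n) t \<in> borel_measurable M" if "t \<in> {0..T}" for n t
      using simple_ito_random_variable[OF spC] simple_ito_random_variable[OF spD] simple_ito_random_variable[OF sp] that by auto
    \<comment> \<open>The part cut off by clipping does not contribute in the limit, as long as
      \<open>\<tau>\<close> has not been passed.\<close>
    have limD: "(\<lambda>n. measure M {\<omega> \<in> space M. \<omega> \<in> G N \<and> norm (simple_ito W (D n) (u j) \<omega>) > \<epsilon>}) \<longlonglongrightarrow> 0"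
      if j: "j \<le> N" and \<epsilon>: "\<epsilon> > 0" for j \<epsilon>
    proof (cases "u j = 0")
      case True
      thus ?thesis using \<epsilon> by (simp add: simple_ito_0[OF spD])
    next
      case False
      hence uj: "u j > 0" "u j \<le> T" using uT[OF j] by auto
      show ?thesis
      proof (rule LIMSEQ_I)
        fix \<eta> :: real assume \<eta>: "\<eta> > 0"
        \<comment> \<open>Adding 1 keeps the divisor positive when \<open>c1 = 0\<close>.\<close>
        define d where "d = c1 + 1"
        have d: "d > 0" "c1 \<le> d" using c1 by (auto simp: d_def)
        define \<delta> where "\<delta> = \<eta> * \<epsilon>\<^sup>2 / (2 * d)"
        have \<delta>: "\<delta> > 0" using \<eta> \<epsilon> d by (simp add: \<delta>_def)
        have "c1 * \<delta> / \<epsilon>\<^sup>2 \<le> d * \<delta> / \<epsilon>\<^sup>2" using d \<delta> by (intro divide_right_mono mult_right_mono) auto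
        also have "\<dots> = \<eta> / 2" using d \<epsilon> by (simp add: \<delta>_def field_simps)
        finally have c\<delta>: "c1 * \<delta> / \<epsilon>\<^sup>2 \<le> \<eta> / 2" .
        obtain n0 where n0: "\<And>n. n \<ge> n0 \<Longrightarrow> measure M {\<omega> \<in> space M. \<delta> < Q n \<omega>} < \<eta> / 2"
          using LIMSEQ_D[OF Qlim[OF \<delta>], of "\<eta> / 2"] \<eta> by auto
        show "\<exists>no. \<forall>n\<ge>no. norm (measure M {\<omega> \<in> space M. \<omega> \<in> G N \<and> norm (simple_ito W (D n) (u j) \<omega>) > \<epsilon>} - 0) < \<eta>"
        proof (intro exI[of _ n0] allI impI)
          fix n assume n: "n \<ge> n0"
          have "measure M {\<omega> \<in> space M. \<omega> \<in> G N \<and> ennreal \<delta> < (\<integral>\<^sup>+r\<in>{0<..u j}. ennreal ((norm (simple_val (D n) r \<omega>))\<^sup>2) \<partial>lborel)}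
             \<le> measure M {\<omega> \<in> space M. \<delta> < Q n \<omega>}"
          proof (rule finite_measure_mono_AE)
            show "AE \<omega> in M. \<omega> \<in> {\<omega> \<in> space M. \<omega> \<in> G N \<and> ennreal \<delta> < (\<integral>\<^sup>+r\<in>{0<..u j}. ennreal ((norm (simple_val (D n) r \<omega>))\<^sup>2) \<partial>lborel)}
               \<longrightarrow> \<omega> \<in> {\<omega> \<in> space M. \<delta> < Q n \<omega>}"
              using HK Qeq
            proof eventually_elim
              case (elim \<omega>)
              show ?case
              proof safe
                assume w: "\<omega> \<in> space M" "\<omega> \<in> G N"
                  and less: "ennreal \<delta> < (\<integral>\<^sup>+r\<in>{0<..u j}. ennreal ((norm (simple_val (D n) r \<omega>))\<^sup>2) \<partial>lborel)"
                have "(\<integral>\<^sup>+r\<in>{0<..u j}. ennreal ((norm (simple_val (D n) r \<omega>))\<^sup>2) \<partial>lborel)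
                   \<le> (\<integral>\<^sup>+r\<in>{0..T}. ennreal ((norm (simple_val (Hs n) r \<omega> - H r \<omega>))\<^sup>2) \<partial>lborel)"
                proof (rule nn_integral_mono)
                  fix r
                  show "ennreal ((norm (simple_val (D n) r \<omega>))\<^sup>2) * indicator {0<..u j} r
                    \<le> ennreal ((norm (simple_val (Hs n) r \<omega> - H r \<omega>))\<^sup>2) * indicator {0..T} r"
                  proof (cases "r \<in> {0<..u j}")
                    case True
                    hence "r \<le> \<tau> \<omega>" using w um[of j N] j by (auto simp: G_def)
                    hence "norm (H r \<omega>) \<le> K" using elim(1) True uj by auto
                    moreover have "norm (simple_val (Hs n) r \<omega>) \<le> norm (simple_val (Hs n) r \<omega> - H r \<omega>) + norm (H r \<omega>)"
                      using norm_triangle_ineq[of "simple_val (Hs n) r \<omega> - H r \<omega>" "H r \<omega>"] by simp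
                    \<comment> \<open>Since \<open>H\<close> stays below \<open>K\<close>, the
                      excess of the simple process over \<open>K\<close> is at most its distance to
                      \<open>H\<close>.\<close>
                    ultimately have "norm (simple_val (D n) r \<omega>) \<le> norm (simple_val (Hs n) r \<omega> - H r \<omega>)"
                      unfolding vD by auto
                    thus ?thesis using True uj by (auto intro!: ennreal_leI power_mono)
                  qed simp
                qed
                also have "\<dots> = ennreal (Q n \<omega>)" using elim(2) by (rule spec)
                finally have "ennreal \<delta> < ennreal (Q n \<omega>)" by (rule order_less_le_trans[OF less])
                thus "\<delta> < Q n \<omega>" using \<delta> by (simp add: ennreal_less_iff)
              qed
            qed
          qed measurable
          hence "measure M {\<omega> \<in> space M. \<omega> \<in> G N \<and> norm (simple_ito W (D n) (u j) \<omega>) > \<epsilon>} < \<eta>"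
            using leng[OF spD uj(1) Gm \<delta> \<epsilon>, of N n] c\<delta> n0[OF n] by linarith
          thus "norm (measure M {\<omega> \<in> space M. \<omega> \<in> G N \<and> norm (simple_ito W (D n) (u j) \<omega>) > \<epsilon>} - 0) < \<eta>" by simp
        qed
      qed
    qed
    have limC: "(\<lambda>n. measure M {\<omega> \<in> space M. \<omega> \<in> G N \<and> norm (simple_ito W (C n) (u j) \<omega> - I (u j) \<omega>) > \<epsilon>}) \<longlonglongrightarrow> 0"
      if j: "j \<le> N" and \<epsilon>: "\<epsilon> > 0" for j \<epsilon>
    proof -
      note [measurable] = jm[OF uT[OF j]] Im[OF uT[OF j]]
      let ?B = "\<lambda>b n. if b then {\<omega> \<in> space M. norm (simple_ito W (Hs n) (u j) \<omega> - I (u j) \<omega>) > \<epsilon> / 2}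
          else {\<omega> \<in> space M. \<omega> \<in> G N \<and> norm (simple_ito W (D n) (u j) \<omega>) > \<epsilon> / 2}"
      show ?thesis
      proof (rule measure_tendsto_0_UN[where J="UNIV :: bool set" and B="?B"])
        show "(\<lambda>n. measure M (?B b n)) \<longlonglongrightarrow> 0" for b
        proof -
          have \<epsilon>2: "\<epsilon> / 2 > 0" using \<epsilon> by simp
          have "(\<lambda>n. measure M {\<omega> \<in> space M. norm (simple_ito W (Hs n) (u j) \<omega> - I (u j) \<omega>) > \<epsilon> / 2}) \<longlonglongrightarrow> 0"
            using cI[OF uT[OF j]] \<epsilon>2 unfolding conv_in_prob_def dist_norm by blast
          thus ?thesis using limD[OF j \<epsilon>2] by (cases b) (simp_all only: if_True if_False)
        qed
        show "?B b n \<in> sets M" for b n by (cases b) (simp_all, measurable)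
        fix n
        show "{\<omega> \<in> space M. \<omega> \<in> G N \<and> norm (simple_ito W (C n) (u j) \<omega> - I (u j) \<omega>) > \<epsilon>} \<subseteq> (\<Union>b. ?B b n)"
        proof (rule subsetI)
          fix \<omega> assume w: "\<omega> \<in> {\<omega> \<in> space M. \<omega> \<in> G N \<and> norm (simple_ito W (C n) (u j) \<omega> - I (u j) \<omega>) > \<epsilon>}"
          have "simple_ito W (C n) (u j) \<omega> - I (u j) \<omega>
             = (simple_ito W (Hs n) (u j) \<omega> - I (u j) \<omega>) - simple_ito W (D n) (u j) \<omega>" unfolding jD by simp
          hence "norm (simple_ito W (C n) (u j) \<omega> - I (u j) \<omega>)
             \<le> norm (simple_ito W (Hs n) (u j) \<omega> - I (u j) \<omega>) + norm (simple_ito W (D n) (u j) \<omega>)"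
            by (metis norm_triangle_ineq4)
          hence "\<omega> \<in> ?B True n \<or> \<omega> \<in> ?B False n" using w by auto
          thus "\<omega> \<in> (\<Union>b. ?B b n)" by blast
        qed
      qed simp
    qed
    define Z where "Z \<omega> = (\<Sum>j<N. A j *v (I (u (Suc j)) \<omega> - I (u j) \<omega>))" for \<omega>
    \<comment> \<open>The indicators of \<open>G j\<close> are kept in the approximation because the
      moment bound on the right is localized with them; on \<open>G N\<close> all of them equal 1
      and \<open>Zn\<close> compares with \<open>Z\<close>.\<close>
    define Zn where "Zn n \<omega> = (\<Sum>j<N. indicator (G j) \<omega> *\<^sub>R
        (A j *v (simple_ito W (C n) (u (Suc j)) \<omega> - simple_ito W (C n) (u j) \<omega>)))" for n \<omega>
    have Zm: "Z \<in> borel_measurable M"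
      unfolding Z_def
      by (intro borel_measurable_sum borel_measurable_matrix_vector_mult borel_measurable_diff Im uT) auto
    have Znm: "Zn n \<in> borel_measurable M" for n
      unfolding Zn_def
      by (intro borel_measurable_sum borel_measurable_scaleR borel_measurable_indicator Gm
          borel_measurable_matrix_vector_mult borel_measurable_diff jm uT) auto
    have N: "N > 0" using u by (cases N) auto
    have limZ: "(\<lambda>n. measure M {\<omega> \<in> space M. \<omega> \<in> G N \<and> norm (Zn n \<omega> - Z \<omega>) > \<epsilon>}) \<longlonglongrightarrow> 0"
      if \<epsilon>: "\<epsilon> > 0" for \<epsilon>
    proof -
      \<comment> \<open>Each of the \<open>N\<close> increments carries the errors at its two
        endpoints.\<close>
      define \<epsilon>' where "\<epsilon>' = \<epsilon> / (2 * real N)"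
      have \<epsilon>': "\<epsilon>' > 0" using \<epsilon> N by (simp add: \<epsilon>'_def)
      let ?e = "\<lambda>n j \<omega>. norm (simple_ito W (C n) (u j) \<omega> - I (u j) \<omega>)"
      show ?thesis
      proof (rule measure_tendsto_0_UN[where J="{..N}" and B="\<lambda>j n. {\<omega> \<in> space M. \<omega> \<in> G N \<and> ?e n j \<omega> > \<epsilon>'}"])
        show "(\<lambda>n. measure M {\<omega> \<in> space M. \<omega> \<in> G N \<and> ?e n j \<omega> > \<epsilon>'}) \<longlonglongrightarrow> 0" if "j \<in> {..N}" for j
          using limC[of j, OF _ \<epsilon>'] that by simp
        show "{\<omega> \<in> space M. \<omega> \<in> G N \<and> ?e n j \<omega> > \<epsilon>'} \<in> sets M" if "j \<in> {..N}" for j n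
        proof -
          have "j \<le> N" using that by simp
          note [measurable] = jm[OF uT[OF this]] Im[OF uT[OF this]]
          show ?thesis by measurable
        qed
        fix n
        show "{\<omega> \<in> space M. \<omega> \<in> G N \<and> norm (Zn n \<omega> - Z \<omega>) > \<epsilon>} \<subseteq> (\<Union>j\<in>{..N}. {\<omega> \<in> space M. \<omega> \<in> G N \<and> ?e n j \<omega> > \<epsilon>'})"
        proof (rule subsetI, rule ccontr)
          fix \<omega> assume w: "\<omega> \<in> {\<omega> \<in> space M. \<omega> \<in> G N \<and> norm (Zn n \<omega> - Z \<omega>) > \<epsilon>}"
            and not: "\<omega> \<notin> (\<Union>j\<in>{..N}. {\<omega> \<in> space M. \<omega> \<in> G N \<and> ?e n j \<omega> > \<epsilon>'})"
          have small: "?e n j \<omega> \<le> \<epsilon>'" if "j \<le> N" for j using not w that by force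
          have ind: "indicator (G j) \<omega> = (1::real)" if "j < N" for j
            using w um[of j N] that by (auto simp: G_def)
          have "Zn n \<omega> - Z \<omega> = (\<Sum>j<N. A j *v ((simple_ito W (C n) (u (Suc j)) \<omega> - I (u (Suc j)) \<omega>) - (simple_ito W (C n) (u j) \<omega> - I (u j) \<omega>)))"
            unfolding Zn_def Z_def sum_subtractf[symmetric]
            by (intro sum.cong refl) (simp add: ind matrix_vector_mult_diff_distrib algebra_simps)
          also have "norm \<dots> \<le> (\<Sum>j<N. 2 * \<epsilon>')"
          proof (rule sum_norm_le)
            fix j assume j: "j \<in> {..<N}"
            have "norm (A j *v ((simple_ito W (C n) (u (Suc j)) \<omega> - I (u (Suc j)) \<omega>) - (simple_ito W (C n) (u j) \<omega> - I (u j) \<omega>)))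
              \<le> norm ((simple_ito W (C n) (u (Suc j)) \<omega> - I (u (Suc j)) \<omega>) - (simple_ito W (C n) (u j) \<omega> - I (u j) \<omega>))"
              using A j by blast
            also have "\<dots> \<le> ?e n (Suc j) \<omega> + ?e n j \<omega>" by (rule norm_triangle_ineq4)
            also have "\<dots> \<le> 2 * \<epsilon>'" using small[of "Suc j"] small[of j] j by simp
            finally show "norm (A j *v ((simple_ito W (C n) (u (Suc j)) \<omega> - I (u (Suc j)) \<omega>) - (simple_ito W (C n) (u j) \<omega> - I (u j) \<omega>))) \<le> 2 * \<epsilon>'" .
          qed
          also have "\<dots> = \<epsilon>" using N by (simp add: \<epsilon>'_def)
          finally show False using w by simp
        qed
      qed simp
    qed
    \<comment> \<open>The truncated power is bounded and Lipschitz on the nonnegative reals.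
      Therefore convergence of the integrands in probability suffices for convergence of the
      right-hand sides, which a plain power would not allow.\<close>
    define mm where "mm x = min K x ^ (2 * k)" for x
    define E where "E n = (\<integral>\<^sup>+\<omega>. (\<integral>\<^sup>+r\<in>{0..T}. ennreal \<bar>mm (norm (simple_val (Hs n) r \<omega>)) - mm (norm (H r \<omega>))\<bar> \<partial>lborel) \<partial>M)" for n
    define C0 where "C0 = real (2 * k) * K ^ (2 * k - 1)"
    have C0: "C0 \<ge> 0" using K by (simp add: C0_def)
    have mm0: "0 \<le> mm x" "mm x \<le> K ^ (2 * k)" if "0 \<le> x" for x
      using K that by (auto simp: mm_def intro!: power_mono)
    have mmd: "\<bar>mm x - mm y\<bar> \<le> C0 * \<bar>x - y\<bar>" if "0 \<le> x" "0 \<le> y" for x y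
    proof -
      have "\<bar>mm x - mm y\<bar> \<le> C0 * \<bar>min K x - min K y\<bar>"
        unfolding mm_def C0_def by (rule power_diff_abs_le) (use K that in auto)
      also have "\<dots> \<le> C0 * \<bar>x - y\<bar>" using C0 by (intro mult_left_mono) auto
      finally show ?thesis .
    qed
    have Elim: "E \<longlonglongrightarrow> 0"
    proof (rule ennreal_tendsto_0I)
      fix e :: real assume e: "e > 0"
      define d where "d = C0 * (T + 1) + 1"
      have den: "d > 0" "C0 * (T + 1) \<le> d" unfolding d_def using C0 T by (intro add_nonneg_pos; simp) simp
      define \<delta> where "\<delta> = e / (2 * d)"
      have \<delta>: "\<delta> > 0" using e den by (simp add: \<delta>_def)
      have "C0 * (T + 1) * \<delta> \<le> d * \<delta>" using \<delta> den by (intro mult_right_mono) auto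
      also have "\<dots> = e / 2" using den by (simp add: \<delta>_def)
      finally have 1: "C0 * (T + 1) * \<delta> \<le> e / 2" .
      have "(\<lambda>n. T * K ^ (2 * k) * measure M {\<omega> \<in> space M. \<delta>\<^sup>2 < Q n \<omega>}) \<longlonglongrightarrow> T * K ^ (2 * k) * 0"
        by (intro tendsto_intros Qlim) (use \<delta> in auto)
      hence "\<forall>\<^sub>F n in sequentially. T * K ^ (2 * k) * measure M {\<omega> \<in> space M. \<delta>\<^sup>2 < Q n \<omega>} < e / 2"
        by (rule order_tendstoD) (use e in auto)
      thus "\<forall>\<^sub>F n in sequentially. E n \<le> ennreal e"
      proof eventually_elim
        case (elim n)
        have TK: "0 \<le> T * K ^ (2 * k)" using T K by simp
        have "E n \<le> (\<integral>\<^sup>+\<omega>. ennreal (C0 * (T + 1) * \<delta>) + ennreal (T * K ^ (2 * k)) * indicator {\<omega> \<in> space M. \<delta>\<^sup>2 < Q n \<omega>} \<omega> \<partial>M)"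
          unfolding E_def
        proof (rule nn_integral_mono_AE, use Qeq AE_space in eventually_elim)
          fix \<omega> assume q: "\<forall>n. (\<integral>\<^sup>+t\<in>{0..T}. ennreal ((norm (simple_val (Hs n) t \<omega> - H t \<omega>))\<^sup>2) \<partial>lborel) = ennreal (Q n \<omega>)"
            and \<omega>: "\<omega> \<in> space M"
          have [measurable]: "(\<lambda>r. H r \<omega>) \<in> borel_measurable borel" by (rule Hm) (use \<omega> in auto)
          have [measurable]: "(\<lambda>r. simple_val (Hs n) r \<omega>) \<in> borel_measurable borel"
            by (rule simple_val_measurable_pair'[OF sp]) (use \<omega> in auto)
          let ?d = "\<lambda>r. \<bar>mm (norm (simple_val (Hs n) r \<omega>)) - mm (norm (H r \<omega>))\<bar>"
          show "(\<integral>\<^sup>+r\<in>{0..T}. ennreal (?d r) \<partial>lborel)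
             \<le> ennreal (C0 * (T + 1) * \<delta>) + ennreal (T * K ^ (2 * k)) * indicator {\<omega> \<in> space M. \<delta>\<^sup>2 < Q n \<omega>} \<omega>"
          \<comment> \<open>On the event of large error the trivial bound
            \<open>T * K ^ (2 * k)\<close> is used, and the probability of the event tends to 0;
            elsewhere the Lipschitz bound is small.\<close>
          proof (cases "\<delta>\<^sup>2 < Q n \<omega>")
            case True
            have "(\<integral>\<^sup>+r\<in>{0..T}. ennreal (?d r) \<partial>lborel) \<le> (\<integral>\<^sup>+r\<in>{0..T}. ennreal (K ^ (2 * k)) \<partial>lborel)"
            proof (intro nn_integral_mono mult_right_mono ennreal_leI)
              fix r
              show "?d r \<le> K ^ (2 * k)"
                using mm0[of "norm (simple_val (Hs n) r \<omega>)"] mm0[of "norm (H r \<omega>)"] by (simp add: abs_le_iff)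
            qed simp
            also have "\<dots> = ennreal (K ^ (2 * k)) * emeasure lborel {0..T}"
              by (rule nn_integral_cmult_indicator) simp
            also have "\<dots> = ennreal (T * K ^ (2 * k))"
              using T K by (simp add: ennreal_mult[symmetric] mult.commute)
            finally show ?thesis using True \<omega> by (simp add: add_increasing)
          next
            case False
            let ?\<Delta> = "\<lambda>r. norm (simple_val (Hs n) r \<omega> - H r \<omega>)"
            have "(\<integral>\<^sup>+r\<in>{0..T}. ennreal (?d r) \<partial>lborel)
               \<le> (\<integral>\<^sup>+r\<in>{0..T}. ennreal (C0 * \<delta>) + ennreal (C0 / \<delta>) * ennreal ((?\<Delta> r)\<^sup>2) \<partial>lborel)"
            proof (intro nn_integral_mono mult_right_mono)
              fix r
              have "?d r \<le> C0 * \<bar>norm (simple_val (Hs n) r \<omega>) - norm (H r \<omega>)\<bar>" by (rule mmd) auto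
              also have "\<dots> \<le> C0 * ?\<Delta> r" using C0 by (intro mult_left_mono norm_triangle_ineq3) auto
              \<comment> \<open>Trades the first power of the error for its square, which is the
                quantity that \<open>Q n\<close> controls.\<close>
              also have "?\<Delta> r \<le> \<delta> + (?\<Delta> r)\<^sup>2 / \<delta>"
              proof (cases "?\<Delta> r \<le> \<delta>")
                case False
                hence "?\<Delta> r * \<delta> \<le> (?\<Delta> r)\<^sup>2" using \<delta> by (simp add: power2_eq_square mult_left_mono)
                thus ?thesis using \<delta> by (simp add: pos_le_divide_eq add_increasing)
              qed (use \<delta> in \<open>auto simp: add_increasing2\<close>)
              finally have "?d r \<le> C0 * \<delta> + C0 / \<delta> * (?\<Delta> r)\<^sup>2"
                using C0 by (simp add: distrib_left mult_left_mono)
              thus "ennreal (?d r) \<le> ennreal (C0 * \<delta>) + ennreal (C0 / \<delta>) * ennreal ((?\<Delta> r)\<^sup>2)"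
                using C0 \<delta> by (simp add: ennreal_mult[symmetric] ennreal_plus[symmetric] ennreal_leI del: ennreal_plus)
            qed simp
            also have "\<dots> = ennreal (C0 * \<delta>) * ennreal T + ennreal (C0 / \<delta>) * (\<integral>\<^sup>+r\<in>{0..T}. ennreal ((?\<Delta> r)\<^sup>2) \<partial>lborel)"
            proof -
              have "(\<integral>\<^sup>+r\<in>{0..T}. ennreal (C0 * \<delta>) + ennreal (C0 / \<delta>) * ennreal ((?\<Delta> r)\<^sup>2) \<partial>lborel)
                = (\<integral>\<^sup>+r. ennreal (C0 * \<delta>) * indicator {0..T} r + ennreal (C0 / \<delta>) * (ennreal ((?\<Delta> r)\<^sup>2) * indicator {0..T} r) \<partial>lborel)"
                by (simp only: distrib_right mult.assoc)
              also have "\<dots> = (\<integral>\<^sup>+r. ennreal (C0 * \<delta>) * indicator {0..T} r \<partial>lborel)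
                 + (\<integral>\<^sup>+r. ennreal (C0 / \<delta>) * (ennreal ((?\<Delta> r)\<^sup>2) * indicator {0..T} r) \<partial>lborel)"
                by (rule nn_integral_add) auto
              also have "(\<integral>\<^sup>+r. ennreal (C0 * \<delta>) * indicator {0..T} r \<partial>lborel) = ennreal (C0 * \<delta>) * ennreal T"
                using T by (subst nn_integral_cmult_indicator) auto
              also have "(\<integral>\<^sup>+r. ennreal (C0 / \<delta>) * (ennreal ((?\<Delta> r)\<^sup>2) * indicator {0..T} r) \<partial>lborel)
                 = ennreal (C0 / \<delta>) * (\<integral>\<^sup>+r\<in>{0..T}. ennreal ((?\<Delta> r)\<^sup>2) \<partial>lborel)"
                by (rule nn_integral_cmult) auto
              finally show ?thesis .
            qed
            also have "\<dots> = ennreal (C0 * \<delta> * T + C0 / \<delta> * Q n \<omega>)"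
              using q C0 \<delta> T Q0 by (simp add: ennreal_mult[symmetric])
            also have "\<dots> \<le> ennreal (C0 * (T + 1) * \<delta>)"
            proof (rule ennreal_leI)
              have "C0 / \<delta> * Q n \<omega> \<le> C0 / \<delta> * \<delta>\<^sup>2" using False C0 \<delta> by (intro mult_left_mono) auto
              also have "\<dots> = C0 * \<delta>" using \<delta> by (simp add: power2_eq_square)
              finally show "C0 * \<delta> * T + C0 / \<delta> * Q n \<omega> \<le> C0 * (T + 1) * \<delta>" by (simp add: algebra_simps)
            qed
            finally show ?thesis using False by simp
          qed
        qed
        also have "\<dots> = ennreal (C0 * (T + 1) * \<delta>) + ennreal (T * K ^ (2 * k)) * emeasure M {\<omega> \<in> space M. \<delta>\<^sup>2 < Q n \<omega>}"
          by (subst nn_integral_add) (auto simp: nn_integral_cmult emeasure_space_1)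
        also have "\<dots> = ennreal (C0 * (T + 1) * \<delta> + T * K ^ (2 * k) * measure M {\<omega> \<in> space M. \<delta>\<^sup>2 < Q n \<omega>})"
          using TK C0 T \<delta> by (simp add: emeasure_eq_measure ennreal_mult[symmetric])
        also have "\<dots> \<le> ennreal e" using 1 elim by (intro ennreal_leI) simp
        finally show ?case .
      qed
    qed
    define X where "X = (\<Sum>j<N. \<integral>\<^sup>+\<omega>. indicator (G j) \<omega> * (\<integral>\<^sup>+r\<in>{u j<..u (Suc j)}. ennreal (mm (norm (H r \<omega>))) \<partial>lborel) \<partial>M)"
    define cL where "cL = ennreal (c * (u N - u 0) ^ (k - 1))"
    have meas[measurable]: "(\<lambda>z. H (snd z) (fst z)) \<in> borel_measurable (M \<Otimes>\<^sub>M lborel)"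
      "(\<lambda>z. simple_val (Hs n) (snd z) (fst z)) \<in> borel_measurable (M \<Otimes>\<^sub>M lborel)" for n
      by (rule Hm; simp) (rule simple_val_measurable_pair'[OF sp]; simp)
    have bound: "(\<integral>\<^sup>+\<omega>. ennreal (norm (Zn n \<omega>) ^ (2 * k)) \<partial>M) \<le> cL * X + cL * (of_nat N * E n)" for n
    proof -
      have "(\<integral>\<^sup>+\<omega>. ennreal (norm (Zn n \<omega>) ^ (2 * k)) \<partial>M) \<le> cL * (\<Sum>j<N.
          \<integral>\<^sup>+\<omega>. indicator (G j) \<omega> * (\<integral>\<^sup>+r\<in>{u j<..u (Suc j)}. ennreal (norm (simple_val (C n) r \<omega>) ^ (2 * k)) \<partial>lborel) \<partial>M)"
        unfolding Zn_def cL_def by (rule part[OF spC u(1-3) A]) (use GF in auto)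
      also have "\<dots> \<le> cL * (\<Sum>j<N. (\<integral>\<^sup>+\<omega>. indicator (G j) \<omega> * (\<integral>\<^sup>+r\<in>{u j<..u (Suc j)}. ennreal (mm (norm (H r \<omega>))) \<partial>lborel) \<partial>M) + E n)"
      proof (intro mult_left_mono sum_mono)
        fix j assume j: "j \<in> {..<N}"
        hence jT: "{u j<..u (Suc j)} \<subseteq> {0..T}" using uT[of j] uT[of "Suc j"] by auto
        let ?a = "\<lambda>\<omega> r. mm (norm (simple_val (Hs n) r \<omega>))" and ?b = "\<lambda>\<omega> r. mm (norm (H r \<omega>))"
        have mmm[measurable]: "mm \<in> borel_measurable borel" unfolding mm_def by measurable
        have "(\<integral>\<^sup>+\<omega>. indicator (G j) \<omega> * (\<integral>\<^sup>+r\<in>{u j<..u (Suc j)}. ennreal (norm (simple_val (C n) r \<omega>) ^ (2 * k)) \<partial>lborel) \<partial>M)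
          \<le> (\<integral>\<^sup>+\<omega>. indicator (G j) \<omega> * (\<integral>\<^sup>+r\<in>{u j<..u (Suc j)}. ennreal (?b \<omega> r) \<partial>lborel) + (\<integral>\<^sup>+r\<in>{0..T}. ennreal \<bar>?a \<omega> r - ?b \<omega> r\<bar> \<partial>lborel) \<partial>M)"
        proof (rule nn_integral_mono)
          fix \<omega> assume \<omega>: "\<omega> \<in> space M"
          have [measurable]: "(\<lambda>r. H r \<omega>) \<in> borel_measurable borel" by (rule Hm) (use \<omega> in auto)
          have [measurable]: "(\<lambda>r. simple_val (Hs n) r \<omega>) \<in> borel_measurable borel"
            by (rule simple_val_measurable_pair'[OF sp]) (use \<omega> in auto)
          have "(\<integral>\<^sup>+r\<in>{u j<..u (Suc j)}. ennreal (norm (simple_val (C n) r \<omega>) ^ (2 * k)) \<partial>lborel)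
             \<le> (\<integral>\<^sup>+r. ennreal (?b \<omega> r) * indicator {u j<..u (Suc j)} r + ennreal \<bar>?a \<omega> r - ?b \<omega> r\<bar> * indicator {0..T} r \<partial>lborel)"
          proof (rule nn_integral_mono)
            fix r
            \<comment> \<open>Replaces the clipped simple process by the truncated integrand at the
              price of a difference that \<open>E n\<close> collects over the whole of
              \<open>[0, T]\<close>.\<close>
            have "ennreal (?a \<omega> r) \<le> ennreal (?b \<omega> r) + ennreal \<bar>?a \<omega> r - ?b \<omega> r\<bar>"
              using mm0 by (subst ennreal_plus[symmetric]) (auto intro!: ennreal_leI simp del: ennreal_plus)
            thus "ennreal (norm (simple_val (C n) r \<omega>) ^ (2 * k)) * indicator {u j<..u (Suc j)} r
               \<le> ennreal (?b \<omega> r) * indicator {u j<..u (Suc j)} r + ennreal \<bar>?a \<omega> r - ?b \<omega> r\<bar> * indicator {0..T} r"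
              unfolding vC mm_def[symmetric] using jT by (auto simp: indicator_def subset_iff)
          qed
          also have "\<dots> = (\<integral>\<^sup>+r\<in>{u j<..u (Suc j)}. ennreal (?b \<omega> r) \<partial>lborel) + (\<integral>\<^sup>+r\<in>{0..T}. ennreal \<bar>?a \<omega> r - ?b \<omega> r\<bar> \<partial>lborel)"
            by (rule nn_integral_add) auto
          finally show "indicator (G j) \<omega> * (\<integral>\<^sup>+r\<in>{u j<..u (Suc j)}. ennreal (norm (simple_val (C n) r \<omega>) ^ (2 * k)) \<partial>lborel)
             \<le> indicator (G j) \<omega> * (\<integral>\<^sup>+r\<in>{u j<..u (Suc j)}. ennreal (?b \<omega> r) \<partial>lborel) + (\<integral>\<^sup>+r\<in>{0..T}. ennreal \<bar>?a \<omega> r - ?b \<omega> r\<bar> \<partial>lborel)"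
            by (auto simp: indicator_def)
        qed
        also have "\<dots> = (\<integral>\<^sup>+\<omega>. indicator (G j) \<omega> * (\<integral>\<^sup>+r\<in>{u j<..u (Suc j)}. ennreal (?b \<omega> r) \<partial>lborel) \<partial>M) + E n"
          unfolding E_def
          by (rule nn_integral_add)
             (auto intro!: borel_measurable_times lborel.borel_measurable_nn_integral simp: split_beta')
        finally show "(\<integral>\<^sup>+\<omega>. indicator (G j) \<omega> * (\<integral>\<^sup>+r\<in>{u j<..u (Suc j)}. ennreal (norm (simple_val (C n) r \<omega>) ^ (2 * k)) \<partial>lborel) \<partial>M)
          \<le> (\<integral>\<^sup>+\<omega>. indicator (G j) \<omega> * (\<integral>\<^sup>+r\<in>{u j<..u (Suc j)}. ennreal (?b \<omega> r) \<partial>lborel) \<partial>M) + E n" .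
      qed simp
      also have "\<dots> = cL * X + cL * (of_nat N * E n)" by (simp add: X_def sum.distrib distrib_left)
      finally show ?thesis .
    qed
    have "(\<lambda>n. cL * (of_nat N * E n)) \<longlonglongrightarrow> cL * (of_nat N * 0)"
    proof (intro ennreal_tendsto_cmult Elim)
      show "cL < top" by (simp add: cL_def)
      show "of_nat N < (top :: ennreal)" by (simp add: less_top[symmetric])
    qed
    hence "(\<lambda>n. cL * (of_nat N * E n)) \<longlonglongrightarrow> 0" by simp
    from nn_integral_norm_power_le_of_prob_limit[OF Znm Zm Gm limZ bound this]
    show ?thesis unfolding G_def Z_def cL_def X_def mm_def by simp
  qed
  thus ?thesis using c by blast
qed

end

section \<open>Moments of solutions of stochastic differential equations\<close>

text \<open>A solution on \<open>[0, E)\<close> whose coefficient processes obey a linear growth bound with a constant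
  that does not deteriorate at \<open>E\<close>.\<close>

locale sde_process = brownian_motion M F W
  for M :: "'w measure" and F :: "real \<Rightarrow> 'w measure" and W :: "real \<Rightarrow> 'w \<Rightarrow> real ^ 'm" +
  fixes E :: real and Y :: "real \<Rightarrow> 'w \<Rightarrow> real ^ 'r"
    and \<mu> :: "real \<Rightarrow> 'w \<Rightarrow> real ^ 'r" and \<sigma> :: "real \<Rightarrow> 'w \<Rightarrow> real ^ 'm ^ 'r" and Cg :: real
  assumes E_pos: "0 < E" and Cg: "0 \<le> Cg"
    and Y_joint: "(\<lambda>z. Y (fst z) (snd z)) \<in> borel_measurable (borel \<Otimes>\<^sub>M M)"
    and \<mu>_joint: "(\<lambda>z. \<mu> (fst z) (snd z)) \<in> borel_measurable (borel \<Otimes>\<^sub>M M)"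
    and \<sigma>_joint: "(\<lambda>z. \<sigma> (fst z) (snd z)) \<in> borel_measurable (borel \<Otimes>\<^sub>M M)"
    and Y_adapted: "\<And>t. 0 \<le> t \<Longrightarrow> t < E \<Longrightarrow> Y t \<in> borel_measurable (F t)"
    and Y_cont: "\<And>\<omega>. \<omega> \<in> space M \<Longrightarrow> continuous_on {0..<E} (\<lambda>t. Y t \<omega>)"
    and \<mu>_growth: "\<And>t \<omega>. 0 \<le> t \<Longrightarrow> t < E \<Longrightarrow> \<omega> \<in> space M \<Longrightarrow> (norm (\<mu> t \<omega>))\<^sup>2 \<le> Cg * (1 + (norm (Y t \<omega>))\<^sup>2)"
    and \<sigma>_growth: "\<And>t \<omega>. 0 \<le> t \<Longrightarrow> t < E \<Longrightarrow> \<omega> \<in> space M \<Longrightarrow> (norm (\<sigma> t \<omega>))\<^sup>2 \<le> Cg * (1 + (norm (Y t \<omega>))\<^sup>2)"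
    and sde: "\<And>T. 0 < T \<Longrightarrow> T < E \<Longrightarrow> \<exists>I. is_ito_integral M F W T \<sigma> I \<and>
      (AE \<omega> in M. \<forall>t\<in>{0..T}. Y t \<omega> = Y 0 \<omega> + (LINT s:{0..t}|lborel. \<mu> s \<omega>) + I t \<omega>)"
begin

section \<open>Path regularity and exit times\<close>

lemma Y_m: "(\<lambda>z. Y (f z) (g z)) \<in> borel_measurable N" if "f \<in> borel_measurable N" "g \<in> measurable N M"
  using measurable_compose[OF measurable_Pair[OF that] Y_joint] by simp

lemma \<mu>_m: "(\<lambda>z. \<mu> (f z) (g z)) \<in> borel_measurable N" if "f \<in> borel_measurable N" "g \<in> measurable N M"
  using measurable_compose[OF measurable_Pair[OF that] \<mu>_joint] by simp

lemma Y_rv[measurable]: "Y t \<in> borel_measurable M"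
  using Y_m[of "\<lambda>_. t" M "\<lambda>\<omega>. \<omega>"] by simp

lemma Y_path_measurable: "\<omega> \<in> space M \<Longrightarrow> (\<lambda>t. Y t \<omega>) \<in> borel_measurable borel"
  by (rule Y_m) auto

lemma \<mu>_path_measurable: "\<omega> \<in> space M \<Longrightarrow> (\<lambda>t. \<mu> t \<omega>) \<in> borel_measurable borel"
  by (rule \<mu>_m) auto

lemma Y_bounded:
  assumes "\<omega> \<in> space M" "T < E"
  obtains B where "B \<ge> 0" "\<And>t. t \<in> {0..T} \<Longrightarrow> norm (Y t \<omega>) \<le> B"
proof -
  have "continuous_on {0..T} (\<lambda>t. Y t \<omega>)"
    by (rule continuous_on_subset[OF Y_cont[OF assms(1)]]) (use assms in auto)
  hence "bounded ((\<lambda>t. Y t \<omega>) ` {0..T})"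
    by (intro compact_imp_bounded compact_continuous_image) auto
  then obtain B where "\<forall>x\<in>(\<lambda>t. Y t \<omega>) ` {0..T}. norm x \<le> B" by (auto simp: bounded_iff)
  thus thesis by (intro that[of "max B 0"]) (auto simp: le_max_iff_disj)
qed

lemma \<mu>_integrable:
  assumes "\<omega> \<in> space M" "0 \<le> s" "t < E"
  shows "set_integrable lborel {s..t} (\<lambda>r. \<mu> r \<omega>)" "set_integrable lborel {s..t} (\<lambda>r. norm (\<mu> r \<omega>))"
proof -
  obtain B where B: "B \<ge> 0" "\<And>r. r \<in> {0..t} \<Longrightarrow> norm (Y r \<omega>) \<le> B" using Y_bounded assms by blast
  define K where "K = sqrt (Cg * (1 + B\<^sup>2))"
  have K: "norm (\<mu> r \<omega>) \<le> K" if "r \<in> {s..t}" for r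
  proof -
    have "(norm (\<mu> r \<omega>))\<^sup>2 \<le> Cg * (1 + (norm (Y r \<omega>))\<^sup>2)" using \<mu>_growth that assms by auto
    also have "\<dots> \<le> Cg * (1 + B\<^sup>2)" using Cg B that assms by (intro mult_left_mono add_left_mono power_mono) auto
    finally show ?thesis unfolding K_def by (rule real_le_rsqrt)
  qed
  have [measurable]: "(\<lambda>r. \<mu> r \<omega>) \<in> borel_measurable borel" by (rule \<mu>_path_measurable[OF assms(1)])
  have "integrable lborel (\<lambda>r. K * indicator {s..t} r)"
    by (intro integrable_mult_right integrable_real_indicator) (auto simp: emeasure_lborel_Icc_eq)
  hence "set_integrable lborel {s..t} (\<lambda>r. \<mu> r \<omega>)"
    unfolding set_integrable_def
    by (rule Bochner_Integration.integrable_bound) (use K in \<open>auto simp: indicator_def intro!: AE_I2 intro: order_trans[OF K abs_ge_self]\<close>)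
  thus "set_integrable lborel {s..t} (\<lambda>r. \<mu> r \<omega>)" "set_integrable lborel {s..t} (\<lambda>r. norm (\<mu> r \<omega>))"
    by (auto dest: set_integrable_norm)
qed

text \<open>Only rational times are inspected, so the events below involve countably many random
  variables; continuity of the paths recovers the other times. Inserting \<open>T\<close> makes the
  set nonempty and caps the value at \<open>T\<close>.\<close>

definition exit_time :: "real \<Rightarrow> real \<Rightarrow> 'w \<Rightarrow> real"
  where "exit_time R T \<omega> = Inf (insert T {q \<in> \<rat> \<inter> {0..T}. R < norm (Y q \<omega>)})"

lemma le_exit_time_iff:
  assumes "0 \<le> T"
  shows "s \<le> exit_time R T \<omega> \<longleftrightarrow> s \<le> T \<and> (\<forall>q\<in>\<rat> \<inter> {0..T}. R < norm (Y q \<omega>) \<longrightarrow> s \<le> q)"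
proof -
  have "bdd_below (insert T {q \<in> \<rat> \<inter> {0..T}. R < norm (Y q \<omega>)})"
    by (rule bdd_belowI[of _ 0]) (use assms in auto)
  thus ?thesis unfolding exit_time_def by (subst le_cInf_iff) auto
qed

text \<open>Whether \<open>s\<close> comes no later than the exit time depends only on
  \<open>Y\<close> at rational times strictly before \<open>s\<close>, all of them known to
  \<open>F s\<close>.\<close>

lemma exit_time_stopping:
  assumes T: "0 < T" "T < E" and s: "s \<in> {0..T}"
  shows "{\<omega> \<in> space M. s \<le> exit_time R T \<omega>} \<in> sets (F s)"
proof -
  have "{\<omega> \<in> space M. s \<le> exit_time R T \<omega>} = {\<omega> \<in> space (F s). \<forall>q\<in>\<rat> \<inter> {0..<s}. norm (Y q \<omega>) \<le> R}"
    using s T by (subst le_exit_time_iff) (force simp: space_F not_le)+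
  also have "\<dots> \<in> sets (F s)"
  proof -
    have "{\<omega> \<in> space (F s). norm (Y q \<omega>) \<le> R} \<in> sets (F s)" if q: "q \<in> \<rat> \<inter> {0..<s}" for q
    proof -
    have [measurable]: "Y q \<in> borel_measurable (F s)"
      by (rule measurable_F_mono[OF Y_adapted]) (use q s T in auto)
      show ?thesis by measurable
    qed
    moreover have "countable (\<rat> \<inter> {0..<s})" by (rule countable_subset[OF _ countable_rat]) auto
    ultimately have "space (F s) \<inter> (\<Inter>q\<in>\<rat> \<inter> {0..<s}. {\<omega> \<in> space (F s). norm (Y q \<omega>) \<le> R}) \<in> sets (F s)"
      by (cases "\<rat> \<inter> {0..<s} = {}") (auto intro!: sets.Int sets.countable_INT')
    moreover have "space (F s) \<inter> (\<Inter>q\<in>\<rat> \<inter> {0..<s}. {\<omega> \<in> space (F s). norm (Y q \<omega>) \<le> R})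
      = {\<omega> \<in> space (F s). \<forall>q\<in>\<rat> \<inter> {0..<s}. norm (Y q \<omega>) \<le> R}" by auto
    ultimately show ?thesis by simp
  qed
  finally show ?thesis .
qed

lemma exit_time_measurable:
  assumes T: "0 < T" "T < E"
  shows "exit_time R T \<in> borel_measurable M"
proof (subst borel_measurable_iff_ge, intro allI)
  fix s
  consider "s < 0" | "s \<in> {0..T}" | "s > T" by fastforce
  thus "{\<omega> \<in> space M. s \<le> exit_time R T \<omega>} \<in> sets M"
  proof cases
    case 1
    hence "{\<omega> \<in> space M. s \<le> exit_time R T \<omega>} = space M"
      using T by (subst le_exit_time_iff) auto
    thus ?thesis by (simp only: sets.top)
  next
    case 2
    thus ?thesis using sets_F[OF _ exit_time_stopping[OF T 2]] by auto
  next
    case 3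
    hence "{\<omega> \<in> space M. s \<le> exit_time R T \<omega>} = {}"
      using T by (subst le_exit_time_iff) auto
    thus ?thesis by (simp only: sets.empty_sets)
  qed
qed

text \<open>If the bound failed at \<open>r\<close>, continuity would produce a rational time
  shortly before \<open>r\<close> that already violates it. At time 0 there is no earlier time: the
  initial value may exceed \<open>R\<close>, hence \<open>0 < r\<close>.\<close>

lemma norm_le_before_exit_time:
  assumes T: "0 < T" "T < E" and \<omega>: "\<omega> \<in> space M" and r: "0 < r" "r \<le> exit_time R T \<omega>"
  shows "norm (Y r \<omega>) \<le> R"
proof (rule ccontr)
  assume gt: "\<not> norm (Y r \<omega>) \<le> R"
  have rT: "r \<le> T" and q: "\<And>q. q \<in> \<rat> \<Longrightarrow> 0 \<le> q \<Longrightarrow> q < r \<Longrightarrow> norm (Y q \<omega>) \<le> R"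
    using r(2) T by (subst (asm) le_exit_time_iff; force simp: not_le)+
  have "continuous_on {0..<E} (\<lambda>t. norm (Y t \<omega>))" by (intro continuous_intros Y_cont \<omega>)
  moreover have "r \<in> {0..<E}" using r rT T by auto
  moreover have "norm (Y r \<omega>) - R > 0" using gt by simp
  ultimately obtain d where d: "d > 0"
    "\<And>x. x \<in> {0..<E} \<Longrightarrow> dist x r < d \<Longrightarrow> dist (norm (Y x \<omega>)) (norm (Y r \<omega>)) < norm (Y r \<omega>) - R"
    unfolding continuous_on_iff by blast
  have "max 0 (r - d) < r" using d r by auto
  then obtain q' where q': "q' \<in> \<rat>" "max 0 (r - d) < q'" "q' < r" using Rats_dense_in_real by blast
  have "norm (Y q' \<omega>) \<le> R" using q q' by auto
  moreover have "dist (norm (Y q' \<omega>)) (norm (Y r \<omega>)) < norm (Y r \<omega>) - R"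
    by (rule d(2)) (use q' rT T in \<open>auto simp: dist_real_def\<close>)
  ultimately show False by (simp add: dist_real_def)
qed

lemma exit_time_eventually:
  assumes T: "0 < T" "T < E" and \<omega>: "\<omega> \<in> space M"
  shows "\<forall>\<^sub>F n in sequentially. T \<le> exit_time (real n) T \<omega>"
proof -
  obtain B where B: "\<And>t. t \<in> {0..T} \<Longrightarrow> norm (Y t \<omega>) \<le> B" using Y_bounded[OF \<omega> T(2)] by blast
  obtain n0 where n0: "B \<le> real n0" using real_arch_simple by blast
  show ?thesis
  proof (rule eventually_sequentiallyI[of n0])
    fix n assume "n0 \<le> n"
    hence "B \<le> real n" using n0 by linarith
    hence "\<not> real n < norm (Y q \<omega>)" if "q \<in> {0..T}" for q using B[OF that] by simp
    thus "T \<le> exit_time (real n) T \<omega>" using T by (subst le_exit_time_iff) auto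
  qed
qed

text \<open>The increments split into a drift part, bounded path by path with the power mean
  inequality, and a stochastic part, bounded by \<open>ito_moment_stopped\<close>. Linear growth
  turns both right-hand sides into moments of \<open>Y\<close>. The constant depends on neither
  \<open>R\<close> nor \<open>T\<close>, only on \<open>E\<close>, so it survives the removal of the
  localization and the approach to \<open>E\<close>.\<close>

lemma stopped_increment_moment:
  assumes k: "k \<ge> 1"
  shows "\<exists>c\<ge>0. \<forall>T R N u (A :: nat \<Rightarrow> real ^ 'r ^ 'q). 0 < T \<longrightarrow> T < E \<longrightarrow> 0 \<le> R \<longrightarrow>
    (\<forall>j<N. u j \<le> u (Suc j)) \<longrightarrow> 0 \<le> u 0 \<longrightarrow> u 0 < u N \<longrightarrow> u N \<le> T \<longrightarrow>
    (\<forall>j<N. \<forall>v. norm (A j *v v) \<le> norm v) \<longrightarrow>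
    (\<integral>\<^sup>+\<omega>. indicator {\<omega> \<in> space M. u N \<le> exit_time R T \<omega>} \<omega> *
        ennreal (norm (\<Sum>j<N. A j *v (Y (u (Suc j)) \<omega> - Y (u j) \<omega>)) ^ (2 * k)) \<partial>M)
      \<le> ennreal (c * (u N - u 0) ^ (k - 1)) * (\<Sum>j<N.
          \<integral>\<^sup>+\<omega>. indicator {\<omega> \<in> space M. u j \<le> exit_time R T \<omega>} \<omega> *
            (\<integral>\<^sup>+r\<in>{u j<..u (Suc j)}. ennreal (1 + min R (norm (Y r \<omega>)) ^ (2 * k)) \<partial>lborel) \<partial>M)"
proof -
  obtain c where c: "c \<ge> 0" and ito: "\<And>T (H :: real \<Rightarrow> 'w \<Rightarrow> real ^ 'm ^ 'r) I \<tau> K N u (A :: nat \<Rightarrow> real ^ 'r ^ 'q).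
    is_ito_integral M F W T H I \<Longrightarrow> (\<lambda>z. H (fst z) (snd z)) \<in> borel_measurable (borel \<Otimes>\<^sub>M M) \<Longrightarrow>
    \<tau> \<in> borel_measurable M \<Longrightarrow> (\<forall>s\<in>{0..T}. {\<omega> \<in> space M. s \<le> \<tau> \<omega>} \<in> sets (F s)) \<Longrightarrow>
    (AE \<omega> in M. \<forall>r\<in>{0<..T}. r \<le> \<tau> \<omega> \<longrightarrow> norm (H r \<omega>) \<le> K) \<Longrightarrow> 0 \<le> K \<Longrightarrow>
    (\<forall>j<N. u j \<le> u (Suc j)) \<Longrightarrow> 0 \<le> u 0 \<Longrightarrow> u 0 < u N \<Longrightarrow> u N \<le> T \<Longrightarrow>
    (\<forall>j<N. \<forall>v. norm (A j *v v) \<le> norm v) \<Longrightarrow>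
    (\<integral>\<^sup>+\<omega>. indicator {\<omega> \<in> space M. u N \<le> \<tau> \<omega>} \<omega> *
        ennreal (norm (\<Sum>j<N. A j *v (I (u (Suc j)) \<omega> - I (u j) \<omega>)) ^ (2 * k)) \<partial>M)
      \<le> ennreal (c * (u N - u 0) ^ (k - 1)) * (\<Sum>j<N.
          \<integral>\<^sup>+\<omega>. indicator {\<omega> \<in> space M. u j \<le> \<tau> \<omega>} \<omega> *
            (\<integral>\<^sup>+r\<in>{u j<..u (Suc j)}. ennreal (min K (norm (H r \<omega>)) ^ (2 * k)) \<partial>lborel) \<partial>M)"
    using ito_moment_stopped[OF k, where 'q='q and 'r='r] by blast
  define \<beta> where "\<beta> = Cg ^ k * 2 ^ k"
  have \<beta>: "\<beta> \<ge> 0" using Cg by (simp add: \<beta>_def)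
  have growth: "x ^ (2 * k) \<le> \<beta> * (1 + y ^ (2 * k))" if "x\<^sup>2 \<le> Cg * (1 + y\<^sup>2)" for x y :: real
  proof -
    have "x ^ (2 * k) \<le> (Cg * (1 + y\<^sup>2)) ^ k" using power_mono[OF that, of k] by (simp add: power_mult)
    also have "\<dots> = Cg ^ k * (1 + y\<^sup>2) ^ k" by (simp add: power_mult_distrib)
    also have "\<dots> \<le> Cg ^ k * (2 ^ k * (1 ^ k + (y\<^sup>2) ^ k))" using Cg by (intro mult_left_mono add_power_le) auto
    also have "\<dots> = \<beta> * (1 + y ^ (2 * k))" by (simp add: \<beta>_def power_mult)
    finally show ?thesis .
  qed
  \<comment> \<open>Factors for splitting a power of a sum and for the growth bound; the bracket
    adds the drift part, whose surplus power of the length is bounded with \<open>E\<close>, and the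
    stochastic part.\<close>
  define c' where "c' = 2 ^ (2 * k) * \<beta> * (E ^ k + c)"
  have c': "c' \<ge> 0" using c \<beta> E_pos by (simp add: c'_def)
  have "(\<integral>\<^sup>+\<omega>. indicator {\<omega> \<in> space M. u N \<le> exit_time R T \<omega>} \<omega> *
        ennreal (norm (\<Sum>j<N. A j *v (Y (u (Suc j)) \<omega> - Y (u j) \<omega>)) ^ (2 * k)) \<partial>M)
      \<le> ennreal (c' * (u N - u 0) ^ (k - 1)) * (\<Sum>j<N.
          \<integral>\<^sup>+\<omega>. indicator {\<omega> \<in> space M. u j \<le> exit_time R T \<omega>} \<omega> *
            (\<integral>\<^sup>+r\<in>{u j<..u (Suc j)}. ennreal (1 + min R (norm (Y r \<omega>)) ^ (2 * k)) \<partial>lborel) \<partial>M)"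
    if T: "0 < T" "T < E" and R: "0 \<le> R" and u: "\<forall>j<N. u j \<le> u (Suc j)" "0 \<le> u 0" "u 0 < u N" "u N \<le> T"
      and A: "\<forall>j<N. \<forall>v. norm (A j *v v) \<le> norm v"
    for T R N u and A :: "nat \<Rightarrow> real ^ 'r ^ 'q"
  proof -
    have um: "u i \<le> u j" if "i \<le> j" "j \<le> N" for i j
      using that
    proof (induction j rule: dec_induct)
      case (step m)
      thus ?case using u(1)[rule_format, of m] by auto
    qed simp
    have u0: "0 \<le> u j" "u j \<le> T" if "j \<le> N" for j using um[of 0 j] um[of j N] that u by auto
    obtain I where I: "is_ito_integral M F W T \<sigma> I"
      and eq: "AE \<omega> in M. \<forall>t\<in>{0..T}. Y t \<omega> = Y 0 \<omega> + (LINT s:{0..t}|lborel. \<mu> s \<omega>) + I t \<omega>"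
      using sde[OF T] by blast
    have Im: "I t \<in> borel_measurable M" if "t \<in> {0..T}" for t
      using I that by (auto simp: is_ito_integral_def intro: measurable_F)
    let ?\<tau> = "exit_time R T"
    have [measurable]: "?\<tau> \<in> borel_measurable M" by (rule exit_time_measurable[OF T])
    \<comment> \<open>The level that linear growth allows for \<open>\<sigma>\<close> while
      \<open>Y\<close> stays within radius \<open>R\<close>.\<close>
    define K where "K = sqrt (Cg * (1 + R\<^sup>2))"
    have K: "K \<ge> 0" "K\<^sup>2 = Cg * (1 + R\<^sup>2)" using Cg by (auto simp: K_def)
    have \<sigma>K: "AE \<omega> in M. \<forall>r\<in>{0<..T}. r \<le> ?\<tau> \<omega> \<longrightarrow> norm (\<sigma> r \<omega>) \<le> K"
    proof (intro AE_I2 ballI impI)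
      fix \<omega> r assume h: "\<omega> \<in> space M" "r \<in> {0<..T}" "r \<le> ?\<tau> \<omega>"
      have "norm (Y r \<omega>) \<le> R" by (rule norm_le_before_exit_time[OF T h(1) _ h(3)]) (use h in auto)
      hence "Cg * (1 + (norm (Y r \<omega>))\<^sup>2) \<le> Cg * (1 + R\<^sup>2)"
        using Cg by (intro mult_left_mono add_left_mono power_mono) auto
      thus "norm (\<sigma> r \<omega>) \<le> K" unfolding K_def
        using \<sigma>_growth[of r \<omega>] h T by (intro real_le_rsqrt) auto
    qed
    let ?G = "\<lambda>j. {\<omega> \<in> space M. u j \<le> ?\<tau> \<omega>}"
    define m where "m r \<omega> = 1 + min R (norm (Y r \<omega>)) ^ (2 * k)" for r \<omega>
    have m0: "m r \<omega> \<ge> 0" for r \<omega> using R by (simp add: m_def add_nonneg_nonneg)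
    have m_jm: "(\<lambda>z. m (f z) (g z)) \<in> borel_measurable N" if "f \<in> borel_measurable N" "g \<in> measurable N M" for f g and N :: "'z measure"
      unfolding m_def using Y_m[OF that] by measurable
    let ?X = "\<lambda>j. \<integral>\<^sup>+\<omega>. indicator (?G j) \<omega> * (\<integral>\<^sup>+r\<in>{u j<..u (Suc j)}. ennreal (m r \<omega>) \<partial>lborel) \<partial>M"
    define L where "L = u N - u 0"
    have L: "L > 0" "L \<le> E" using u T by (auto simp: L_def)
    \<comment> \<open>Clipping \<open>\<sigma>\<close> at \<open>K\<close> corresponds to clipping
      \<open>Y\<close> at \<open>R\<close>: the growth bound survives the truncation of both
      sides.\<close>
    have \<sigma>m: "min K (norm (\<sigma> r \<omega>)) ^ (2 * k) \<le> \<beta> * m r \<omega>" if "r \<in> {0..T}" "\<omega> \<in> space M" for r \<omega>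
      unfolding m_def
    proof (rule growth)
      have s: "(norm (\<sigma> r \<omega>))\<^sup>2 \<le> Cg * (1 + (norm (Y r \<omega>))\<^sup>2)" using \<sigma>_growth that T by auto
      show "(min K (norm (\<sigma> r \<omega>)))\<^sup>2 \<le> Cg * (1 + (min R (norm (Y r \<omega>)))\<^sup>2)"
      proof (cases "norm (Y r \<omega>) \<le> R")
        case True
        have "(min K (norm (\<sigma> r \<omega>)))\<^sup>2 \<le> (norm (\<sigma> r \<omega>))\<^sup>2" using K by (intro power_mono) auto
        hence "(min K (norm (\<sigma> r \<omega>)))\<^sup>2 \<le> Cg * (1 + (norm (Y r \<omega>))\<^sup>2)" using s by linarith
        moreover have "min R (norm (Y r \<omega>)) = norm (Y r \<omega>)" using True by simp
        ultimately show ?thesis by simp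
      next
        case False
        have "(min K (norm (\<sigma> r \<omega>)))\<^sup>2 \<le> K\<^sup>2" using K by (intro power_mono) auto
        moreover have "min R (norm (Y r \<omega>)) = R" using False by simp
        ultimately show ?thesis using K by simp
      qed
    qed
    define J where "J \<omega> = (\<Sum>j<N. A j *v (I (u (Suc j)) \<omega> - I (u j) \<omega>))" for \<omega>
    have "(\<lambda>\<omega>. A j *v (I (u (Suc j)) \<omega> - I (u j) \<omega>)) \<in> borel_measurable M" if "j < N" for j
    proof -
      have [measurable]: "I (u j) \<in> borel_measurable M" "I (u (Suc j)) \<in> borel_measurable M"
        using Im u0[of j] u0[of "Suc j"] that by auto
      show ?thesis by measurable
    qed
    hence Jm[measurable]: "J \<in> borel_measurable M" unfolding J_def by (intro borel_measurable_sum) auto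
    have "(\<integral>\<^sup>+\<omega>. indicator (?G N) \<omega> * ennreal (norm (J \<omega>) ^ (2 * k)) \<partial>M)
      \<le> ennreal (c * L ^ (k - 1)) * (\<Sum>j<N.
          \<integral>\<^sup>+\<omega>. indicator (?G j) \<omega> * (\<integral>\<^sup>+r\<in>{u j<..u (Suc j)}. ennreal (min K (norm (\<sigma> r \<omega>)) ^ (2 * k)) \<partial>lborel) \<partial>M)"
      unfolding J_def L_def
      by (rule ito[OF I \<sigma>_joint _ _ \<sigma>K K(1) u A]) (use exit_time_stopping[OF T] in auto)
    also have "\<dots> \<le> ennreal (c * L ^ (k - 1)) * (\<Sum>j<N. ennreal \<beta> * ?X j)"
    proof (intro mult_left_mono sum_mono)
      fix j assume j: "j \<in> {..<N}"
      have "(\<integral>\<^sup>+\<omega>. indicator (?G j) \<omega> * (\<integral>\<^sup>+r\<in>{u j<..u (Suc j)}. ennreal (min K (norm (\<sigma> r \<omega>)) ^ (2 * k)) \<partial>lborel) \<partial>M)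
        \<le> (\<integral>\<^sup>+\<omega>. ennreal \<beta> * (indicator (?G j) \<omega> * (\<integral>\<^sup>+r\<in>{u j<..u (Suc j)}. ennreal (m r \<omega>) \<partial>lborel)) \<partial>M)"
      proof (rule nn_integral_mono)
        fix \<omega> assume \<omega>: "\<omega> \<in> space M"
        have [measurable]: "(\<lambda>r. m r \<omega>) \<in> borel_measurable borel" by (rule m_jm) (use \<omega> in auto)
        have "(\<integral>\<^sup>+r\<in>{u j<..u (Suc j)}. ennreal (min K (norm (\<sigma> r \<omega>)) ^ (2 * k)) \<partial>lborel)
          \<le> (\<integral>\<^sup>+r. ennreal \<beta> * (ennreal (m r \<omega>) * indicator {u j<..u (Suc j)} r) \<partial>lborel)"
        proof (rule nn_integral_mono)
          fix r
          show "ennreal (min K (norm (\<sigma> r \<omega>)) ^ (2 * k)) * indicator {u j<..u (Suc j)} r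
            \<le> ennreal \<beta> * (ennreal (m r \<omega>) * indicator {u j<..u (Suc j)} r)"
            using \<sigma>m[of r \<omega>] \<omega> u0[of j] u0[of "Suc j"] j \<beta> m0
            by (auto simp: indicator_def ennreal_mult[symmetric] intro!: ennreal_leI)
        qed
        also have "\<dots> = ennreal \<beta> * (\<integral>\<^sup>+r\<in>{u j<..u (Suc j)}. ennreal (m r \<omega>) \<partial>lborel)"
          by (rule nn_integral_cmult) auto
        finally show "indicator (?G j) \<omega> * (\<integral>\<^sup>+r\<in>{u j<..u (Suc j)}. ennreal (min K (norm (\<sigma> r \<omega>)) ^ (2 * k)) \<partial>lborel)
          \<le> ennreal \<beta> * (indicator (?G j) \<omega> * (\<integral>\<^sup>+r\<in>{u j<..u (Suc j)}. ennreal (m r \<omega>) \<partial>lborel))"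
          by (auto simp: indicator_def)
      qed
      also have "\<dots> = ennreal \<beta> * ?X j"
      proof (rule nn_integral_cmult)
        have [measurable]: "(\<lambda>z. m (snd z) (fst z)) \<in> borel_measurable (M \<Otimes>\<^sub>M lborel)" by (rule m_jm) auto
        show "(\<lambda>\<omega>. indicator (?G j) \<omega> * (\<integral>\<^sup>+r\<in>{u j<..u (Suc j)}. ennreal (m r \<omega>) \<partial>lborel)) \<in> borel_measurable M"
          by (auto intro!: borel_measurable_times lborel.borel_measurable_nn_integral simp: split_beta')
      qed
      finally show "(\<integral>\<^sup>+\<omega>. indicator (?G j) \<omega> * (\<integral>\<^sup>+r\<in>{u j<..u (Suc j)}. ennreal (min K (norm (\<sigma> r \<omega>)) ^ (2 * k)) \<partial>lborel) \<partial>M)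
        \<le> ennreal \<beta> * ?X j" .
    qed simp
    finally have J: "(\<integral>\<^sup>+\<omega>. indicator (?G N) \<omega> * ennreal (norm (J \<omega>) ^ (2 * k)) \<partial>M)
       \<le> ennreal (c * L ^ (k - 1) * \<beta>) * (\<Sum>j<N. ?X j)"
      using c L \<beta> by (simp add: sum_distrib_left[symmetric] ennreal_mult mult.assoc)
    define V where "V \<omega> = (\<Sum>j<N. \<integral>\<^sup>+r\<in>{u j<..u (Suc j)}. ennreal (m r \<omega>) \<partial>lborel)" for \<omega>
    \<comment> \<open>On the event \<open>u N \<le> exit_time R T \<omega>\<close> the indicators of
      all earlier grid times equal 1, so they can be inserted into the drift term to match the
      stochastic one.\<close>
    have pw: "AE \<omega> in M. indicator (?G N) \<omega> * ennreal (norm (\<Sum>j<N. A j *v (Y (u (Suc j)) \<omega> - Y (u j) \<omega>)) ^ (2 * k))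
      \<le> ennreal (2 ^ (2 * k)) * (ennreal (L ^ (2 * k - 1) * \<beta>) * (\<Sum>j<N. indicator (?G j) \<omega> * (\<integral>\<^sup>+r\<in>{u j<..u (Suc j)}. ennreal (m r \<omega>) \<partial>lborel))
          + indicator (?G N) \<omega> * ennreal (norm (J \<omega>) ^ (2 * k)))"
      using eq AE_space
    proof eventually_elim
      case (elim \<omega>)
      note \<omega> = elim(2)
      show ?case
      proof (cases "\<omega> \<in> ?G N")
        case True
        have gj: "indicator (?G j) \<omega> = (1::ennreal)" if "j < N" for j
          using True um[of j N] that by auto
        have [measurable]: "(\<lambda>r. m r \<omega>) \<in> borel_measurable borel" "(\<lambda>r. \<mu> r \<omega>) \<in> borel_measurable borel"
          by (rule m_jm \<mu>_path_measurable; use \<omega> in simp)+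
        define q where "q = (LINT r:{u 0<..u N}|lborel. norm (\<mu> r \<omega>))"
        have mi: "set_integrable lborel {0..t} (\<lambda>r. \<mu> r \<omega>)" "set_integrable lborel {0..t} (\<lambda>r. norm (\<mu> r \<omega>))" if "t \<le> T" for t
          using \<mu>_integrable[OF \<omega>, of 0 t] that T by auto
        have ms: "set_integrable lborel {s<..t} (\<lambda>r. \<mu> r \<omega>)" "set_integrable lborel {s<..t} (\<lambda>r. norm (\<mu> r \<omega>))" if "0 \<le> s" "t \<le> T" for s t
          by (rule set_integrable_subset[OF mi(1)[OF that(2)]] set_integrable_subset[OF mi(2)[OF that(2)]]; use that in auto)+
        have spl: "(LINT r:{0..t}|lborel. g r) = (LINT r:{0..s}|lborel. g r) + (LINT r:{s<..t}|lborel. g r)"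
          if "0 \<le> s" "s \<le> t" "set_integrable lborel {0..t} g" for s t and g :: "real \<Rightarrow> 'z::{banach, second_countable_topology}"
        proof -
          have "{0..t} = {0..s} \<union> {s<..t}" using that by auto
          moreover have "set_integrable lborel {0..s} g" "set_integrable lborel {s<..t} g"
            using that by (auto intro: set_integrable_subset[OF that(3)])
          moreover have "{0..s} \<inter> {s<..t} = {}" by auto
          ultimately show ?thesis using set_integral_Un[of "{0..s}" "{s<..t}" lborel g] by simp
        qed
        define Dj where "Dj j = (LINT r:{u j<..u (Suc j)}|lborel. \<mu> r \<omega>)" for j
        have inc: "Y (u (Suc j)) \<omega> - Y (u j) \<omega> = Dj j + (I (u (Suc j)) \<omega> - I (u j) \<omega>)" if j: "j < N" for j
        proof -
          have "Y (u (Suc j)) \<omega> = Y 0 \<omega> + (LINT s:{0..u (Suc j)}|lborel. \<mu> s \<omega>) + I (u (Suc j)) \<omega>"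
            "Y (u j) \<omega> = Y 0 \<omega> + (LINT s:{0..u j}|lborel. \<mu> s \<omega>) + I (u j) \<omega>"
            by (rule bspec[OF elim(1)]; use u0[of j] u0[of "Suc j"] j in simp)+
          thus ?thesis using spl[of "u j" "u (Suc j)" "\<lambda>r. \<mu> r \<omega>"] mi u0[of j] u0[of "Suc j"] u(1) j
            by (simp add: Dj_def)
        qed
        \<comment> \<open>The drift norms telescope to one integral over the whole partition, so
          that no factor \<open>N\<close> appears.\<close>
        have sumD: "(\<Sum>j<n. (LINT r:{u j<..u (Suc j)}|lborel. norm (\<mu> r \<omega>))) = (LINT r:{0..u n}|lborel. norm (\<mu> r \<omega>)) - (LINT r:{0..u 0}|lborel. norm (\<mu> r \<omega>))"
          if "n \<le> N" for n
          using that
        proof (induction n)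
          case (Suc n)
          thus ?case using spl[of "u n" "u (Suc n)" "\<lambda>r. norm (\<mu> r \<omega>)"] mi u0[of n] u0[of "Suc n"] u(1) by simp
        qed simp
        have "norm (\<Sum>j<N. A j *v Dj j) \<le> (\<Sum>j<N. (LINT r:{u j<..u (Suc j)}|lborel. norm (\<mu> r \<omega>)))"
        proof (rule sum_norm_le)
          fix j assume j: "j \<in> {..<N}"
          have "norm (A j *v Dj j) \<le> norm (Dj j)" using A j by blast
          also have "\<dots> \<le> (LINT r:{u j<..u (Suc j)}|lborel. norm (\<mu> r \<omega>))"
            unfolding Dj_def by (rule set_integral_norm_bound) (use ms u0[of j] u0[of "Suc j"] j in auto)
          finally show "norm (A j *v Dj j) \<le> (LINT r:{u j<..u (Suc j)}|lborel. norm (\<mu> r \<omega>))" .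
        qed
        also have "\<dots> = q" unfolding q_def
          using sumD[of N] spl[of "u 0" "u N" "\<lambda>r. norm (\<mu> r \<omega>)"] mi u by simp
        finally have nq: "norm (\<Sum>j<N. A j *v Dj j) \<le> q" .
        have Vsum: "(\<integral>\<^sup>+r\<in>{u 0<..u n}. ennreal (m r \<omega>) \<partial>lborel) = (\<Sum>j<n. \<integral>\<^sup>+r\<in>{u j<..u (Suc j)}. ennreal (m r \<omega>) \<partial>lborel)" if "n \<le> N" for n
          using that
        proof (induction n)
          case (Suc n)
          have "{u 0<..u (Suc n)} = {u 0<..u n} \<union> {u n<..u (Suc n)}" "{u 0<..u n} \<inter> {u n<..u (Suc n)} = {}"
            using um[of 0 n] um[of n "Suc n"] Suc.prems by auto
          thus ?case using Suc by (simp add: nn_integral_disjoint_pair)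
        qed simp
        \<comment> \<open>The power mean inequality turns the power of the drift integral into an
          integral of powers, with a surplus factor \<open>L ^ (2 * k - 1)\<close>.\<close>
        have "ennreal (q ^ (2 * k)) = ennreal q ^ (2 * k)"
          unfolding q_def by (subst ennreal_power) (auto simp: set_lebesgue_integral_def intro!: Bochner_Integration.integral_nonneg)
        also have "ennreal q = (\<integral>\<^sup>+r\<in>{u 0<..u N}. ennreal (norm (\<mu> r \<omega>)) \<partial>lborel)"
        proof -
          have "integrable lborel (\<lambda>r. indicator {u 0<..u N} r *\<^sub>R norm (\<mu> r \<omega>))"
            using ms(2)[of "u 0" "u N"] u unfolding set_integrable_def by simp
          from nn_integral_eq_integral[OF this] show ?thesis
            by (simp add: q_def set_lebesgue_integral_def ennreal_mult' ennreal_indicator[symmetric] mult.commute)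
        qed
        also have "\<dots> ^ (2 * k) \<le> ennreal (L ^ (2 * k - 1)) * (\<integral>\<^sup>+r\<in>{u 0<..u N}. ennreal (norm (\<mu> r \<omega>) ^ (2 * k)) \<partial>lborel)"
          by (rule nn_integral_power_mean) (use L k in \<open>auto simp: L_def\<close>)
        also have "\<dots> \<le> ennreal (L ^ (2 * k - 1)) * (\<integral>\<^sup>+r. ennreal \<beta> * (ennreal (m r \<omega>) * indicator {u 0<..u N} r) \<partial>lborel)"
        proof (intro mult_left_mono nn_integral_mono)
          fix r
          show "ennreal (norm (\<mu> r \<omega>) ^ (2 * k)) * indicator {u 0<..u N} r \<le> ennreal \<beta> * (ennreal (m r \<omega>) * indicator {u 0<..u N} r)"
          proof (cases "r \<in> {u 0<..u N}")
            case r: True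
            hence "norm (Y r \<omega>) \<le> R"
              using norm_le_before_exit_time[OF T \<omega>, of r R] True u by auto
            hence "norm (\<mu> r \<omega>) ^ (2 * k) \<le> \<beta> * m r \<omega>"
              using growth[OF \<mu>_growth[of r \<omega>]] \<omega> r u T by (simp add: m_def)
            thus ?thesis using r \<beta> m0 by (auto simp: ennreal_mult[symmetric] intro!: ennreal_leI)
          qed simp
        qed simp
        also have "\<dots> = ennreal (L ^ (2 * k - 1) * \<beta>) * (\<integral>\<^sup>+r\<in>{u 0<..u N}. ennreal (m r \<omega>) \<partial>lborel)"
          using L \<beta> by (subst nn_integral_cmult) (auto simp: ennreal_mult mult.assoc)
        also have "(\<integral>\<^sup>+r\<in>{u 0<..u N}. ennreal (m r \<omega>) \<partial>lborel) = V \<omega>" unfolding V_def by (rule Vsum) simp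
        finally have q: "ennreal (q ^ (2 * k)) \<le> ennreal (L ^ (2 * k - 1) * \<beta>) * V \<omega>" .
        have "(\<Sum>j<N. A j *v (Y (u (Suc j)) \<omega> - Y (u j) \<omega>)) = (\<Sum>j<N. A j *v Dj j) + J \<omega>"
          unfolding J_def sum.distrib[symmetric] by (intro sum.cong refl) (simp add: inc matrix_vector_right_distrib)
        hence "norm (\<Sum>j<N. A j *v (Y (u (Suc j)) \<omega> - Y (u j) \<omega>)) \<le> q + norm (J \<omega>)"
          using norm_triangle_ineq[of "\<Sum>j<N. A j *v Dj j" "J \<omega>"] nq by simp
        hence "norm (\<Sum>j<N. A j *v (Y (u (Suc j)) \<omega> - Y (u j) \<omega>)) ^ (2 * k) \<le> (q + norm (J \<omega>)) ^ (2 * k)"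
          by (rule power_mono) simp
        also have "\<dots> \<le> 2 ^ (2 * k) * (q ^ (2 * k) + norm (J \<omega>) ^ (2 * k))"
          by (rule add_power_le) (use nq norm_ge_zero order_trans in \<open>blast, simp\<close>)
        finally have "ennreal (norm (\<Sum>j<N. A j *v (Y (u (Suc j)) \<omega> - Y (u j) \<omega>)) ^ (2 * k))
           \<le> ennreal (2 ^ (2 * k)) * (ennreal (q ^ (2 * k)) + ennreal (norm (J \<omega>) ^ (2 * k)))"
          by (simp add: ennreal_mult[symmetric] ennreal_plus[symmetric] ennreal_leI del: ennreal_plus)
        also have "\<dots> \<le> ennreal (2 ^ (2 * k)) * (ennreal (L ^ (2 * k - 1) * \<beta>) * V \<omega> + ennreal (norm (J \<omega>) ^ (2 * k)))"
          using q by (intro mult_left_mono add_right_mono) auto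
        finally show ?thesis using True gj by (simp add: V_def)
      qed simp
    qed
    have Xm: "(\<lambda>\<omega>. indicator (?G j) \<omega> * (\<integral>\<^sup>+r\<in>{u j<..u (Suc j)}. ennreal (m r \<omega>) \<partial>lborel)) \<in> borel_measurable M" for j
    proof -
      have [measurable]: "(\<lambda>z. m (snd z) (fst z)) \<in> borel_measurable (M \<Otimes>\<^sub>M lborel)" by (rule m_jm) auto
      show ?thesis
        by (auto intro!: borel_measurable_times lborel.borel_measurable_nn_integral simp: split_beta')
    qed
    have "(\<integral>\<^sup>+\<omega>. indicator (?G N) \<omega> * ennreal (norm (\<Sum>j<N. A j *v (Y (u (Suc j)) \<omega> - Y (u j) \<omega>)) ^ (2 * k)) \<partial>M)
      \<le> (\<integral>\<^sup>+\<omega>. ennreal (2 ^ (2 * k)) * (ennreal (L ^ (2 * k - 1) * \<beta>) * (\<Sum>j<N. indicator (?G j) \<omega> * (\<integral>\<^sup>+r\<in>{u j<..u (Suc j)}. ennreal (m r \<omega>) \<partial>lborel))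
          + indicator (?G N) \<omega> * ennreal (norm (J \<omega>) ^ (2 * k))) \<partial>M)"
      by (rule nn_integral_mono_AE[OF pw])
    also have "\<dots> = ennreal (2 ^ (2 * k)) * (ennreal (L ^ (2 * k - 1) * \<beta>) * (\<Sum>j<N. ?X j)
          + (\<integral>\<^sup>+\<omega>. indicator (?G N) \<omega> * ennreal (norm (J \<omega>) ^ (2 * k)) \<partial>M))"
    proof -
      define Sx where "Sx \<omega> = (\<Sum>j<N. indicator (?G j) \<omega> * (\<integral>\<^sup>+r\<in>{u j<..u (Suc j)}. ennreal (m r \<omega>) \<partial>lborel))" for \<omega>
      define P where "P \<omega> = indicator (?G N) \<omega> * ennreal (norm (J \<omega>) ^ (2 * k))" for \<omega>
      have [measurable]: "Sx \<in> borel_measurable M" unfolding Sx_def by (intro borel_measurable_sum Xm)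
      have [measurable]: "P \<in> borel_measurable M" unfolding P_def by measurable
      have "(\<integral>\<^sup>+\<omega>. ennreal (2 ^ (2 * k)) * (ennreal (L ^ (2 * k - 1) * \<beta>) * Sx \<omega> + P \<omega>) \<partial>M)
        = ennreal (2 ^ (2 * k)) * (\<integral>\<^sup>+\<omega>. ennreal (L ^ (2 * k - 1) * \<beta>) * Sx \<omega> + P \<omega> \<partial>M)"
        by (rule nn_integral_cmult) measurable
      also have "(\<integral>\<^sup>+\<omega>. ennreal (L ^ (2 * k - 1) * \<beta>) * Sx \<omega> + P \<omega> \<partial>M)
        = (\<integral>\<^sup>+\<omega>. ennreal (L ^ (2 * k - 1) * \<beta>) * Sx \<omega> \<partial>M) + (\<integral>\<^sup>+\<omega>. P \<omega> \<partial>M)"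
        by (rule nn_integral_add) measurable
      also have "(\<integral>\<^sup>+\<omega>. ennreal (L ^ (2 * k - 1) * \<beta>) * Sx \<omega> \<partial>M) = ennreal (L ^ (2 * k - 1) * \<beta>) * (\<integral>\<^sup>+\<omega>. Sx \<omega> \<partial>M)"
        by (rule nn_integral_cmult) measurable
      also have "(\<integral>\<^sup>+\<omega>. Sx \<omega> \<partial>M) = (\<Sum>j<N. ?X j)" unfolding Sx_def by (rule nn_integral_sum) (rule Xm)
      finally show ?thesis unfolding Sx_def P_def .
    qed
    also have "\<dots> \<le> ennreal (2 ^ (2 * k)) * (ennreal (L ^ (2 * k - 1) * \<beta>) * (\<Sum>j<N. ?X j) + ennreal (c * L ^ (k - 1) * \<beta>) * (\<Sum>j<N. ?X j))"
      using J by (intro mult_left_mono add_left_mono) auto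
    also have "\<dots> = ennreal (2 ^ (2 * k) * (L ^ (2 * k - 1) * \<beta> + c * L ^ (k - 1) * \<beta>)) * (\<Sum>j<N. ?X j)"
      using L \<beta> c by (simp add: ennreal_mult ennreal_plus distrib_right mult.assoc)
    also have "\<dots> \<le> ennreal (c' * L ^ (k - 1)) * (\<Sum>j<N. ?X j)"
    proof (intro mult_right_mono ennreal_leI)
      have e: "L ^ (2 * k - 1) = L ^ k * L ^ (k - 1)" using k by (simp add: power_add[symmetric] mult_2)
      have "L ^ (2 * k - 1) * \<beta> + c * L ^ (k - 1) * \<beta> = (L ^ k + c) * (\<beta> * L ^ (k - 1))" unfolding e by (simp add: algebra_simps)
      also have "\<dots> \<le> (E ^ k + c) * (\<beta> * L ^ (k - 1))"
        using L \<beta> by (intro mult_right_mono add_right_mono power_mono) auto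
      finally have "2 ^ (2 * k) * (L ^ (2 * k - 1) * \<beta> + c * L ^ (k - 1) * \<beta>) \<le> 2 ^ (2 * k) * ((E ^ k + c) * (\<beta> * L ^ (k - 1)))"
        by (rule mult_left_mono) simp
      thus "2 ^ (2 * k) * (L ^ (2 * k - 1) * \<beta> + c * L ^ (k - 1) * \<beta>) \<le> c' * L ^ (k - 1)"
        by (simp add: c'_def mult_ac)
    qed simp
    finally show ?thesis unfolding L_def m_def .
  qed
  thus ?thesis using c' by blast
qed

end

section \<open>Moments without localization\<close>

context sde_process
begin

lemma nn_integral_time_swap:
  assumes g: "(\<lambda>z. g (fst z) (snd z)) \<in> borel_measurable (borel \<Otimes>\<^sub>M M)" and A: "A \<in> sets borel"
  shows "(\<integral>\<^sup>+\<omega>. (\<integral>\<^sup>+r\<in>A. g r \<omega> \<partial>lborel) \<partial>M) = (\<integral>\<^sup>+r\<in>A. (\<integral>\<^sup>+\<omega>. g r \<omega> \<partial>M) \<partial>lborel)"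
    and "(\<lambda>r. \<integral>\<^sup>+\<omega>. g r \<omega> \<partial>M) \<in> borel_measurable borel"
    and "(\<lambda>\<omega>. \<integral>\<^sup>+r\<in>A. g r \<omega> \<partial>lborel) \<in> borel_measurable M"
proof -
  show "(\<lambda>r. \<integral>\<^sup>+\<omega>. g r \<omega> \<partial>M) \<in> borel_measurable borel"
    using borel_measurable_nn_integral[of g borel] g by (simp add: split_beta')
  interpret pair_sigma_finite lborel M ..
  have sets: "sets (lborel \<Otimes>\<^sub>M M) = sets (borel \<Otimes>\<^sub>M M)" by (rule sets_pair_measure_cong) auto
  have g'[measurable]: "(\<lambda>z. g (fst z) (snd z)) \<in> borel_measurable (lborel \<Otimes>\<^sub>M M)"
    using g by (simp cong: measurable_cong_sets add: sets)
  have ga[measurable]: "case_prod (\<lambda>r \<omega>. g r \<omega> * indicator A r) \<in> borel_measurable (lborel \<Otimes>\<^sub>M M)"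
    using A by (simp add: split_beta')
  have swap: "(\<lambda>z. (snd z, fst z)) \<in> measurable (M \<Otimes>\<^sub>M lborel) (lborel \<Otimes>\<^sub>M M)" by measurable
  show "(\<lambda>\<omega>. \<integral>\<^sup>+r\<in>A. g r \<omega> \<partial>lborel) \<in> borel_measurable M"
    by (rule lborel.borel_measurable_nn_integral) (use measurable_compose[OF swap ga] in \<open>simp add: split_beta'\<close>)
  have "(\<integral>\<^sup>+\<omega>. (\<integral>\<^sup>+r\<in>A. g r \<omega> \<partial>lborel) \<partial>M) = (\<integral>\<^sup>+r. (\<integral>\<^sup>+\<omega>. g r \<omega> * indicator A r \<partial>M) \<partial>lborel)"
    by (rule Fubini'[OF ga])
  also have "\<dots> = (\<integral>\<^sup>+r\<in>A. (\<integral>\<^sup>+\<omega>. g r \<omega> \<partial>M) \<partial>lborel)"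
  proof (rule nn_integral_cong)
    fix r
    have [measurable]: "(\<lambda>\<omega>. g r \<omega>) \<in> borel_measurable M"
      using measurable_compose[OF measurable_Pair[OF measurable_const measurable_ident_sets[OF refl]] g, of r] by simp
    show "(\<integral>\<^sup>+\<omega>. g r \<omega> * indicator A r \<partial>M) = (\<integral>\<^sup>+\<omega>. g r \<omega> \<partial>M) * indicator A r"
      by (rule nn_integral_multc) measurable
  qed
  finally show "(\<integral>\<^sup>+\<omega>. (\<integral>\<^sup>+r\<in>A. g r \<omega> \<partial>lborel) \<partial>M) = (\<integral>\<^sup>+r\<in>A. (\<integral>\<^sup>+\<omega>. g r \<omega> \<partial>M) \<partial>lborel)" .
qed

text \<open>A continuous path on a compact interval is bounded, so for each outcome the indicators
  are eventually 1.\<close>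

lemma exit_time_Fatou:
  assumes T: "0 < T" "T < E" and [measurable]: "X \<in> borel_measurable M"
    and le: "\<And>n::nat. (\<integral>\<^sup>+\<omega>. indicator {\<omega> \<in> space M. T \<le> exit_time (real n) T \<omega>} \<omega> * X \<omega> \<partial>M) \<le> C"
  shows "(\<integral>\<^sup>+\<omega>. X \<omega> \<partial>M) \<le> C"
proof -
  let ?G = "\<lambda>n::nat. {\<omega> \<in> space M. T \<le> exit_time (real n) T \<omega>}"
  have [measurable]: "exit_time (real n) T \<in> borel_measurable M" for n by (rule exit_time_measurable[OF T])
  have "(\<integral>\<^sup>+\<omega>. X \<omega> \<partial>M) = (\<integral>\<^sup>+\<omega>. liminf (\<lambda>n. indicator (?G n) \<omega> * X \<omega>) \<partial>M)"
  proof (rule nn_integral_cong)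
    fix \<omega> assume \<omega>: "\<omega> \<in> space M"
    have "(\<lambda>n. indicator (?G n) \<omega> * X \<omega>) \<longlonglongrightarrow> X \<omega>"
    proof (rule tendsto_eventually)
      show "\<forall>\<^sub>F n in sequentially. indicator (?G n) \<omega> * X \<omega> = X \<omega>"
        using exit_time_eventually[OF T \<omega>] by eventually_elim (use \<omega> in auto)
    qed
    thus "X \<omega> = liminf (\<lambda>n. indicator (?G n) \<omega> * X \<omega>)"
      by (intro lim_imp_Liminf[symmetric]) auto
  qed
  also have "\<dots> \<le> liminf (\<lambda>n. \<integral>\<^sup>+\<omega>. indicator (?G n) \<omega> * X \<omega> \<partial>M)"
    by (rule nn_integral_liminf) measurable
  also have "\<dots> \<le> C"
    using Liminf_mono[of "\<lambda>n. \<integral>\<^sup>+\<omega>. indicator (?G n) \<omega> * X \<omega> \<partial>M" "\<lambda>_. C" sequentially] le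
    by (simp add: Liminf_const)
  finally show ?thesis .
qed

text \<open>For fixed \<open>T\<close> and \<open>R\<close> the stopped moment is bounded in time a
  priori and satisfies a Gronwall inequality whose constants contain neither of the two; the
  resulting bound allows \<open>R\<close> to tend to infinity. The increment estimate localizes at
  left ends of blocks, so it is applied to ever finer equidistant partitions, in whose limit the
  stopped moment itself stands under the integral.\<close>

lemma moment_bound:
  assumes k: "k \<ge> 1" and C0: "C0 \<ge> 0" "(\<integral>\<^sup>+\<omega>. ennreal (norm (Y 0 \<omega>) ^ (2 * k)) \<partial>M) \<le> ennreal C0"
  shows "\<exists>C\<ge>0. \<forall>t\<in>{0..<E}. (\<integral>\<^sup>+\<omega>. ennreal (norm (Y t \<omega>) ^ (2 * k)) \<partial>M) \<le> ennreal C"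
proof -
  obtain c where c: "c \<ge> 0" and inc: "\<And>T R N u (A :: nat \<Rightarrow> real ^ 'r ^ 'r). 0 < T \<Longrightarrow> T < E \<Longrightarrow> 0 \<le> R \<Longrightarrow>
    (\<forall>j<N. u j \<le> u (Suc j)) \<Longrightarrow> 0 \<le> u 0 \<Longrightarrow> u 0 < u N \<Longrightarrow> u N \<le> T \<Longrightarrow>
    (\<forall>j<N. \<forall>v. norm (A j *v v) \<le> norm v) \<Longrightarrow>
    (\<integral>\<^sup>+\<omega>. indicator {\<omega> \<in> space M. u N \<le> exit_time R T \<omega>} \<omega> *
        ennreal (norm (\<Sum>j<N. A j *v (Y (u (Suc j)) \<omega> - Y (u j) \<omega>)) ^ (2 * k)) \<partial>M)
      \<le> ennreal (c * (u N - u 0) ^ (k - 1)) * (\<Sum>j<N.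
          \<integral>\<^sup>+\<omega>. indicator {\<omega> \<in> space M. u j \<le> exit_time R T \<omega>} \<omega> *
            (\<integral>\<^sup>+r\<in>{u j<..u (Suc j)}. ennreal (1 + min R (norm (Y r \<omega>)) ^ (2 * k)) \<partial>lborel) \<partial>M)"
    using stopped_increment_moment[OF k, where 'q='r] by blast
  define c1 where "c1 = c * E ^ (k - 1)"
  have c1: "c1 \<ge> 0" using c E_pos by (simp add: c1_def)
  define a where "a = 2 ^ (2 * k) * (C0 + c1 * E)"
  \<comment> \<open>The added 1 makes \<open>b\<close> positive, as \<open>gronwall_ennreal\<close>
    divides by it.\<close>
  define b where "b = 2 ^ (2 * k) * c1 + 1"
  have a: "a \<ge> 0" "C0 \<le> a" and b: "b > 0"
  proof -
    have "C0 + c1 * E \<le> a" unfolding a_def using C0 c1 E_pos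
      by (intro mult_left_mono[of 1 "2 ^ (2*k)" "C0 + c1 * E", simplified mult_1 mult.commute[of "C0 + c1 * E"]]) auto
    moreover have "0 \<le> c1 * E" using c1 E_pos by simp
    ultimately show "a \<ge> 0" "C0 \<le> a" using C0 by linarith+
    show "b > 0" using c1 by (simp add: b_def add_nonneg_pos)
  qed
  have main: "(\<integral>\<^sup>+\<omega>. indicator {\<omega> \<in> space M. T \<le> exit_time R T \<omega>} \<omega> * ennreal (norm (Y T \<omega>) ^ (2 * k)) \<partial>M)
      \<le> ennreal (2 * a * exp (2 * b * E))" if T: "0 < T" "T < E" and R: "R \<ge> 0" for T R
  proof -
    let ?\<tau> = "exit_time R T"
    have [measurable]: "?\<tau> \<in> borel_measurable M" by (rule exit_time_measurable[OF T])
    \<comment> \<open>The indicator varies with the time \<open>t\<close> at which the moment is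
      taken, with the same exit time throughout.\<close>
    define f where "f t = (\<integral>\<^sup>+\<omega>. indicator {\<omega> \<in> space M. t \<le> ?\<tau> \<omega>} \<omega> * ennreal (norm (Y t \<omega>) ^ (2 * k)) \<partial>M)" for t
    have f_eq: "f t = (\<integral>\<^sup>+\<omega>. (if t \<le> ?\<tau> \<omega> then ennreal (norm (Y t \<omega>) ^ (2 * k)) else 0) \<partial>M)" for t
      unfolding f_def by (rule nn_integral_cong) auto
    have [measurable]: "(\<lambda>z. Y (fst z) (snd z)) \<in> borel_measurable (borel \<Otimes>\<^sub>M M)" by (rule Y_joint)
    have fm: "f \<in> borel_measurable borel"
      unfolding f_eq by (rule nn_integral_time_swap(2)[where A="{}"]) auto
    define m where "m r \<omega> = 1 + min R (norm (Y r \<omega>)) ^ (2 * k)" for r \<omega>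
    define mR where "mR = 1 + R ^ (2 * k)"
    have m: "0 \<le> m r \<omega>" "m r \<omega> \<le> mR" for r \<omega>
      using R by (auto simp: m_def mR_def add_nonneg_nonneg intro!: power_mono)
    have mR: "mR \<ge> 0" using R by (simp add: mR_def)
    have inc0: "(\<integral>\<^sup>+\<omega>. indicator {\<omega> \<in> space M. t \<le> ?\<tau> \<omega>} \<omega> * ennreal (norm (Y t \<omega> - Y 0 \<omega>) ^ (2 * k)) \<partial>M)
       \<le> ennreal c1 * (ennreal t + (\<integral>\<^sup>+r\<in>{0..t}. f r \<partial>lborel))" if t: "0 < t" "t \<le> T" for t
    proof -
      define \<Phi> where "\<Phi> = (\<integral>\<^sup>+\<omega>. (\<integral>\<^sup>+r\<in>{0<..t}. (if r \<le> ?\<tau> \<omega> then ennreal (m r \<omega>) else 0) \<partial>lborel) \<partial>M)"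
      let ?L = "\<integral>\<^sup>+\<omega>. indicator {\<omega> \<in> space M. t \<le> ?\<tau> \<omega>} \<omega> * ennreal (norm (Y t \<omega> - Y 0 \<omega>) ^ (2 * k)) \<partial>M"
      have mjm[measurable]: "(\<lambda>z. m (fst z) (snd z)) \<in> borel_measurable (borel \<Otimes>\<^sub>M M)"
        unfolding m_def by measurable
      have mjm': "(\<lambda>z. m (snd z) (fst z)) \<in> borel_measurable (M \<Otimes>\<^sub>M lborel)"
        unfolding m_def using Y_m[of snd "M \<Otimes>\<^sub>M lborel" fst] by measurable
      have \<Phi>jm: "(\<lambda>z. if fst z \<le> ?\<tau> (snd z) then ennreal (m (fst z) (snd z)) else 0) \<in> borel_measurable (borel \<Otimes>\<^sub>M M)"
        by measurable
      \<comment> \<open>With equal blocks, deciding the stopping at left ends overshoots the exit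
        time by at most one block, which costs \<open>mR * (t / real (Suc n))\<close>.\<close>
      have bnd: "?L \<le> ennreal (c * t ^ (k - 1)) * (\<Phi> + ennreal (mR * (t / real (Suc n))))" for n
      proof -
        define u where "u j = t * real j / real (Suc n)" for j
        have u: "u 0 = 0" "u (Suc n) = t" "\<And>j. u (Suc j) = u j + t / real (Suc n)"
        proof -
          show "u 0 = 0" by (simp add: u_def)
          show "u (Suc n) = t" by (simp add: u_def del: of_nat_Suc)
          fix j
          have "t * real (Suc j) = t * real j + t" by (simp add: algebra_simps)
          thus "u (Suc j) = u j + t / real (Suc n)" unfolding u_def by (simp only: add_divide_distrib)
        qed
        have umono: "u j \<le> u (Suc j)" for j using u(3)[of j] t by simp
        have u0: "0 \<le> u j" for j using t by (simp add: u_def)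
        have tel: "(\<Sum>j<Suc n. mat 1 *v (Y (u (Suc j)) \<omega> - Y (u j) \<omega>)) = Y t \<omega> - Y 0 \<omega>" for \<omega>
          using sum_lessThan_telescope[of "\<lambda>j. Y (u j) \<omega>" "Suc n"] u(1,2) by simp
        have "?L \<le> ennreal (c * t ^ (k - 1)) * (\<Sum>j<Suc n.
          \<integral>\<^sup>+\<omega>. indicator {\<omega> \<in> space M. u j \<le> ?\<tau> \<omega>} \<omega> * (\<integral>\<^sup>+r\<in>{u j<..u (Suc j)}. ennreal (m r \<omega>) \<partial>lborel) \<partial>M)"
          using inc[OF T R, of "Suc n" u "\<lambda>_. mat 1"] umono t u(1,2)
          unfolding tel m_def by simp
        also have "(\<Sum>j<Suc n. \<integral>\<^sup>+\<omega>. indicator {\<omega> \<in> space M. u j \<le> ?\<tau> \<omega>} \<omega> * (\<integral>\<^sup>+r\<in>{u j<..u (Suc j)}. ennreal (m r \<omega>) \<partial>lborel) \<partial>M)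
          = (\<integral>\<^sup>+\<omega>. (\<Sum>j<Suc n. indicator {\<omega> \<in> space M. u j \<le> ?\<tau> \<omega>} \<omega> * (\<integral>\<^sup>+r\<in>{u j<..u (Suc j)}. ennreal (m r \<omega>) \<partial>lborel)) \<partial>M)"
        proof (rule nn_integral_sum[symmetric])
          fix j
          have "(\<lambda>\<omega>. \<integral>\<^sup>+r\<in>{u j<..u (Suc j)}. ennreal (m r \<omega>) \<partial>lborel) \<in> borel_measurable M"
            by (rule nn_integral_time_swap(3)) auto
          thus "(\<lambda>\<omega>. indicator {\<omega> \<in> space M. u j \<le> ?\<tau> \<omega>} \<omega> * (\<integral>\<^sup>+r\<in>{u j<..u (Suc j)}. ennreal (m r \<omega>) \<partial>lborel)) \<in> borel_measurable M"
            by measurable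
        qed
        also have "\<dots> \<le> (\<integral>\<^sup>+\<omega>. (\<integral>\<^sup>+r\<in>{0<..t}. (if r \<le> ?\<tau> \<omega> then ennreal (m r \<omega>) else 0) \<partial>lborel) + ennreal (mR * (t / real (Suc n))) \<partial>M)"
        proof (rule nn_integral_mono)
          fix \<omega> assume \<omega>: "\<omega> \<in> space M"
          have [measurable]: "(\<lambda>r. m r \<omega>) \<in> borel_measurable borel"
            unfolding m_def using Y_path_measurable[OF \<omega>] by measurable
          \<comment> \<open>The second summand covers the part beyond the exit time of the block in
            which the exit occurs: that block ends at most one mesh width later.\<close>
          define g where "g r = (if r \<le> ?\<tau> \<omega> then ennreal (m r \<omega>) else 0)
             + ennreal mR * indicator {?\<tau> \<omega><..?\<tau> \<omega> + t / real (Suc n)} r" for r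
          have [measurable]: "g \<in> borel_measurable borel" unfolding g_def by measurable
          have Vsum: "(\<integral>\<^sup>+r\<in>{0<..u i}. g r \<partial>lborel) = (\<Sum>j<i. \<integral>\<^sup>+r\<in>{u j<..u (Suc j)}. g r \<partial>lborel)" for i
          proof (induction i)
            case (Suc i)
            have "{0<..u (Suc i)} = {0<..u i} \<union> {u i<..u (Suc i)}" "{0<..u i} \<inter> {u i<..u (Suc i)} = {}"
              using u0[of i] umono[of i] by auto
            thus ?case using Suc by (simp add: nn_integral_disjoint_pair)
          qed (simp add: u)
          have "(\<Sum>j<Suc n. indicator {\<omega> \<in> space M. u j \<le> ?\<tau> \<omega>} \<omega> * (\<integral>\<^sup>+r\<in>{u j<..u (Suc j)}. ennreal (m r \<omega>) \<partial>lborel))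
            \<le> (\<Sum>j<Suc n. \<integral>\<^sup>+r\<in>{u j<..u (Suc j)}. g r \<partial>lborel)"
          proof (rule sum_mono)
            fix j
            show "indicator {\<omega> \<in> space M. u j \<le> ?\<tau> \<omega>} \<omega> * (\<integral>\<^sup>+r\<in>{u j<..u (Suc j)}. ennreal (m r \<omega>) \<partial>lborel) \<le> (\<integral>\<^sup>+r\<in>{u j<..u (Suc j)}. g r \<partial>lborel)"
            proof (cases "u j \<le> ?\<tau> \<omega>")
              case True
              have "(\<integral>\<^sup>+r\<in>{u j<..u (Suc j)}. ennreal (m r \<omega>) \<partial>lborel) \<le> (\<integral>\<^sup>+r\<in>{u j<..u (Suc j)}. g r \<partial>lborel)"
              proof (rule nn_integral_mono)
                fix r
                show "ennreal (m r \<omega>) * indicator {u j<..u (Suc j)} r \<le> g r * indicator {u j<..u (Suc j)} r"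
                proof (cases "r \<in> {u j<..u (Suc j)}")
                  case r: True
                  hence "r \<le> ?\<tau> \<omega> + t / real (Suc n)" using True u(3)[of j] by simp
                  thus ?thesis using r m[of r \<omega>] by (auto simp: g_def intro!: ennreal_leI)
                qed simp
              qed
              thus ?thesis using True \<omega> by simp
            qed simp
          qed
          also have "\<dots> = (\<integral>\<^sup>+r\<in>{0<..t}. g r \<partial>lborel)" using Vsum[of "Suc n"] u(2) by simp
          also have "\<dots> \<le> (\<integral>\<^sup>+r. (if r \<le> ?\<tau> \<omega> then ennreal (m r \<omega>) else 0) * indicator {0<..t} r
             + ennreal mR * indicator {?\<tau> \<omega><..?\<tau> \<omega> + t / real (Suc n)} r \<partial>lborel)"
            by (intro nn_integral_mono) (auto simp: g_def split: split_indicator)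
          also have "\<dots> = (\<integral>\<^sup>+r\<in>{0<..t}. (if r \<le> ?\<tau> \<omega> then ennreal (m r \<omega>) else 0) \<partial>lborel)
             + (\<integral>\<^sup>+r. ennreal mR * indicator {?\<tau> \<omega><..?\<tau> \<omega> + t / real (Suc n)} r \<partial>lborel)"
            by (rule nn_integral_add) auto
          also have "(\<integral>\<^sup>+r. ennreal mR * indicator {?\<tau> \<omega><..?\<tau> \<omega> + t / real (Suc n)} r \<partial>lborel) = ennreal (mR * (t / real (Suc n)))"
            using t mR by (subst nn_integral_cmult_indicator) (auto simp: ennreal_mult[symmetric])
          finally show "(\<Sum>j<Suc n. indicator {\<omega> \<in> space M. u j \<le> ?\<tau> \<omega>} \<omega> * (\<integral>\<^sup>+r\<in>{u j<..u (Suc j)}. ennreal (m r \<omega>) \<partial>lborel))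
            \<le> (\<integral>\<^sup>+r\<in>{0<..t}. (if r \<le> ?\<tau> \<omega> then ennreal (m r \<omega>) else 0) \<partial>lborel) + ennreal (mR * (t / real (Suc n)))" .
        qed
        also have "\<dots> = \<Phi> + ennreal (mR * (t / real (Suc n)))"
          unfolding \<Phi>_def
          by (subst nn_integral_add) (auto simp: emeasure_space_1 intro!: nn_integral_time_swap(3)[OF \<Phi>jm])
        finally show ?thesis by (simp add: mult_left_mono)
      qed
      have lim: "(\<lambda>n. ennreal (c * t ^ (k - 1)) * (\<Phi> + ennreal (mR * (t / real (Suc n))))) \<longlonglongrightarrow> ennreal (c * t ^ (k - 1)) * (\<Phi> + ennreal (mR * 0))"
      proof (intro ennreal_tendsto_cmult tendsto_intros tendsto_ennrealI)
        have "(\<lambda>n. t * (1 / real (Suc n))) \<longlonglongrightarrow> t * 0"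
          by (intro tendsto_intros LIMSEQ_Suc lim_1_over_n)
        thus "(\<lambda>n. t / real (Suc n)) \<longlonglongrightarrow> 0" by simp
      qed simp
      have "?L \<le> ennreal (c * t ^ (k - 1)) * (\<Phi> + ennreal (mR * 0))"
        by (rule LIMSEQ_le_const[OF lim]) (use bnd in blast)
      hence "?L \<le> ennreal (c * t ^ (k - 1)) * \<Phi>" by simp
      also have "\<dots> \<le> ennreal c1 * \<Phi>"
        unfolding c1_def using c t T by (intro mult_right_mono ennreal_leI mult_left_mono power_mono) auto
      also have "\<Phi> = (\<integral>\<^sup>+r\<in>{0<..t}. (\<integral>\<^sup>+\<omega>. (if r \<le> ?\<tau> \<omega> then ennreal (m r \<omega>) else 0) \<partial>M) \<partial>lborel)"
        unfolding \<Phi>_def by (rule nn_integral_time_swap(1)[OF \<Phi>jm]) simp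
      also have "\<dots> \<le> (\<integral>\<^sup>+r. indicator {0..t} r + f r * indicator {0..t} r \<partial>lborel)"
      proof (rule nn_integral_mono)
        fix r
        have "(\<integral>\<^sup>+\<omega>. (if r \<le> ?\<tau> \<omega> then ennreal (m r \<omega>) else 0) \<partial>M)
           \<le> (\<integral>\<^sup>+\<omega>. 1 + (if r \<le> ?\<tau> \<omega> then ennreal (norm (Y r \<omega>) ^ (2 * k)) else 0) \<partial>M)"
        proof (rule nn_integral_mono)
          fix \<omega>
          have "min R (norm (Y r \<omega>)) ^ (2 * k) \<le> norm (Y r \<omega>) ^ (2 * k)" using R by (intro power_mono) auto
          hence "ennreal (m r \<omega>) \<le> ennreal (1 + norm (Y r \<omega>) ^ (2 * k))" unfolding m_def by (intro ennreal_leI) simp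
          thus "(if r \<le> ?\<tau> \<omega> then ennreal (m r \<omega>) else 0) \<le> 1 + (if r \<le> ?\<tau> \<omega> then ennreal (norm (Y r \<omega>) ^ (2 * k)) else 0)"
            by simp
        qed
        also have "\<dots> = 1 + f r"
          unfolding f_eq by (subst nn_integral_add) (auto simp: emeasure_space_1)
        finally show "(\<integral>\<^sup>+\<omega>. (if r \<le> ?\<tau> \<omega> then ennreal (m r \<omega>) else 0) \<partial>M) * indicator {0<..t} r
           \<le> indicator {0..t} r + f r * indicator {0..t} r" by (auto split: split_indicator)
      qed
      also have "\<dots> = ennreal t + (\<integral>\<^sup>+r\<in>{0..t}. f r \<partial>lborel)"
        using fm t by (subst nn_integral_add) auto
      finally show ?thesis by (simp add: mult_left_mono)
    qed
    have f0: "f 0 \<le> ennreal C0"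
      using C0(2) unfolding f_def by (rule order_trans[rotated]) (auto intro!: nn_integral_mono simp: indicator_def)
    have fle: "f t \<le> ennreal a + ennreal b * (\<integral>\<^sup>+r\<in>{0..t}. f r \<partial>lborel)" if t: "t \<in> {0..T}" for t
    proof (cases "t = 0")
      case True
      have "f t \<le> ennreal a" using f0 True a(2) by (auto intro: order_trans ennreal_leI)
      thus ?thesis by (simp add: add_increasing2)
    next
      case False
      hence t': "0 < t" "t \<le> T" using t by auto
      let ?I = "\<integral>\<^sup>+r\<in>{0..t}. f r \<partial>lborel"
      let ?P = "\<lambda>\<omega>. indicator {\<omega> \<in> space M. t \<le> ?\<tau> \<omega>} \<omega> * ennreal (norm (Y t \<omega> - Y 0 \<omega>) ^ (2 * k))"
      have "f t \<le> (\<integral>\<^sup>+\<omega>. ennreal (2 ^ (2 * k)) * (ennreal (norm (Y 0 \<omega>) ^ (2 * k)) + ?P \<omega>) \<partial>M)"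
        unfolding f_def
      proof (rule nn_integral_mono)
        fix \<omega>
        have "norm (Y t \<omega>) \<le> norm (Y 0 \<omega>) + norm (Y t \<omega> - Y 0 \<omega>)"
          using norm_triangle_ineq[of "Y 0 \<omega>" "Y t \<omega> - Y 0 \<omega>"] by simp
        hence "norm (Y t \<omega>) ^ (2 * k) \<le> (norm (Y 0 \<omega>) + norm (Y t \<omega> - Y 0 \<omega>)) ^ (2 * k)" by (rule power_mono) simp
        also have "\<dots> \<le> 2 ^ (2 * k) * (norm (Y 0 \<omega>) ^ (2 * k) + norm (Y t \<omega> - Y 0 \<omega>) ^ (2 * k))" by (rule add_power_le) auto
        finally have "ennreal (norm (Y t \<omega>) ^ (2 * k)) \<le> ennreal (2 ^ (2 * k)) * (ennreal (norm (Y 0 \<omega>) ^ (2 * k)) + ennreal (norm (Y t \<omega> - Y 0 \<omega>) ^ (2 * k)))"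
          by (simp add: ennreal_mult[symmetric] ennreal_plus[symmetric] ennreal_leI del: ennreal_plus)
        thus "indicator {\<omega> \<in> space M. t \<le> ?\<tau> \<omega>} \<omega> * ennreal (norm (Y t \<omega>) ^ (2 * k))
          \<le> ennreal (2 ^ (2 * k)) * (ennreal (norm (Y 0 \<omega>) ^ (2 * k)) + ?P \<omega>)"
          by (auto simp: indicator_def)
      qed
      also have "\<dots> = ennreal (2 ^ (2 * k)) * ((\<integral>\<^sup>+\<omega>. ennreal (norm (Y 0 \<omega>) ^ (2 * k)) \<partial>M) + (\<integral>\<^sup>+\<omega>. ?P \<omega> \<partial>M))"
      proof -
        have Pm: "?P \<in> borel_measurable M" by measurable
        have Ym: "(\<lambda>\<omega>. ennreal (norm (Y 0 \<omega>) ^ (2 * k))) \<in> borel_measurable M" by measurable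
        show ?thesis
          unfolding nn_integral_add[OF Ym Pm, symmetric] by (rule nn_integral_cmult) (intro borel_measurable_add Pm Ym)
      qed
      also have "\<dots> \<le> ennreal (2 ^ (2 * k)) * (ennreal C0 + ennreal c1 * (ennreal E + ?I))"
        using C0 inc0[OF t'] t' T
        by (intro mult_left_mono add_mono order_trans[OF inc0[OF t']] ennreal_leI) auto
      also have "\<dots> = ennreal a + ennreal (2 ^ (2 * k) * c1) * ?I"
        unfolding a_def using C0 c1 E_pos by (simp add: ennreal_mult ennreal_plus distrib_left mult.assoc add.assoc)
      also have "\<dots> \<le> ennreal a + ennreal b * ?I"
        unfolding b_def using c1 by (intro add_left_mono mult_right_mono ennreal_leI) auto
      finally show ?thesis .
    qed
    \<comment> \<open>For positive times the stopped process is bounded by \<open>R\<close>; at time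
      0 only the initial moment is available. This bound enters \<open>gronwall_ennreal\<close>
      merely for finiteness.\<close>
    have fb: "f t \<le> ennreal (max (R ^ (2 * k)) C0)" if t: "t \<in> {0..T}" for t
    proof (cases "t = 0")
      case True
      have "ennreal C0 \<le> ennreal (max (R ^ (2 * k)) C0)" by (rule ennreal_leI) simp
      thus ?thesis using f0 True order_trans by blast
    next
      case False
      have "f t \<le> (\<integral>\<^sup>+\<omega>. ennreal (R ^ (2 * k)) \<partial>M)"
        unfolding f_def
      proof (rule nn_integral_mono)
        fix \<omega> assume \<omega>: "\<omega> \<in> space M"
        show "indicator {\<omega> \<in> space M. t \<le> ?\<tau> \<omega>} \<omega> * ennreal (norm (Y t \<omega>) ^ (2 * k)) \<le> ennreal (R ^ (2 * k))"
          using norm_le_before_exit_time[OF T \<omega>, of t R] t False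
          by (auto simp: indicator_def intro!: ennreal_leI power_mono)
      qed
      also have "\<dots> = ennreal (R ^ (2 * k))" by (simp add: emeasure_space_1)
      also have "\<dots> \<le> ennreal (max (R ^ (2 * k)) C0)" by (rule ennreal_leI) simp
      finally show ?thesis .
    qed
    have "f T \<le> ennreal (2 * a * exp (2 * b * T))"
      by (rule gronwall_ennreal[OF fm fb a(1) b fle]) (use T in auto)
    also have "\<dots> \<le> ennreal (2 * a * exp (2 * b * E))"
      using T a b by (intro ennreal_leI mult_left_mono) auto
    finally show ?thesis unfolding f_def .
  qed
  \<comment> \<open>\<open>C0\<close> is added for the time 0, which the stopped estimate does not
    reach.\<close>
  define C where "C = 2 * a * exp (2 * b * E) + C0"
  have "(\<integral>\<^sup>+\<omega>. ennreal (norm (Y t \<omega>) ^ (2 * k)) \<partial>M) \<le> ennreal C" if t: "t \<in> {0..<E}" for t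
  proof (cases "t = 0")
    case True
    have "ennreal C0 \<le> ennreal C" unfolding C_def using a by (intro ennreal_leI) auto
    thus ?thesis using True C0(2) order_trans by blast
  next
    case False
    hence t': "0 < t" "t < E" using t by auto
    have "(\<integral>\<^sup>+\<omega>. ennreal (norm (Y t \<omega>) ^ (2 * k)) \<partial>M) \<le> ennreal (2 * a * exp (2 * b * E))"
      by (rule exit_time_Fatou[OF t' _ main[OF t']]) auto
    also have "\<dots> \<le> ennreal C" unfolding C_def using C0 by (intro ennreal_leI) auto
    finally show ?thesis .
  qed
  moreover have "C \<ge> 0" unfolding C_def using a C0 by auto
  ultimately show ?thesis by blast
qed

text \<open>With moments bounded uniformly in time, the sum over blocks on the right of the stopped
  estimate is at most \<open>(1 + C) * (u N - u 0)\<close>. This raises the exponent from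
  \<open>k - 1\<close> to \<open>k\<close>, which for \<open>k = 2\<close> is the order Kolmogorov's
  criterion needs; \<open>exit_time_Fatou\<close> removes the stopping.\<close>

lemma increment_moment:
  assumes k: "k \<ge> 1" and C: "C \<ge> 0" "\<And>t. t \<in> {0..<E} \<Longrightarrow> (\<integral>\<^sup>+\<omega>. ennreal (norm (Y t \<omega>) ^ (2 * k)) \<partial>M) \<le> ennreal C"
  shows "\<exists>c\<ge>0. \<forall>N u (A :: nat \<Rightarrow> real ^ 'r ^ 'q).
    (\<forall>j<N. u j \<le> u (Suc j)) \<longrightarrow> 0 \<le> u 0 \<longrightarrow> u 0 < u N \<longrightarrow> u N < E \<longrightarrow>
    (\<forall>j<N. \<forall>v. norm (A j *v v) \<le> norm v) \<longrightarrow>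
    (\<integral>\<^sup>+\<omega>. ennreal (norm (\<Sum>j<N. A j *v (Y (u (Suc j)) \<omega> - Y (u j) \<omega>)) ^ (2 * k)) \<partial>M)
      \<le> ennreal (c * (u N - u 0) ^ k)"
proof -
  obtain c where c: "c \<ge> 0" and inc: "\<And>T R N u (A :: nat \<Rightarrow> real ^ 'r ^ 'q). 0 < T \<Longrightarrow> T < E \<Longrightarrow> 0 \<le> R \<Longrightarrow>
    (\<forall>j<N. u j \<le> u (Suc j)) \<Longrightarrow> 0 \<le> u 0 \<Longrightarrow> u 0 < u N \<Longrightarrow> u N \<le> T \<Longrightarrow>
    (\<forall>j<N. \<forall>v. norm (A j *v v) \<le> norm v) \<Longrightarrow>
    (\<integral>\<^sup>+\<omega>. indicator {\<omega> \<in> space M. u N \<le> exit_time R T \<omega>} \<omega> *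
        ennreal (norm (\<Sum>j<N. A j *v (Y (u (Suc j)) \<omega> - Y (u j) \<omega>)) ^ (2 * k)) \<partial>M)
      \<le> ennreal (c * (u N - u 0) ^ (k - 1)) * (\<Sum>j<N.
          \<integral>\<^sup>+\<omega>. indicator {\<omega> \<in> space M. u j \<le> exit_time R T \<omega>} \<omega> *
            (\<integral>\<^sup>+r\<in>{u j<..u (Suc j)}. ennreal (1 + min R (norm (Y r \<omega>)) ^ (2 * k)) \<partial>lborel) \<partial>M)"
    using stopped_increment_moment[OF k, where 'q='q] by blast
  have "(\<integral>\<^sup>+\<omega>. ennreal (norm (\<Sum>j<N. A j *v (Y (u (Suc j)) \<omega> - Y (u j) \<omega>)) ^ (2 * k)) \<partial>M)
      \<le> ennreal (c * (1 + C) * (u N - u 0) ^ k)"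
    if u: "\<forall>j<N. u j \<le> u (Suc j)" "0 \<le> u 0" "u 0 < u N" "u N < E"
      and A: "\<forall>j<N. \<forall>v. norm (A j *v v) \<le> norm v" for N u and A :: "nat \<Rightarrow> real ^ 'r ^ 'q"
  proof -
    have um: "u i \<le> u j" if "i \<le> j" "j \<le> N" for i j
      using that
    proof (induction j rule: dec_induct)
      case (step m)
      thus ?case using u(1)[rule_format, of m] by auto
    qed simp
    define L where "L = u N - u 0"
    have L: "L > 0" using u by (simp add: L_def)
    have T: "0 < u N" "u N < E" using u by auto
    have [measurable]: "(\<lambda>z. Y (fst z) (snd z)) \<in> borel_measurable (borel \<Otimes>\<^sub>M M)" by (rule Y_joint)
    show ?thesis
    proof (rule exit_time_Fatou[OF T])
      show "(\<lambda>\<omega>. ennreal (norm (\<Sum>j<N. A j *v (Y (u (Suc j)) \<omega> - Y (u j) \<omega>)) ^ (2 * k))) \<in> borel_measurable M"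
        by measurable
      fix n :: nat
      have "(\<integral>\<^sup>+\<omega>. indicator {\<omega> \<in> space M. u N \<le> exit_time (real n) (u N) \<omega>} \<omega> *
          ennreal (norm (\<Sum>j<N. A j *v (Y (u (Suc j)) \<omega> - Y (u j) \<omega>)) ^ (2 * k)) \<partial>M)
        \<le> ennreal (c * L ^ (k - 1)) * (\<Sum>j<N.
          \<integral>\<^sup>+\<omega>. indicator {\<omega> \<in> space M. u j \<le> exit_time (real n) (u N) \<omega>} \<omega> *
            (\<integral>\<^sup>+r\<in>{u j<..u (Suc j)}. ennreal (1 + min (real n) (norm (Y r \<omega>)) ^ (2 * k)) \<partial>lborel) \<partial>M)"
        unfolding L_def by (rule inc[OF T _ u(1-3) _ A]) auto
      also have "\<dots> \<le> ennreal (c * L ^ (k - 1)) * (\<Sum>j<N. ennreal ((1 + C) * (u (Suc j) - u j)))"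
      proof (intro mult_left_mono sum_mono)
        fix j assume j: "j \<in> {..<N}"
        hence uj: "0 \<le> u j" "u j \<le> u (Suc j)" "u (Suc j) < E" using um[of 0 j] um[of "Suc j" N] u by auto
        have "(\<integral>\<^sup>+\<omega>. indicator {\<omega> \<in> space M. u j \<le> exit_time (real n) (u N) \<omega>} \<omega> *
            (\<integral>\<^sup>+r\<in>{u j<..u (Suc j)}. ennreal (1 + min (real n) (norm (Y r \<omega>)) ^ (2 * k)) \<partial>lborel) \<partial>M)
          \<le> (\<integral>\<^sup>+\<omega>. (\<integral>\<^sup>+r\<in>{u j<..u (Suc j)}. ennreal (1 + norm (Y r \<omega>) ^ (2 * k)) \<partial>lborel) \<partial>M)"
        proof (rule nn_integral_mono)
          fix \<omega>
          have "(\<integral>\<^sup>+r\<in>{u j<..u (Suc j)}. ennreal (1 + min (real n) (norm (Y r \<omega>)) ^ (2 * k)) \<partial>lborel)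
             \<le> (\<integral>\<^sup>+r\<in>{u j<..u (Suc j)}. ennreal (1 + norm (Y r \<omega>) ^ (2 * k)) \<partial>lborel)"
            by (intro nn_integral_mono mult_right_mono ennreal_leI add_left_mono power_mono) auto
          thus "indicator {\<omega> \<in> space M. u j \<le> exit_time (real n) (u N) \<omega>} \<omega> *
            (\<integral>\<^sup>+r\<in>{u j<..u (Suc j)}. ennreal (1 + min (real n) (norm (Y r \<omega>)) ^ (2 * k)) \<partial>lborel)
            \<le> (\<integral>\<^sup>+r\<in>{u j<..u (Suc j)}. ennreal (1 + norm (Y r \<omega>) ^ (2 * k)) \<partial>lborel)"
            by (auto simp: indicator_def)
        qed
        also have "\<dots> = (\<integral>\<^sup>+r\<in>{u j<..u (Suc j)}. (\<integral>\<^sup>+\<omega>. ennreal (1 + norm (Y r \<omega>) ^ (2 * k)) \<partial>M) \<partial>lborel)"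
          by (rule nn_integral_time_swap(1)) auto
        also have "\<dots> \<le> (\<integral>\<^sup>+r\<in>{u j<..u (Suc j)}. ennreal (1 + C) \<partial>lborel)"
        proof (rule nn_integral_mono)
          fix r
          show "(\<integral>\<^sup>+\<omega>. ennreal (1 + norm (Y r \<omega>) ^ (2 * k)) \<partial>M) * indicator {u j<..u (Suc j)} r \<le> ennreal (1 + C) * indicator {u j<..u (Suc j)} r"
          proof (cases "r \<in> {u j<..u (Suc j)}")
            case True
            have "(\<integral>\<^sup>+\<omega>. ennreal (1 + norm (Y r \<omega>) ^ (2 * k)) \<partial>M) = 1 + (\<integral>\<^sup>+\<omega>. ennreal (norm (Y r \<omega>) ^ (2 * k)) \<partial>M)"
              by (simp add: nn_integral_add emeasure_space_1)
            also have "\<dots> \<le> 1 + ennreal C" using C(2)[of r] True uj by (intro add_left_mono) auto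
            also have "\<dots> = ennreal (1 + C)" using C by (simp add: ennreal_plus)
            finally show ?thesis using True by simp
          qed simp
        qed
        also have "\<dots> = ennreal ((1 + C) * (u (Suc j) - u j))"
          using uj C by (subst nn_integral_cmult_indicator) (auto simp: ennreal_mult)
        finally show "(\<integral>\<^sup>+\<omega>. indicator {\<omega> \<in> space M. u j \<le> exit_time (real n) (u N) \<omega>} \<omega> *
            (\<integral>\<^sup>+r\<in>{u j<..u (Suc j)}. ennreal (1 + min (real n) (norm (Y r \<omega>)) ^ (2 * k)) \<partial>lborel) \<partial>M)
          \<le> ennreal ((1 + C) * (u (Suc j) - u j))" .
      qed simp
      also have "(\<Sum>j<N. ennreal ((1 + C) * (u (Suc j) - u j))) = ennreal (\<Sum>j<N. (1 + C) * (u (Suc j) - u j))"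
        using u C by (intro sum_ennreal) auto
      also have "(\<Sum>j<N. (1 + C) * (u (Suc j) - u j)) = (1 + C) * L"
        by (simp add: sum_distrib_left[symmetric] sum_lessThan_telescope L_def)
      also have "ennreal (c * L ^ (k - 1)) * ennreal ((1 + C) * L) = ennreal (c * (1 + C) * (L ^ (k - 1) * L))"
        using c C L by (simp add: ennreal_mult[symmetric] mult_ac)
      also have "L ^ (k - 1) * L = L ^ k" using k by (cases k) auto
      finally show "(\<integral>\<^sup>+\<omega>. indicator {\<omega> \<in> space M. u N \<le> exit_time (real n) (u N) \<omega>} \<omega> *
          ennreal (norm (\<Sum>j<N. A j *v (Y (u (Suc j)) \<omega> - Y (u j) \<omega>)) ^ (2 * k)) \<partial>M)
        \<le> ennreal (c * (1 + C) * (u N - u 0) ^ k)" unfolding L_def .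
    qed
  qed
  moreover have "c * (1 + C) \<ge> 0" using c C by simp
  ultimately show ?thesis by blast
qed

end

section \<open>Hoelder continuity of paths\<close>

lemma holder_continuous_on_add:
  fixes f g :: "real \<Rightarrow> 'b::real_normed_vector"
  assumes "holder_continuous_on \<alpha> A f" "holder_continuous_on \<alpha> A g"
  shows "holder_continuous_on \<alpha> A (\<lambda>t. f t + g t)"
proof -
  obtain C where C: "\<And>s t. s \<in> A \<Longrightarrow> t \<in> A \<Longrightarrow> dist (f s) (f t) \<le> C * \<bar>s - t\<bar> powr \<alpha>"
    using assms(1) unfolding holder_continuous_on_def by blast
  obtain C' where C': "\<And>s t. s \<in> A \<Longrightarrow> t \<in> A \<Longrightarrow> dist (g s) (g t) \<le> C' * \<bar>s - t\<bar> powr \<alpha>"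
    using assms(2) unfolding holder_continuous_on_def by blast
  have "dist (f s + g s) (f t + g t) \<le> (C + C') * \<bar>s - t\<bar> powr \<alpha>" if "s \<in> A" "t \<in> A" for s t
    using dist_triangle_add[of "f s" "g s" "f t" "g t"] C[OF that] C'[OF that] by (simp add: distrib_right)
  thus ?thesis unfolding holder_continuous_on_def by blast
qed

lemma holder_continuous_on_cong:
  "holder_continuous_on \<alpha> A f \<Longrightarrow> (\<And>x. x \<in> A \<Longrightarrow> f x = g x) \<Longrightarrow> holder_continuous_on \<alpha> A g"
  unfolding holder_continuous_on_def by metis

text \<open>Kolmogorov's continuity criterion for fourth moments; continuity of the paths themselves is
  given, so that only the dyadic increments have to be controlled.\<close>

lemma (in prob_space) kolmogorov_holder:
  fixes N :: "real \<Rightarrow> 'a \<Rightarrow> 'b::euclidean_space"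
  assumes [measurable]: "\<And>t. N t \<in> borel_measurable M" and T: "T > 0" and c: "c \<ge> 0"
    and mom: "\<And>s t. 0 \<le> s \<Longrightarrow> s < t \<Longrightarrow> t < T \<Longrightarrow>
      (\<integral>\<^sup>+\<omega>. ennreal (norm (N t \<omega> - N s \<omega>) ^ 4) \<partial>M) \<le> ennreal (c * (t - s)\<^sup>2)"
    and cont: "AE \<omega> in M. continuous_on {0..<T} (\<lambda>t. N t \<omega>)"
  shows "AE \<omega> in M. holder_continuous_on (1 / 8) {0..<T} (\<lambda>t. N t \<omega>)"
proof -
  define \<rho> :: real where "\<rho> = 2 powr - (1 / 8)"
  \<comment> \<open>Here \<theta> is the inverse square root of 2. Level \<open>n\<close> has at
    most \<open>2 ^ n\<close> increments, each of fourth moment at most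
    \<open>c * (T / 2 ^ n)\<^sup>2\<close>; after division by \<open>\<theta> ^ n\<close> the level
    contributes at most \<open>c * T\<^sup>2 * (1 / (2 * \<theta>)) ^ n\<close>, and 1 / (2
    \<theta>) = \<theta> < 1.\<close>
  define \<theta> where "\<theta> = \<rho> ^ 4"
  have \<rho>: "0 < \<rho>" by (simp add: \<rho>_def)
  have \<theta>2: "\<theta> * \<theta> = 1 / 2"
  proof -
    have "\<theta> * \<theta> = \<rho> ^ 8" unfolding \<theta>_def by (simp add: power_add[symmetric])
    also have "\<dots> = 2 powr (- 1)" unfolding \<rho>_def by (subst powr_power) auto
    also have "\<dots> = 1 / 2" by (simp add: powr_minus)
    finally show ?thesis .
  qed
  have \<theta>0: "0 < \<theta>" using \<rho> by (simp add: \<theta>_def)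
  have \<theta>1: "\<theta> < 1"
  proof (rule ccontr)
    assume "\<not> \<theta> < 1"
    hence "1 * 1 \<le> \<theta> * \<theta>" by (intro mult_mono) auto
    thus False using \<theta>2 by simp
  qed
  have \<theta>': "2 * (1 / \<theta>) * (1 / 4) = \<theta>" using \<theta>2 \<theta>0 by (simp add: field_simps)
  define x where "x n j = T * real j / 2 ^ n" for n j :: nat
  define d where "d n j \<omega> = norm (N (x n (Suc j)) \<omega> - N (x n j) \<omega>) ^ 4 * (1 / \<theta>) ^ n" for n j \<omega>
  have d0: "d n j \<omega> \<ge> 0" for n j \<omega> using \<theta>0 by (simp add: d_def)
  have [measurable]: "d n j \<in> borel_measurable M" for n j unfolding d_def by measurable
  \<comment> \<open>A single random variable dominating all weighted dyadic increments; its finite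
    expectation makes it finite almost surely.\<close>
  define \<Psi> where "\<Psi> \<omega> = (\<Sum>n. \<Sum>j\<in>{j. Suc j < 2 ^ n}. ennreal (d n j \<omega>))" for \<omega>
  have fin: "finite {j::nat. Suc j < 2 ^ n}" for n by (rule finite_subset[of _ "{..2^n}"]) auto
  have cardle: "card {j::nat. Suc j < 2 ^ n} \<le> 2 ^ n" for n
  proof -
    have "{j::nat. Suc j < 2 ^ n} \<subseteq> {..<2 ^ n}" by auto
    from card_mono[OF _ this] show ?thesis by simp
  qed
  have Ed: "(\<integral>\<^sup>+\<omega>. ennreal (d n j \<omega>) \<partial>M) \<le> ennreal (c * T\<^sup>2 * ((1 / 4) * (1 / \<theta>)) ^ n)" if j: "Suc j < 2 ^ n" for n j
  proof -
    have xx: "x n (Suc j) - x n j = T / 2 ^ n" by (simp add: x_def algebra_simps add_divide_distrib)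
    have "real (Suc j) < 2 ^ n" using j of_nat_less_iff[where 'a=real, of "Suc j" "2^n"] by (simp del: of_nat_Suc)
    hence "T * real (Suc j) < T * 2 ^ n" using T by (rule mult_strict_left_mono)
    hence xT: "0 \<le> x n j" "x n j < x n (Suc j)" "x n (Suc j) < T"
      using xx T by (auto simp: x_def divide_less_eq simp del: of_nat_Suc)
    have "(\<integral>\<^sup>+\<omega>. ennreal (d n j \<omega>) \<partial>M) = (\<integral>\<^sup>+\<omega>. ennreal (norm (N (x n (Suc j)) \<omega> - N (x n j) \<omega>) ^ 4) \<partial>M) * ennreal ((1 / \<theta>) ^ n)"
      unfolding d_def using \<theta>0 by (subst nn_integral_multc[symmetric]) (auto simp: ennreal_mult)
    also have "\<dots> \<le> ennreal (c * (T / 2 ^ n)\<^sup>2) * ennreal ((1 / \<theta>) ^ n)"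
      using mom[OF xT] unfolding xx by (rule mult_right_mono) simp
    also have "\<dots> = ennreal (c * T\<^sup>2 * ((1 / 4) * (1 / \<theta>)) ^ n)"
    proof -
      have "((2::real) ^ n)\<^sup>2 = 4 ^ n" by (simp add: power2_eq_square power_mult_distrib[symmetric])
      thus ?thesis using c \<theta>0 by (simp add: ennreal_mult[symmetric] power_divide power_mult_distrib)
    qed
    finally show ?thesis .
  qed
  have "(\<integral>\<^sup>+\<omega>. \<Psi> \<omega> \<partial>M) = (\<Sum>n. \<Sum>j\<in>{j. Suc j < 2 ^ n}. \<integral>\<^sup>+\<omega>. ennreal (d n j \<omega>) \<partial>M)"
    unfolding \<Psi>_def by (subst nn_integral_suminf) (auto simp: nn_integral_sum)
  also have "\<dots> \<le> (\<Sum>n. ennreal (c * T\<^sup>2 * \<theta> ^ n))"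
  proof (rule suminf_le)
    fix n
    have "(\<Sum>j\<in>{j. Suc j < 2 ^ n}. \<integral>\<^sup>+\<omega>. ennreal (d n j \<omega>) \<partial>M)
      \<le> (\<Sum>j\<in>{j::nat. Suc j < 2 ^ n}. ennreal (c * T\<^sup>2 * ((1 / 4) * (1 / \<theta>)) ^ n))"
      by (rule sum_mono) (use Ed in auto)
    also have "\<dots> = of_nat (card {j::nat. Suc j < 2 ^ n}) * ennreal (c * T\<^sup>2 * ((1 / 4) * (1 / \<theta>)) ^ n)" by simp
    also have "\<dots> \<le> of_nat (2 ^ n) * ennreal (c * T\<^sup>2 * ((1 / 4) * (1 / \<theta>)) ^ n)"
      using cardle by (intro mult_right_mono) (simp_all only: of_nat_le_iff zero_le)
    also have "\<dots> = ennreal (2 ^ n) * ennreal (c * T\<^sup>2 * ((1 / 4) * (1 / \<theta>)) ^ n)"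
      by (simp add: ennreal_of_nat_eq_real_of_nat)
    also have "\<dots> = ennreal (c * T\<^sup>2 * (2 ^ n * ((1 / 4) * (1 / \<theta>)) ^ n))"
      using c \<theta>0 by (subst ennreal_mult[symmetric]) (auto simp: mult_ac)
    also have "2 ^ n * ((1 / 4) * (1 / \<theta>)) ^ n = (2 * (1 / \<theta>) * (1 / 4)) ^ n"
      unfolding power_mult_distrib by (simp add: mult_ac)
    also have "\<dots> = \<theta> ^ n" unfolding \<theta>' ..
    finally show "(\<Sum>j\<in>{j. Suc j < 2 ^ n}. \<integral>\<^sup>+\<omega>. ennreal (d n j \<omega>) \<partial>M) \<le> ennreal (c * T\<^sup>2 * \<theta> ^ n)" .
  qed auto
  also have "\<dots> = ennreal (\<Sum>n. c * T\<^sup>2 * \<theta> ^ n)"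
    by (rule suminf_ennreal2) (use c \<theta>0 \<theta>1 in \<open>auto intro!: summable_mult summable_geometric\<close>)
  finally have "(\<integral>\<^sup>+\<omega>. \<Psi> \<omega> \<partial>M) < \<infinity>" by (simp add: le_less_trans[OF _ ennreal_less_top])
  hence "AE \<omega> in M. \<Psi> \<omega> \<noteq> \<infinity>"
    by (intro nn_integral_PInf_AE) (auto simp: \<Psi>_def)
  thus ?thesis using cont
  proof eventually_elim
    case (elim \<omega>)
    obtain \<psi> where \<psi>: "\<Psi> \<omega> = ennreal \<psi>" "\<psi> \<ge> 0" using elim(1) by (cases "\<Psi> \<omega>") auto
    \<comment> \<open>Since \<open>K\<close> is at least 1, \<open>\<psi> \<le> K ^ 4\<close>, and
      no fourth root of \<open>\<psi>\<close> has to be taken.\<close>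
    define K where "K = max 1 \<psi>"
    have K: "K \<ge> 1" "\<psi> \<le> K" by (auto simp: K_def)
    show ?case
    proof (rule dyadic_chaining[OF elim(2) T, where K=K])
      fix n j :: nat assume j: "Suc j < 2 ^ n"
      have "ennreal (d n j \<omega>) \<le> (\<Sum>j\<in>{j. Suc j < 2 ^ n}. ennreal (d n j \<omega>))"
        by (rule member_le_sum) (use j fin in auto)
      also have "\<dots> \<le> \<Psi> \<omega>"
        unfolding \<Psi>_def using sum_le_suminf[of "\<lambda>n. \<Sum>j\<in>{j. Suc j < 2 ^ n}. ennreal (d n j \<omega>)" "{n}"] by simp
      finally have "d n j \<omega> \<le> \<psi>" using \<psi> by simp
      hence "norm (N (x n (Suc j)) \<omega> - N (x n j) \<omega>) ^ 4 \<le> \<psi> * \<theta> ^ n"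
        using \<theta>0 by (simp add: d_def power_divide field_simps)
      also have "\<dots> \<le> K ^ 4 * \<theta> ^ n"
      proof (rule mult_right_mono)
        have "K ^ 1 \<le> K ^ 4" using K by (intro power_increasing) auto
        thus "\<psi> \<le> K ^ 4" using K by simp
      qed (use \<theta>0 in simp)
      also have "\<dots> = (K * \<rho> ^ n) ^ 4" by (simp add: \<theta>_def power_mult_distrib power_mult[symmetric] mult.commute)
      finally have "norm (N (x n (Suc j)) \<omega> - N (x n j) \<omega>) \<le> K * \<rho> ^ n"
        by (rule power_le_imp_le_base[of _ 3, simplified, rotated -1] power_mono_iff[THEN iffD1, rotated -1])
           (use K \<rho> in auto)
      thus "norm (N (T * real (Suc j) / 2 ^ n) \<omega> - N (T * real j / 2 ^ n) \<omega>) \<le> K * (2 powr - (1 / 8)) ^ n"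
        by (simp only: x_def \<rho>_def)
    qed (use K in auto)
  qed
qed

section \<open>Primitives of square integrable functions and Riemann sums\<close>

lemma ennreal_power2_le_imp_le:
  assumes "x\<^sup>2 \<le> (ennreal b)\<^sup>2" "0 \<le> b"
  shows "x \<le> ennreal b"
proof (cases x)
  case (real a)
  hence "a\<^sup>2 \<le> b\<^sup>2" using assms by (simp add: ennreal_power)
  thus ?thesis using real assms by (auto intro!: ennreal_leI power2_le_imp_le)
next
  case top
  thus ?thesis using assms by (simp add: ennreal_power top_unique power2_eq_square ennreal_mult_eq_top_iff)
qed

text \<open>Cauchy-Schwarz gives exponent 1/2; on a bounded interval it may be lowered to 1/8 to
  match the stochastic part.\<close>

lemma square_integrable_primitive_holder:
  fixes g :: "real \<Rightarrow> 'b::euclidean_space"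
  assumes [measurable]: "g \<in> borel_measurable borel" and E: "E > 0"
    and fin: "(\<integral>\<^sup>+r\<in>{0<..<E}. ennreal ((norm (g r))\<^sup>2) \<partial>lborel) < \<infinity>"
  shows "holder_continuous_on (1 / 8) {0..<E} (\<lambda>t. LINT r:{0..t}|lborel. g r)"
    and "\<And>s t. 0 \<le> s \<Longrightarrow> t < E \<Longrightarrow> set_integrable lborel {s..t} g"
proof -
  obtain Q where Q: "(\<integral>\<^sup>+r\<in>{0<..<E}. ennreal ((norm (g r))\<^sup>2) \<partial>lborel) = ennreal Q" "Q \<ge> 0"
    using fin by (cases "\<integral>\<^sup>+r\<in>{0<..<E}. ennreal ((norm (g r))\<^sup>2) \<partial>lborel") auto
  have L2: "(\<integral>\<^sup>+r\<in>{s<..t}. ennreal (norm (g r)) \<partial>lborel) \<le> ennreal (sqrt ((t - s) * Q))"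
    if st: "0 \<le> s" "s < t" "t < E" for s t
  proof -
    have "(\<integral>\<^sup>+r\<in>{s<..t}. ennreal (norm (g r)) \<partial>lborel) ^ 2 \<le> ennreal ((t - s) ^ (2 - 1)) * (\<integral>\<^sup>+r\<in>{s<..t}. ennreal (norm (g r) ^ 2) \<partial>lborel)"
      by (rule nn_integral_power_mean) (use st in auto)
    also have "\<dots> \<le> ennreal (t - s) * ennreal Q"
      unfolding Q(1)[symmetric] using st
      by (intro mult_mono nn_integral_mono) (auto simp: indicator_def)
    also have "\<dots> = ennreal (sqrt ((t - s) * Q)) ^ 2"
      using st Q by (simp add: ennreal_power ennreal_mult[symmetric])
    finally show ?thesis by (rule ennreal_power2_le_imp_le) (use st Q in simp)
  qed
  have int': "set_integrable lborel {s<..t} g" if st: "0 \<le> s" "s < t" "t < E" for s t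
    unfolding set_integrable_def
  proof (rule integrableI_bounded)
    have "(\<integral>\<^sup>+r. ennreal (norm (indicator {s<..t} r *\<^sub>R g r)) \<partial>lborel) = (\<integral>\<^sup>+r\<in>{s<..t}. ennreal (norm (g r)) \<partial>lborel)"
      by (rule nn_integral_cong) (auto simp: indicator_def)
    also have "\<dots> < \<infinity>" using L2[OF st] by (simp add: le_less_trans[OF _ ennreal_less_top])
    finally show "(\<integral>\<^sup>+r. ennreal (norm (indicator {s<..t} r *\<^sub>R g r)) \<partial>lborel) < \<infinity>" .
  qed measurable
  show int: "set_integrable lborel {s..t} g" if st: "0 \<le> s" "t < E" for s t
  proof (cases "s < t")
    case True
    have "set_integrable lborel {s} g"
    proof -
      have ae: "AE r in lborel. indicator {s} r *\<^sub>R g r = 0"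
        using AE_lborel_singleton[of s] by eventually_elim (auto simp: indicator_def)
      show ?thesis unfolding set_integrable_def by (subst integrable_cong_AE[OF _ _ ae]) auto
    qed
    hence "set_integrable lborel ({s} \<union> {s<..t}) g"
      by (rule set_integrable_Un) (use int' st True in auto)
    moreover have "{s} \<union> {s<..t} = {s..t}" using True by auto
    ultimately show ?thesis by simp
  next
    case False
    have ae: "AE r in lborel. indicator {s..t} r *\<^sub>R g r = 0"
      using AE_lborel_singleton[of s] by eventually_elim (use False in \<open>auto simp: indicator_def\<close>)
    show ?thesis unfolding set_integrable_def by (subst integrable_cong_AE[OF _ _ ae]) auto
  qed
  \<comment> \<open>The exponent 3/8 is the difference between 1/2 and 1/8.\<close>
  define C where "C = sqrt Q * E powr (3 / 8)"
  have main: "dist (LINT r:{0..s}|lborel. g r) (LINT r:{0..t}|lborel. g r) \<le> C * \<bar>s - t\<bar> powr (1 / 8)"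
    if st: "0 \<le> s" "s < t" "t < E" for s t
  proof -
    have un: "{0..t} = {0..s} \<union> {s<..t}" "{0..s} \<inter> {s<..t} = {}" using st by auto
    have "(LINT r:{0..t}|lborel. g r) = (LINT r:{0..s}|lborel. g r) + (LINT r:{s<..t}|lborel. g r)"
      unfolding un(1) by (rule set_integral_Un) (use un int[of 0 s] int'[OF st] st in auto)
    hence "dist (LINT r:{0..s}|lborel. g r) (LINT r:{0..t}|lborel. g r) = norm (LINT r:{s<..t}|lborel. g r)"
      by (simp add: dist_norm)
    also have "\<dots> \<le> (LINT r:{s<..t}|lborel. norm (g r))" by (rule set_integral_norm_bound[OF int'[OF st]])
    also have "\<dots> \<le> sqrt ((t - s) * Q)"
    proof -
      have "integrable lborel (\<lambda>r. indicator {s<..t} r *\<^sub>R norm (g r))"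
        using set_integrable_norm[OF int'[OF st]] unfolding set_integrable_def .
      from nn_integral_eq_integral[OF this]
      have "ennreal (LINT r:{s<..t}|lborel. norm (g r)) = (\<integral>\<^sup>+r\<in>{s<..t}. ennreal (norm (g r)) \<partial>lborel)"
        by (simp add: set_lebesgue_integral_def ennreal_mult' ennreal_indicator[symmetric] mult.commute)
      hence "ennreal (LINT r:{s<..t}|lborel. norm (g r)) \<le> ennreal (sqrt ((t - s) * Q))" using L2[OF st] by simp
      thus ?thesis using st Q by (subst (asm) ennreal_le_iff) auto
    qed
    also have "\<dots> = sqrt Q * (t - s) powr (1 / 2)" using st by (simp add: real_sqrt_mult powr_half_sqrt)
    also have "(t - s) powr (1 / 2) = (t - s) powr (3 / 8) * (t - s) powr (1 / 8)" using st by (simp add: powr_add[symmetric])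
    also have "\<dots> \<le> E powr (3 / 8) * (t - s) powr (1 / 8)"
      using st by (intro mult_right_mono powr_mono2) auto
    finally show ?thesis using Q st by (simp add: C_def mult_left_mono mult.assoc abs_minus_commute[of s])
  qed
  show "holder_continuous_on (1 / 8) {0..<E} (\<lambda>t. LINT r:{0..t}|lborel. g r)"
    unfolding holder_continuous_on_def
  proof (intro exI[of _ C] ballI)
    fix s t assume "s \<in> {0..<E}" "t \<in> {0..<E}"
    thus "dist (LINT r:{0..s}|lborel. g r) (LINT r:{0..t}|lborel. g r) \<le> C * \<bar>s - t\<bar> powr (1 / 8)"
      using main[of s t] main[of t s] by (cases s t rule: linorder_cases) (auto simp: dist_commute abs_minus_commute)
  qed
qed

lemma linear_transpose_mult: "linear (\<lambda>A::real^'d^'r. transpose A *v y)"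
proof (rule linearI)
  show "transpose (A + B) *v y = transpose A *v y + transpose B *v y" for A B :: "real^'d^'r"
    by (simp add: transpose_def matrix_vector_mult_def vec_eq_iff algebra_simps sum.distrib)
  show "transpose (r *\<^sub>R A) *v y = r *\<^sub>R (transpose A *v y)" for r and A :: "real^'d^'r"
    by (simp add: transpose_def matrix_vector_mult_def vec_eq_iff sum_distrib_left mult.assoc)
qed

text \<open>Summation by parts: the Riemann sums of \<open>\<integral> U\<^sup>T dy\<close> converge although \<open>y\<close> need not have
  bounded variation, because \<open>U\<close> is absolutely continuous.\<close>

lemma riemann_sum_by_parts:
  fixes U D :: "real \<Rightarrow> real^'d^'r" and y :: "real \<Rightarrow> real^'r"
  assumes st: "s < t" and Dint: "set_integrable lborel {s..t} D"
    and UD: "\<And>a b. s \<le> a \<Longrightarrow> a \<le> b \<Longrightarrow> b \<le> t \<Longrightarrow> U b - U a = (LINT u:{a..b}|lborel. D u)"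
    and y: "continuous_on {s..t} y" and ym: "y \<in> borel_measurable borel"
    and u: "\<And>n j. u n j = s + (t - s) * real j / real (Suc n)"
  shows "(\<lambda>n. \<Sum>j<Suc n. transpose (U (u n j)) *v (y (u n (Suc j)) - y (u n j)))
    \<longlonglongrightarrow> transpose (U t) *v y t - transpose (U s) *v y s - (LINT r:{s..t}|lborel. transpose (D r) *v y r)"
proof (rule LIMSEQ_I)
  fix e :: real assume e: "e > 0"
  define ID where "ID = (LINT r:{s..t}|lborel. norm (D r))"
  have ID: "ID \<ge> 0" unfolding ID_def set_lebesgue_integral_def by (rule Bochner_Integration.integral_nonneg) auto
  \<comment> \<open>The total error will be at most \<open>\<epsilon>\<close> times the integral of
    \<open>norm (D r)\<close>; the added 1 keeps the quotient meaningful and the final inequality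
    strict.\<close>
  define \<epsilon> where "\<epsilon> = e / (ID + 1)"
  have \<epsilon>: "\<epsilon> > 0" using e ID by (simp add: \<epsilon>_def)
  have "\<epsilon> * ID < \<epsilon> * (ID + 1)" using \<epsilon> by simp
  also have "\<dots> = e" using ID by (simp add: \<epsilon>_def)
  finally have \<epsilon>e: "\<epsilon> * ID < e" .
  have "uniformly_continuous_on {s..t} y" by (rule compact_uniformly_continuous[OF y]) simp
  then obtain \<delta> where \<delta>: "\<delta> > 0" "\<And>a b. a \<in> {s..t} \<Longrightarrow> b \<in> {s..t} \<Longrightarrow> dist b a < \<delta> \<Longrightarrow> dist (y b) (y a) < \<epsilon>"
    using \<epsilon> unfolding uniformly_continuous_on_def by metis
  obtain n0 :: nat where n0: "(t - s) / \<delta> < real n0" using reals_Archimedean2 by blast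
  have bl: "bounded_linear (\<lambda>A::real^'d^'r. transpose A *v v)" for v
    using linear_transpose_mult linear_conv_bounded_linear by blast
  have tn: "norm (transpose A *v v) \<le> norm A * norm v" for A :: "real^'d^'r" and v
    using norm_matrix_vector_le[of "transpose A" v] by (simp add: norm_transpose)
  have Dm: "set_borel_measurable lborel {s..t} D" using Dint by (simp add: set_integrable_def set_borel_measurable_def)
  obtain By where By: "\<And>r. r \<in> {s..t} \<Longrightarrow> norm (y r) \<le> By"
  proof -
    have "bounded (y ` {s..t})" by (rule compact_imp_bounded[OF compact_continuous_image[OF y]]) simp
    then obtain b where "\<forall>x\<in>y ` {s..t}. norm x \<le> b" by (auto simp: bounded_iff)
    thus thesis by (intro that[of b]) auto
  qed
  have Iy: "set_integrable lborel {s..t} (\<lambda>r. transpose (D r) *v z r)"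
    if z: "z \<in> borel_measurable borel" "\<And>r. r \<in> {s..t} \<Longrightarrow> norm (z r) \<le> B" for z B
    unfolding set_integrable_def
  proof (rule Bochner_Integration.integrable_bound)
    show "integrable lborel (\<lambda>r. B * norm (indicator {s..t} r *\<^sub>R D r))"
      using Dint unfolding set_integrable_def by (intro integrable_mult_right integrable_norm)
    have "(\<lambda>r. transpose (indicator {s..t} r *\<^sub>R D r) *v z r) \<in> borel_measurable lborel"
      using Dm z(1) unfolding set_borel_measurable_def
      by (intro borel_measurable_matrix_vector_mult borel_measurable_transpose) simp_all
    moreover have "transpose (indicator {s..t} r *\<^sub>R D r) *v z r = indicator {s..t} r *\<^sub>R (transpose (D r) *v z r)" for r
      by (rule linear_cmul[OF linear_transpose_mult])
    ultimately show "(\<lambda>r. indicator {s..t} r *\<^sub>R (transpose (D r) *v z r)) \<in> borel_measurable lborel" by simp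
    show "AE r in lborel. norm (indicator {s..t} r *\<^sub>R (transpose (D r) *v z r)) \<le> norm (B * norm (indicator {s..t} r *\<^sub>R D r))"
    proof (intro AE_I2)
      fix r
      show "norm (indicator {s..t} r *\<^sub>R (transpose (D r) *v z r)) \<le> norm (B * norm (indicator {s..t} r *\<^sub>R D r))"
      proof (cases "r \<in> {s..t}")
        case True
        have "norm (transpose (D r) *v z r) \<le> norm (D r) * norm (z r)" by (rule tn)
        also have "\<dots> \<le> norm (D r) * \<bar>B\<bar>" using z(2)[OF True] by (intro mult_left_mono) auto
        finally show ?thesis using True by (simp add: abs_mult mult.commute)
      qed simp
    qed
  qed
  have Iyc: "set_integrable lborel {s..t} (\<lambda>r. transpose (D r) *v v)" for v
    by (rule Iy[where B="norm v"]) auto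
  have Iyy: "set_integrable lborel {s..t} (\<lambda>r. transpose (D r) *v y r)" by (rule Iy[OF ym By])
  show "\<exists>no. \<forall>n\<ge>no. norm ((\<Sum>j<Suc n. transpose (U (u n j)) *v (y (u n (Suc j)) - y (u n j)))
     - (transpose (U t) *v y t - transpose (U s) *v y s - (LINT r:{s..t}|lborel. transpose (D r) *v y r))) < e"
  proof (intro exI[of _ n0] allI impI)
    fix n assume n: "n \<ge> n0"
    define p where "p j = u n j" for j
    define h where "h = (t - s) / real (Suc n)"
    have h0: "h > 0" using st by (simp add: h_def)
    have p: "p 0 = s" "p (Suc n) = t" "\<And>j. p (Suc j) = p j + h"
    proof -
      show "p 0 = s" by (simp add: p_def u)
      show "p (Suc n) = t" by (simp add: p_def u del: of_nat_Suc)
      fix j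
      have "(t - s) * real (Suc j) = (t - s) * real j + (t - s)" by (simp add: algebra_simps)
      thus "p (Suc j) = p j + h" unfolding p_def u h_def by (simp only: add_divide_distrib add.assoc)
    qed
    have "(t - s) / \<delta> < real (Suc n)" using n0 n by linarith
    hence h\<delta>: "h < \<delta>" using \<delta>(1) by (simp add: h_def field_simps del: of_nat_Suc)
    have pm: "s \<le> p i \<and> p i \<le> p (Suc i)" for i
    proof (induction i)
      case (Suc i)
      thus ?case using p(3)[of i] p(3)[of "Suc i"] h0 by linarith
    qed (use p h0 in auto)
    have pt: "p i \<le> t" if "i \<le> Suc n" for i
    proof -
      have "p i \<le> p (Suc n)"
        using that
      proof (induction rule: inc_induct)
        case (step m)
        thus ?case using pm[of m] by linarith
      qed simp
      thus ?thesis using p by simp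
    qed
    have split: "(LINT r:{s..p i}|lborel. f r) = (\<Sum>j<i. LINT r:{p j..p (Suc j)}|lborel. f r)"
      if f: "set_integrable lborel {s..t} f" and i: "i \<le> Suc n" for f :: "real \<Rightarrow> 'z::euclidean_space" and i
      using i
    proof (induction i)
      case 0
      have "AE r in lborel. indicator {s..s} r *\<^sub>R f r = 0"
        using AE_lborel_singleton[of s] by eventually_elim (auto simp: indicator_def)
      hence "(LINT r:{s..s}|lborel. f r) = 0"
        unfolding set_lebesgue_integral_def by (rule integral_eq_zero_AE)
      thus ?case by (simp add: p)
    next
      case (Suc i)
      have un: "{s..p (Suc i)} = {s..p i} \<union> {p i..p (Suc i)}" using pm[of i] by auto
      have sub: "set_integrable lborel {s..p i} f" "set_integrable lborel {p i..p (Suc i)} f"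
        using pm[of i] pt[of i] pt[of "Suc i"] Suc.prems by (auto intro!: set_integrable_subset[OF f])
      have "(LINT r:{s..p (Suc i)}|lborel. f r) = (LINT r:{s..p i}|lborel. f r) + (LINT r:{p i..p (Suc i)}|lborel. f r)"
        unfolding un
      proof (rule set_integral_Un_AE[OF _ _ _ sub])
        show "AE x in lborel. \<not> (x \<in> {s..p i} \<and> x \<in> {p i..p (Suc i)})"
          using AE_lborel_singleton[of "p i"] by eventually_elim auto
      qed auto
      thus ?case using Suc by simp
    qed
    \<comment> \<open>The error of one block: within it \<open>y\<close> is compared with its value
      at the right end, where summation by parts evaluates it.\<close>
    define J where "J j = (LINT r:{p j..p (Suc j)}|lborel. transpose (D r) *v (y (p (Suc j)) - y r))" for j
    have sub: "set_integrable lborel {p j..p (Suc j)} f" if "set_integrable lborel {s..t} f" "j < Suc n"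
      for f :: "real \<Rightarrow> 'z::euclidean_space" and j
      using pm[of j] pt[of j] pt[of "Suc j"] that by (auto intro!: set_integrable_subset[OF that(1)])
    have Jeq: "transpose (U (p (Suc j)) - U (p j)) *v y (p (Suc j)) - (LINT r:{p j..p (Suc j)}|lborel. transpose (D r) *v y r) = J j"
      \<comment> \<open>The increment of \<open>U\<close> is the integral of \<open>D\<close>, so
        the constant vector can be moved under the integral.\<close>
      if j: "j < Suc n" for j
    proof -
      have D1: "set_integrable lborel {p j..p (Suc j)} D" by (rule sub[OF Dint j])
      have "transpose (U (p (Suc j)) - U (p j)) *v y (p (Suc j)) = transpose (LINT r:{p j..p (Suc j)}|lborel. D r) *v y (p (Suc j))"
        using UD[of "p j" "p (Suc j)"] pm[of j] pt[of "Suc j"] j by simp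
      also have "\<dots> = (LINT r:{p j..p (Suc j)}|lborel. transpose (D r) *v y (p (Suc j)))"
        using integral_bounded_linear[OF bl D1[unfolded set_integrable_def], of "y (p (Suc j))"]
        unfolding set_lebesgue_integral_def linear_cmul[OF linear_transpose_mult] by (rule sym)
      also have "\<dots> - (LINT r:{p j..p (Suc j)}|lborel. transpose (D r) *v y r) = J j"
        unfolding J_def matrix_vector_mult_diff_distrib
        by (rule set_integral_diff(2)[symmetric])
           (rule sub[OF Iyc j] sub[OF Iyy j])+
      finally show ?thesis .
    qed
    have Jn: "norm (J j) \<le> \<epsilon> * (LINT r:{p j..p (Suc j)}|lborel. norm (D r))" if j: "j < Suc n" for j
    proof -
      have Iz: "set_integrable lborel {p j..p (Suc j)} (\<lambda>r. transpose (D r) *v (y (p (Suc j)) - y r))"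
        unfolding matrix_vector_mult_diff_distrib
        by (rule set_integral_diff(1))
           (rule sub[OF Iyc j] sub[OF Iyy j])+
      have "norm (J j) \<le> (LINT r:{p j..p (Suc j)}|lborel. norm (transpose (D r) *v (y (p (Suc j)) - y r)))"
        unfolding J_def by (rule set_integral_norm_bound[OF Iz])
      also have "\<dots> \<le> (LINT r:{p j..p (Suc j)}|lborel. \<epsilon> * norm (D r))"
      proof (rule set_integral_mono)
        show "set_integrable lborel {p j..p (Suc j)} (\<lambda>r. norm (transpose (D r) *v (y (p (Suc j)) - y r)))"
          by (rule set_integrable_norm[OF Iz])
        show "set_integrable lborel {p j..p (Suc j)} (\<lambda>r. \<epsilon> * norm (D r))"
          by (rule set_integrable_mult_right) (rule set_integrable_norm[OF sub[OF Dint j]])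
        fix r assume r: "r \<in> {p j..p (Suc j)}"
        have "dist (y (p (Suc j))) (y r) < \<epsilon>"
          by (rule \<delta>(2)) (use r pm[of j] pt[of "Suc j"] j p(3)[of j] h\<delta> in \<open>auto simp: dist_real_def\<close>)
        hence "norm (y (p (Suc j)) - y r) \<le> \<epsilon>" by (simp add: dist_norm)
        hence "norm (D r) * norm (y (p (Suc j)) - y r) \<le> norm (D r) * \<epsilon>" by (intro mult_left_mono) auto
        thus "norm (transpose (D r) *v (y (p (Suc j)) - y r)) \<le> \<epsilon> * norm (D r)"
          using tn[of "D r" "y (p (Suc j)) - y r"] by (simp add: mult.commute)
      qed
      finally show ?thesis by simp
    qed
    have gen: "S = AB - V \<Longrightarrow> S - (AB - I) = I - V" for S AB V I :: "real^'d" by simp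
    have "(\<Sum>j<Suc n. transpose (U (p j)) *v (y (p (Suc j)) - y (p j)))
       = (\<Sum>j<Suc n. (transpose (U (p (Suc j))) *v y (p (Suc j)) - transpose (U (p j)) *v y (p j)) - transpose (U (p (Suc j)) - U (p j)) *v y (p (Suc j)))"
      unfolding matrix_vector_mult_diff_distrib linear_diff[OF linear_transpose_mult]
      by (intro sum.cong refl) (simp only: diff_diff_eq2 diff_add_cancel add_diff_cancel algebra_simps)
    also have "\<dots> = (transpose (U t) *v y t - transpose (U s) *v y s) - (\<Sum>j<Suc n. transpose (U (p (Suc j)) - U (p j)) *v y (p (Suc j)))"
      unfolding sum_subtractf[of _ "\<lambda>j. transpose (U (p (Suc j)) - U (p j)) *v y (p (Suc j))"]
      using sum_lessThan_telescope[of "\<lambda>j. transpose (U (p j)) *v y (p j)" "Suc n"] p(1,2) by simp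
    finally have "(\<Sum>j<Suc n. transpose (U (p j)) *v (y (p (Suc j)) - y (p j)))
        - (transpose (U t) *v y t - transpose (U s) *v y s - (LINT r:{s..t}|lborel. transpose (D r) *v y r))
       = (LINT r:{s..p (Suc n)}|lborel. transpose (D r) *v y r) - (\<Sum>j<Suc n. transpose (U (p (Suc j)) - U (p j)) *v y (p (Suc j)))"
      unfolding p(2) by (rule gen)
    also have "\<dots> = - (\<Sum>j<Suc n. J j)"
      unfolding split[OF Iyy order_refl] sum_negf[symmetric] sum_subtractf[symmetric]
    proof (intro sum.cong refl)
      fix j assume "j \<in> {..<Suc n}"
      hence j: "j < Suc n" by simp
      have swap: "a - b = c \<Longrightarrow> b - a = - c" for a b c :: "real^'d" by auto
      show "(LINT r:{p j..p (Suc j)}|lborel. transpose (D r) *v y r) - transpose (U (p (Suc j)) - U (p j)) *v y (p (Suc j)) = - J j"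
        by (rule swap[OF Jeq[OF j]])
    qed
    also have "norm \<dots> \<le> (\<Sum>j<Suc n. \<epsilon> * (LINT r:{p j..p (Suc j)}|lborel. norm (D r)))"
      unfolding norm_minus_cancel by (rule sum_norm_le) (use Jn in auto)
    also have "\<dots> = \<epsilon> * ID"
      using split[OF set_integrable_norm[OF Dint] order_refl] p(2) by (simp only: ID_def sum_distrib_left[symmetric])
    finally show "norm ((\<Sum>j<Suc n. transpose (U (u n j)) *v (y (u n (Suc j)) - y (u n j)))
     - (transpose (U t) *v y t - transpose (U s) *v y s - (LINT r:{s..t}|lborel. transpose (D r) *v y r))) < e"
      using \<epsilon>e unfolding p_def by linarith
  qed
qed

section \<open>Decomposition of the paths of the approximation\<close>

context sde_process
begin

text \<open>Let V be the primitive of the transpose of \<open>D\<close> applied to \<open>Y\<close>.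
  The stochastic part is never built as an integral: it is the difference of X and V, which
  summation by parts identifies as the limit of sums of increments of \<open>Y\<close> weighted by
  the contractions \<open>transpose (U (u n j))\<close>. Those sums have fourth moments bounded
  uniformly in the partition, and Fatou's lemma passes the bound to the difference.\<close>

lemma holder_paths:
  fixes U D :: "real \<Rightarrow> real^'d^'r"
  assumes Dm[measurable]: "D \<in> borel_measurable borel"
    and Dint: "\<And>t. 0 \<le> t \<Longrightarrow> t < E \<Longrightarrow> set_integrable lborel {0..t} D"
    and UD: "\<And>s t. 0 \<le> s \<Longrightarrow> s \<le> t \<Longrightarrow> t < E \<Longrightarrow> U t - U s = (LINT u:{s..t}|lborel. D u)"
    and Ucont: "continuous_on {0..<E} U"
    and Ucon: "\<And>t v. t \<in> {0..<E} \<Longrightarrow> norm (transpose (U t) *v v) \<le> norm v"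
    and B: "B \<ge> 0"
    and en: "AE u in lborel. u \<in> {0<..<E} \<longrightarrow> (\<integral>\<^sup>+\<omega>. ennreal ((norm (transpose (D u) *v Y u \<omega>))\<^sup>2) \<partial>M) \<le> ennreal B"
    and C: "C \<ge> 0" and mom: "\<And>t. t \<in> {0..<E} \<Longrightarrow> (\<integral>\<^sup>+\<omega>. ennreal (norm (Y t \<omega>) ^ 4) \<partial>M) \<le> ennreal C"
  shows "AE \<omega> in M. holder_continuous_on (1 / 8) {0..<E} (\<lambda>t. transpose (U t) *v Y t \<omega>)"
proof -
  define X where "X t \<omega> = transpose (U t) *v Y t \<omega>" for t \<omega>
  define g where "g u \<omega> = transpose (D u) *v Y u \<omega>" for u \<omega>
  define V where "V t \<omega> = (LINT r:{0..t}|lborel. g r \<omega>)" for t \<omega>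
  have [measurable]: "(\<lambda>z. Y (fst z) (snd z)) \<in> borel_measurable (borel \<Otimes>\<^sub>M M)" by (rule Y_joint)
  have gjm[measurable]: "(\<lambda>z. g (fst z) (snd z)) \<in> borel_measurable (borel \<Otimes>\<^sub>M M)" unfolding g_def by measurable
  have gpath: "(\<lambda>r. g r \<omega>) \<in> borel_measurable borel" if "\<omega> \<in> space M" for \<omega>
    unfolding g_def using Y_path_measurable[OF that] by measurable
  have Xm[measurable]: "X t \<in> borel_measurable M" for t unfolding X_def by measurable
  have Vm[measurable]: "V t \<in> borel_measurable M" for t
  proof -
    have "(\<lambda>z. g (snd z) (fst z)) \<in> borel_measurable (M \<Otimes>\<^sub>M lborel)"
      unfolding g_def using Y_m[of snd "M \<Otimes>\<^sub>M lborel" fst] by measurable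
    hence "(\<lambda>z. indicator {0..t} (snd z) *\<^sub>R g (snd z) (fst z)) \<in> borel_measurable (M \<Otimes>\<^sub>M lborel)" by measurable
    thus ?thesis unfolding V_def set_lebesgue_integral_def
      by (intro lborel.borel_measurable_lebesgue_integral) (simp add: split_beta')
  qed
  have "(\<integral>\<^sup>+\<omega>. (\<integral>\<^sup>+r\<in>{0<..<E}. ennreal ((norm (g r \<omega>))\<^sup>2) \<partial>lborel) \<partial>M)
      = (\<integral>\<^sup>+r\<in>{0<..<E}. (\<integral>\<^sup>+\<omega>. ennreal ((norm (g r \<omega>))\<^sup>2) \<partial>M) \<partial>lborel)"
    by (rule nn_integral_time_swap(1)) auto
  also have "\<dots> \<le> (\<integral>\<^sup>+r\<in>{0<..<E}. ennreal B \<partial>lborel)"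
    by (rule nn_integral_mono_AE, use en in eventually_elim) (auto simp: g_def indicator_def)
  also have "\<dots> < \<infinity>" using E_pos by (simp add: nn_integral_cmult_indicator ennreal_mult_less_top)
  finally have "(\<integral>\<^sup>+\<omega>. (\<integral>\<^sup>+r\<in>{0<..<E}. ennreal ((norm (g r \<omega>))\<^sup>2) \<partial>lborel) \<partial>M) \<noteq> \<infinity>" by simp
  \<comment> \<open>Finite expected energy on the bounded interval makes the energy of almost every
    path finite.\<close>
  hence "AE \<omega> in M. (\<integral>\<^sup>+r\<in>{0<..<E}. ennreal ((norm (g r \<omega>))\<^sup>2) \<partial>lborel) \<noteq> \<infinity>"
    by (rule nn_integral_PInf_AE[rotated]) (auto intro!: nn_integral_time_swap(3))
  hence good: "AE \<omega> in M. \<omega> \<in> space M \<and> holder_continuous_on (1 / 8) {0..<E} (\<lambda>t. V t \<omega>) \<and>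
      (\<forall>s t. 0 \<le> s \<longrightarrow> t < E \<longrightarrow> set_integrable lborel {s..t} (\<lambda>r. g r \<omega>))"
    using AE_space
  proof eventually_elim
    case (elim \<omega>)
    hence "(\<integral>\<^sup>+r\<in>{0<..<E}. ennreal ((norm (g r \<omega>))\<^sup>2) \<partial>lborel) < \<infinity>" by (simp add: less_top)
    from square_integrable_primitive_holder[OF gpath[OF elim(2)] E_pos this] elim(2)
    show ?case unfolding V_def by blast
  qed
  have Xcont: "continuous_on {0..<E} (\<lambda>t. X t \<omega>)" if "\<omega> \<in> space M" for \<omega>
    unfolding X_def transpose_def matrix_vector_mult_def
    by (intro continuous_intros Ucont Y_cont[OF that])
  \<comment> \<open>Used with exponent 4 for sums with values in the \<open>'d\<close>-dimensional
    space, although \<open>Y\<close> lives in the \<open>'r\<close>-dimensional one.\<close>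
  obtain c where c: "c \<ge> 0" and inc: "\<And>N u (A :: nat \<Rightarrow> real ^ 'r ^ 'd).
    (\<forall>j<N. u j \<le> u (Suc j)) \<Longrightarrow> 0 \<le> u 0 \<Longrightarrow> u 0 < u N \<Longrightarrow> u N < E \<Longrightarrow>
    (\<forall>j<N. \<forall>v. norm (A j *v v) \<le> norm v) \<Longrightarrow>
    (\<integral>\<^sup>+\<omega>. ennreal (norm (\<Sum>j<N. A j *v (Y (u (Suc j)) \<omega> - Y (u j) \<omega>)) ^ (2 * 2)) \<partial>M)
      \<le> ennreal (c * (u N - u 0) ^ 2)"
    using increment_moment[of 2 C, where 'q='d] C mom by auto
  have "AE \<omega> in M. holder_continuous_on (1 / 8) {0..<E} (\<lambda>t. X t \<omega> - V t \<omega>)"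
  proof (rule kolmogorov_holder[OF _ E_pos c])
    show "AE \<omega> in M. continuous_on {0..<E} (\<lambda>t. X t \<omega> - V t \<omega>)"
      using good
    proof eventually_elim
      case (elim \<omega>)
      thus ?case using Xcont[of \<omega>] holder_continuous_on_imp_continuous_on[of "1/8" "{0..<E}" "\<lambda>t. V t \<omega>"]
        by (intro continuous_on_diff) auto
    qed
    show "(\<lambda>\<omega>. X t \<omega> - V t \<omega>) \<in> borel_measurable M" for t by measurable
    fix s t assume st: "0 \<le> s" "s < t" "t < E"
    define u where "u n j = s + (t - s) * real j / real (Suc n)" for n j
    define S where "S n \<omega> = (\<Sum>j<Suc n. transpose (U (u n j)) *v (Y (u n (Suc j)) \<omega> - Y (u n j) \<omega>))" for n \<omega>
    have [measurable]: "S n \<in> borel_measurable M" for n unfolding S_def by measurable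
    have um: "u n j \<le> u n (Suc j)" for n j
      unfolding u_def using st by (intro add_left_mono divide_right_mono mult_left_mono) auto
    have u0: "u n 0 = s" "u n (Suc n) = t" for n by (simp_all add: u_def del: of_nat_Suc)
    have ur: "s \<le> u n j \<and> u n j \<le> t" if "j \<le> Suc n" for n j
    proof -
      have "s \<le> u n j" unfolding u_def using st by simp
      moreover have "u n j \<le> u n (Suc n)"
        unfolding u_def using st that by (intro add_left_mono divide_right_mono mult_left_mono) auto
      ultimately show ?thesis using u0 by simp
    qed
    have Dst: "set_integrable lborel {s..t} D"
      by (rule set_integrable_subset[OF Dint[of t]]) (use st in auto)
    \<comment> \<open>Splitting the primitive V at \<open>s\<close> leaves exactly the integral that
      summation by parts subtracts.\<close>
    have "AE \<omega> in M. (\<lambda>n. S n \<omega>) \<longlonglongrightarrow> X t \<omega> - V t \<omega> - (X s \<omega> - V s \<omega>)"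
      using good
    proof eventually_elim
      case (elim \<omega>)
      hence \<omega>: "\<omega> \<in> space M" and gi: "\<And>s t. 0 \<le> s \<Longrightarrow> t < E \<Longrightarrow> set_integrable lborel {s..t} (\<lambda>r. g r \<omega>)" by auto
      have Yc: "continuous_on {s..t} (\<lambda>r. Y r \<omega>)"
        by (rule continuous_on_subset[OF Y_cont[OF \<omega>]]) (use st in auto)
      have lim: "(\<lambda>n. S n \<omega>) \<longlonglongrightarrow> X t \<omega> - X s \<omega> - (LINT r:{s..t}|lborel. g r \<omega>)"
        unfolding S_def X_def g_def
        by (rule riemann_sum_by_parts[OF st(2) Dst _ Yc Y_path_measurable[OF \<omega>]]) (use st UD in \<open>auto simp: u_def\<close>)
      have un: "{0..t} = {0..s} \<union> {s..t}" using st by auto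
      have "V t \<omega> = V s \<omega> + (LINT r:{s..t}|lborel. g r \<omega>)"
        unfolding V_def un
      proof (rule set_integral_Un_AE)
        show "AE x in lborel. \<not> (x \<in> {0..s} \<and> x \<in> {s..t})"
          using AE_lborel_singleton[of s] by eventually_elim auto
      qed (use gi st in auto)
      thus ?case using lim by (simp add: algebra_simps)
    qed
    hence "(\<integral>\<^sup>+\<omega>. ennreal (norm (X t \<omega> - V t \<omega> - (X s \<omega> - V s \<omega>)) ^ 4) \<partial>M)
       = (\<integral>\<^sup>+\<omega>. liminf (\<lambda>n. ennreal (norm (S n \<omega>) ^ 4)) \<partial>M)"
      by (intro nn_integral_cong_AE, elim eventually_mono)
         (intro lim_imp_Liminf[symmetric] tendsto_intros; simp)
    also have "\<dots> \<le> liminf (\<lambda>n. \<integral>\<^sup>+\<omega>. ennreal (norm (S n \<omega>) ^ 4) \<partial>M)"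
      by (rule nn_integral_liminf) measurable
    also have "\<dots> \<le> ennreal (c * (t - s)\<^sup>2)"
    proof -
      have "(\<integral>\<^sup>+\<omega>. ennreal (norm (S n \<omega>) ^ 4) \<partial>M) \<le> ennreal (c * (t - s)\<^sup>2)" for n
      proof -
        have con: "\<forall>j<Suc n. \<forall>v. norm (transpose (U (u n j)) *v v) \<le> norm v"
        proof (intro allI impI)
          fix j v assume "j < Suc n"
          hence "u n j \<in> {0..<E}" using ur[of j n] st by auto
          thus "norm (transpose (U (u n j)) *v v) \<le> norm v" by (rule Ucon)
        qed
        show ?thesis using inc[of "Suc n" "u n", OF _ _ _ _ con] um u0 st
          unfolding S_def by (simp del: sum.lessThan_Suc)
      qed
      thus ?thesis
        using Liminf_mono[of "\<lambda>n. \<integral>\<^sup>+\<omega>. ennreal (norm (S n \<omega>) ^ 4) \<partial>M" "\<lambda>_. ennreal (c * (t - s)\<^sup>2)" sequentially]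
        by (simp add: Liminf_const)
    qed
    finally show "(\<integral>\<^sup>+\<omega>. ennreal (norm (X t \<omega> - V t \<omega> - (X s \<omega> - V s \<omega>)) ^ 4) \<partial>M) \<le> ennreal (c * (t - s)\<^sup>2)" .
  qed
  thus ?thesis using good
  proof eventually_elim
    case (elim \<omega>)
    have "holder_continuous_on (1 / 8) {0..<E} (\<lambda>t. (X t \<omega> - V t \<omega>) + V t \<omega>)"
      by (rule holder_continuous_on_add) (use elim in auto)
    thus ?case by (simp add: X_def)
  qed
qed

end

section \<open>Dynamically orthogonal solutions\<close>

lemma continuous_on_half_open:
  fixes f :: "real \<Rightarrow> 'b::topological_space"
  assumes "\<And>t. 0 \<le> t \<Longrightarrow> t < E \<Longrightarrow> \<exists>T>t. continuous_on {0..T} f"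
  shows "continuous_on {0..<E} f"
  unfolding continuous_on_eq_continuous_within
proof
  fix t assume t: "t \<in> {0..<E}"
  obtain T where T: "t < T" "continuous_on {0..T} f" using assms[of t] t by auto
  have "continuous (at t within {0..T}) f"
    using T t by (auto simp: continuous_on_eq_continuous_within)
  hence "continuous (at t within {0..<E} \<inter> {0..T}) f" by (rule continuous_within_subset) auto
  moreover have "at t within {0..<E} \<inter> {0..T} = at t within {0..<E}"
    by (rule at_within_nhd[of _ "{..<T}"]) (use T t in auto)
  ultimately show "continuous (at t within {0..<E}) f" by simp
qed

lemma has_vector_derivative_imp_quotient_limit:
  fixes f :: "real \<Rightarrow> 'b::real_normed_vector"
  assumes "(f has_vector_derivative D) (at x)"
  shows "(\<lambda>n. real (Suc n) *\<^sub>R (f (x + 1 / real (Suc n)) - f x)) \<longlonglongrightarrow> D"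
proof -
  have "((\<lambda>y. norm ((f y - f x) - (y - x) *\<^sub>R D) / norm (y - x)) \<longlongrightarrow> 0) (at x)"
    using assms unfolding has_vector_derivative_def has_derivative_iff_norm by simp
  moreover have "filterlim (\<lambda>n. x + 1 / real (Suc n)) (at x) sequentially"
    unfolding filterlim_at
  proof
    have "(\<lambda>n. x + 1 / real (Suc n)) \<longlonglongrightarrow> x + 0"
      by (intro tendsto_intros LIMSEQ_Suc lim_1_over_n)
    thus "(\<lambda>n. x + 1 / real (Suc n)) \<longlonglongrightarrow> x" by simp
  qed auto
  ultimately have "(\<lambda>n. norm ((f (x + 1 / real (Suc n)) - f x) - (x + 1 / real (Suc n) - x) *\<^sub>R D) / norm (x + 1 / real (Suc n) - x)) \<longlonglongrightarrow> 0"
    by (rule filterlim_compose)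
  moreover have "norm ((f (x + 1 / real (Suc n)) - f x) - (x + 1 / real (Suc n) - x) *\<^sub>R D) / norm (x + 1 / real (Suc n) - x)
     = norm (real (Suc n) *\<^sub>R (f (x + 1 / real (Suc n)) - f x) - D)" for n
  proof -
    have gen: "norm (v - (1 / c) *\<^sub>R D) / (1 / c) = norm (c *\<^sub>R v - D)" if "c > 0" for v and c :: real
    proof -
      have "c *\<^sub>R v - D = c *\<^sub>R (v - (1 / c) *\<^sub>R D)" using that by (simp add: scaleR_diff_right)
      hence "norm (c *\<^sub>R v - D) = c * norm (v - (1 / c) *\<^sub>R D)" using that by simp
      thus ?thesis by simp
    qed
    show ?thesis using gen[of "real (Suc n)" "f (x + 1 / real (Suc n)) - f x"] by (simp del: of_nat_Suc)
  qed
  ultimately have "(\<lambda>n. norm (real (Suc n) *\<^sub>R (f (x + 1 / real (Suc n)) - f x) - D)) \<longlonglongrightarrow> 0" by simp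
  thus ?thesis by (simp add: tendsto_norm_zero_iff LIM_zero_iff)
qed

text \<open>Allows the coefficient to be replaced by a version that is measurable in time and
  outcome together. That measurability of \<open>H'\<close> is what makes the new approximation
  errors random variables, as \<open>conv_in_prob\<close> demands.\<close>

lemma (in usual_filtered_space) is_ito_integral_cong_AE:
  fixes H H' :: "real \<Rightarrow> 'w \<Rightarrow> real ^ 'm ^ 'r"
  assumes ito: "is_ito_integral M F W T H I" and eq: "AE \<omega> in M. \<forall>t\<in>{0..T}. H t \<omega> = H' t \<omega>"
    and H': "(\<lambda>z. H' (fst z) (snd z)) \<in> borel_measurable (borel \<Otimes>\<^sub>M M)"
  shows "is_ito_integral M F W T H' I"
proof -
  obtain Hs where sp: "\<And>n. is_simple_proc M F (Hs n)"
    and cq: "conv_in_prob M (\<lambda>n \<omega>. LINT t:{0..T}|lborel. (norm (simple_val (Hs n) t \<omega> - H t \<omega>))\<^sup>2) (\<lambda>_. 0)"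
    and cI: "\<forall>t\<in>{0..T}. conv_in_prob M (\<lambda>n. simple_ito W (Hs n) t) (I t)"
    and path: "AE \<omega> in M. set_borel_measurable lborel {0..T} (\<lambda>t. H t \<omega>) \<and>
                set_integrable lborel {0..T} (\<lambda>t. (norm (H t \<omega>))\<^sup>2)"
    and I: "\<forall>t\<in>{0..T}. I t \<in> borel_measurable (F t)" "AE \<omega> in M. continuous_on {0..T} (\<lambda>t. I t \<omega>)"
    using ito unfolding is_ito_integral_def by blast
  have path': "AE \<omega> in M. set_borel_measurable lborel {0..T} (\<lambda>t. H' t \<omega>) \<and>
                set_integrable lborel {0..T} (\<lambda>t. (norm (H' t \<omega>))\<^sup>2)"
    using path eq
  proof eventually_elim
    case (elim \<omega>)
    have "(\<lambda>t. indicator {0..T} t *\<^sub>R H t \<omega>) = (\<lambda>t. indicator {0..T} t *\<^sub>R H' t \<omega>)"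
      "(\<lambda>t. indicator {0..T} t *\<^sub>R (norm (H t \<omega>))\<^sup>2) = (\<lambda>t. indicator {0..T} t *\<^sub>R (norm (H' t \<omega>))\<^sup>2)"
      using elim(2) by (auto simp: fun_eq_iff indicator_def)
    thus ?case using elim(1) unfolding set_borel_measurable_def set_integrable_def by simp
  qed
  define Q where "Q H n \<omega> = (LINT t:{0..T}|lborel. (norm (simple_val (Hs n) t \<omega> - H t \<omega>))\<^sup>2)" for H n \<omega>
  have Qm: "Q H n \<in> borel_measurable M" for n using cq by (auto simp: conv_in_prob_def Q_def[abs_def])
  have Qm': "Q H' n \<in> borel_measurable M" for n
  proof -
    obtain N p \<xi> where Hs: "Hs n = (N, p, \<xi>)" by (cases "Hs n")
    have "\<xi> i \<in> borel_measurable M" if i: "i < N" for i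
      by (rule measurable_F[of _ "p i"])
         (use sp[of n] i is_simple_proc_times(2)[of M F N p \<xi> i] in \<open>auto simp: Hs is_simple_proc_def\<close>)
    hence "(\<lambda>z. \<Sum>i<N. indicator {p i<..p (Suc i)} (snd z) *\<^sub>R \<xi> i (fst z)) \<in> borel_measurable (M \<Otimes>\<^sub>M lborel)"
      by (intro borel_measurable_sum borel_measurable_scaleR measurable_compose[OF measurable_fst]
          measurable_compose[OF measurable_snd]) auto
    hence [measurable]: "(\<lambda>z. simple_val (Hs n) (snd z) (fst z)) \<in> borel_measurable (M \<Otimes>\<^sub>M lborel)"
      by (simp add: simple_val_def Hs del: indicator_simps)
    have "(\<lambda>z. (snd z, fst z)) \<in> measurable (M \<Otimes>\<^sub>M lborel) (borel \<Otimes>\<^sub>M M)" by measurable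
    from measurable_compose[OF this H'] have [measurable]: "(\<lambda>z. H' (snd z) (fst z)) \<in> borel_measurable (M \<Otimes>\<^sub>M lborel)" by simp
    have "(\<lambda>z. indicator {0..T} (snd z) *\<^sub>R (norm (simple_val (Hs n) (snd z) (fst z) - H' (snd z) (fst z)))\<^sup>2) \<in> borel_measurable (M \<Otimes>\<^sub>M lborel)"
      by measurable
    thus ?thesis unfolding Q_def set_lebesgue_integral_def
      by (intro lborel.borel_measurable_lebesgue_integral) (simp add: split_beta')
  qed
  have QQ: "AE \<omega> in M. Q H n \<omega> = Q H' n \<omega>" for n
    using eq unfolding Q_def
    by eventually_elim (rule set_lebesgue_integral_cong, auto)
  have "conv_in_prob M (Q H') (\<lambda>_. 0)"
    unfolding conv_in_prob_def
  proof (intro conjI allI impI Qm')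
    fix \<epsilon> :: real assume "\<epsilon> > 0"
    hence "(\<lambda>n. measure M {\<omega> \<in> space M. dist (Q H n \<omega>) 0 > \<epsilon>}) \<longlonglongrightarrow> 0"
      using cq unfolding conv_in_prob_def Q_def by auto
    moreover have "measure M {\<omega> \<in> space M. dist (Q H n \<omega>) 0 > \<epsilon>} = measure M {\<omega> \<in> space M. dist (Q H' n \<omega>) 0 > \<epsilon>}" for n
    proof (rule finite_measure_eq_AE)
      show "AE x in M. (x \<in> {\<omega> \<in> space M. \<epsilon> < dist (Q H n \<omega>) 0}) = (x \<in> {\<omega> \<in> space M. \<epsilon> < dist (Q H' n \<omega>) 0})"
        using QQ[of n] by eventually_elim auto
      note [measurable] = Qm[of n] Qm'[of n]
      show "{\<omega> \<in> space M. \<epsilon> < dist (Q H n \<omega>) 0} \<in> sets M" "{\<omega> \<in> space M. \<epsilon> < dist (Q H' n \<omega>) 0} \<in> sets M"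
        by measurable
    qed
    ultimately show "(\<lambda>n. measure M {\<omega> \<in> space M. dist (Q H' n \<omega>) 0 > \<epsilon>}) \<longlonglongrightarrow> 0" by simp
  qed simp
  thus ?thesis using path' I sp cI unfolding is_ito_integral_def Q_def by blast
qed

text \<open>The coefficients are measurable for nonnegative times only; \<open>max 0\<close> sends
  every time there.\<close>

lemma jointly_measurable_compose:
  assumes a: "jointly_measurable a" and f: "f \<in> borel_measurable N" and g: "g \<in> borel_measurable N"
  shows "(\<lambda>z. a (max 0 (f z)) (g z)) \<in> borel_measurable N"
proof -
  have "(\<lambda>z. max 0 (f z)) \<in> measurable N (restrict_space borel {0..})"
    using f by (intro measurable_restrict_space2) auto
  from measurable_compose[OF measurable_Pair[OF this g] a[unfolded jointly_measurable_def]]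
  show ?thesis by simp
qed

text \<open>\<open>E\<close> is any horizon such that the solution exists on every shorter interval,
  not necessarily the explosion time. Some small horizon is used to show that the explosion time is
  positive, after which the explosion time itself becomes the horizon.\<close>

locale do_solution = brownian_motion M F W
  for M :: "'w measure" and F :: "real \<Rightarrow> 'w measure" and W :: "real \<Rightarrow> 'w \<Rightarrow> real ^ 'm" +
  fixes a :: "real \<Rightarrow> real ^ 'd \<Rightarrow> real ^ 'd" and b :: "real \<Rightarrow> real ^ 'd \<Rightarrow> real ^ 'm ^ 'd"
    and E :: real and U :: "real \<Rightarrow> real ^ 'd ^ 'r" and Y :: "real \<Rightarrow> 'w \<Rightarrow> real ^ 'r" and Cg :: real
  assumes a_meas: "jointly_measurable a" and b_meas: "jointly_measurable b"
    and Cg: "0 \<le> Cg"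
    and growth: "\<And>s x. 0 \<le> s \<Longrightarrow> (norm (a s x))\<^sup>2 + (norm (b s x))\<^sup>2 \<le> Cg * (1 + (norm x)\<^sup>2)"
    and E_pos: "0 < E"
    and sol: "\<And>T. 0 < T \<Longrightarrow> T < E \<Longrightarrow> strong_DO_solution M F W a b T U Y"
begin

section \<open>Orthonormality of the rows of \<open>U\<close> and its derivative\<close>

lemma approx_times: "t < E \<Longrightarrow> \<exists>T. 0 < T \<and> t < T \<and> T < E"
  using E_pos by (intro exI[of _ "(max 0 t + E) / 2"]) auto

lemma seq_times: "\<exists>T :: nat \<Rightarrow> real. (\<forall>n. 0 < T n \<and> T n < E) \<and> (\<forall>t<E. \<exists>n. t < T n)"
proof (intro exI[of _ "\<lambda>n. E * (1 - 1 / real (n + 2))"] conjI allI impI)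
  fix n :: nat
  have x: "0 < 1 / real (n + 2)" "1 / real (n + 2) < 1" by auto
  show "0 < E * (1 - 1 / real (n + 2))" using E_pos x by (intro mult_pos_pos) linarith+
  have "E * (1 - 1 / real (n + 2)) < E * 1" using E_pos x by (intro mult_strict_left_mono) linarith+
  thus "E * (1 - 1 / real (n + 2)) < E" by simp
next
  fix t assume t: "t < E"
  obtain n where n: "E / (E - t) < real n" using reals_Archimedean2 by blast
  have "E < real n * (E - t)" using n t by (simp add: field_simps)
  also have "\<dots> \<le> real (n + 2) * (E - t)" using t by (intro mult_right_mono) auto
  finally have "E / real (n + 2) < E - t" by (simp add: field_simps)
  hence "t < E * (1 - 1 / real (n + 2))" by (simp add: algebra_simps)
  thus "\<exists>n. t < E * (1 - 1 / real (n + 2))" by blast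
qed

text \<open>The solution property is given on each \<open>[0, T]\<close> with its own null set; an
  increasing sequence of horizons leaves countably many of them.\<close>

lemma AE_time_seq:
  assumes "\<And>T. 0 < T \<Longrightarrow> T < E \<Longrightarrow> AE t in lborel. t \<in> {0<..<T} \<longrightarrow> P t"
  shows "AE t in lborel. t \<in> {0<..<E} \<longrightarrow> P t"
proof -
  obtain T :: "nat \<Rightarrow> real" where T: "\<And>n. 0 < T n \<and> T n < E" "\<And>t. t < E \<Longrightarrow> \<exists>n. t < T n"
    using seq_times by blast
  have "AE t in lborel. \<forall>n. t \<in> {0<..<T n} \<longrightarrow> P t"
    unfolding AE_all_countable using assms T(1) by blast
  thus ?thesis
  proof eventually_elim
    case (elim t)
    thus ?case using T(2)[of t] by auto
  qed
qed

lemma U_abs_continuous: "0 < T \<Longrightarrow> T < E \<Longrightarrow> abs_continuous_on 0 T U"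
  using sol unfolding strong_DO_solution_def by blast

lemma U_cont: "continuous_on {0..<E} U"
proof (rule continuous_on_half_open)
  fix t assume "0 \<le> t" "t < E"
  then obtain T where T: "0 < T" "t < T" "T < E" using approx_times[of t] by auto
  thus "\<exists>T>t. continuous_on {0..T} U"
    using abs_continuous_on_imp_continuous_on[OF U_abs_continuous[OF T(1,3)]] by blast
qed

text \<open>The inner products of rows are absolutely continuous, and their derivative vanishes
  almost everywhere by the gauge condition \<open>U t ** transpose D = 0\<close>. They therefore
  keep their initial values.\<close>

lemma rows_orthonormal:
  assumes t: "t \<in> {0..<E}"
  shows "row i (U t) \<bullet> row j (U t) = (if i = j then 1 else 0)"
proof -
  obtain T where T: "0 < T" "t < T" "T < E" using approx_times[of t] t by auto
  note AC = U_abs_continuous[OF T(1,3)]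
  define f where "f s = row i (U s) \<bullet> row j (U s)" for s
  have bl: "bounded_linear (\<lambda>A::real^'d^'r. row k A)" for k
    unfolding row_def by (simp add: vec_lambda_eta bounded_linear_vec_nth)
  have rn: "norm (row k A) \<le> norm A" for k and A :: "real^'d^'r"
    unfolding row_def by (simp add: vec_lambda_eta Finite_Cartesian_Product.norm_nth_le)
  have rd: "row k (A - A') = row k A - row k A'" for k and A A' :: "real^'d^'r"
    by (rule bounded_linear.linear[OF bl, THEN linear_diff])
  obtain B where B: "\<And>s. s \<in> {0..T} \<Longrightarrow> norm (U s) \<le> B" "B > 0"
  proof -
    have "bounded (U ` {0..T})"
      by (rule compact_imp_bounded[OF compact_continuous_image[OF abs_continuous_on_imp_continuous_on[OF AC]]]) simp
    then obtain B where "B > 0" "\<forall>x\<in>U ` {0..T}. norm x \<le> B" by (auto simp: bounded_pos)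
    thus thesis by (intro that[of B]) auto
  qed
  have fAC: "abs_continuous_on 0 T f"
  \<comment> \<open>An inner product changes by at most the change of one factor times the bound
    \<open>B\<close> of the other, once for each factor.\<close>
  proof (rule abs_continuous_on_dominated[OF AC, of "2 * B"])
    fix x y assume xy: "0 \<le> x" "x \<le> y" "y \<le> T"
    have "f y - f x = (row i (U y) - row i (U x)) \<bullet> row j (U y) + row i (U x) \<bullet> (row j (U y) - row j (U x))"
      by (simp add: f_def inner_diff_left inner_diff_right)
    also have "norm \<dots> \<le> norm (row i (U y) - row i (U x)) * norm (row j (U y)) + norm (row i (U x)) * norm (row j (U y) - row j (U x))"
      by (rule norm_triangle_le, rule add_mono) (simp_all add: Cauchy_Schwarz_ineq2)
    also have "\<dots> \<le> norm (U y - U x) * B + B * norm (U y - U x)"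
      unfolding rd[symmetric] using B xy order_trans[OF rn]
      by (intro add_mono mult_mono) (auto intro: rn order_trans[OF rn])
    finally show "norm (f y - f x) \<le> 2 * B * norm (U y - U x)" by (simp add: mult.commute)
  qed (use B in simp)
  have fd: "AE s in lborel. s \<in> {0<..<T} \<longrightarrow> (f has_vector_derivative 0) (at s)"
  proof -
    have "AE s in lborel. s \<in> {0<..<T} \<longrightarrow> (\<exists>D. (U has_vector_derivative D) (at s) \<and> U s ** transpose D = 0)"
      using sol[OF T(1,3)] unfolding strong_DO_solution_def by blast
    thus ?thesis
    proof eventually_elim
      case (elim s)
      show ?case
      proof
        assume "s \<in> {0<..<T}"
        then obtain D where D: "(U has_vector_derivative D) (at s)" "U s ** transpose D = 0" using elim by blast
        have z: "row k (U s) \<bullet> row l D = 0" for k l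
        proof -
          have "(U s ** transpose D) $ k $ l = row k (U s) \<bullet> row l D"
            by (simp add: matrix_matrix_mult_def transpose_def row_def inner_vec_def)
          thus ?thesis using D(2) by simp
        qed
        have r: "((\<lambda>s. row k (U s)) has_vector_derivative row k D) (at s)" for k
          by (rule bounded_linear.has_vector_derivative[OF bl D(1)])
        have "(f has_vector_derivative (row i (U s) \<bullet> row j D + row i D \<bullet> row j (U s))) (at s)"
          unfolding f_def by (rule bounded_bilinear.has_vector_derivative[OF bounded_bilinear_inner r r])
        thus "(f has_vector_derivative 0) (at s)" using z by (simp add: inner_commute[of "row i D"])
      qed
    qed
  qed
  have "((\<lambda>_. 0) has_integral f t - f 0) {0..t}"
    by (rule abs_continuous_on_has_integral[OF fAC _ _ _ fd]) (use t T in auto)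
  hence "f t = f 0" using has_integral_unique[OF has_integral_0] by fastforce
  thus ?thesis using sol[OF T(1,3)] unfolding f_def strong_DO_solution_def by simp
qed

lemma U_mult_transpose: "t \<in> {0..<E} \<Longrightarrow> U t ** transpose (U t) = mat 1"
  using rows_orthonormal[of t]
  by (simp add: matrix_matrix_mult_def transpose_def mat_def row_def inner_vec_def vec_eq_iff)

lemma norm_transpose_U: 
  assumes t: "t \<in> {0..<E}"
  shows "norm (transpose (U t) *v v) = norm v"
proof -
  have "(norm (transpose (U t) *v v))\<^sup>2 = v \<bullet> (U t *v (transpose (U t) *v v))"
    unfolding power2_norm_eq_inner by (metis dot_lmul_matrix transpose_matrix_vector)
  also have "\<dots> = (norm v)\<^sup>2"
    unfolding matrix_vector_mul_assoc U_mult_transpose[OF t] by (simp add: power2_norm_eq_inner)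
  finally show ?thesis by (simp add: power2_eq_iff_nonneg)
qed

lemma norm_U_le: 
  assumes t: "t \<in> {0..<E}"
  shows "norm (U t *v x) \<le> norm x"
proof -
  have "(norm (U t *v x))\<^sup>2 = x \<bullet> (transpose (U t) *v (U t *v x))"
    unfolding power2_norm_eq_inner by (metis dot_lmul_matrix inner_commute transpose_matrix_vector)
  also have "\<dots> \<le> norm x * norm (U t *v x)"
    using Cauchy_Schwarz_ineq2[of x "transpose (U t) *v (U t *v x)"] unfolding norm_transpose_U[OF t] by simp
  finally have "norm (U t *v x) * norm (U t *v x) \<le> norm x * norm (U t *v x)" by (simp add: power2_eq_square)
  thus ?thesis by (metis mult_right_le_imp_le norm_ge_zero order_le_less)
qed

text \<open>\<open>U\<close> is constrained on \<open>[0, E)\<close> only; the cutoff gives a Borel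
  function on the whole line.\<close>

definition Uc :: "real \<Rightarrow> real ^ 'd ^ 'r"
  where "Uc t = indicator {0..<E} t *\<^sub>R U t"

text \<open>\<open>U\<close> is differentiable only almost everywhere; limits of difference quotients give a Borel
  measurable version of its derivative.\<close>

definition D :: "real \<Rightarrow> real ^ 'd ^ 'r"
  where "D t = lim (\<lambda>n. real (Suc n) *\<^sub>R (Uc (t + 1 / real (Suc n)) - Uc t))"

lemma Uc_measurable[measurable]: "Uc \<in> borel_measurable borel"
  unfolding Uc_def using borel_measurable_continuous_on_indicator[OF _ U_cont] by simp

lemma D_measurable[measurable]: "D \<in> borel_measurable borel"
  unfolding D_def by measurable

lemma D_unique:
  assumes t: "0 < t" "t < E" and D': "(U has_vector_derivative D') (at t)"
  shows "D t = D'"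
proof -
  have lim: "(\<lambda>n. real (Suc n) *\<^sub>R (U (t + 1 / real (Suc n)) - U t)) \<longlonglongrightarrow> D'"
    by (rule has_vector_derivative_imp_quotient_limit[OF D'])
  have "(\<lambda>n. t + 1 / real (Suc n)) \<longlonglongrightarrow> t + 0"
    by (intro tendsto_intros LIMSEQ_Suc lim_1_over_n)
  \<comment> \<open>The quotients of \<open>Uc\<close> and \<open>U\<close> agree as soon as the
    shifted time lies below \<open>E\<close>.\<close>
  hence "\<forall>\<^sub>F n in sequentially. t + 1 / real (Suc n) < E" by (rule order_tendstoD) (use t in simp)
  hence "\<forall>\<^sub>F n in sequentially. real (Suc n) *\<^sub>R (U (t + 1 / real (Suc n)) - U t) = real (Suc n) *\<^sub>R (Uc (t + 1 / real (Suc n)) - Uc t)"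
    by eventually_elim (use t in \<open>auto simp: Uc_def add_nonneg_nonneg\<close>)
  with lim have "(\<lambda>n. real (Suc n) *\<^sub>R (Uc (t + 1 / real (Suc n)) - Uc t)) \<longlonglongrightarrow> D'"
    by (rule Lim_transform_eventually)
  thus ?thesis unfolding D_def by (rule limI)
qed

lemma U_deriv: "AE t in lborel. t \<in> {0<..<E} \<longrightarrow> (U has_vector_derivative D t) (at t)"
proof (rule AE_time_seq)
  fix T assume T: "0 < T" "T < E"
  have "AE s in lborel. s \<in> {0<..<T} \<longrightarrow> (\<exists>D. (U has_vector_derivative D) (at s) \<and> U s ** transpose D = 0)"
    using sol[OF T] unfolding strong_DO_solution_def by blast
  thus "AE t in lborel. t \<in> {0<..<T} \<longrightarrow> (U has_vector_derivative D t) (at t)"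
    by eventually_elim (use D_unique T in auto)
qed

lemma D_integrable:
  assumes t: "0 \<le> t" "t < E"
  shows "set_integrable lborel {0..t} D"
proof -
  obtain T where T: "0 < T" "t < T" "T < E" using approx_times[of t] t by auto
  have "AE s in lborel. s \<in> {0<..<T} \<longrightarrow> (U has_vector_derivative D s) (at s)"
    using U_deriv by eventually_elim (use T in auto)
  hence "D absolutely_integrable_on {0..T}"
    by (intro abs_continuous_on_absolutely_integrable[OF U_abs_continuous[OF T(1,3)]]) (use T in auto)
  hence "set_integrable lebesgue {0..t} D" by (rule set_integrable_subset) (use t T in auto)
  thus ?thesis
    unfolding set_integrable_def by (subst (asm) integrable_completion) auto
qed

lemma U_diff_eq_integral:
  assumes st: "0 \<le> s" "s \<le> t" "t < E"
  shows "U t - U s = (LINT r:{s..t}|lborel. D r)"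
proof -
  obtain T where T: "0 < T" "t < T" "T < E" using approx_times[of t] st by auto
  have "AE s in lborel. s \<in> {0<..<T} \<longrightarrow> (U has_vector_derivative D s) (at s)"
    using U_deriv by eventually_elim (use T in auto)
  hence "(D has_integral U t - U s) {s..t}"
    by (intro abs_continuous_on_has_integral[OF U_abs_continuous[OF T(1,3)]]) (use T st in auto)
  moreover have "set_integrable lborel {s..t} D"
    by (rule set_integrable_subset[OF D_integrable[of t]]) (use st in auto)
  hence "(D has_integral (LINT r:{s..t}|lborel. D r)) {s..t}"
    using set_borel_integral_eq_integral[of "{s..t}" D] by (simp add: has_integral_iff)
  ultimately show ?thesis by (rule has_integral_unique)
qed

end

text \<open>Put z = \<open>transpose D *v y\<close>. Pairing both sides of \<open>eq\<close> with
  \<open>D\<close> turns the left one into the expectation of the squared norm of z, and the right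
  one into the expectation of the inner product of \<alpha> with \<open>Q *v\<close> z. As
  \<open>Q\<close> is a contraction, the latter is at most half the sum of the energies of \<alpha>
  and z, and the half belonging to z is absorbed. The covariance matrix is never inverted.\<close>

lemma (in prob_space) energy_le:
  fixes y :: "'a \<Rightarrow> real ^ 'r" and \<alpha> :: "'a \<Rightarrow> real ^ 'd" and D :: "real ^ 'd ^ 'r" and Q :: "real ^ 'd ^ 'd"
  assumes [measurable]: "y \<in> borel_measurable M" "\<alpha> \<in> borel_measurable M"
    and y2: "integrable M (\<lambda>\<omega>. (norm (y \<omega>))\<^sup>2)" and \<alpha>2: "integrable M (\<lambda>\<omega>. (norm (\<alpha> \<omega>))\<^sup>2)"
    and eq: "cross_moment M y y ** D = cross_moment M y \<alpha> ** Q"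
    and Q: "\<And>x. norm (Q *v x) \<le> norm x"
  shows "integrable M (\<lambda>\<omega>. (norm (transpose D *v y \<omega>))\<^sup>2)"
    and "(LINT \<omega>|M. (norm (transpose D *v y \<omega>))\<^sup>2) \<le> (LINT \<omega>|M. (norm (\<alpha> \<omega>))\<^sup>2)"
proof -
  have prod: "integrable M (\<lambda>\<omega>. f \<omega> $ i * g \<omega> $ j)"
    if [measurable]: "f \<in> borel_measurable M" "g \<in> borel_measurable M"
      and "integrable M (\<lambda>\<omega>. (norm (f \<omega>))\<^sup>2)" "integrable M (\<lambda>\<omega>. (norm (g \<omega>))\<^sup>2)"
    for f :: "'a \<Rightarrow> real ^ 'n" and g :: "'a \<Rightarrow> real ^ 'l" and i j
  proof (rule Bochner_Integration.integrable_bound)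
    show "integrable M (\<lambda>\<omega>. (norm (f \<omega>))\<^sup>2 + (norm (g \<omega>))\<^sup>2)" using that by auto
    show "AE \<omega> in M. norm (f \<omega> $ i * g \<omega> $ j) \<le> norm ((norm (f \<omega>))\<^sup>2 + (norm (g \<omega>))\<^sup>2)"
    proof (intro AE_I2)
      fix \<omega>
      have "norm (f \<omega> $ i * g \<omega> $ j) \<le> norm (f \<omega>) * norm (g \<omega>)"
        using Finite_Cartesian_Product.norm_nth_le[of "f \<omega>" i] Finite_Cartesian_Product.norm_nth_le[of "g \<omega>" j]
        by (auto simp: abs_mult intro!: mult_mono)
      also have "\<dots> \<le> (norm (f \<omega>))\<^sup>2 + (norm (g \<omega>))\<^sup>2"
        using sum_squares_bound[of "norm (f \<omega>)" "norm (g \<omega>)"] mult_nonneg_nonneg[of "norm (f \<omega>)" "norm (g \<omega>)", OF norm_ge_zero norm_ge_zero]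
        unfolding mult.assoc by linarith
      finally show "norm (f \<omega> $ i * g \<omega> $ j) \<le> norm ((norm (f \<omega>))\<^sup>2 + (norm (g \<omega>))\<^sup>2)" by simp
    qed
    show "(\<lambda>\<omega>. f \<omega> $ i * g \<omega> $ j) \<in> borel_measurable M"
      using that(1,2) by (intro borel_measurable_times borel_measurable_continuous_on[OF linear_continuous_on[OF bounded_linear_vec_nth]])
  qed
  define z where "z \<omega> = transpose D *v y \<omega>" for \<omega>
  have [measurable]: "z \<in> borel_measurable M" unfolding z_def by measurable
  have zj: "z \<omega> $ j = (\<Sum>i\<in>UNIV. D $ i $ j * y \<omega> $ i)" for \<omega> j
    by (simp add: z_def transpose_def matrix_vector_mult_def)
  have z2: "integrable M (\<lambda>\<omega>. (norm (z \<omega>))\<^sup>2)"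
  proof (rule Bochner_Integration.integrable_bound)
    show "integrable M (\<lambda>\<omega>. (norm D)\<^sup>2 * (norm (y \<omega>))\<^sup>2)" using y2 by auto
    show "AE \<omega> in M. norm ((norm (z \<omega>))\<^sup>2) \<le> norm ((norm D)\<^sup>2 * (norm (y \<omega>))\<^sup>2)"
    proof (intro AE_I2)
      fix \<omega>
      have "norm (z \<omega>) \<le> norm D * norm (y \<omega>)"
        unfolding z_def using norm_matrix_vector_le[of "transpose D" "y \<omega>"] by (simp add: norm_transpose)
      hence "(norm (z \<omega>))\<^sup>2 \<le> (norm D * norm (y \<omega>))\<^sup>2" by (rule power_mono) simp
      thus "norm ((norm (z \<omega>))\<^sup>2) \<le> norm ((norm D)\<^sup>2 * (norm (y \<omega>))\<^sup>2)" by (simp add: power_mult_distrib)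
    qed
  qed measurable
  thus "integrable M (\<lambda>\<omega>. (norm (transpose D *v y \<omega>))\<^sup>2)" unfolding z_def .
  have yz: "integrable M (\<lambda>\<omega>. y \<omega> $ i * z \<omega> $ j)" for i j by (rule prod) (use y2 z2 in auto)
  have yy: "integrable M (\<lambda>\<omega>. y \<omega> $ i * y \<omega> $ j)" for i j by (rule prod) (use y2 in auto)
  have ya: "integrable M (\<lambda>\<omega>. y \<omega> $ i * \<alpha> \<omega> $ j)" for i j by (rule prod) (use y2 \<alpha>2 in auto)
  have CD: "(cross_moment M y y ** D) $ i $ j = (LINT \<omega>|M. y \<omega> $ i * z \<omega> $ j)" for i j
  proof -
    have "(cross_moment M y y ** D) $ i $ j = (\<Sum>l\<in>UNIV. (LINT \<omega>|M. y \<omega> $ i * y \<omega> $ l) * D $ l $ j)"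
      by (simp add: matrix_matrix_mult_def cross_moment_def)
    also have "\<dots> = (LINT \<omega>|M. (\<Sum>l\<in>UNIV. y \<omega> $ i * y \<omega> $ l * D $ l $ j))"
      using yy by (subst Bochner_Integration.integral_sum) auto
    also have "\<dots> = (LINT \<omega>|M. y \<omega> $ i * z \<omega> $ j)"
      by (simp add: zj sum_distrib_left mult_ac)
    finally show ?thesis .
  qed
  define \<beta> where "\<beta> \<omega> = transpose Q *v \<alpha> \<omega>" for \<omega>
  have \<beta>j: "\<beta> \<omega> $ j = (\<Sum>l\<in>UNIV. Q $ l $ j * \<alpha> \<omega> $ l)" for \<omega> j
    by (simp add: \<beta>_def transpose_def matrix_vector_mult_def)
  have yb: "integrable M (\<lambda>\<omega>. y \<omega> $ i * \<beta> \<omega> $ j)" for i j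
  proof -
    have "integrable M (\<lambda>\<omega>. \<Sum>l\<in>UNIV. Q $ l $ j * (y \<omega> $ i * \<alpha> \<omega> $ l))"
      using ya by (intro Bochner_Integration.integrable_sum integrable_mult_right) auto
    thus ?thesis by (simp add: \<beta>j sum_distrib_left mult_ac)
  qed
  have CQ: "(cross_moment M y \<alpha> ** Q) $ i $ j = (LINT \<omega>|M. y \<omega> $ i * \<beta> \<omega> $ j)" for i j
  proof -
    have "(cross_moment M y \<alpha> ** Q) $ i $ j = (\<Sum>l\<in>UNIV. (LINT \<omega>|M. y \<omega> $ i * \<alpha> \<omega> $ l) * Q $ l $ j)"
      by (simp add: matrix_matrix_mult_def cross_moment_def)
    also have "\<dots> = (LINT \<omega>|M. (\<Sum>l\<in>UNIV. y \<omega> $ i * \<alpha> \<omega> $ l * Q $ l $ j))"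
      using ya by (subst Bochner_Integration.integral_sum) auto
    also have "\<dots> = (LINT \<omega>|M. y \<omega> $ i * \<beta> \<omega> $ j)"
      by (simp add: \<beta>j sum_distrib_left mult_ac)
    finally show ?thesis .
  qed
  \<comment> \<open>Pairing with \<open>D\<close> entry by entry, for a general second factor
    \<open>w\<close>; it is used with \<open>z\<close> itself and with
    \<open>\<beta>\<close>.\<close>
  have trace: "(LINT \<omega>|M. z \<omega> \<bullet> w \<omega>) = (\<Sum>j\<in>UNIV. \<Sum>i\<in>UNIV. D $ i $ j * (LINT \<omega>|M. y \<omega> $ i * w \<omega> $ j))"
    and tint: "integrable M (\<lambda>\<omega>. z \<omega> \<bullet> w \<omega>)"
    if int: "\<And>i j. integrable M (\<lambda>\<omega>. y \<omega> $ i * w \<omega> $ j)" for w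
  proof -
    have zw: "z \<omega> \<bullet> w \<omega> = (\<Sum>j\<in>UNIV. \<Sum>i\<in>UNIV. D $ i $ j * (y \<omega> $ i * w \<omega> $ j))" for \<omega>
      by (simp add: inner_vec_def zj sum_distrib_right mult.assoc)
    show "integrable M (\<lambda>\<omega>. z \<omega> \<bullet> w \<omega>)"
      unfolding zw by (intro Bochner_Integration.integrable_sum integrable_mult_right int)
    have "(LINT \<omega>|M. z \<omega> \<bullet> w \<omega>) = (\<Sum>j\<in>UNIV. (LINT \<omega>|M. (\<Sum>i\<in>UNIV. D $ i $ j * (y \<omega> $ i * w \<omega> $ j))))"
      unfolding zw by (rule Bochner_Integration.integral_sum) (intro Bochner_Integration.integrable_sum integrable_mult_right int)
    also have "\<dots> = (\<Sum>j\<in>UNIV. \<Sum>i\<in>UNIV. (LINT \<omega>|M. D $ i $ j * (y \<omega> $ i * w \<omega> $ j)))"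
      by (intro sum.cong refl Bochner_Integration.integral_sum integrable_mult_right int)
    finally show "(LINT \<omega>|M. z \<omega> \<bullet> w \<omega>) = (\<Sum>j\<in>UNIV. \<Sum>i\<in>UNIV. D $ i $ j * (LINT \<omega>|M. y \<omega> $ i * w \<omega> $ j))"
      by simp
  qed
  have "(LINT \<omega>|M. (norm (z \<omega>))\<^sup>2) = (LINT \<omega>|M. z \<omega> \<bullet> \<beta> \<omega>)"
    unfolding power2_norm_eq_inner trace[OF yz] trace[OF yb] CD[symmetric] CQ[symmetric] eq ..
  also have "\<dots> \<le> (LINT \<omega>|M. (norm (\<alpha> \<omega>))\<^sup>2 / 2 + (norm (z \<omega>))\<^sup>2 / 2)"
  proof (rule integral_mono)
    fix \<omega>
    have "z \<omega> \<bullet> \<beta> \<omega> = \<alpha> \<omega> \<bullet> (Q *v z \<omega>)"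
      unfolding \<beta>_def by (metis dot_lmul_matrix inner_commute transpose_matrix_vector)
    also have "\<dots> \<le> norm (\<alpha> \<omega>) * norm (Q *v z \<omega>)" by (rule norm_cauchy_schwarz)
    also have "\<dots> \<le> norm (\<alpha> \<omega>) * norm (z \<omega>)" by (intro mult_left_mono Q) auto
    also have "\<dots> \<le> (norm (\<alpha> \<omega>))\<^sup>2 / 2 + (norm (z \<omega>))\<^sup>2 / 2"
      using sum_squares_bound[of "norm (\<alpha> \<omega>)" "norm (z \<omega>)"] by simp
    finally show "z \<omega> \<bullet> \<beta> \<omega> \<le> (norm (\<alpha> \<omega>))\<^sup>2 / 2 + (norm (z \<omega>))\<^sup>2 / 2" .
  qed (use tint[OF yb] \<alpha>2 z2 in auto)
  also have "\<dots> = (LINT \<omega>|M. (norm (\<alpha> \<omega>))\<^sup>2) / 2 + (LINT \<omega>|M. (norm (z \<omega>))\<^sup>2) / 2"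
    using \<alpha>2 z2 by simp
  finally show "(LINT \<omega>|M. (norm (transpose D *v y \<omega>))\<^sup>2) \<le> (LINT \<omega>|M. (norm (\<alpha> \<omega>))\<^sup>2)"
    unfolding z_def by simp
qed

lemma norm_orth_compl_proj_le:
  fixes S :: "(real ^ 'd) set"
  assumes "subspace S"
  shows "norm ((mat 1 - orth_proj S) *v x) \<le> norm x"
proof -
  have e: "(mat 1 - orth_proj S) *v x = x - orth_proj S *v x"
    by (simp add: matrix_vector_mult_diff_rdistrib)
  have "orthogonal (x - orth_proj S *v x) (orth_proj S *v x)"
    by (rule orth_proj(2)[OF assms orth_proj(1)[OF assms]])
  hence "(norm ((x - orth_proj S *v x) + orth_proj S *v x))\<^sup>2 = (norm (x - orth_proj S *v x))\<^sup>2 + (norm (orth_proj S *v x))\<^sup>2"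
    by (rule norm_add_Pythagorean)
  hence "(norm (x - orth_proj S *v x))\<^sup>2 \<le> (norm x)\<^sup>2" by simp
  thus ?thesis unfolding e by (rule power2_le_imp_le) simp
qed

section \<open>The solution as an \<open>sde_process\<close>\<close>

context do_solution
begin

lemma Y_square_integrable:
  assumes "t \<in> {0..<E}"
  shows "square_integrable M (Y t)"
proof -
  obtain T where T: "0 < T" "T < E" "t < T" using approx_times[of t] assms by auto
  have "\<forall>t\<in>{0..T}. square_integrable M (Y t)" using sol[OF T(1,2)] unfolding strong_DO_solution_def by blast
  thus ?thesis using assms T(3) by auto
qed

lemma Y_adapted:
  assumes "t \<in> {0..<E}"
  shows "Y t \<in> borel_measurable (F t)"
proof -
  obtain T where T: "0 < T" "T < E" "t < T" using approx_times[of t] assms by auto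
  have "\<forall>t\<in>{0..T}. Y t \<in> borel_measurable (F t)" using sol[OF T(1,2)] unfolding strong_DO_solution_def by blast
  thus ?thesis using assms T(3) by auto
qed

lemma Y_path_cont: "AE \<omega> in M. continuous_on {0..<E} (\<lambda>t. Y t \<omega>)"
proof -
  obtain T :: "nat \<Rightarrow> real" where T: "\<And>n. 0 < T n \<and> T n < E" "\<And>t. t < E \<Longrightarrow> \<exists>n. t < T n"
    using seq_times by blast
  have "AE \<omega> in M. \<forall>n. continuous_on {0..T n} (\<lambda>t. Y t \<omega>)"
    unfolding AE_all_countable using sol T(1) unfolding strong_DO_solution_def by blast
  thus ?thesis
  proof eventually_elim
    case (elim \<omega>)
    show ?case by (rule continuous_on_half_open) (use elim T(2) in blast)
  qed
qed

text \<open>\<open>Y\<close> is set to zero on the null set of discontinuous paths and outside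
  \<open>[0, E)\<close>. The new process has continuous paths for every outcome and is measurable in
  time and outcome together. Orthonormal rows let \<open>U t\<close> act as a contraction, and its
  transpose as an isometry, so the growth bound of \<open>a\<close> and \<open>b\<close> carries
  over with the same constant.\<close>

lemma ex_sde_process:
  "\<exists>Yc \<mu> \<sigma>. sde_process M F W E Yc \<mu> (\<sigma> :: real \<Rightarrow> 'w \<Rightarrow> real ^ 'm ^ 'r) Cg \<and>
     (AE \<omega> in M. \<forall>t\<in>{0..<E}. Yc t \<omega> = Y t \<omega>)"
proof -
  obtain N where N: "{\<omega> \<in> space M. \<not> continuous_on {0..<E} (\<lambda>t. Y t \<omega>)} \<subseteq> N" "N \<in> null_sets M"
    using Y_path_cont by (auto simp: eventually_ae_filter)
  define \<Omega> where "\<Omega> = space M - N"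
  \<comment> \<open>The usual conditions enter here: null sets belong to \<open>F 0\<close>, so
    discarding one of them keeps the process adapted.\<close>
  have \<Omega>F: "\<Omega> \<in> sets (F t)" if "0 \<le> t" for t
  proof -
    have "N \<in> sets (F t)" using null_sets_F0 N(2) mono[of 0 t] that by auto
    hence "space (F t) - N \<in> sets (F t)" by auto
    thus ?thesis unfolding \<Omega>_def space_F[OF that] .
  qed
  have \<Omega>M[measurable]: "\<Omega> \<in> sets M" using sets_F[OF order_refl \<Omega>F] by simp
  have \<Omega>c: "continuous_on {0..<E} (\<lambda>t. Y t \<omega>)" if "\<omega> \<in> \<Omega>" for \<omega> using N(1) that by (auto simp: \<Omega>_def)
  have \<Omega>ae: "AE \<omega> in M. \<omega> \<in> \<Omega>"
    using AE_not_in[OF N(2)] AE_space by eventually_elim (simp add: \<Omega>_def)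
  define Yc where "Yc t \<omega> = (if \<omega> \<in> \<Omega> \<and> t \<in> {0..<E} then Y t \<omega> else 0)" for t \<omega>
  have Yceq: "Yc t \<omega> = Y t \<omega>" if "\<omega> \<in> \<Omega>" "t \<in> {0..<E}" for t \<omega> using that by (simp add: Yc_def)
  have Yc_F: "Yc t \<in> borel_measurable (F t)" if t: "0 \<le> t" "t < E" for t
  proof -
    have "(\<lambda>\<omega>. if \<omega> \<in> \<Omega> then Y t \<omega> else 0) \<in> borel_measurable (F t)"
      by (rule measurable_If_set) (use Y_adapted[of t] \<Omega>F[OF t(1)] sets.Int_space_eq2[OF \<Omega>F[OF t(1)]] t in auto)
    thus ?thesis using t by (simp add: Yc_def[abs_def])
  qed
  have Yc_M[measurable]: "Yc t \<in> borel_measurable M" for t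
  proof (cases "t \<in> {0..<E}")
    case True
    thus ?thesis using measurable_F[OF Yc_F] by auto
  next
    case False
    hence "Yc t = (\<lambda>_. 0)" by (intro ext) (auto simp: Yc_def)
    thus ?thesis by simp
  qed
  \<comment> \<open>Rounding time down to a grid leaves countably many random variables, hence a
    jointly measurable process; continuity of the paths gives the limit. Rounding down keeps the
    times inside \<open>[0, E)\<close>.\<close>
  define s where "s n t = real_of_int \<lfloor>real (Suc n) * t\<rfloor> / real (Suc n)" for n t
  have s: "0 \<le> s n t" "s n t \<le> t" "t - 1 / real (Suc n) \<le> s n t" if "0 \<le> t" for n t
  proof -
    show "0 \<le> s n t" using that by (simp add: s_def)
    have "s n t \<le> real (Suc n) * t / real (Suc n)" unfolding s_def by (intro divide_right_mono) auto
    thus "s n t \<le> t" by (simp del: of_nat_Suc)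
    have "(real (Suc n) * t - 1) / real (Suc n) \<le> s n t" unfolding s_def by (intro divide_right_mono) linarith+
    thus "t - 1 / real (Suc n) \<le> s n t" by (simp add: diff_divide_distrib del: of_nat_Suc)
  qed
  have jm: "(\<lambda>z. Yc (fst z) (snd z)) \<in> borel_measurable (borel \<Otimes>\<^sub>M M)"
  proof (rule borel_measurable_LIMSEQ_metric)
    fix n
    have "(\<lambda>z. Yc (real_of_int \<lfloor>real (Suc n) * fst z\<rfloor> / real (Suc n)) (snd z)) \<in> borel_measurable (borel \<Otimes>\<^sub>M M)"
    proof (rule measurable_compose_countable[where f="\<lambda>i z. Yc (real_of_int i / real (Suc n)) (snd z)" and g="\<lambda>z. \<lfloor>real (Suc n) * fst z\<rfloor>"])
      show "(\<lambda>z. Yc (real_of_int i / real (Suc n)) (snd z)) \<in> borel_measurable (borel \<Otimes>\<^sub>M M)" for i by measurable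
      show "(\<lambda>z. \<lfloor>real (Suc n) * fst z\<rfloor>) \<in> measurable (borel \<Otimes>\<^sub>M M) (count_space UNIV)" by measurable
    qed
    thus "(\<lambda>z. indicator {0..<E} (fst z) *\<^sub>R Yc (s n (fst z)) (snd z)) \<in> borel_measurable (borel \<Otimes>\<^sub>M M)"
      unfolding s_def by (intro borel_measurable_scaleR) auto
  next
    fix z assume "z \<in> space (borel \<Otimes>\<^sub>M M :: (real \<times> 'w) measure)"
    obtain t \<omega> where z: "z = (t, \<omega>)" by (cases z)
    show "(\<lambda>n. indicator {0..<E} (fst z) *\<^sub>R Yc (s n (fst z)) (snd z)) \<longlonglongrightarrow> Yc (fst z) (snd z)"
    proof (cases "\<omega> \<in> \<Omega> \<and> t \<in> {0..<E}")
      case True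
      have "(\<lambda>n. s n t) \<longlonglongrightarrow> t"
      proof (rule tendsto_sandwich)
        have "(\<lambda>n. t - 1 / real (Suc n)) \<longlonglongrightarrow> t - 0" by (intro tendsto_intros LIMSEQ_Suc lim_1_over_n)
        thus "(\<lambda>n. t - 1 / real (Suc n)) \<longlonglongrightarrow> t" by simp
      qed (use s[of t] True in auto)
      moreover have sE: "s n t \<in> {0..<E}" for n using s[of t n] True by auto
      ultimately have "(\<lambda>n. Y (s n t) \<omega>) \<longlonglongrightarrow> Y t \<omega>"
        using continuous_on_tendsto_compose[OF \<Omega>c[of \<omega>], of "\<lambda>n. s n t" t sequentially] True by auto
      thus ?thesis using True sE by (simp add: z Yc_def)
    next
      case False
      hence "indicator {0..<E} t *\<^sub>R Yc (s n t) \<omega> = 0" for n by (auto simp: Yc_def)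
      hence "(\<lambda>n. indicator {0..<E} t *\<^sub>R Yc (s n t) \<omega>) = (\<lambda>_. 0)" by blast
      moreover have "Yc t \<omega> = 0" using False by (auto simp: Yc_def)
      ultimately show ?thesis by (simp add: z)
    qed
  qed
  \<comment> \<open>With \<open>Uc\<close> and \<open>max 0\<close> the coefficients become jointly
    measurable on all of time; on \<open>[0, E)\<close> nothing changes.\<close>
  define \<mu> where "\<mu> t \<omega> = Uc t *v a (max 0 t) (transpose (Uc t) *v Yc t \<omega>)" for t \<omega>
  define \<sigma> where "\<sigma> t \<omega> = Uc t ** b (max 0 t) (transpose (Uc t) *v Yc t \<omega>)" for t \<omega>
  have Uc: "Uc t = U t" if "t \<in> {0..<E}" for t using that by (simp add: Uc_def)
  note jm[measurable]
  have Ucm[measurable]: "(\<lambda>z. Uc (fst z)) \<in> borel_measurable (borel \<Otimes>\<^sub>M M)" by measurable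
  have "(\<lambda>z. a (max 0 (fst z)) (transpose (Uc (fst z)) *v Yc (fst z) (snd z))) \<in> borel_measurable (borel \<Otimes>\<^sub>M M)"
    by (rule jointly_measurable_compose[OF a_meas]) measurable
  hence \<mu>jm: "(\<lambda>z. \<mu> (fst z) (snd z)) \<in> borel_measurable (borel \<Otimes>\<^sub>M M)" unfolding \<mu>_def by measurable
  have "(\<lambda>z. b (max 0 (fst z)) (transpose (Uc (fst z)) *v Yc (fst z) (snd z))) \<in> borel_measurable (borel \<Otimes>\<^sub>M M)"
    by (rule jointly_measurable_compose[OF b_meas]) measurable
  hence \<sigma>jm: "(\<lambda>z. \<sigma> (fst z) (snd z)) \<in> borel_measurable (borel \<Otimes>\<^sub>M M)" unfolding \<sigma>_def by measurable
  have gr: "(norm (a t (transpose (U t) *v v)))\<^sup>2 + (norm (b t (transpose (U t) *v v)))\<^sup>2 \<le> Cg * (1 + (norm v)\<^sup>2)"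
    if "t \<in> {0..<E}" for t v
    using growth[of t "transpose (U t) *v v"] norm_transpose_U[OF that, of v] that by simp
  have "sde_process M F W E Yc \<mu> \<sigma> Cg"
  proof (intro sde_process.intro sde_process_axioms.intro)
    show "brownian_motion M F W" by (rule brownian_motion_axioms)
    show "continuous_on {0..<E} (\<lambda>t. Yc t \<omega>)" for \<omega>
    proof (cases "\<omega> \<in> \<Omega>")
      case True
      thus ?thesis using \<Omega>c[OF True] by (subst continuous_on_cong[OF refl Yceq]) auto
    next
      case False
      thus ?thesis by (simp add: Yc_def)
    qed
    fix t \<omega> assume t: "0 \<le> t" "t < E"
    hence tE: "t \<in> {0..<E}" by simp
    have "norm (\<mu> t \<omega>) \<le> norm (a t (transpose (U t) *v Yc t \<omega>))"
      using norm_U_le[OF tE] t by (simp add: \<mu>_def Uc[OF tE])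
    hence "(norm (\<mu> t \<omega>))\<^sup>2 \<le> (norm (a t (transpose (U t) *v Yc t \<omega>)))\<^sup>2" by (rule power_mono) simp
    thus "(norm (\<mu> t \<omega>))\<^sup>2 \<le> Cg * (1 + (norm (Yc t \<omega>))\<^sup>2)" using gr[OF tE, of "Yc t \<omega>"] by (smt (verit) zero_le_power2)
    have "norm (\<sigma> t \<omega>) \<le> norm (b t (transpose (U t) *v Yc t \<omega>))"
      using norm_contraction_matrix_mult[of "U t", OF norm_U_le[OF tE]] t by (simp add: \<sigma>_def Uc[OF tE])
    hence "(norm (\<sigma> t \<omega>))\<^sup>2 \<le> (norm (b t (transpose (U t) *v Yc t \<omega>)))\<^sup>2" by (rule power_mono) simp
    thus "(norm (\<sigma> t \<omega>))\<^sup>2 \<le> Cg * (1 + (norm (Yc t \<omega>))\<^sup>2)" using gr[OF tE, of "Yc t \<omega>"] by (smt (verit) zero_le_power2)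
  next
    fix T assume T: "0 < T" "T < E"
    have "solves_sde M F W T (\<lambda>t \<omega>. U t *v a t (DO_approx U Y t \<omega>)) (\<lambda>t \<omega>. U t ** b t (DO_approx U Y t \<omega>)) Y"
      using sol[OF T] unfolding strong_DO_solution_def by blast
    then obtain I where I: "is_ito_integral M F W T (\<lambda>t \<omega>. U t ** b t (DO_approx U Y t \<omega>)) I"
      "AE \<omega> in M. \<forall>t\<in>{0..T}. Y t \<omega> = Y 0 \<omega> + (LINT s:{0..t}|lborel. U s *v a s (DO_approx U Y s \<omega>)) + I t \<omega>"
      unfolding solves_sde_def by blast
    have "is_ito_integral M F W T \<sigma> I"
    proof (rule is_ito_integral_cong_AE[OF I(1) _ \<sigma>jm], use \<Omega>ae in eventually_elim)
      case (elim \<omega>)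
      thus ?case using T by (auto simp: \<sigma>_def Uc Yceq DO_approx_def)
    qed
    moreover have "AE \<omega> in M. \<forall>t\<in>{0..T}. Yc t \<omega> = Yc 0 \<omega> + (LINT s:{0..t}|lborel. \<mu> s \<omega>) + I t \<omega>"
      using I(2) \<Omega>ae
    proof eventually_elim
      case (elim \<omega>)
      show ?case
      proof
        fix t assume t: "t \<in> {0..T}"
        have "(LINT s:{0..t}|lborel. U s *v a s (DO_approx U Y s \<omega>)) = (LINT s:{0..t}|lborel. \<mu> s \<omega>)"
          by (rule set_lebesgue_integral_cong) (use elim(2) T t in \<open>auto simp: \<mu>_def Uc Yceq DO_approx_def\<close>)
        thus "Yc t \<omega> = Yc 0 \<omega> + (LINT s:{0..t}|lborel. \<mu> s \<omega>) + I t \<omega>"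
          using bspec[OF elim(1) t] Yceq[OF elim(2), of t] Yceq[OF elim(2), of 0] t T E_pos by simp
      qed
    qed
    ultimately show "\<exists>I. is_ito_integral M F W T \<sigma> I \<and>
      (AE \<omega> in M. \<forall>t\<in>{0..T}. Yc t \<omega> = Yc 0 \<omega> + (LINT s:{0..t}|lborel. \<mu> s \<omega>) + I t \<omega>)" by blast
  qed (use E_pos Cg jm \<mu>jm \<sigma>jm Yc_F in auto)
  moreover have "AE \<omega> in M. \<forall>t\<in>{0..<E}. Yc t \<omega> = Y t \<omega>"
    using \<Omega>ae by eventually_elim (simp add: Yceq)
  ultimately show ?thesis by blast
qed

lemma Y_moment_bound:
  assumes k: "k \<ge> 1" and C0: "C0 \<ge> 0" "(\<integral>\<^sup>+\<omega>. ennreal (norm (Y 0 \<omega>) ^ (2 * k)) \<partial>M) \<le> ennreal C0"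
  shows "\<exists>C\<ge>0. \<forall>t\<in>{0..<E}. (\<integral>\<^sup>+\<omega>. ennreal (norm (Y t \<omega>) ^ (2 * k)) \<partial>M) \<le> ennreal C"
proof -
  obtain Yc \<mu> and \<sigma> :: "real \<Rightarrow> 'w \<Rightarrow> real ^ 'm ^ 'r" where sp: "sde_process M F W E Yc \<mu> \<sigma> Cg"
    and eq: "AE \<omega> in M. \<forall>t\<in>{0..<E}. Yc t \<omega> = Y t \<omega>" using ex_sde_process by blast
  have e: "(\<integral>\<^sup>+\<omega>. ennreal (norm (Yc t \<omega>) ^ (2 * k)) \<partial>M) = (\<integral>\<^sup>+\<omega>. ennreal (norm (Y t \<omega>) ^ (2 * k)) \<partial>M)"
    if "t \<in> {0..<E}" for t
    by (rule nn_integral_cong_AE, use eq in eventually_elim) (use that in simp)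
  have "(\<integral>\<^sup>+\<omega>. ennreal (norm (Yc 0 \<omega>) ^ (2 * k)) \<partial>M) \<le> ennreal C0" using e[of 0] E_pos C0 by simp
  from sde_process.moment_bound[OF sp k C0(1) this] show ?thesis using e by auto
qed

text \<open>Mean-square continuity at time 0 from square integrable initial data alone, that is, the
  case \<open>k = 1\<close> of the moment estimates; it feeds the positivity of the explosion
  time.\<close>

lemma Y_increment_second_moment:
  "\<exists>c\<ge>0. \<forall>t\<in>{0<..<E}. (\<integral>\<^sup>+\<omega>. ennreal ((norm (Y t \<omega> - Y 0 \<omega>))\<^sup>2) \<partial>M) \<le> ennreal (c * t)"
proof -
  obtain Yc \<mu> and \<sigma> :: "real \<Rightarrow> 'w \<Rightarrow> real ^ 'm ^ 'r" where sp: "sde_process M F W E Yc \<mu> \<sigma> Cg"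
    and eq: "AE \<omega> in M. \<forall>t\<in>{0..<E}. Yc t \<omega> = Y t \<omega>" using ex_sde_process by blast
  have "integrable M (\<lambda>\<omega>. (norm (Y 0 \<omega>))\<^sup>2)" using Y_square_integrable[of 0] E_pos by (simp add: square_integrable_def)
  from nn_integral_eq_integral[OF this]
  have "(\<integral>\<^sup>+\<omega>. ennreal (norm (Y 0 \<omega>) ^ (2 * 1)) \<partial>M) \<le> ennreal (LINT \<omega>|M. (norm (Y 0 \<omega>))\<^sup>2)" by simp
  from Y_moment_bound[OF order_refl _ this]
  obtain C where C: "C \<ge> 0" "\<And>t. t \<in> {0..<E} \<Longrightarrow> (\<integral>\<^sup>+\<omega>. ennreal (norm (Y t \<omega>) ^ (2 * 1)) \<partial>M) \<le> ennreal C"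
    by (auto intro: Bochner_Integration.integral_nonneg)
  have "(\<integral>\<^sup>+\<omega>. ennreal (norm (Yc t \<omega>) ^ (2 * 1)) \<partial>M) \<le> ennreal C" if t: "t \<in> {0..<E}" for t
  proof -
    have "(\<integral>\<^sup>+\<omega>. ennreal (norm (Yc t \<omega>) ^ (2 * 1)) \<partial>M) = (\<integral>\<^sup>+\<omega>. ennreal (norm (Y t \<omega>) ^ (2 * 1)) \<partial>M)"
      by (rule nn_integral_cong_AE, use eq in eventually_elim) (use t in simp)
    thus ?thesis using C(2)[OF t] by simp
  qed
  from sde_process.increment_moment[OF sp order_refl C(1) this, where 'q='r]
  obtain c where c: "c \<ge> 0" and inc: "\<And>N u (A :: nat \<Rightarrow> real ^ 'r ^ 'r).
    (\<forall>j<N. u j \<le> u (Suc j)) \<Longrightarrow> 0 \<le> u 0 \<Longrightarrow> u 0 < u N \<Longrightarrow> u N < E \<Longrightarrow>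
    (\<forall>j<N. \<forall>v. norm (A j *v v) \<le> norm v) \<Longrightarrow>
    (\<integral>\<^sup>+\<omega>. ennreal (norm (\<Sum>j<N. A j *v (Yc (u (Suc j)) \<omega> - Yc (u j) \<omega>)) ^ (2 * 1)) \<partial>M)
      \<le> ennreal (c * (u N - u 0) ^ 1)" by blast
  have "(\<integral>\<^sup>+\<omega>. ennreal ((norm (Y t \<omega> - Y 0 \<omega>))\<^sup>2) \<partial>M) \<le> ennreal (c * t)" if t: "t \<in> {0<..<E}" for t
  proof -
    have "(\<integral>\<^sup>+\<omega>. ennreal ((norm (Y t \<omega> - Y 0 \<omega>))\<^sup>2) \<partial>M) = (\<integral>\<^sup>+\<omega>. ennreal ((norm (Yc t \<omega> - Yc 0 \<omega>))\<^sup>2) \<partial>M)"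
      by (rule nn_integral_cong_AE, use eq in eventually_elim) (use t in simp)
    thus ?thesis using inc[of 1 "\<lambda>j. if j = 0 then 0 else t" "\<lambda>_. mat 1"] t by simp
  qed
  thus ?thesis using c by blast
qed

text \<open>The evolution equation of \<open>U\<close> has the form required by
  \<open>energy_le\<close>, the complementary projection being a contraction. Linear growth and the
  isometry of the transpose of \<open>U\<close> bound the energy of the drift by the second moment
  of \<open>Y\<close>.\<close>

lemma energy_bound:
  assumes C: "C \<ge> 0" "\<And>t. t \<in> {0..<E} \<Longrightarrow> (\<integral>\<^sup>+\<omega>. ennreal ((norm (Y t \<omega>))\<^sup>2) \<partial>M) \<le> ennreal C"
  shows "AE u in lborel. u \<in> {0<..<E} \<longrightarrow>
    (\<integral>\<^sup>+\<omega>. ennreal ((norm (transpose (D u) *v Y u \<omega>))\<^sup>2) \<partial>M) \<le> ennreal (Cg * (1 + C))"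
proof (rule AE_time_seq)
  fix T assume T: "0 < T" "T < E"
  have "AE t in lborel. t \<in> {0<..<T} \<longrightarrow>
      (\<exists>D. (U has_vector_derivative D) (at t) \<and>
        cross_moment M (Y t) (Y t) ** D =
          cross_moment M (Y t) (\<lambda>\<omega>. a t (DO_approx U Y t \<omega>)) **
            (mat 1 - orth_proj (span (rows (U t)))))"
    using sol[OF T] unfolding strong_DO_solution_def by blast
  thus "AE u in lborel. u \<in> {0<..<T} \<longrightarrow>
    (\<integral>\<^sup>+\<omega>. ennreal ((norm (transpose (D u) *v Y u \<omega>))\<^sup>2) \<partial>M) \<le> ennreal (Cg * (1 + C))"
  proof eventually_elim
    case (elim t)
    show ?case
    proof
      assume t: "t \<in> {0<..<T}"
      hence tE: "t \<in> {0..<E}" using T by simp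
      let ?\<alpha> = "\<lambda>\<omega>. a t (DO_approx U Y t \<omega>)"
      have eq: "cross_moment M (Y t) (Y t) ** D t = cross_moment M (Y t) ?\<alpha> ** (mat 1 - orth_proj (span (rows (U t))))"
        using elim t T D_unique[of t] by auto
      have Y[measurable]: "Y t \<in> borel_measurable M" and Y2: "integrable M (\<lambda>\<omega>. (norm (Y t \<omega>))\<^sup>2)"
        using Y_square_integrable[OF tE] by (auto simp: square_integrable_def)
      have [measurable]: "DO_approx U Y t \<in> borel_measurable M" unfolding DO_approx_def[abs_def] by measurable
      have am[measurable]: "?\<alpha> \<in> borel_measurable M"
        using jointly_measurable_compose[OF a_meas, of "\<lambda>_. t" M "DO_approx U Y t"] t by simp
      have a2le: "(norm (?\<alpha> \<omega>))\<^sup>2 \<le> Cg * (1 + (norm (Y t \<omega>))\<^sup>2)" for \<omega>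
        using growth[of t "DO_approx U Y t \<omega>"] norm_transpose_U[OF tE, of "Y t \<omega>"] t
          zero_le_power2[of "norm (b t (DO_approx U Y t \<omega>))"]
        unfolding DO_approx_def by (auto intro: order_trans[rotated])
      have a2: "integrable M (\<lambda>\<omega>. (norm (?\<alpha> \<omega>))\<^sup>2)"
      proof (rule Bochner_Integration.integrable_bound)
        show "integrable M (\<lambda>\<omega>. Cg * (1 + (norm (Y t \<omega>))\<^sup>2))" using Y2 by auto
        show "AE \<omega> in M. norm ((norm (?\<alpha> \<omega>))\<^sup>2) \<le> norm (Cg * (1 + (norm (Y t \<omega>))\<^sup>2))"
          using a2le Cg by (intro AE_I2) (simp add: abs_of_nonneg)
      qed measurable
      note en = energy_le[OF Y am Y2 a2 eq norm_orth_compl_proj_le[OF subspace_span]]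
      have "(\<integral>\<^sup>+\<omega>. ennreal ((norm (transpose (D t) *v Y t \<omega>))\<^sup>2) \<partial>M) = ennreal (LINT \<omega>|M. (norm (transpose (D t) *v Y t \<omega>))\<^sup>2)"
        by (rule nn_integral_eq_integral[OF en(1)]) simp
      also have "\<dots> \<le> ennreal (LINT \<omega>|M. (norm (?\<alpha> \<omega>))\<^sup>2)" by (rule ennreal_leI[OF en(2)])
      also have "\<dots> \<le> ennreal (LINT \<omega>|M. Cg * (1 + (norm (Y t \<omega>))\<^sup>2))"
        by (intro ennreal_leI integral_mono a2 a2le) (use Y2 in auto)
      also have "(LINT \<omega>|M. Cg * (1 + (norm (Y t \<omega>))\<^sup>2)) = Cg * (1 + (LINT \<omega>|M. (norm (Y t \<omega>))\<^sup>2))"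
        using Y2 by (simp add: prob_space)
      also have "ennreal \<dots> \<le> ennreal (Cg * (1 + C))"
      proof (intro ennreal_leI mult_left_mono add_left_mono Cg)
        have "ennreal (LINT \<omega>|M. (norm (Y t \<omega>))\<^sup>2) \<le> ennreal C"
          using C(2)[OF tE] nn_integral_eq_integral[OF Y2] by simp
        thus "(LINT \<omega>|M. (norm (Y t \<omega>))\<^sup>2) \<le> C" using C(1) by (simp add: ennreal_le_iff)
      qed
      finally show "(\<integral>\<^sup>+\<omega>. ennreal ((norm (transpose (D t) *v Y t \<omega>))\<^sup>2) \<partial>M) \<le> ennreal (Cg * (1 + C))" .
    qed
  qed
qed

lemma DO_approx_holder:
  assumes C0: "C0 \<ge> 0" "(\<integral>\<^sup>+\<omega>. ennreal (norm (Y 0 \<omega>) ^ 4) \<partial>M) \<le> ennreal C0"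
  shows "AE \<omega> in M. holder_continuous_on (1 / 8) {0..<E} (\<lambda>t. DO_approx U Y t \<omega>)"
proof -
  obtain Yc \<mu> and \<sigma> :: "real \<Rightarrow> 'w \<Rightarrow> real ^ 'm ^ 'r" where sp: "sde_process M F W E Yc \<mu> \<sigma> Cg"
    and eq: "AE \<omega> in M. \<forall>t\<in>{0..<E}. Yc t \<omega> = Y t \<omega>" using ex_sde_process by blast
  have e: "(\<integral>\<^sup>+\<omega>. f (Yc t \<omega>) \<partial>M) = (\<integral>\<^sup>+\<omega>. f (Y t \<omega>) \<partial>M)"
    if "t \<in> {0..<E}" for t and f :: "real ^ 'r \<Rightarrow> ennreal"
    by (rule nn_integral_cong_AE, use eq in eventually_elim) (use that in simp)
  obtain C4 where C4: "C4 \<ge> 0" "\<And>t. t \<in> {0..<E} \<Longrightarrow> (\<integral>\<^sup>+\<omega>. ennreal (norm (Y t \<omega>) ^ 4) \<partial>M) \<le> ennreal C4"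
    using Y_moment_bound[of 2 C0] C0 by auto
  \<comment> \<open>The energy bound needs second moments; they follow from the fourth ones because
    x \<le> 1 + x * x.\<close>
  have C2: "(\<integral>\<^sup>+\<omega>. ennreal ((norm (Y t \<omega>))\<^sup>2) \<partial>M) \<le> ennreal (1 + C4)" if t: "t \<in> {0..<E}" for t
  proof -
    have [measurable]: "Y t \<in> borel_measurable M" using Y_square_integrable[OF t] by (simp add: square_integrable_def)
    have "(\<integral>\<^sup>+\<omega>. ennreal ((norm (Y t \<omega>))\<^sup>2) \<partial>M) \<le> (\<integral>\<^sup>+\<omega>. 1 + ennreal (norm (Y t \<omega>) ^ 4) \<partial>M)"
    proof (rule nn_integral_mono)
      fix \<omega>
      have "(norm (Y t \<omega>))\<^sup>2 \<le> 1 + ((norm (Y t \<omega>))\<^sup>2)\<^sup>2"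
        using sum_squares_bound[of 1 "(norm (Y t \<omega>))\<^sup>2"] zero_le_power2[of "norm (Y t \<omega>)"]
        unfolding power_one mult_1_right by linarith
      hence "ennreal ((norm (Y t \<omega>))\<^sup>2) \<le> ennreal (1 + norm (Y t \<omega>) ^ 4)" by (intro ennreal_leI) simp
      thus "ennreal ((norm (Y t \<omega>))\<^sup>2) \<le> 1 + ennreal (norm (Y t \<omega>) ^ 4)" by simp
    qed
    also have "\<dots> = 1 + (\<integral>\<^sup>+\<omega>. ennreal (norm (Y t \<omega>) ^ 4) \<partial>M)" by (simp add: nn_integral_add emeasure_space_1)
    also have "\<dots> \<le> ennreal (1 + C4)" using C4(2)[OF t] C4(1) by (simp add: add_left_mono)
    finally show ?thesis .
  qed
  have "AE \<omega> in M. holder_continuous_on (1 / 8) {0..<E} (\<lambda>t. transpose (U t) *v Yc t \<omega>)"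
  proof (rule sde_process.holder_paths[OF sp D_measurable D_integrable U_diff_eq_integral U_cont _ _ _ C4(1)])
    show "norm (transpose (U t) *v v) \<le> norm v" if "t \<in> {0..<E}" for t v using norm_transpose_U[OF that] by simp
    show "0 \<le> Cg * (1 + (1 + C4))" using Cg C4 by simp
    show "AE u in lborel. u \<in> {0<..<E} \<longrightarrow> (\<integral>\<^sup>+\<omega>. ennreal ((norm (transpose (D u) *v Yc u \<omega>))\<^sup>2) \<partial>M) \<le> ennreal (Cg * (1 + (1 + C4)))"
      using energy_bound[of "1 + C4", OF _ C2] C4(1) e[of u "\<lambda>y. ennreal ((norm (transpose (D u) *v y))\<^sup>2)" for u]
      by (auto elim!: eventually_mono)
    show "(\<integral>\<^sup>+\<omega>. ennreal (norm (Yc t \<omega>) ^ 4) \<partial>M) \<le> ennreal C4" if "t \<in> {0..<E}" for t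
      using C4(2)[OF that] e[OF that, of "\<lambda>y. ennreal (norm y ^ 4)"] by simp
  qed
  thus ?thesis using eq
  proof eventually_elim
    case (elim \<omega>)
    show ?case by (rule holder_continuous_on_cong[OF elim(1)]) (use elim(2) in \<open>auto simp: DO_approx_def\<close>)
  qed
qed

end

section \<open>Covariance matrices and positivity of the explosion time\<close>

lemma square_integrable_prod_integrable:
  assumes "square_integrable M y"
  shows "integrable M (\<lambda>\<omega>. y \<omega> $ i * y \<omega> $ j)"
proof (rule Bochner_Integration.integrable_bound)
  have [measurable]: "y \<in> borel_measurable M" using assms by (simp add: square_integrable_def)
  show "integrable M (\<lambda>\<omega>. (norm (y \<omega>))\<^sup>2)" using assms by (simp add: square_integrable_def)
  show "(\<lambda>\<omega>. y \<omega> $ i * y \<omega> $ j) \<in> borel_measurable M"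
    by (intro borel_measurable_times borel_measurable_continuous_on[OF linear_continuous_on[OF bounded_linear_vec_nth]]) measurable
  show "AE \<omega> in M. norm (y \<omega> $ i * y \<omega> $ j) \<le> norm ((norm (y \<omega>))\<^sup>2)"
  proof (rule AE_I2)
    fix \<omega>
    show "norm (y \<omega> $ i * y \<omega> $ j) \<le> norm ((norm (y \<omega>))\<^sup>2)"
      using mult_mono[OF Finite_Cartesian_Product.norm_nth_le[of "y \<omega>" i] Finite_Cartesian_Product.norm_nth_le[of "y \<omega>" j]]
      by (simp add: abs_mult power2_eq_square)
  qed
qed

lemma square_integrable_inner_integrable:
  assumes "square_integrable M y"
  shows "integrable M (\<lambda>\<omega>. (x \<bullet> y \<omega>)\<^sup>2)"
proof (rule Bochner_Integration.integrable_bound)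
  have [measurable]: "y \<in> borel_measurable M" using assms by (simp add: square_integrable_def)
  show "integrable M (\<lambda>\<omega>. (norm x)\<^sup>2 * (norm (y \<omega>))\<^sup>2)" using assms by (simp add: square_integrable_def)
  show "(\<lambda>\<omega>. (x \<bullet> y \<omega>)\<^sup>2) \<in> borel_measurable M" by measurable
  show "AE \<omega> in M. norm ((x \<bullet> y \<omega>)\<^sup>2) \<le> norm ((norm x)\<^sup>2 * (norm (y \<omega>))\<^sup>2)"
    using power_mono[OF Cauchy_Schwarz_ineq2 abs_ge_zero, where n=2]
    by (intro AE_I2) (simp add: power_mult_distrib)
qed

lemma cross_moment_quadratic_form:
  assumes "square_integrable M y"
  shows "x \<bullet> (cross_moment M y y *v x) = (LINT \<omega>|M. (x \<bullet> y \<omega>)\<^sup>2)"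
proof -
  note int = square_integrable_prod_integrable[OF assms]
  have e: "(x \<bullet> y \<omega>)\<^sup>2 = (\<Sum>i\<in>UNIV. \<Sum>j\<in>UNIV. x $ i * x $ j * (y \<omega> $ i * y \<omega> $ j))" for \<omega>
    by (simp add: inner_vec_def power2_eq_square sum_product mult_ac)
  have "(LINT \<omega>|M. (x \<bullet> y \<omega>)\<^sup>2) = (\<Sum>i\<in>UNIV. \<Sum>j\<in>UNIV. x $ i * x $ j * (LINT \<omega>|M. y \<omega> $ i * y \<omega> $ j))"
    unfolding e using int by (simp add: Bochner_Integration.integral_sum Bochner_Integration.integrable_sum)
  thus ?thesis
    by (simp add: inner_vec_def matrix_vector_mult_def cross_moment_def sum_distrib_left mult_ac)
qed

text \<open>A column v of the inverse solves \<open>A *v\<close> v = \<open>axis j 1\<close>.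
  Coercivity gives l times the squared norm of v at most its j-th entry, hence norm of v at most 1 /
  l; there are \<open>CARD('r)\<close> columns.\<close>

lemma norm_matrix_inv_le:
  fixes A :: "real ^ 'r ^ 'r"
  assumes l: "l > 0" and A: "\<And>x. l * (norm x)\<^sup>2 \<le> x \<bullet> (A *v x)"
  shows "norm (matrix_inv A) \<le> sqrt (real CARD('r)) / l"
proof -
  have "x = 0" if "A *v x = 0" for x using A[of x] that l by (simp add: mult_le_0_iff)
  \<comment> \<open>\<open>matrix_inv\<close> is defined by choice, so the existence of an inverse
    has to be derived first, from the trivial kernel.\<close>
  hence inv: "A ** matrix_inv A = mat 1"
    using someI_ex[of "\<lambda>B. A ** B = mat 1 \<and> B ** A = mat 1"] invertible_left_inverse[of A] matrix_left_invertible_ker[of A]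
    unfolding matrix_inv_def invertible_def by blast
  have col: "(norm (column j (matrix_inv A)))\<^sup>2 \<le> (1 / l)\<^sup>2" for j
  proof -
    let ?v = "column j (matrix_inv A)"
    have "A *v ?v = axis j 1"
      using inv by (metis matrix_vector_mul_assoc matrix_vector_mul_lid matrix_vector_mult_basis)
    hence "l * (norm ?v)\<^sup>2 \<le> ?v $ j" using A[of ?v] by (simp add: inner_axis)
    also have "\<dots> \<le> norm ?v" using Finite_Cartesian_Product.norm_nth_le[of ?v j] by simp
    finally have "norm ?v * (l * norm ?v) \<le> norm ?v * 1" by (simp add: power2_eq_square mult_ac)
    hence "l * norm ?v \<le> 1" by (cases "norm ?v = 0") (auto simp: mult_le_cancel_left)
    hence "norm ?v \<le> 1 / l" using l by (simp add: field_simps)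
    thus ?thesis by (rule power_mono) simp
  qed
  have "(norm (matrix_inv A))\<^sup>2 \<le> (\<Sum>j\<in>(UNIV :: 'r set). (1 / l)\<^sup>2)"
    unfolding norm_matrix_power2_columns by (intro sum_mono col)
  also have "\<dots> = (sqrt (real CARD('r)) / l)\<^sup>2" by (simp add: power_divide)
  finally show ?thesis by (rule power2_le_imp_le) (use l in simp)
qed

text \<open>The quadratic form attains its minimum on the unit sphere, and linear independence
  excludes the value 0 there; homogeneity extends the bound to all vectors.\<close>

lemma lin_indep_components_positive_definite:
  assumes sq: "square_integrable M y" and li: "lin_indep_components M y"
  shows "\<exists>l>0. \<forall>x. l * (norm x)\<^sup>2 \<le> (LINT \<omega>|M. (x \<bullet> y \<omega>)\<^sup>2)"
proof -
  define q where "q x = (LINT \<omega>|M. (x \<bullet> y \<omega>)\<^sup>2)" for x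
  have qe: "q x = x \<bullet> (cross_moment M y y *v x)" for x
    unfolding q_def using cross_moment_quadratic_form[OF sq] by simp
  have "continuous_on (sphere 0 1) q"
    unfolding qe[abs_def] by (intro continuous_intros matrix_vector_mult_linear_continuous_on)
  moreover have "sphere (0 :: real ^ 'r) 1 \<noteq> {}" by simp
  ultimately obtain x0 where x0: "x0 \<in> sphere 0 1" "\<And>x. x \<in> sphere 0 1 \<Longrightarrow> q x0 \<le> q x"
    using continuous_attains_inf[OF compact_sphere] by blast
  have "q x0 \<noteq> 0"
  proof
    assume "q x0 = 0"
    hence "AE \<omega> in M. (x0 \<bullet> y \<omega>)\<^sup>2 = 0"
      using integral_nonneg_eq_0_iff_AE[OF square_integrable_inner_integrable[OF sq, of x0]] by (simp add: q_def)
    hence "AE \<omega> in M. (\<Sum>i\<in>UNIV. x0 $ i * y \<omega> $ i) = 0" by (simp add: inner_vec_def)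
    hence "\<forall>i. x0 $ i = 0" using li unfolding lin_indep_components_def by blast
    hence "x0 = 0" by (simp add: vec_eq_iff)
    thus False using x0(1) by simp
  qed
  moreover have "0 \<le> q x0" unfolding q_def by (rule Bochner_Integration.integral_nonneg) simp
  ultimately have "q x0 > 0" by simp
  moreover have "q x0 * (norm x)\<^sup>2 \<le> q x" for x
  proof (cases "x = 0")
    case False
    have "q x0 \<le> q (x /\<^sub>R norm x)" using False by (intro x0(2)) simp
    also have "\<dots> = q x / (norm x)\<^sup>2"
      by (simp add: qe matrix_vector_mult_scaleR power2_eq_square divide_inverse mult_ac)
    finally show ?thesis using False by (simp add: field_simps)
  qed (simp add: qe)
  ultimately show ?thesis unfolding q_def by blast
qed

context do_solution
begin

text \<open>Mean-square continuity at 0 keeps the covariance matrix uniformly coercive and the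
  second moment bounded for a short time, so neither quantity that defines the explosion time can be
  large there.\<close>

lemma initial_bounds:
  "\<exists>t0\<in>{0<..E}. \<exists>K. \<forall>t\<in>{0<..<t0}.
     norm (matrix_inv (cross_moment M (Y t) (Y t))) \<le> K \<and> L2_norm M (Y t) \<le> K"
proof -
  have sq0: "square_integrable M (Y 0)" using Y_square_integrable[of 0] E_pos by simp
  have "lin_indep_components M (Y 0)"
    using sol[of "E / 2"] E_pos unfolding strong_DO_solution_def by simp
  from lin_indep_components_positive_definite[OF sq0 this]
  obtain l where l: "l > 0" "\<And>x. l * (norm x)\<^sup>2 \<le> (LINT \<omega>|M. (x \<bullet> Y 0 \<omega>)\<^sup>2)" by blast
  obtain c where c: "c \<ge> 0" "\<And>t. t \<in> {0<..<E} \<Longrightarrow> (\<integral>\<^sup>+\<omega>. ennreal ((norm (Y t \<omega> - Y 0 \<omega>))\<^sup>2) \<partial>M) \<le> ennreal (c * t)"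
    using Y_increment_second_moment by blast
  \<comment> \<open>Up to \<open>t0\<close> the squared increment has expectation at most
    \<open>l / 4\<close>. Splitting \<open>x \<bullet> Y 0 \<omega>\<close> then costs at most half
    of the coercivity \<open>l\<close>, and the factor 2 in front of the remaining form leaves
    \<open>l / 4\<close>.\<close>
  define t0 where "t0 = min E (l / (4 * (c + 1)))"
  have t0: "t0 \<in> {0<..E}" using l c E_pos by (simp add: t0_def)
  have int0: "integrable M (\<lambda>\<omega>. (norm (Y 0 \<omega>))\<^sup>2)" using sq0 by (simp add: square_integrable_def)
  define K2 where "K2 = sqrt (2 * (LINT \<omega>|M. (norm (Y 0 \<omega>))\<^sup>2) + 2 * (c * E))"
  show ?thesis
  proof (intro bexI[OF _ t0] exI[of _ "max (sqrt (real CARD('r)) / (l / 4)) K2"] ballI)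
    fix t assume t: "t \<in> {0<..<t0}"
    have tE: "t \<in> {0<..<E}" using t t0 by simp
    have tE': "t \<in> {0..<E}" using tE by simp
    note sq = Y_square_integrable[OF tE']
    have [measurable]: "Y t \<in> borel_measurable M" "Y 0 \<in> borel_measurable M"
      using sq sq0 by (auto simp: square_integrable_def)
    have ct: "c * t \<ge> 0" using c t by simp
    have incint: "integrable M (\<lambda>\<omega>. (norm (Y t \<omega> - Y 0 \<omega>))\<^sup>2)"
      using c(2)[OF tE] by (intro integrableI_nonneg) (auto intro: le_less_trans)
    have inc: "(LINT \<omega>|M. (norm (Y t \<omega> - Y 0 \<omega>))\<^sup>2) \<le> c * t"
      using c(2)[OF tE] nn_integral_eq_integral[OF incint] ct by (simp add: ennreal_le_iff)
    have dbl: "u\<^sup>2 \<le> 2 * v\<^sup>2 + 2 * (w * w)" if "\<bar>u\<bar> \<le> \<bar>v\<bar> + w" for u v w :: real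
    proof -
      have "u\<^sup>2 \<le> (\<bar>v\<bar> + w)\<^sup>2" using power_mono[OF that, of 2] by simp
      thus ?thesis using sum_squares_bound[of "\<bar>v\<bar>" w] by (simp add: power2_eq_square algebra_simps)
    qed
    have pd: "l / 4 * (norm x)\<^sup>2 \<le> x \<bullet> (cross_moment M (Y t) (Y t) *v x)" for x
    proof -
      have "(LINT \<omega>|M. (x \<bullet> Y 0 \<omega>)\<^sup>2) \<le> (LINT \<omega>|M. 2 * (x \<bullet> Y t \<omega>)\<^sup>2 + 2 * ((norm x)\<^sup>2 * (norm (Y t \<omega> - Y 0 \<omega>))\<^sup>2))"
      proof (rule integral_mono)
        fix \<omega>
        have "\<bar>x \<bullet> Y 0 \<omega>\<bar> \<le> \<bar>x \<bullet> Y t \<omega>\<bar> + \<bar>x \<bullet> (Y t \<omega> - Y 0 \<omega>)\<bar>" by (simp add: inner_diff_right)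
        also have "\<dots> \<le> \<bar>x \<bullet> Y t \<omega>\<bar> + norm x * norm (Y t \<omega> - Y 0 \<omega>)" by (simp add: Cauchy_Schwarz_ineq2)
        finally show "(x \<bullet> Y 0 \<omega>)\<^sup>2 \<le> 2 * (x \<bullet> Y t \<omega>)\<^sup>2 + 2 * ((norm x)\<^sup>2 * (norm (Y t \<omega> - Y 0 \<omega>))\<^sup>2)"
          using dbl[of "x \<bullet> Y 0 \<omega>" "x \<bullet> Y t \<omega>" "norm x * norm (Y t \<omega> - Y 0 \<omega>)"] by (simp add: power2_eq_square mult_ac)
      qed (use square_integrable_inner_integrable[OF sq] square_integrable_inner_integrable[OF sq0] incint in auto)
      also have "\<dots> = 2 * (LINT \<omega>|M. (x \<bullet> Y t \<omega>)\<^sup>2) + 2 * ((norm x)\<^sup>2 * (LINT \<omega>|M. (norm (Y t \<omega> - Y 0 \<omega>))\<^sup>2))"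
        using square_integrable_inner_integrable[OF sq, of x] incint by simp
      also have "\<dots> \<le> 2 * (LINT \<omega>|M. (x \<bullet> Y t \<omega>)\<^sup>2) + 2 * ((norm x)\<^sup>2 * (l / 4))"
      proof -
        have "t \<le> l / (4 * (c + 1))" using t by (simp add: t0_def)
        hence "4 * (c * t + t) \<le> l" using c by (simp add: field_simps)
        hence "c * t \<le> l / 4" using t by simp
        with inc show ?thesis by (intro add_left_mono mult_left_mono) auto
      qed
      finally have "(LINT \<omega>|M. (x \<bullet> Y 0 \<omega>)\<^sup>2) \<le> 2 * (LINT \<omega>|M. (x \<bullet> Y t \<omega>)\<^sup>2) + 2 * ((norm x)\<^sup>2 * (l / 4))" .
      with l(2)[of x] show ?thesis unfolding cross_moment_quadratic_form[OF sq] by (simp add: mult_ac)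
    qed
    have "(LINT \<omega>|M. (norm (Y t \<omega>))\<^sup>2) \<le> (LINT \<omega>|M. 2 * (norm (Y 0 \<omega>))\<^sup>2 + 2 * (norm (Y t \<omega> - Y 0 \<omega>))\<^sup>2)"
    proof (rule integral_mono)
      fix \<omega>
      have "\<bar>norm (Y t \<omega>)\<bar> \<le> \<bar>norm (Y 0 \<omega>)\<bar> + norm (Y t \<omega> - Y 0 \<omega>)" using norm_triangle_sub[of "Y t \<omega>" "Y 0 \<omega>"] by simp
      thus "(norm (Y t \<omega>))\<^sup>2 \<le> 2 * (norm (Y 0 \<omega>))\<^sup>2 + 2 * (norm (Y t \<omega> - Y 0 \<omega>))\<^sup>2"
        using dbl by (simp add: power2_eq_square)
    qed (use sq int0 incint in \<open>auto simp: square_integrable_def\<close>)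
    also have "\<dots> = 2 * (LINT \<omega>|M. (norm (Y 0 \<omega>))\<^sup>2) + 2 * (LINT \<omega>|M. (norm (Y t \<omega> - Y 0 \<omega>))\<^sup>2)"
      using int0 incint by simp
    also have "\<dots> \<le> 2 * (LINT \<omega>|M. (norm (Y 0 \<omega>))\<^sup>2) + 2 * (c * E)"
      using inc mult_left_mono[of t E c] c tE by simp
    finally have "L2_norm M (Y t) \<le> K2" unfolding L2_norm_def K2_def by (rule real_sqrt_le_mono)
    thus "norm (matrix_inv (cross_moment M (Y t) (Y t))) \<le> max (sqrt (real CARD('r)) / (l / 4)) K2
      \<and> L2_norm M (Y t) \<le> max (sqrt (real CARD('r)) / (l / 4)) K2"
      using norm_matrix_inv_le[of "l / 4", OF _ pd] l(1) by (simp add: le_max_iff_disj)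
  qed
qed

text \<open>Levels above the bound \<open>K\<close> are not hit before \<open>t0\<close>, so every
  hitting time of large index is at least \<open>t0\<close>; this includes the infinite
  ones.\<close>

lemma explosion_time_pos:
  assumes "is_explosion_time M S Y (ereal Te)"
  shows "0 < Te"
proof -
  obtain t0 K where t0: "0 < t0" "t0 \<le> E" and K: "\<And>t. t \<in> {0<..<t0} \<Longrightarrow> norm (matrix_inv (cross_moment M (Y t) (Y t))) \<le> K"
     "\<And>t. t \<in> {0<..<t0} \<Longrightarrow> L2_norm M (Y t) \<le> K"
    using initial_bounds by (metis greaterThanAtMost_iff)
  obtain n0 :: nat where n0: "K < real n0" using reals_Archimedean2 by blast
  have L0: "0 \<le> L2_norm M (Y 0)" by (simp add: L2_norm_def)
  have "ereal t0 \<le> min (DO_tau1 M S Y n) (DO_tau2 M S Y n)" if n: "n \<ge> n0" for n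
  proof (rule min.boundedI)
    have nK: "K < real n" using n n0 by simp
    have "t0 \<le> t" if "0 < t" and "norm (matrix_inv (cross_moment M (Y t) (Y t))) = norm (matrix_inv (cross_moment M (Y 0) (Y 0))) + real n" for t
    proof (rule ccontr)
      assume "\<not> t0 \<le> t"
      thus False using K(1)[of t] that nK norm_ge_zero[of "matrix_inv (cross_moment M (Y 0) (Y 0))"] by simp
    qed
    thus "ereal t0 \<le> DO_tau1 M S Y n" unfolding DO_tau1_def by (intro INF_greatest) auto
    have "t0 \<le> t" if "0 < t" and "L2_norm M (Y t) = L2_norm M (Y 0) + real n" for t
    proof (rule ccontr)
      assume "\<not> t0 \<le> t"
      thus False using K(2)[of t] that nK L0 by simp
    qed
    thus "ereal t0 \<le> DO_tau2 M S Y n" unfolding DO_tau2_def by (intro INF_greatest) auto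
  qed
  hence "ereal t0 \<le> ereal Te"
    by (intro LIMSEQ_le_const[OF assms[unfolded is_explosion_time_def]]) blast
  thus ?thesis using t0 by simp
qed

text \<open>At the final time the extension is the limit along one sequence of times common to all
  outcomes, hence a random variable, and Fatou's lemma along this sequence transfers the uniform
  moment bound to it. Uniqueness holds because any continuous extension must have the same limit
  along the sequence.\<close>

lemma DO_approx_extension:
  fixes k :: nat
  assumes k: "k > 1" and X0: "integrable M (\<lambda>\<omega>. norm (DO_approx U Y 0 \<omega>) ^ (2 * k))"
  shows "\<exists>Xe :: real \<Rightarrow> 'w \<Rightarrow> real ^ 'd.
    (AE \<omega> in M. continuous_extension E (\<lambda>t. DO_approx U Y t \<omega>) (\<lambda>t. Xe t \<omega>) \<and>
      (\<forall>z. continuous_extension E (\<lambda>t. DO_approx U Y t \<omega>) z \<longrightarrow> (\<forall>t\<in>{0..E}. z t = Xe t \<omega>))) \<and>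
    (AE \<omega> in M. holder_continuous_on (1 / 8) {0..E} (\<lambda>t. Xe t \<omega>)) \<and>
    (\<forall>t\<in>{0..E}. integrable M (\<lambda>\<omega>. norm (Xe t \<omega>) ^ (2 * k)))"
proof -
  have Ym: "Y t \<in> borel_measurable M" if "t \<in> {0..<E}" for t
    using Y_square_integrable[OF that] by (simp add: square_integrable_def)
  have nY: "norm (DO_approx U Y t \<omega>) = norm (Y t \<omega>)" if "t \<in> {0..<E}" for t \<omega>
    unfolding DO_approx_def by (rule norm_transpose_U[OF that])
  have z: "0 \<in> {0..<E}" using E_pos by simp
  note [measurable] = Ym[OF z]
  define C0 where "C0 = (LINT \<omega>|M. norm (Y 0 \<omega>) ^ (2 * k))"
  have C0: "0 \<le> C0" unfolding C0_def by (rule Bochner_Integration.integral_nonneg) simp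
  have Y0: "(\<integral>\<^sup>+\<omega>. ennreal (norm (Y 0 \<omega>) ^ (2 * k)) \<partial>M) = ennreal C0"
    unfolding C0_def using X0 by (intro nn_integral_eq_integral) (auto simp: nY[OF z])
  have "(\<integral>\<^sup>+\<omega>. ennreal (norm (Y 0 \<omega>) ^ 4) \<partial>M) \<le> (\<integral>\<^sup>+\<omega>. 1 + ennreal (norm (Y 0 \<omega>) ^ (2 * k)) \<partial>M)"
  proof (rule nn_integral_mono)
    fix \<omega>
    \<comment> \<open>Uses \<open>k > 1\<close>: the Hoelder estimate needs fourth moments, and
      these are dominated by 1 plus the moment of order \<open>2 * k\<close>.\<close>
    have "x ^ 4 \<le> 1 + x ^ (2 * k)" if "0 \<le> x" for x :: real
    proof (cases "x \<le> 1")
      case True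
      thus ?thesis using power_le_one[OF that True, of 4] zero_le_power[OF that, of "2 * k"] by linarith
    next
      case False
      hence "x ^ 4 \<le> x ^ (2 * k)" using k by (intro power_increasing) auto
      thus ?thesis by linarith
    qed
    from ennreal_leI[OF this[of "norm (Y 0 \<omega>)"]]
    show "ennreal (norm (Y 0 \<omega>) ^ 4) \<le> 1 + ennreal (norm (Y 0 \<omega>) ^ (2 * k))" by simp
  qed
  also have "\<dots> = ennreal (1 + C0)" using C0 Y0 by (simp add: nn_integral_add emeasure_space_1)
  finally have hold: "AE \<omega> in M. holder_continuous_on (1 / 8) {0..<E} (\<lambda>t. DO_approx U Y t \<omega>)"
    using C0 by (intro DO_approx_holder[of "1 + C0"]) auto
  obtain C where C: "C \<ge> 0" "\<And>t. t \<in> {0..<E} \<Longrightarrow> (\<integral>\<^sup>+\<omega>. ennreal (norm (Y t \<omega>) ^ (2 * k)) \<partial>M) \<le> ennreal C"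
    using Y_moment_bound[of k C0] k C0 Y0 by auto
  define s where "s n = E * (1 - 1 / real (Suc n))" for n
  have s: "s n \<in> {0..<E}" for n using E_pos by (simp add: s_def field_simps)
  have "(\<lambda>n. E * (1 - 1 / real (Suc n))) \<longlonglongrightarrow> E * (1 - 0)" by (intro tendsto_intros LIMSEQ_Suc lim_1_over_n)
  hence slim: "s \<longlonglongrightarrow> E" by (simp add: s_def[abs_def])
  define Xe where "Xe t \<omega> = (if t < E then DO_approx U Y t \<omega> else lim (\<lambda>n. DO_approx U Y (s n) \<omega>))" for t \<omega>
  have Xm: "DO_approx U Y t \<in> borel_measurable M" if "t \<in> {0..<E}" for t
  proof -
    note [measurable] = Ym[OF that]
    show ?thesis unfolding DO_approx_def[abs_def] by measurable
  qed
  have hX: "AE \<omega> in M. holder_continuous_on (1 / 8) {0..E} (\<lambda>t. Xe t \<omega>)"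
    using hold
  proof eventually_elim
    case (elim \<omega>)
    show ?case unfolding Xe_def s_def by (rule holder_continuous_on_extend(2)[OF elim]) (use E_pos in auto)
  qed
  have lim: "AE \<omega> in M. (\<lambda>n. DO_approx U Y (s n) \<omega>) \<longlonglongrightarrow> Xe E \<omega>"
    using hold
  proof eventually_elim
    case (elim \<omega>)
    have "convergent (\<lambda>n. DO_approx U Y (s n) \<omega>)"
      unfolding s_def by (rule holder_continuous_on_extend(1)[OF elim]) (use E_pos in auto)
    thus ?case by (simp add: Xe_def convergent_LIMSEQ_iff)
  qed
  have "AE \<omega> in M. continuous_extension E (\<lambda>t. DO_approx U Y t \<omega>) (\<lambda>t. Xe t \<omega>) \<and>
      (\<forall>z. continuous_extension E (\<lambda>t. DO_approx U Y t \<omega>) z \<longrightarrow> (\<forall>t\<in>{0..E}. z t = Xe t \<omega>))"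
    using hX lim
  proof eventually_elim
    case (elim \<omega>)
    have "continuous_on {0..E} (\<lambda>t. Xe t \<omega>)" by (rule holder_continuous_on_imp_continuous_on[OF elim(1)]) simp
    moreover have "z t = Xe t \<omega>" if z: "continuous_extension E (\<lambda>t. DO_approx U Y t \<omega>) z" and t: "t \<in> {0..E}" for z t
    proof (cases "t < E")
      case True
      thus ?thesis using z t by (simp add: continuous_extension_def Xe_def)
    next
      case False
      \<comment> \<open>Only the value at \<open>E\<close> is in question; it is forced by
        continuity along \<open>s\<close>.\<close>
      have "(\<lambda>n. z (s n)) \<longlonglongrightarrow> z E"
        using z s E_pos unfolding continuous_extension_def
        by (intro continuous_on_tendsto_compose[OF _ slim, of "{0..E}"]) (auto simp: less_imp_le intro!: always_eventually)
      moreover have "z (s n) = DO_approx U Y (s n) \<omega>" for n using z s[of n] by (simp add: continuous_extension_def)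
      ultimately have "(\<lambda>n. DO_approx U Y (s n) \<omega>) \<longlonglongrightarrow> z E" by simp
      from LIMSEQ_unique[OF this elim(2)] show ?thesis using False t by simp
    qed
    ultimately show ?case unfolding continuous_extension_def[of _ _ "\<lambda>t. Xe t \<omega>"] by (auto simp: Xe_def)
  qed
  moreover have "integrable M (\<lambda>\<omega>. norm (Xe t \<omega>) ^ (2 * k))" if t: "t \<in> {0..E}" for t
  proof (cases "t < E")
    case True
    hence tE: "t \<in> {0..<E}" using t by simp
    have "integrable M (\<lambda>\<omega>. norm (Y t \<omega>) ^ (2 * k))"
      using Ym[OF tE] C(2)[OF tE] by (intro integrableI_nonneg) (auto intro: le_less_trans)
    thus ?thesis using True nY[OF tE] by (simp add: Xe_def)
  next
    case False
    hence t: "t = E" using t by simp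
    have XeE: "Xe E = (\<lambda>\<omega>. lim (\<lambda>n. DO_approx U Y (s n) \<omega>))" by (simp add: Xe_def[abs_def])
    have [measurable]: "Xe E \<in> borel_measurable M"
      unfolding XeE by (rule borel_measurable_lim_metric) (rule Xm[OF s])
    have "(\<integral>\<^sup>+\<omega>. ennreal (norm (Xe E \<omega>) ^ (2 * k)) \<partial>M)
        = (\<integral>\<^sup>+\<omega>. liminf (\<lambda>n. ennreal (norm (DO_approx U Y (s n) \<omega>) ^ (2 * k))) \<partial>M)"
    proof (rule nn_integral_cong_AE, use lim in eventually_elim)
      case (elim \<omega>)
      have "(\<lambda>n. ennreal (norm (DO_approx U Y (s n) \<omega>) ^ (2 * k))) \<longlonglongrightarrow> ennreal (norm (Xe E \<omega>) ^ (2 * k))"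
        by (intro tendsto_ennrealI tendsto_intros elim)
      thus ?case by (intro lim_imp_Liminf[symmetric]) auto
    qed
    also have "\<dots> \<le> liminf (\<lambda>n. \<integral>\<^sup>+\<omega>. ennreal (norm (DO_approx U Y (s n) \<omega>) ^ (2 * k)) \<partial>M)"
    proof (rule nn_integral_liminf)
      fix n
      note [measurable] = Xm[OF s[of n]]
      show "(\<lambda>\<omega>. ennreal (norm (DO_approx U Y (s n) \<omega>) ^ (2 * k))) \<in> borel_measurable M" by measurable
    qed
    also have "\<dots> \<le> ennreal C"
      using C(2)[OF s] nY[OF s] by (intro Liminf_le) (auto intro!: always_eventually)
    finally show ?thesis unfolding t by (intro integrableI_nonneg) (auto intro: le_less_trans)
  qed
  ultimately show ?thesis using hX by blast
qed

end

theorem theorem4p4: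
  fixes M :: "'w measure" and F :: "real \<Rightarrow> 'w measure"
    and W :: "real \<Rightarrow> 'w \<Rightarrow> real ^ 'm"
    and a :: "real \<Rightarrow> real ^ 'd \<Rightarrow> real ^ 'd"
    and b :: "real \<Rightarrow> real ^ 'd \<Rightarrow> real ^ 'm ^ 'd"
    and U :: "real \<Rightarrow> real ^ 'd ^ 'r"
    and Y :: "real \<Rightarrow> 'w \<Rightarrow> real ^ 'r"
    and S :: ereal and Te :: real and k :: nat
  assumes "brownian_motion M F W"
    and "CARD('r) \<le> CARD('d)"
    and "jointly_measurable a" and "jointly_measurable b"
    and "lipschitz_cond a b" and "linear_growth a b"
    and "maximal_DO_solution M F W a b S U Y"
    and "is_explosion_time M S Y (ereal Te)"
    and "k > 1" and "integrable M (\<lambda>\<omega>. norm (DO_approx U Y 0 \<omega>) ^ (2 * k))"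
  shows "\<exists>Xe :: real \<Rightarrow> 'w \<Rightarrow> real ^ 'd.
    (AE \<omega> in M. continuous_extension Te (\<lambda>t. DO_approx U Y t \<omega>) (\<lambda>t. Xe t \<omega>) \<and>
      (\<forall>z. continuous_extension Te (\<lambda>t. DO_approx U Y t \<omega>) z \<longrightarrow> (\<forall>t\<in>{0..Te}. z t = Xe t \<omega>))) \<and>
    (\<exists>\<alpha>\<in>{0<..1}. AE \<omega> in M. holder_continuous_on \<alpha> {0..Te} (\<lambda>t. Xe t \<omega>)) \<and>
    (\<forall>t\<in>{0..Te}. integrable M (\<lambda>\<omega>. norm (Xe t \<omega>) ^ (2 * k)))"
proof -
  obtain Cg where Cg: "Cg > 0" "\<And>s x. 0 \<le> s \<Longrightarrow> (norm (a s x))\<^sup>2 + (norm (b s x))\<^sup>2 \<le> Cg * (1 + (norm x)\<^sup>2)"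
    using assms(6) unfolding linear_growth_def by blast
  have S: "0 < S" "\<And>T. 0 < T \<Longrightarrow> ereal T < S \<Longrightarrow> strong_DO_solution M F W a b T U Y"
    using assms(7) unfolding maximal_DO_solution_def by blast+
  have sol: "do_solution M F W a b E U Y Cg" if E: "0 < E" "ereal E \<le> S" for E
  proof (intro do_solution.intro do_solution_axioms.intro)
    show "strong_DO_solution M F W a b T U Y" if "0 < T" "T < E" for T
      using that E by (intro S(2)) (auto intro: less_le_trans[of _ "ereal E"])
  qed (use assms Cg E in auto)
  \<comment> \<open>Any finite horizon inside the interval of existence serves to show that
    \<open>Te\<close> is positive; when \<open>S\<close> is infinite, 1 is taken.\<close>
  obtain E1 where "0 < E1" "ereal E1 \<le> S"
  proof (cases S)
    case (real r)
    thus ?thesis using that[of r] S(1) by simp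
  qed (use that[of 1] S(1) in auto)
  from do_solution.explosion_time_pos[OF sol[OF this] assms(8)] have Te: "0 < Te" .
  note tau = assms(8)[unfolded is_explosion_time_def]
  \<comment> \<open>Finiteness of \<open>Te\<close> makes the hitting times finite for large
    \<open>n\<close>. A finite infimum is taken over a nonempty set of times below \<open>S\<close>,
    so it is at most \<open>S\<close>, and so is the limit; the solution therefore exists on all of
    \<open>[0, Te)\<close>.\<close>
  have "eventually (\<lambda>n. min (DO_tau1 M S Y n) (DO_tau2 M S Y n) < \<infinity>) sequentially"
    using tau by (rule order_tendstoD) simp
  hence "eventually (\<lambda>n. min (DO_tau1 M S Y n) (DO_tau2 M S Y n) \<le> S) sequentially"
  proof eventually_elim
    case (elim n)
    have "Inf (ereal ` {t. 0 < t \<and> ereal t < S \<and> P t}) \<le> S" if "Inf (ereal ` {t. 0 < t \<and> ereal t < S \<and> P t}) < \<infinity>" for P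
    proof -
      from that obtain t where "ereal t < S" "P t" "0 < t" unfolding INF_less_iff by auto
      thus ?thesis by (intro INF_lower2[of t]) auto
    qed
    from this[of "\<lambda>t. norm (matrix_inv (cross_moment M (Y t) (Y t))) = norm (matrix_inv (cross_moment M (Y 0) (Y 0))) + real n"]
      this[of "\<lambda>t. L2_norm M (Y t) = L2_norm M (Y 0) + real n"]
    show ?case using elim unfolding DO_tau1_def DO_tau2_def min_less_iff_disj min_le_iff_disj by blast
  qed
  hence "ereal Te \<le> S" by (rule tendsto_upperbound[OF tau]) simp
  from do_solution.DO_approx_extension[OF sol[OF Te this] assms(9,10)]
  obtain Xe where Xe: "AE \<omega> in M. continuous_extension Te (\<lambda>t. DO_approx U Y t \<omega>) (\<lambda>t. Xe t \<omega>) \<and>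
      (\<forall>z. continuous_extension Te (\<lambda>t. DO_approx U Y t \<omega>) z \<longrightarrow> (\<forall>t\<in>{0..Te}. z t = Xe t \<omega>))"
    "AE \<omega> in M. holder_continuous_on (1 / 8) {0..Te} (\<lambda>t. Xe t \<omega>)"
    "\<forall>t\<in>{0..Te}. integrable M (\<lambda>\<omega>. norm (Xe t \<omega>) ^ (2 * k))" by blast
  show ?thesis using Xe by (intro exI[of _ Xe] conjI bexI[of _ "1 / 8"]) auto
qed

end
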